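(* Let $(M,g,\mu)$ be a weighted Riemannian manifold, $0<\lambda\le\Lambda$, and let $(\mathbb{L}_{\varepsilon})$ be a sequence of symmetric coefficient fields in $\mathcal{M}(M,\lambda,\Lambda)$ (i.e. $g(\mathbb{L}_{\varepsilon}\xi,\eta)=g(\xi,\mathbb{L}_{\varepsilon}\eta)$ for all $\xi,\eta$) that $H$-converges in $(M,g,\mu)$ to $\mathbb{L}_0$. Let $\Omega\subset M$ be open and relatively compact with $m_0(\Omega)<0$. For $\varepsilon\ge0$ (that is, for the indices $\varepsilon>0$ of the sequence and for $\varepsilon=0$) consider the unbounded operator $$-\operatorname{div}(\mathbb{L}_{\varepsilon}\nabla)\colon H^1_0(\Omega)\subset L^2(\Omega)\to L^2(\Omega),$$ let $0<\lambda_{\varepsilon,1}\le\lambda_{\varepsilon,2}\le\lambda_{\varepsilon,3}\le\cdots$ denote the list of its increasingly ordered eigenvalues, repeated according to multiplicity, and let $u_{\varepsilon,1},u_{\varepsilon,2},u_{\varepsilon,3},\dots$ denote associated linearly independent eigenfunctions. Then for all $k\in\mathbb{N}$, $$\lambda_{\varepsilon,k}\to\lambda_{0,k}\quad\text{as }\varepsilon\to0,$$ and if $s\in\mathbb{N}$ denotes the multiplicity of $\lambda_{0,k}$, i.e. $$\lambda_{0,k-1}<\lambda_{0,k}=\cdots=\lambda_{0,k+s-1}<\lambda_{0,k+s}\qquad(\text{with the convention }\lambda_{0,0}=0),$$ then there exists a sequence $\bar u_{\varepsilon,k}$ of linear combinations of $u_{\varepsilon,k},\dots,u_{\varepsilon,k+s-1}$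 such that $$\bar u_{\varepsilon,k}\to u_{0,k}\quad\text{strongly in }L^2(\Omega).$$
   Context: A weighted Riemannian manifold $(M,g,\mu)$ is an $n$-dimensional ($n\ge2$), smooth, connected manifold $M$ without boundary with Riemannian metric $g$ and a measure $\mu$ having a smooth positive density with respect to the Riemannian volume of $g$. $|\xi|=\sqrt{g(\xi,\xi)}$, $\nabla=\nabla_g$ is the gradient. For $\Omega\subset M$ open, $L^2(\Omega)$ is taken with respect to $\mu$; $L^2(T\Omega)$ is the space of measurable sections $\xi$ of $T\Omega$ with $|\xi|\in L^2(\Omega)$; $H^1(\Omega)$ is the Sobolev space with norm $\|u\|_{H^1(\Omega)}^2=\int_\Omega|u|^2+|\nabla u|^2\,d\mu$; $H^1_0(\Omega)$ is the closure of $C_c^\infty(\Omega)$ in $H^1(\Omega)$; $H^{-1}(\Omega)$ is the dual of $H^1_0(\Omega)$. The operator $\operatorname{div}\colon L^2(T\Omega)\to H^{-1}(\Omega)$ is defined by $\langle\operatorname{div}\xi,u\rangle=-\int_\Omega g(\xi,\nabla u)\,d\mu$. $\omega\Subset\Omega$ means that $\omega$ is open with compact closure contained in $\Omega$. An eigenpair of $-\operatorname{div}(\mathbb{L}\nabla)$ on $\Omega$ is a pair $(\lambda,u)$ with $0\neq u\in H^1_0(\Omega)$ and $-\operatorname{div}(\mathbb{L}\nabla u)=\lambda u$ in $H^{-1}(\Omega)$. A coefficient field is a measurable $(1,1)$-tensor field $\mathbb{L}$. For $0<\lambda\le\Lambda$, $\mathcal{M}(\Omega,\lambda,\Lambda)$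 is the set of measurable coefficient fields $\mathbb{L}\colon\Omega\to\operatorname{Lin}(T\Omega)$ such that for $\mu$-a.e. $x\in\Omega$ and all $\xi\in T_x\Omega$: $g(\xi,\mathbb{L}(x)\xi)\ge\lambda|\xi|^2$ and $g(\xi,\mathbb{L}(x)^{-1}\xi)\ge\frac1\Lambda|\xi|^2$. $m_0(\Omega)$ is the infimum of all $m\in\mathbb{R}$ such that $\inf\{\int_\Omega m|u|^2+g(\nabla u,\nabla u)\,d\mu:\ u\in H^1_0(\Omega),\ \|u\|_{H^1(\Omega)}=1\}>0$. (The condition $m_0(\Omega)<0$ is equivalent to the Poincaré inequality $\int_\Omega|u|^2\,d\mu\le C\int_\Omega|\nabla u|^2\,d\mu$ on $H^1_0(\Omega)$.) $H$-convergence: a sequence $(\mathbb{L}_{\varepsilon})\subset\mathcal{M}(\Omega,\lambda,\Lambda)$ $H$-converges in $(\Omega,g,\mu)$ to $\mathbb{L}_0\in\mathcal{M}(\Omega,\lambda,\Lambda)$ as $\varepsilon\to0$ if for every open $\omega\Subset\Omega$ with $m_0(\omega)<0$ and every $f\in H^{-1}(\omega)$ the unique solutions $u_{\varepsilon},u_0\in H^1_0(\omega)$ to $-\operatorname{div}(\mathbb{L}_{\varepsilon}\nabla u_{\varepsilon})=f$ and $-\operatorname{div}(\mathbb{L}_0\nabla u_0)=f$ in $H^{-1}(\omega)$ satisfy $u_{\varepsilon}\rightharpoonup u_0$ weakly in $H^1(\omega)$ and $\mathbb{L}_{\varepsilon}\nabla u_{\varepsilon}\rightharpoonup\mathbb{L}_0\nabla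 u_0$ weakly in $L^2(T\omega)$. *)

theory Defs
  imports "HOL-Analysis.Analysis"
begin

section \<open>Smooth manifolds\<close>

text \<open>The underlying set of the manifold is a whole type, which carries a Hausdorff, second countable
  topology. A chart is a pair of its (open) domain and its coordinate map.\<close>

type_synonym ('m, 'n) chart = "'m set \<times> ('m \<Rightarrow> real ^ 'n)"

definition chart_inv :: "('m, 'n::finite) chart \<Rightarrow> real ^ 'n \<Rightarrow> 'm" where
  "chart_inv c = inv_into (fst c) (snd c)"

text \<open>Continuous differentiability of order \<open>k\<close> on an open set \<open>S\<close>.\<close>

primrec Ck_on :: "nat \<Rightarrow> 'a::real_normed_vector set \<Rightarrow> ('a \<Rightarrow> 'b::real_normed_vector) \<Rightarrow> bool" where
  "Ck_on 0 S f \<longleftrightarrow> continuous_on S f"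
| "Ck_on (Suc k) S f \<longleftrightarrow>
     (\<forall>x\<in>S. f differentiable (at x)) \<and> (\<forall>v. Ck_on k S (\<lambda>x. frechet_derivative f (at x) v))"

definition smooth_on :: "'a::real_normed_vector set \<Rightarrow> ('a \<Rightarrow> 'b::real_normed_vector) \<Rightarrow> bool" where
  "smooth_on S f \<longleftrightarrow> (\<forall>k. Ck_on k S f)"

definition smooth_atlas ::
  "('m::{t2_space,second_countable_topology}, 'n::finite) chart set \<Rightarrow> bool" where
  "smooth_atlas A \<longleftrightarrow>
     (\<Union>c\<in>A. fst c) = UNIV \<and>
     (\<forall>c\<in>A. open (fst c) \<and> open (snd c ` fst c) \<and>
        homeomorphism (fst c) (snd c ` fst c) (snd c) (chart_inv c)) \<and>
     (\<forall>c\<in>A. \<forall>d\<in>A. smooth_on (snd c ` (fst c \<inter> fst d)) (snd d \<circ> chart_inv c))"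

text \<open>
  Each point \<open>x\<close> has a preferred chart \<open>chart_at A x\<close>, and the tangent space at \<open>x\<close> is identified with
  \<open>real ^ 'n\<close> by taking components in that chart. A vector field is therefore a function
  \<open>'m \<Rightarrow> real ^ 'n\<close>. As the preferred chart may jump from point to point, measurability and
  smoothness of tensor fields are always expressed by their components in a fixed chart, which
  \<open>to_chart\<close> and \<open>from_chart\<close> compute.
\<close>

definition chart_at :: "('m, 'n::finite) chart set \<Rightarrow> 'm \<Rightarrow> ('m, 'n) chart" where
  "chart_at A x = (SOME c. c \<in> A \<and> x \<in> fst c)"

definition change_components ::
  "('m, 'n::finite) chart \<Rightarrow> ('m, 'n) chart \<Rightarrow> 'm \<Rightarrow> real ^ 'n \<Rightarrow> real ^ 'n" where
  "change_components c d x v = frechet_derivative (snd d \<circ> chart_inv c) (at (snd c x)) v"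

definition to_chart ::
  "('m, 'n::finite) chart set \<Rightarrow> ('m, 'n) chart \<Rightarrow> 'm \<Rightarrow> real ^ 'n \<Rightarrow> real ^ 'n" where
  "to_chart A c x = change_components (chart_at A x) c x"

definition from_chart ::
  "('m, 'n::finite) chart set \<Rightarrow> ('m, 'n) chart \<Rightarrow> 'm \<Rightarrow> real ^ 'n \<Rightarrow> real ^ 'n" where
  "from_chart A c x = change_components c (chart_at A x) x"

definition smooth_fun ::
  "('m::topological_space, 'n::finite) chart set \<Rightarrow> ('m \<Rightarrow> real) \<Rightarrow> bool" where
  "smooth_fun A f \<longleftrightarrow> (\<forall>c\<in>A. smooth_on (snd c ` fst c) (f \<circ> chart_inv c))"

text \<open>The functions in \<open>C_c^\<infinity>(W)\<close> for open \<open>W\<close>, extended by zero.\<close>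

definition test_functions ::
  "('m::topological_space, 'n::finite) chart set \<Rightarrow> 'm set \<Rightarrow> ('m \<Rightarrow> real) set" where
  "test_functions A W =
     {f. smooth_fun A f \<and> compact (closure {x. f x \<noteq> 0}) \<and> closure {x. f x \<noteq> 0} \<subseteq> W}"


section \<open>Weighted Riemannian manifolds\<close>

definition riemannian_metric ::
  "('m, 'n::finite) chart set \<Rightarrow> ('m \<Rightarrow> real ^ 'n \<Rightarrow> real ^ 'n \<Rightarrow> real) \<Rightarrow> bool" where
  "riemannian_metric A g \<longleftrightarrow>
     (\<forall>x. bilinear (g x) \<and> (\<forall>v w. g x v w = g x w v) \<and> (\<forall>v. v \<noteq> 0 \<longrightarrow> 0 < g x v v)) \<and>
     (\<forall>c\<in>A. \<forall>v w. smooth_on (snd c ` fst c)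
        (\<lambda>y. g (chart_inv c y) (from_chart A c (chart_inv c y) v) (from_chart A c (chart_inv c y) w)))"

definition gram_matrix ::
  "('m, 'n::finite) chart set \<Rightarrow> ('m \<Rightarrow> real ^ 'n \<Rightarrow> real ^ 'n \<Rightarrow> real) \<Rightarrow> ('m, 'n) chart \<Rightarrow> 'm
     \<Rightarrow> real ^ 'n ^ 'n" where
  "gram_matrix A g c x = (\<chi> i j. g x (from_chart A c x (axis i 1)) (from_chart A c x (axis j 1)))"

definition riemannian_volume ::
  "('m::topological_space, 'n::finite) chart set \<Rightarrow> ('m \<Rightarrow> real ^ 'n \<Rightarrow> real ^ 'n \<Rightarrow> real)
     \<Rightarrow> 'm measure \<Rightarrow> bool" where
  "riemannian_volume A g vol \<longleftrightarrow>
     sets vol = sets borel \<and>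
     (\<forall>c\<in>A. \<forall>B\<in>sets borel. B \<subseteq> fst c \<longrightarrow>
        emeasure vol B =
          (\<integral>\<^sup>+y\<in>snd c ` B. ennreal (sqrt (det (gram_matrix A g c (chart_inv c y)))) \<partial>lborel))"

record ('m, 'n) weighted_manifold =
  atlas :: "('m, 'n) chart set"
  metric :: "'m \<Rightarrow> real ^ 'n \<Rightarrow> real ^ 'n \<Rightarrow> real"
  meas :: "'m measure"

text \<open>The measure is taken to be complete, so that measurable means measurable up to null sets.\<close>

definition weighted_riemannian_manifold ::
  "('m::{t2_space,second_countable_topology}, 'n::finite) weighted_manifold \<Rightarrow> bool" where
  "weighted_riemannian_manifold M \<longleftrightarrow>
     CARD('n) \<ge> 2 \<and> connected (UNIV :: 'm set) \<and>
     smooth_atlas (atlas M) \<and> riemannian_metric (atlas M) (metric M) \<and>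
     (\<exists>vol \<rho>. riemannian_volume (atlas M) (metric M) vol \<and>
        smooth_fun (atlas M) \<rho> \<and> (\<forall>x. 0 < \<rho> x) \<and>
        meas M = completion (density vol (\<lambda>x. ennreal (\<rho> x))))"


section \<open>Function spaces\<close>

text \<open>Elements of the spaces below are representatives, i.e. functions on the whole manifold of which
  only the values on \<open>\<Omega>\<close> matter, up to null sets.\<close>

definition measurable_section ::
  "('m, 'n::finite) weighted_manifold \<Rightarrow> 'm set \<Rightarrow> ('m \<Rightarrow> real ^ 'n) \<Rightarrow> bool" where
  "measurable_section M \<Omega> \<xi> \<longleftrightarrow>
     (\<forall>c\<in>atlas M. set_borel_measurable (meas M) (\<Omega> \<inter> fst c) (\<lambda>x. to_chart (atlas M) c x (\<xi> x)))"

definition L2 :: "('m, 'n::finite) weighted_manifold \<Rightarrow> 'm set \<Rightarrow> ('m \<Rightarrow> real) set" where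
  "L2 M \<Omega> = {u. set_borel_measurable (meas M) \<Omega> u \<and> set_integrable (meas M) \<Omega> (\<lambda>x. (u x)\<^sup>2)}"

definition L2_norm :: "('m, 'n::finite) weighted_manifold \<Rightarrow> 'm set \<Rightarrow> ('m \<Rightarrow> real) \<Rightarrow> real" where
  "L2_norm M \<Omega> u = sqrt (LINT x:\<Omega>|meas M. (u x)\<^sup>2)"

definition L2T :: "('m, 'n::finite) weighted_manifold \<Rightarrow> 'm set \<Rightarrow> ('m \<Rightarrow> real ^ 'n) set" where
  "L2T M \<Omega> = {\<xi>. measurable_section M \<Omega> \<xi> \<and>
                 set_integrable (meas M) \<Omega> (\<lambda>x. metric M x (\<xi> x) (\<xi> x))}"

definition L2T_norm ::
  "('m, 'n::finite) weighted_manifold \<Rightarrow> 'm set \<Rightarrow> ('m \<Rightarrow> real ^ 'n) \<Rightarrow> real" where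
  "L2T_norm M \<Omega> \<xi> = sqrt (LINT x:\<Omega>|meas M. metric M x (\<xi> x) (\<xi> x))"

text \<open>In every chart, the weak partial derivatives of \<open>u\<close> are those prescribed by the one-form
  \<open>g(\<xi>, _)\<close>, i.e. \<open>du = g(\<xi>, _)\<close> in the sense of distributions.\<close>

definition is_weak_gradient ::
  "('m::topological_space, 'n::finite) weighted_manifold \<Rightarrow> 'm set \<Rightarrow> ('m \<Rightarrow> real)
     \<Rightarrow> ('m \<Rightarrow> real ^ 'n) \<Rightarrow> bool" where
  "is_weak_gradient M \<Omega> u \<xi> \<longleftrightarrow>
     (\<forall>c\<in>atlas M. \<forall>v. \<forall>\<psi>\<in>test_functions (atlas M) (\<Omega> \<inter> fst c).
        (LINT y:snd c ` (\<Omega> \<inter> fst c)|lebesgue.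
           u (chart_inv c y) * frechet_derivative (\<psi> \<circ> chart_inv c) (at y) v) =
        - (LINT y:snd c ` (\<Omega> \<inter> fst c)|lebesgue.
           metric M (chart_inv c y) (\<xi> (chart_inv c y)) (from_chart (atlas M) c (chart_inv c y) v)
             * \<psi> (chart_inv c y)))"

definition H1 ::
  "('m::topological_space, 'n::finite) weighted_manifold \<Rightarrow> 'm set \<Rightarrow> ('m \<Rightarrow> real) set" where
  "H1 M \<Omega> = {u \<in> L2 M \<Omega>. \<exists>\<xi>\<in>L2T M \<Omega>. is_weak_gradient M \<Omega> u \<xi>}"

text \<open>The gradient of \<open>u \<in> H1 M \<Omega>\<close>; it is unique up to null sets.\<close>

definition grad ::
  "('m::topological_space, 'n::finite) weighted_manifold \<Rightarrow> 'm set \<Rightarrow> ('m \<Rightarrow> real)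
     \<Rightarrow> 'm \<Rightarrow> real ^ 'n" where
  "grad M \<Omega> u = (SOME \<xi>. \<xi> \<in> L2T M \<Omega> \<and> is_weak_gradient M \<Omega> u \<xi>)"

definition H1_norm ::
  "('m::topological_space, 'n::finite) weighted_manifold \<Rightarrow> 'm set \<Rightarrow> ('m \<Rightarrow> real) \<Rightarrow> real" where
  "H1_norm M \<Omega> u =
     sqrt (LINT x:\<Omega>|meas M. (u x)\<^sup>2 + metric M x (grad M \<Omega> u x) (grad M \<Omega> u x))"

definition H10 ::
  "('m::topological_space, 'n::finite) weighted_manifold \<Rightarrow> 'm set \<Rightarrow> ('m \<Rightarrow> real) set" where
  "H10 M \<Omega> = {u \<in> H1 M \<Omega>. \<forall>e>0. \<exists>\<psi>\<in>test_functions (atlas M) \<Omega>. H1_norm M \<Omega> (\<lambda>x. u x - \<psi> x) < e}"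

text \<open>Bounded linear functionals on a space \<open>V\<close> of functions with (semi)norm \<open>N\<close>. Boundedness forces
  them to respect equality up to null sets.\<close>

definition dual_space ::
  "('m \<Rightarrow> 'b::real_vector) set \<Rightarrow> (('m \<Rightarrow> 'b) \<Rightarrow> real) \<Rightarrow> (('m \<Rightarrow> 'b) \<Rightarrow> real) set" where
  "dual_space V N =
     {F. (\<forall>u\<in>V. \<forall>v\<in>V. \<forall>a b. F (\<lambda>x. a *\<^sub>R u x + b *\<^sub>R v x) = a * F u + b * F v) \<and>
         (\<exists>C. \<forall>u\<in>V. \<bar>F u\<bar> \<le> C * N u)}"

definition weakly_converges ::
  "('m \<Rightarrow> 'b::real_vector) set \<Rightarrow> (('m \<Rightarrow> 'b) \<Rightarrow> real) \<Rightarrow> (nat \<Rightarrow> 'm \<Rightarrow> 'b) \<Rightarrow> ('m \<Rightarrow> 'b) \<Rightarrow> bool" where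
  "weakly_converges V N us u \<longleftrightarrow> (\<forall>F\<in>dual_space V N. (\<lambda>j. F (us j)) \<longlonglongrightarrow> F u)"

definition Hm1 ::
  "('m::topological_space, 'n::finite) weighted_manifold \<Rightarrow> 'm set \<Rightarrow> (('m \<Rightarrow> real) \<Rightarrow> real) set" where
  "Hm1 M \<Omega> = dual_space (H10 M \<Omega>) (H1_norm M \<Omega>)"

definition divergence ::
  "('m::topological_space, 'n::finite) weighted_manifold \<Rightarrow> 'm set \<Rightarrow> ('m \<Rightarrow> real ^ 'n)
     \<Rightarrow> ('m \<Rightarrow> real) \<Rightarrow> real" where
  "divergence M \<Omega> \<xi> v = - (LINT x:\<Omega>|meas M. metric M x (\<xi> x) (grad M \<Omega> v x))"

text \<open>Extended reals are needed here: for \<open>\<Omega> = {}\<close> the inner infimum is over the empty set, and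
  the value is \<open>-\<infinity>\<close>.\<close>

definition m0 ::
  "('m::topological_space, 'n::finite) weighted_manifold \<Rightarrow> 'm set \<Rightarrow> ereal" where
  "m0 M \<Omega> = Inf {ereal m | m::real.
     (INF u\<in>{u \<in> H10 M \<Omega>. H1_norm M \<Omega> u = 1}.
        ereal (LINT x:\<Omega>|meas M. m * (u x)\<^sup>2 + metric M x (grad M \<Omega> u x) (grad M \<Omega> u x))) > 0}"


section \<open>Coefficient fields and H-convergence\<close>

definition coefficient_field ::
  "('m, 'n::finite) weighted_manifold \<Rightarrow> 'm set \<Rightarrow> ('m \<Rightarrow> real ^ 'n \<Rightarrow> real ^ 'n) \<Rightarrow> bool" where
  "coefficient_field M \<Omega> L \<longleftrightarrow>
     (\<forall>x\<in>\<Omega>. linear (L x)) \<and>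
     (\<forall>c\<in>atlas M. \<forall>v. set_borel_measurable (meas M) (\<Omega> \<inter> fst c)
        (\<lambda>x. to_chart (atlas M) c x (L x (from_chart (atlas M) c x v))))"

definition elliptic_fields ::
  "('m, 'n::finite) weighted_manifold \<Rightarrow> 'm set \<Rightarrow> real \<Rightarrow> real
     \<Rightarrow> ('m \<Rightarrow> real ^ 'n \<Rightarrow> real ^ 'n) set" where
  "elliptic_fields M \<Omega> a b =
     {L. coefficient_field M \<Omega> L \<and>
         (AE x in meas M. x \<in> \<Omega> \<longrightarrow>
            (\<forall>\<xi>. metric M x \<xi> (L x \<xi>) \<ge> a * metric M x \<xi> \<xi> \<and>
                 metric M x \<xi> (inv (L x) \<xi>) \<ge> 1 / b * metric M x \<xi> \<xi>))}"

definition symmetric_field ::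
  "('m, 'n::finite) weighted_manifold \<Rightarrow> 'm set \<Rightarrow> ('m \<Rightarrow> real ^ 'n \<Rightarrow> real ^ 'n) \<Rightarrow> bool" where
  "symmetric_field M \<Omega> L \<longleftrightarrow>
     (AE x in meas M. x \<in> \<Omega> \<longrightarrow> (\<forall>\<xi> \<eta>. metric M x (L x \<xi>) \<eta> = metric M x \<xi> (L x \<eta>)))"

text \<open>\<open>u \<in> H10 M \<Omega>\<close> and \<open>- div (L \<nabla>u) = f\<close> in \<open>Hm1 M \<Omega>\<close>.\<close>

definition weak_solution ::
  "('m::topological_space, 'n::finite) weighted_manifold \<Rightarrow> 'm set
     \<Rightarrow> ('m \<Rightarrow> real ^ 'n \<Rightarrow> real ^ 'n) \<Rightarrow> (('m \<Rightarrow> real) \<Rightarrow> real) \<Rightarrow> ('m \<Rightarrow> real) \<Rightarrow> bool" where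
  "weak_solution M \<Omega> L f u \<longleftrightarrow>
     u \<in> H10 M \<Omega> \<and> (\<forall>v\<in>H10 M \<Omega>. - divergence M \<Omega> (\<lambda>x. L x (grad M \<Omega> u x)) v = f v)"

definition H_converges ::
  "('m::topological_space, 'n::finite) weighted_manifold \<Rightarrow> 'm set \<Rightarrow> real \<Rightarrow> real
     \<Rightarrow> (nat \<Rightarrow> 'm \<Rightarrow> real ^ 'n \<Rightarrow> real ^ 'n) \<Rightarrow> ('m \<Rightarrow> real ^ 'n \<Rightarrow> real ^ 'n) \<Rightarrow> bool" where
  "H_converges M \<Omega> a b L L0 \<longleftrightarrow>
     (\<forall>j. L j \<in> elliptic_fields M \<Omega> a b) \<and> L0 \<in> elliptic_fields M \<Omega> a b \<and>
     (\<forall>\<omega>. open \<omega> \<and> compact (closure \<omega>) \<and> closure \<omega> \<subseteq> \<Omega> \<and> m0 M \<omega> < 0 \<longrightarrow>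
        (\<forall>f\<in>Hm1 M \<omega>. \<forall>u u0.
           (\<forall>j. weak_solution M \<omega> (L j) f (u j)) \<and> weak_solution M \<omega> L0 f u0 \<longrightarrow>
           weakly_converges (H1 M \<omega>) (H1_norm M \<omega>) u u0 \<and>
           weakly_converges (L2T M \<omega>) (L2T_norm M \<omega>)
             (\<lambda>j x. L j x (grad M \<omega> (u j) x)) (\<lambda>x. L0 x (grad M \<omega> u0 x))))"


section \<open>Eigenvalues\<close>

definition eigenpair ::
  "('m::topological_space, 'n::finite) weighted_manifold \<Rightarrow> 'm set
     \<Rightarrow> ('m \<Rightarrow> real ^ 'n \<Rightarrow> real ^ 'n) \<Rightarrow> real \<Rightarrow> ('m \<Rightarrow> real) \<Rightarrow> bool" where
  "eigenpair M \<Omega> L l u \<longleftrightarrow>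
     \<not> (AE x in meas M. x \<in> \<Omega> \<longrightarrow> u x = 0) \<and>
     weak_solution M \<Omega> L (\<lambda>v. LINT x:\<Omega>|meas M. l * u x * v x) u"

text \<open>
  The list \<open>l 1 \<le> l 2 \<le> \<dots>\<close> of all eigenvalues, repeated according to multiplicity, with linearly
  independent eigenfunctions \<open>u 1, u 2, \<dots>\<close>; index \<open>0\<close> is not used. Every value occurs in the list
  as often as the dimension of its eigenspace: for each eigenvalue \<open>e\<close>, the finitely many \<open>u k\<close>
  with \<open>l k = e\<close> are a basis of its eigenspace.
\<close>

definition eigenvalue_list ::
  "('m::topological_space, 'n::finite) weighted_manifold \<Rightarrow> 'm set
     \<Rightarrow> ('m \<Rightarrow> real ^ 'n \<Rightarrow> real ^ 'n) \<Rightarrow> (nat \<Rightarrow> real) \<Rightarrow> (nat \<Rightarrow> 'm \<Rightarrow> real) \<Rightarrow> bool" where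
  "eigenvalue_list M \<Omega> L l u \<longleftrightarrow>
     (\<forall>k\<ge>1. eigenpair M \<Omega> L (l k) (u k)) \<and>
     (\<forall>k\<ge>1. l k \<le> l (Suc k)) \<and>
     (\<forall>K c. finite K \<and> K \<subseteq> {1..} \<and> (AE x in meas M. x \<in> \<Omega> \<longrightarrow> (\<Sum>k\<in>K. c k * u k x) = 0) \<longrightarrow>
        (\<forall>k\<in>K. c k = (0::real))) \<and>
     (\<forall>e v. eigenpair M \<Omega> L e v \<longrightarrow>
        finite {k. 1 \<le> k \<and> l k = e} \<and>
        (\<exists>c. AE x in meas M. x \<in> \<Omega> \<longrightarrow> v x = (\<Sum>k\<in>{k. 1 \<le> k \<and> l k = e}. c k * u k x)))"

end

theory Submission
  imports Defs "HOL-Library.Function_Algebras"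
begin

text \<open>
  Let \<open>T\<^sub>j\<close> be the operator on \<open>L\<^sup>2(\<Omega>)\<close> that maps \<open>f\<close> to the solution \<open>u \<in> H\<^sup>1\<^sub>0(\<Omega>)\<close> of
  \<open>- div (L\<^sub>j \<nabla>u) = f\<close>, and \<open>T\<^sub>0\<close> the same for the limit field. These operators are symmetric and
  positive, and their eigenvalues are the reciprocals of the eigenvalues of the differential operators.
  Applied on \<open>\<Omega>\<close> itself, H-convergence says that \<open>T\<^sub>j f\<close> tends to \<open>T\<^sub>0 f\<close> weakly in \<open>H\<^sup>1\<close> for every fixed
  \<open>f\<close>. The theorem follows from the stronger fact that \<open>T\<^sub>j\<close> tends to \<open>T\<^sub>0\<close> in operator norm, which
  comes from compactness and symmetry.

  Compactness is used as an inequality: for every \<open>\<epsilon> > 0\<close> there is a finite set \<open>D\<close> in \<open>L\<^sup>2\<close> such that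
  \<open>\<parallel>v\<parallel>\<^sup>2 \<le> \<epsilon> \<parallel>v\<parallel>\<^sup>2\<^bsub>H\<^esub> + (\<Sum>e\<in>D. (v, e)\<^sup>2)\<close> for all \<open>v \<in> H\<^sup>1\<^sub>0\<close> (lemma \<open>compactness_estimate\<close>), where
  \<open>\<parallel>v\<parallel>\<^bsub>H\<^esub>\<close> is the \<open>H\<^sup>1\<close> norm. With \<open>v = D\<^sub>j f\<close>, \<open>D\<^sub>j = T\<^sub>j - T\<^sub>0\<close>, the first term is small because the
  operators are uniformly bounded into \<open>H\<^sup>1\<^sub>0\<close>, and in the second one symmetry moves \<open>D\<^sub>j\<close> to the other
  side, \<open>\<bar>(D\<^sub>j f, e)\<bar> = \<bar>(f, D\<^sub>j e)\<bar> \<le> \<parallel>f\<parallel> \<parallel>D\<^sub>j e\<parallel>\<close>, where only the finitely many \<open>D\<^sub>j e\<close> have to tend to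
  zero strongly. They do so by the same inequality (lemmas \<open>D_strong\<close> and \<open>D_uniform\<close>).

  The min-max principle bounds the difference of the \<open>k\<close>-th eigenvalues of \<open>T\<^sub>j\<close> and \<open>T\<^sub>0\<close> by
  \<open>\<parallel>D\<^sub>j\<parallel>\<close>, which gives the convergence of the eigenvalues. For the eigenfunctions, decompose \<open>u\<^sub>0\<^sub>,\<^sub>k\<close> into its
  projection to the span of \<open>u\<^sub>j\<^sub>,\<^sub>1, \<dots>, u\<^sub>j\<^sub>,\<^sub>k\<^sub>+\<^sub>s\<^sub>-\<^sub>1\<close> and a remainder. The vector
  \<open>(T\<^sub>j - 1 / \<lambda>\<^sub>0\<^sub>,\<^sub>k) u\<^sub>0\<^sub>,\<^sub>k = D\<^sub>j u\<^sub>0\<^sub>,\<^sub>k\<close> tends to zero. Testing it with the remainder and with the part of the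
  projection with index below \<open>k\<close>, the gaps around \<open>\<lambda>\<^sub>0\<^sub>,\<^sub>k\<close> show that both of these tend to zero
  (lemmas \<open>eigenvector_remainders\<close> and \<open>eigenvectors_converge\<close>).
  The limit field is symmetric on \<open>H\<^sup>1\<^sub>0\<close> as a limit of symmetric ones (lemma \<open>limit_form_symmetric\<close>).

  This argument is carried out for abstract forms in the locale \<open>converging_forms\<close>. Since elements of
  \<open>L\<^sup>2\<close> are represented by functions, all spaces carry positive semidefinite inner products, and
  vectors of length zero take the place of functions that vanish almost everywhere. The rest of the
  text verifies the hypotheses of that locale: the weak gradient is unique and linear, \<open>H\<^sup>1\<^sub>0\<close> is
  complete, \<open>m\<^sub>0(\<Omega>) < 0\<close> is a Poincare inequality (lemma \<open>poincare_of_m0\<close>) that makes the energy forms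
  uniformly coercive, and the compactness estimate holds. The latter follows from the elementary
  Poincare inequality on convex sets (lemma \<open>poincare_convex\<close>), applied in charts to the pieces of a
  fine division of finitely many boxes that cover \<open>\<Omega>\<close>.
\<close>

section \<open>Semi-inner product spaces\<close>

locale semi_inner =
  fixes X :: "'v::real_vector set" and ip :: "'v \<Rightarrow> 'v \<Rightarrow> real"
  assumes carrier_subspace: "subspace X"
    and ip_sym: "\<lbrakk>x \<in> X; y \<in> X\<rbrakk> \<Longrightarrow> ip x y = ip y x"
    and add_left: "\<lbrakk>x \<in> X; y \<in> X; z \<in> X\<rbrakk> \<Longrightarrow> ip (x + y) z = ip x z + ip y z"
    and scale_left: "\<lbrakk>x \<in> X; z \<in> X\<rbrakk> \<Longrightarrow> ip (c *\<^sub>R x) z = c * ip x z"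
    and ip_nonneg: "x \<in> X \<Longrightarrow> 0 \<le> ip x x"
begin

lemma zero_mem: "0 \<in> X" and add_mem: "\<lbrakk>x \<in> X; y \<in> X\<rbrakk> \<Longrightarrow> x + y \<in> X"
  and scale_mem: "x \<in> X \<Longrightarrow> c *\<^sub>R x \<in> X" and diff_mem: "\<lbrakk>x \<in> X; y \<in> X\<rbrakk> \<Longrightarrow> x - y \<in> X"
  and sum_mem: "(\<And>i. i \<in> I \<Longrightarrow> f i \<in> X) \<Longrightarrow> sum f I \<in> X"
  using carrier_subspace by (auto simp: subspace_0 subspace_add subspace_scale subspace_diff subspace_sum)

lemmas mem = zero_mem add_mem scale_mem diff_mem sum_mem

lemma add_right: "\<lbrakk>x \<in> X; y \<in> X; z \<in> X\<rbrakk> \<Longrightarrow> ip z (x + y) = ip z x + ip z y"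
  using add_left[of x y z] ip_sym mem by metis

lemma scale_right: "\<lbrakk>x \<in> X; z \<in> X\<rbrakk> \<Longrightarrow> ip z (c *\<^sub>R x) = c * ip z x"
  using scale_left[of x z c] ip_sym mem by metis

lemma diff_left: "\<lbrakk>x \<in> X; y \<in> X; z \<in> X\<rbrakk> \<Longrightarrow> ip (x - y) z = ip x z - ip y z"
  using add_left[of x "(-1) *\<^sub>R y" z] scale_left[of y z "-1"] mem(3)[of y "-1"] by simp

lemma diff_right: "\<lbrakk>x \<in> X; y \<in> X; z \<in> X\<rbrakk> \<Longrightarrow> ip z (x - y) = ip z x - ip z y"
  using diff_left[of x y z] ip_sym mem by metis

lemma zero_left: "z \<in> X \<Longrightarrow> ip 0 z = 0"
  using scale_left[of 0 z 0] mem by simp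

lemma zero_right: "z \<in> X \<Longrightarrow> ip z 0 = 0"
  using zero_left[of z] ip_sym[of z 0] mem by simp

lemma sum_left: "\<lbrakk>\<And>i. i \<in> I \<Longrightarrow> f i \<in> X; z \<in> X\<rbrakk> \<Longrightarrow> ip (sum f I) z = (\<Sum>i\<in>I. ip (f i) z)"
  by (induction I rule: infinite_finite_induct) (auto simp: zero_left add_left mem)

lemma sum_right: "\<lbrakk>\<And>i. i \<in> I \<Longrightarrow> f i \<in> X; z \<in> X\<rbrakk> \<Longrightarrow> ip z (sum f I) = (\<Sum>i\<in>I. ip z (f i))"
  by (induction I rule: infinite_finite_induct) (auto simp: zero_right add_right mem)

lemmas bilin = add_left add_right diff_left diff_right scale_left scale_right zero_left zero_right

lemma quadratic_expand:
  "\<lbrakk>x \<in> X; y \<in> X\<rbrakk> \<Longrightarrow> ip (x + t *\<^sub>R y) (x + t *\<^sub>R y) = ip x x + 2 * t * ip x y + t\<^sup>2 * ip y y"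
  using ip_sym[of x y] by (simp add: bilin mem algebra_simps power2_eq_square)

lemma Cauchy_Schwarz: 
  assumes "x \<in> X" "y \<in> X" shows "(ip x y)\<^sup>2 \<le> ip x x * ip y y"
proof (cases "ip y y = 0")
  case True
  have "ip x y = 0"
  proof (rule ccontr)
    assume n: "ip x y \<noteq> 0"
    have "0 \<le> ip x x + 2 * (-(ip x x + 1) / (2 * ip x y)) * ip x y + (-(ip x x + 1) / (2 * ip x y))\<^sup>2 * ip y y"
      by (subst quadratic_expand[symmetric]) (use assms in \<open>auto intro!: ip_nonneg mem\<close>)
    then show False using n True by (simp add: field_simps)
  qed
  then show ?thesis using True by simp
next
  case False
  then have p: "ip y y > 0" using ip_nonneg[OF assms(2)] by simp
  have "0 \<le> ip x x + 2 * (- ip x y / ip y y) * ip x y + (- ip x y / ip y y)\<^sup>2 * ip y y"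
    by (subst quadratic_expand[symmetric]) (use assms in \<open>auto intro!: ip_nonneg mem\<close>)
  also have "\<dots> = ip x x - (ip x y)\<^sup>2 / ip y y"
    using p by (simp add: power2_eq_square field_simps)
  finally show ?thesis using p by (simp add: field_simps)
qed

lemma Cauchy_Schwarz_sqrt:
  assumes "x \<in> X" "y \<in> X" shows "\<bar>ip x y\<bar> \<le> sqrt (ip x x) * sqrt (ip y y)"
  using Cauchy_Schwarz[OF assms] real_sqrt_le_mono by (fastforce simp: real_sqrt_mult)

lemma null_right: "\<lbrakk>x \<in> X; y \<in> X; ip y y = 0\<rbrakk> \<Longrightarrow> ip x y = 0"
  using Cauchy_Schwarz[of x y] by simp

lemma add_square_le: assumes "x \<in> X" "y \<in> X" shows "ip (x + y) (x + y) \<le> 2 * ip x x + 2 * ip y y"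
  using ip_nonneg[of "x - y"] assms ip_sym[of x y] by (simp add: bilin mem)

lemma diff_square_le: assumes "x \<in> X" "y \<in> X" shows "ip (x - y) (x - y) \<le> 2 * ip x x + 2 * ip y y"
  using ip_nonneg[of "x + y"] assms ip_sym[of x y] by (simp add: bilin mem)

lemma triangle: assumes "x \<in> X" "y \<in> X" 
  shows "sqrt (ip (x + y) (x + y)) \<le> sqrt (ip x x) + sqrt (ip y y)"
proof (rule real_le_lsqrt)
  have "ip (x + y) (x + y) = ip x x + 2 * ip x y + ip y y"
    using assms ip_sym[of x y] by (simp add: bilin mem)
  also have "\<dots> \<le> ip x x + 2 * (sqrt (ip x x) * sqrt (ip y y)) + ip y y"
    using Cauchy_Schwarz_sqrt[OF assms] by linarith
  also have "\<dots> = (sqrt (ip x x) + sqrt (ip y y))\<^sup>2"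
    using assms by (simp add: power2_sum ip_nonneg)
  finally show "ip (x + y) (x + y) \<le> (sqrt (ip x x) + sqrt (ip y y))\<^sup>2" .
qed (use assms in \<open>auto simp: ip_nonneg mem\<close>)

lemma tendsto_ip:
  assumes s: "\<And>n. s n \<in> X" and x: "x \<in> X" and y: "y \<in> X"
    and lim: "(\<lambda>n. ip (s n - x) (s n - x)) \<longlonglongrightarrow> 0"
  shows "(\<lambda>n. ip (s n) y) \<longlonglongrightarrow> ip x y"
proof (rule LIM_zero_cancel, rule Lim_null_comparison)
  show "\<forall>\<^sub>F n in sequentially. norm (ip (s n) y - ip x y) \<le> sqrt (ip (s n - x) (s n - x)) * sqrt (ip y y)"
    using Cauchy_Schwarz_sqrt[of "s _ - x" y] s x y by (auto simp: bilin mem)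
  show "(\<lambda>n. sqrt (ip (s n - x) (s n - x)) * sqrt (ip y y)) \<longlonglongrightarrow> 0"
    using tendsto_mult_right[OF tendsto_real_sqrt[OF lim], of "sqrt (ip y y)"] by simp
qed

lemma tendsto_square:
  assumes s: "\<And>n. s n \<in> X" and x: "x \<in> X"
    and lim: "(\<lambda>n. ip (s n - x) (s n - x)) \<longlonglongrightarrow> 0"
  shows "(\<lambda>n. ip (s n) (s n)) \<longlonglongrightarrow> ip x x"
proof -
  have "ip (s n) (s n) = ip (s n - x) (s n - x) + 2 * ip (s n) x - ip x x" for n
    using s[of n] x ip_sym[of x "s n"] by (simp add: bilin mem)
  moreover have "(\<lambda>n. ip (s n - x) (s n - x) + 2 * ip (s n) x - ip x x) \<longlonglongrightarrow> 0 + 2 * ip x x - ip x x"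
    by (intro tendsto_intros lim tendsto_ip s x)
  ultimately show ?thesis by simp
qed

text \<open>Gram-Schmidt, one vector at a time: the new vector is first made orthogonal to the old ones. If that
  leaves a vector of length zero, the division by zero in its coefficient gives the value zero, which is
  a correct choice.\<close>

lemma finite_projection:
  assumes "finite I" "\<And>i. i \<in> I \<Longrightarrow> u i \<in> X" "f \<in> X"
  shows "\<exists>c. \<forall>m\<in>I. ip (f - (\<Sum>i\<in>I. c i *\<^sub>R u i)) (u m) = 0"
  using assms
proof (induction I arbitrary: f rule: finite_induct)
  case empty
  then show ?case by simp
next
  case (insert n I)
  have u: "\<And>i. i \<in> I \<Longrightarrow> u i \<in> X" and un: "u n \<in> X" and f: "f \<in> X" using insert.prems by auto
  obtain c where c: "\<forall>m\<in>I. ip (f - (\<Sum>i\<in>I. c i *\<^sub>R u i)) (u m) = 0" 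
    using insert.IH[OF u f] by blast
  obtain d where d: "\<forall>m\<in>I. ip (u n - (\<Sum>i\<in>I. d i *\<^sub>R u i)) (u m) = 0" 
    using insert.IH[OF u un] by blast
  define z where "z = u n - (\<Sum>i\<in>I. d i *\<^sub>R u i)"
  define f' where "f' = f - (\<Sum>i\<in>I. c i *\<^sub>R u i)"
  have S: "(\<Sum>i\<in>I. c i *\<^sub>R u i) \<in> X" for c by (intro mem u)
  have zX: "z \<in> X" "f' \<in> X" unfolding z_def f'_def using un f S by (auto intro!: diff_mem)
  define t where "t = ip f' z / ip z z"
  define e where "e = (\<lambda>i. if i = n then t else c i - t * d i)"
  have nI: "n \<notin> I" using insert by simp
  have "(\<Sum>i\<in>I. e i *\<^sub>R u i) = (\<Sum>i\<in>I. c i *\<^sub>R u i - t *\<^sub>R (d i *\<^sub>R u i))"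
    by (rule sum.cong) (use nI in \<open>auto simp: e_def algebra_simps\<close>)
  also have "\<dots> = (\<Sum>i\<in>I. c i *\<^sub>R u i) - t *\<^sub>R (\<Sum>i\<in>I. d i *\<^sub>R u i)"
    by (simp add: sum_subtractf scaleR_sum_right)
  finally have "(\<Sum>i\<in>insert n I. e i *\<^sub>R u i) = t *\<^sub>R u n + ((\<Sum>i\<in>I. c i *\<^sub>R u i) - t *\<^sub>R (\<Sum>i\<in>I. d i *\<^sub>R u i))"
    using insert.hyps by (simp add: e_def)
  then have eq: "f - (\<Sum>i\<in>insert n I. e i *\<^sub>R u i) = f' - t *\<^sub>R z"
    by (simp add: f'_def z_def algebra_simps)
  have o: "ip (f' - t *\<^sub>R z) (u m) = 0" if "m \<in> I" for m
    using c d that zX u[OF that] by (simp add: bilin mem z_def[symmetric] f'_def[symmetric])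
  have oz: "ip (f' - t *\<^sub>R z) z = 0"
  proof (cases "ip z z = 0")
    case True then show ?thesis using zX null_right[of _ z] by (simp add: mem)
  next
    case False then show ?thesis using zX by (simp add: bilin mem t_def)
  qed
  have "u n = z + (\<Sum>i\<in>I. d i *\<^sub>R u i)" by (simp add: z_def)
  then have "ip (f' - t *\<^sub>R z) (u n) = ip (f' - t *\<^sub>R z) z + (\<Sum>i\<in>I. d i * ip (f' - t *\<^sub>R z) (u i))"
    using zX u S by (simp add: add_right mem sum_right scale_right)
  then have "ip (f' - t *\<^sub>R z) (u n) = 0" using o oz by simp
  then show ?case using o eq by (intro exI[of _ e]) auto
qed

definition ip_complete :: bool where
  "ip_complete \<longleftrightarrow> (\<forall>s. (\<forall>n. s n \<in> X) \<and> (\<forall>e>0. \<exists>N. \<forall>m\<ge>N. \<forall>n\<ge>N. ip (s m - s n) (s m - s n) < e) \<longrightarrow>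
      (\<exists>x\<in>X. (\<lambda>n. ip (s n - x) (s n - x)) \<longlonglongrightarrow> 0))"

text \<open>The representing vector minimises \<open>J v = (v, v) - 2 F v\<close>: minimising sequences are Cauchy by the
  parallelogram identity, and the first variation at the limit is \<open>(u, v) - F v\<close>.\<close>

lemma riesz_representation:
  assumes comp: "ip_complete"
    and F_add: "\<And>x y. \<lbrakk>x \<in> X; y \<in> X\<rbrakk> \<Longrightarrow> F (x + y) = F x + F y"
    and F_scale: "\<And>c x. x \<in> X \<Longrightarrow> F (c *\<^sub>R x) = c * F x"
    and F_bound: "\<And>x. x \<in> X \<Longrightarrow> (F x)\<^sup>2 \<le> C * ip x x"
  shows "\<exists>u\<in>X. \<forall>v\<in>X. ip u v = F v"
proof -
  define J where "J v = ip v v - 2 * F v" for v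
  have J_lb: "- \<bar>C\<bar> \<le> J v" if "v \<in> X" for v
  proof -
    have n: "0 \<le> ip v v" by (rule ip_nonneg[OF that])
    have "(F v)\<^sup>2 \<le> \<bar>C\<bar> * ip v v" 
      using F_bound[OF that] mult_right_mono[OF abs_ge_self n, of C] by linarith
    then have "\<bar>F v\<bar> \<le> sqrt (\<bar>C\<bar> * ip v v)" using real_le_rsqrt by simp
    also have "\<dots> = sqrt \<bar>C\<bar> * sqrt (ip v v)" by (simp add: real_sqrt_mult)
    also have "2 * (sqrt \<bar>C\<bar> * sqrt (ip v v)) \<le> \<bar>C\<bar> + ip v v"
      using sum_squares_bound[of "sqrt \<bar>C\<bar>" "sqrt (ip v v)"] n by (simp add: mult.assoc)
    finally show ?thesis unfolding J_def by (auto simp: abs_le_iff)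
  qed
  define m where "m = Inf (J ` X)"
  have bdd: "bdd_below (J ` X)" using J_lb by (auto intro!: bdd_belowI2)
  have ne: "J ` X \<noteq> {}" using mem by auto
  have m_le: "m \<le> J v" if "v \<in> X" for v unfolding m_def using that bdd by (auto intro: cInf_lower)
  have "\<exists>v\<in>X. J v < m + 1 / real (Suc n)" for n
    using cInf_lessD[OF ne, of "m + 1 / real (Suc n)"] by (auto simp: m_def)
  then obtain s where s: "\<And>n. s n \<in> X" and Js: "\<And>n. J (s n) < m + 1 / real (Suc n)" by metis
  have par: "ip (s i - s j) (s i - s j) \<le> 2 / real (Suc i) + 2 / real (Suc j)" for i j
  proof -
    have si: "s i \<in> X" "s j \<in> X" by (auto intro: s)
    have "ip (s i - s j) (s i - s j) = 2 * J (s i) + 2 * J (s j) - 4 * J ((1/2) *\<^sub>R (s i + s j))"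
      unfolding J_def using si ip_sym[of "s i" "s j"] by (simp add: bilin mem F_add F_scale algebra_simps)
    moreover have "m \<le> J ((1/2) *\<^sub>R (s i + s j))" by (intro m_le mem si)
    moreover have "2 / x = 2 * (1 / x)" for x :: real by simp
    ultimately show ?thesis using Js[of i] Js[of j] by linarith
  qed
  have "\<exists>N. \<forall>m\<ge>N. \<forall>n\<ge>N. ip (s m - s n) (s m - s n) < e" if "e > 0" for e
  proof -
    have "0 < e / 4" using that by simp
    then obtain N where N: "1 / real (Suc N) < e / 4" by (rule nat_approx_posE)
    have "1 / real (Suc n) < e / 4" if "n \<ge> N" for n
      using N that by (smt (verit, best) frac_le of_nat_mono of_nat_0_less_iff zero_less_Suc Suc_le_mono)
    then have *: "2 / real (Suc n) < e / 2" if "n \<ge> N" for n using that by fastforce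
    have "ip (s m - s n) (s m - s n) < e" if "m \<ge> N" "n \<ge> N" for m n
      using par[of m n] *[OF that(1)] *[OF that(2)] by linarith
    then show ?thesis by blast
  qed
  then obtain u where u: "u \<in> X" and lim: "(\<lambda>n. ip (s n - u) (s n - u)) \<longlonglongrightarrow> 0"
    using comp s unfolding ip_complete_def by blast
  have "ip u w = F w" if w: "w \<in> X" for w
  proof -
    have *: "0 \<le> 2 * t * (ip u w - F w) + t\<^sup>2 * ip w w" for t
    proof -
      have "- (1 / real (Suc n)) \<le> 2 * t * (ip (s n) w - F w) + t\<^sup>2 * ip w w" for n
      proof -
        have "m \<le> J (s n + t *\<^sub>R w)" by (intro m_le mem s w)
        also have "J (s n + t *\<^sub>R w) = J (s n) + 2 * t * (ip (s n) w - F w) + t\<^sup>2 * ip w w"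
          unfolding J_def using s[of n] w by (simp add: quadratic_expand F_add F_scale mem algebra_simps)
        finally show ?thesis using Js[of n] by simp
      qed
      moreover have "(\<lambda>n. 2 * t * (ip (s n) w - F w) + t\<^sup>2 * ip w w) \<longlonglongrightarrow> 2 * t * (ip u w - F w) + t\<^sup>2 * ip w w"
        by (intro tendsto_intros tendsto_ip s u w lim)
      moreover have "(\<lambda>n. - (1 / real (Suc n))) \<longlonglongrightarrow> -0" 
        by (intro tendsto_minus) (rule LIMSEQ_Suc[OF lim_1_over_n])
      ultimately show ?thesis by (intro LIMSEQ_le[of "\<lambda>n. - (1 / real (Suc n))"]) auto
    qed
    show ?thesis
    proof (rule ccontr)
      assume n: "ip u w \<noteq> F w"
      define d where "d = ip u w - F w"
      have d: "d \<noteq> 0" using n by (simp add: d_def)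
      define p where "p = ip w w + 1"
      have p: "p > 0" using ip_nonneg[OF w] by (simp add: p_def)
      have "0 \<le> 2 * (- d / p) * d + (- d / p)\<^sup>2 * ip w w" using *[of "-d/p"] by (simp add: d_def)
      also have "\<dots> \<le> 2 * (- d / p) * d + (- d / p)\<^sup>2 * p"
        by (intro add_left_mono mult_left_mono) (auto simp: p_def)
      also have "\<dots> = - (d\<^sup>2 / p)" using p by (simp add: power2_eq_square field_simps)
      also have "\<dots> < 0" using d p by simp
      finally show False by simp
    qed
  qed
  then show ?thesis using u by blast
qed

end

text \<open>Gaussian elimination; it replaces a dimension count in the min-max principle, where the space is
  spanned by vectors whose independence is only known modulo vectors of length zero.\<close>

lemma homogeneous_system_solution:
  fixes A :: "'i \<Rightarrow> 'j \<Rightarrow> real"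
  assumes "finite I" "finite J" "card I < card J"
  shows "\<exists>c. (\<exists>j\<in>J. c j \<noteq> 0) \<and> (\<forall>i\<in>I. (\<Sum>j\<in>J. c j * A i j) = 0)"
  using assms
proof (induction I arbitrary: J A rule: finite_induct)
  case empty
  then have "J \<noteq> {}" by auto
  then show ?case by (intro exI[of _ "\<lambda>_. 1"]) auto
next
  case (insert i0 I)
  show ?case
  proof (cases "\<forall>j\<in>J. A i0 j = 0")
    case True
    obtain c where "\<exists>j\<in>J. c j \<noteq> 0" "\<forall>i\<in>I. (\<Sum>j\<in>J. c j * A i j) = 0"
      using insert.IH[of J A] insert.prems insert.hyps by (metis Suc_lessD card_insert_disjoint)
    then show ?thesis using True by (intro exI[of _ c]) auto
  next
    case False
    then obtain j0 where j0: "j0 \<in> J" "A i0 j0 \<noteq> 0" by blast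
    define A' where "A' i j = A i j - A i j0 * A i0 j / A i0 j0" for i j
    have "card I < card (J - {j0})" using insert j0 by simp
    then obtain c where c: "\<exists>j\<in>J - {j0}. c j \<noteq> 0" "\<forall>i\<in>I. (\<Sum>j\<in>J - {j0}. c j * A' i j) = 0"
      using insert.IH[of "J - {j0}" A'] insert.prems(1) by blast
    define t where "t = - (\<Sum>j\<in>J - {j0}. c j * A i0 j) / A i0 j0"
    define d where "d = c(j0 := t)"
    have s: "(\<Sum>j\<in>J. d j * A i j) = t * A i j0 + (\<Sum>j\<in>J - {j0}. c j * A i j)" for i
      using insert.prems j0 by (subst sum.remove[of J j0]) (auto simp: d_def intro!: sum.cong)
    have "(\<Sum>j\<in>J. d j * A i0 j) = 0" using s[of i0] j0 by (simp add: t_def)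
    moreover have "(\<Sum>j\<in>J. d j * A i j) = 0" if "i \<in> I" for i
    proof -
      have "0 = (\<Sum>j\<in>J - {j0}. c j * A' i j)" using c that by simp
      also have "\<dots> = (\<Sum>j\<in>J - {j0}. c j * A i j) - (\<Sum>j\<in>J - {j0}. (A i j0 / A i0 j0) * (c j * A i0 j))"
        unfolding A'_def by (subst sum_subtractf[symmetric], rule sum.cong) (auto simp: algebra_simps)
      also have "\<dots> = (\<Sum>j\<in>J. d j * A i j)"
        unfolding s sum_distrib_left[symmetric] t_def by simp
      finally show ?thesis by simp
    qed
    moreover have "\<exists>j\<in>J. d j \<noteq> 0" using c by (auto simp: d_def)
    ultimately show ?thesis by (intro exI[of _ d]) auto
  qed
qed

lemma bounded_finite_family_subseq:
  fixes \<psi> :: "'e \<Rightarrow> nat \<Rightarrow> real"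
  assumes "finite E" "\<And>e. e \<in> E \<Longrightarrow> Bseq (\<psi> e)"
  shows "\<exists>r::nat\<Rightarrow>nat. strict_mono r \<and> (\<forall>e\<in>E. convergent (\<lambda>n. \<psi> e (r n)))"
  using assms
proof (induction E rule: finite_induct)
  case empty
  then show ?case by (auto intro: exI[of _ id] simp: strict_mono_def)
next
  case (insert e E)
  then obtain r :: "nat \<Rightarrow> nat" where r: "strict_mono r" "\<forall>e\<in>E. convergent (\<lambda>n. \<psi> e (r n))" by auto
  have "bounded (range (\<lambda>n. \<psi> e (r n)))"
    using insert.prems[of e] by (auto simp: Bseq_eq_bounded intro: bounded_subset)
  then obtain l q where q: "strict_mono q" "((\<lambda>n. \<psi> e (r n)) \<circ> q) \<longlonglongrightarrow> l"
    using bounded_imp_convergent_subsequence by blast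
  have "convergent (\<lambda>n. \<psi> e' (r (q n)))" if "e' \<in> E" for e'
    using r(2) that q(1) convergent_subseq_convergent[of "\<lambda>n. \<psi> e' (r n)" q] by (auto simp: o_def)
  moreover have "convergent (\<lambda>n. \<psi> e (r (q n)))" using q(2) by (auto simp: convergent_def o_def)
  ultimately show ?case using strict_mono_o[OF r(1) q(1)] by (intro exI[of _ "r \<circ> q"]) (auto simp: o_def)
qed

section \<open>Spectral theory of coercive forms\<close>

lemma (in semi_inner) ip_completeD:
  assumes "ip_complete" and "\<And>n::nat. s n \<in> X"
    and "\<And>e. e > 0 \<Longrightarrow> \<exists>N. \<forall>m\<ge>N. \<forall>n\<ge>N. ip (s m - s n) (s m - s n) < e"
  shows "\<exists>x\<in>X. (\<lambda>n. ip (s n - x) (s n - x)) \<longlonglongrightarrow> 0"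
  using assms(1)[unfolded ip_complete_def, rule_format, of s] assms(2,3) by simp

lemma (in semi_inner) lincomb_null:
  assumes "\<And>i. i \<in> I \<Longrightarrow> f i \<in> X" "z \<in> X" "\<And>i. i \<in> I \<Longrightarrow> ip (f i) z = 0"
  shows "ip (\<Sum>i\<in>I. c i *\<^sub>R f i) z = 0"
  using assms by (subst sum_left) (auto intro!: scale_mem sum.neutral simp: scale_left)

text \<open>A space \<open>V\<close> that is compactly embedded in \<open>X\<close>, as \<open>H\<^sup>1\<^sub>0\<close> in \<open>L\<^sup>2\<close>. The last assumption is the
  quantitative form of compactness: up to a small multiple of the norm of \<open>V\<close>, the norm of \<open>X\<close> is
  controlled by finitely many functionals.\<close>

locale rellich_pair = L: semi_inner X ip + E: semi_inner V h
  for X V :: "'v::real_vector set" and ip h :: "'v \<Rightarrow> 'v \<Rightarrow> real" +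
  assumes V_sub: "V \<subseteq> X" 
    and ip_le: "\<And>v. v \<in> V \<Longrightarrow> ip v v \<le> h v v"
    and complete: "semi_inner.ip_complete V h"
    and rellich: "\<And>\<epsilon>. \<epsilon> > 0 \<Longrightarrow> 
      \<exists>D. finite D \<and> D \<subseteq> X \<and> (\<forall>v\<in>V. ip v v \<le> \<epsilon> * h v v + (\<Sum>e\<in>D. (ip v e)\<^sup>2))"
begin

lemma VX: "v \<in> V \<Longrightarrow> v \<in> X" using V_sub by auto

end

locale energy_form = rellich_pair X V ip h + A: semi_inner V a
  for X V :: "'v::real_vector set" and ip h a :: "'v \<Rightarrow> 'v \<Rightarrow> real" +
  fixes \<alpha> \<beta> :: real
  assumes \<alpha>_pos: "0 < \<alpha>" 
    and coercive: "\<And>v. v \<in> V \<Longrightarrow> \<alpha> * h v v \<le> a v v"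
    and bounded: "\<And>v. v \<in> V \<Longrightarrow> a v v \<le> \<beta> * h v v"
begin

lemma energy_complete: "A.ip_complete"
  unfolding A.ip_complete_def
proof (intro allI impI)
  fix s assume s: "(\<forall>n::nat. s n \<in> V) \<and> (\<forall>e>0. \<exists>N. \<forall>m\<ge>N. \<forall>n\<ge>N. a (s m - s n) (s m - s n) < e)"
  have "\<exists>N. \<forall>m\<ge>N. \<forall>n\<ge>N. h (s m - s n) (s m - s n) < e" if "e > 0" for e
  proof -
    have "0 < \<alpha> * e" using \<alpha>_pos that by simp
    then obtain N where N: "\<forall>m\<ge>N. \<forall>n\<ge>N. a (s m - s n) (s m - s n) < \<alpha> * e"
      using s by blast
    have "h (s m - s n) (s m - s n) < e" if "m \<ge> N" "n \<ge> N" for m n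
    proof -
      have "\<alpha> * h (s m - s n) (s m - s n) < \<alpha> * e"
        using coercive[of "s m - s n"] N that s E.mem(4) by (metis le_less_trans)
      then show ?thesis using \<alpha>_pos by simp
    qed
    then show ?thesis by blast
  qed
  then obtain x where x: "x \<in> V" "(\<lambda>n. h (s n - x) (s n - x)) \<longlonglongrightarrow> 0"
    using E.ip_completeD[OF complete, of s] conjunct1[OF s] by blast
  have "(\<lambda>n. a (s n - x) (s n - x)) \<longlonglongrightarrow> 0"
  proof (rule Lim_null_comparison)
    have "norm (a (s n - x) (s n - x)) \<le> \<beta> * h (s n - x) (s n - x)" for n
    proof -
      have "s n - x \<in> V" using conjunct1[OF s] x by (intro E.diff_mem) auto
      then show ?thesis using bounded[of "s n - x"] A.ip_nonneg[of "s n - x"] by simp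
    qed
    then show "\<forall>\<^sub>F n in sequentially. norm (a (s n - x) (s n - x)) \<le> \<beta> * h (s n - x) (s n - x)" by simp
    show "(\<lambda>n. \<beta> * h (s n - x) (s n - x)) \<longlonglongrightarrow> 0" using tendsto_mult_left[OF x(2), of \<beta>] by simp
  qed
  then show "\<exists>x\<in>V. (\<lambda>n. a (s n - x) (s n - x)) \<longlonglongrightarrow> 0" using x by blast
qed

lemma solve:
  assumes "\<And>x y. \<lbrakk>x \<in> V; y \<in> V\<rbrakk> \<Longrightarrow> F (x + y) = F x + F y"
    and "\<And>c x. x \<in> V \<Longrightarrow> F (c *\<^sub>R x) = c * F x"
    and F_bound: "\<And>x. x \<in> V \<Longrightarrow> (F x)\<^sup>2 \<le> C * h x x"
  shows "\<exists>u\<in>V. \<forall>v\<in>V. a u v = F v"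
proof (rule A.riesz_representation[OF energy_complete assms(1,2)])
  fix x assume x: "x \<in> V"
  have "(F x)\<^sup>2 \<le> \<bar>C\<bar> * h x x" 
    using F_bound[OF x] mult_right_mono[OF abs_ge_self E.ip_nonneg[OF x], of C] by linarith
  also have "h x x \<le> a x x / \<alpha>" using coercive[OF x] \<alpha>_pos by (simp add: field_simps)
  then have "\<bar>C\<bar> * h x x \<le> \<bar>C\<bar> * (a x x / \<alpha>)" by (rule mult_left_mono) simp
  finally show "(F x)\<^sup>2 \<le> (\<bar>C\<bar> / \<alpha>) * a x x" by simp
qed auto

text \<open>The solution operator of the form. The solution is unique only up to a vector of length zero, so one
  is chosen; all statements about \<open>T\<close> are insensitive to the choice.\<close>

definition T :: "'v \<Rightarrow> 'v" where
  "T f = (SOME u. u \<in> V \<and> (\<forall>v\<in>V. a u v = ip f v))"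

lemma T_solves: assumes f: "f \<in> X" shows "T f \<in> V" "v \<in> V \<Longrightarrow> a (T f) v = ip f v"
proof -
  have "(ip f v)\<^sup>2 \<le> ip f f * h v v" if "v \<in> V" for v
    using L.Cauchy_Schwarz[OF f VX[OF that]] mult_left_mono[OF ip_le[OF that] L.ip_nonneg[OF f]] by linarith
  then have "\<exists>u\<in>V. \<forall>v\<in>V. a u v = ip f v"
    by (intro solve[where F = "ip f" and C = "ip f f"] L.add_right L.scale_right VX f)
  then have "T f \<in> V \<and> (\<forall>v\<in>V. a (T f) v = ip f v)"
    using someI_ex[of "\<lambda>u. u \<in> V \<and> (\<forall>v\<in>V. a u v = ip f v)"] unfolding T_def by blast
  then show "T f \<in> V" "v \<in> V \<Longrightarrow> a (T f) v = ip f v" by auto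
qed

lemma T_X: "f \<in> X \<Longrightarrow> T f \<in> X" using T_solves VX by auto

text \<open>Stated for an arbitrary solution so that it also applies to \<open>T f - T g\<close>, which need not be the chosen
  solution \<open>T (f - g)\<close>.\<close>

lemma energy_bound:
  assumes d: "d \<in> X" and D: "D \<in> V" "\<And>v. v \<in> V \<Longrightarrow> a D v = ip d v"
  shows "\<alpha>\<^sup>2 * h D D \<le> ip d d"
proof (cases "h D D = 0")
  case True then show ?thesis using L.ip_nonneg[OF d] by simp
next
  case False
  then have p: "h D D > 0" using E.ip_nonneg[OF D(1)] by simp
  have "\<alpha> * h D D \<le> ip d D" using coercive[OF D(1)] D(2)[OF D(1)] by simp
  then have "(\<alpha> * h D D)\<^sup>2 \<le> (ip d D)\<^sup>2" using p \<alpha>_pos by (intro power_mono) auto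
  also have "\<dots> \<le> ip d d * ip D D" by (intro L.Cauchy_Schwarz d VX D)
  also have "\<dots> \<le> ip d d * h D D" by (intro mult_left_mono ip_le D L.ip_nonneg d)
  finally show ?thesis using p by (simp add: power2_eq_square)
qed

lemma T_h_bound: "f \<in> X \<Longrightarrow> \<alpha>\<^sup>2 * h (T f) (T f) \<le> ip f f"
  by (intro energy_bound) (auto simp: T_solves)

lemma T_diff_h_bound: "\<lbrakk>f \<in> X; g \<in> X\<rbrakk> \<Longrightarrow> \<alpha>\<^sup>2 * h (T f - T g) (T f - T g) \<le> ip (f - g) (f - g)"
  by (intro energy_bound) (auto simp: T_solves L.mem E.mem A.bilin L.bilin VX)

lemma T_bound: assumes "f \<in> X" shows "\<alpha>\<^sup>2 * ip (T f) (T f) \<le> ip f f"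
  using T_h_bound[OF assms] mult_left_mono[OF ip_le[OF T_solves(1)[OF assms]], of "\<alpha>\<^sup>2"] by simp

lemma T_sym: assumes "f \<in> X" "g \<in> X" shows "ip (T f) g = ip f (T g)"
proof -
  have "ip (T f) g = ip g (T f)" by (intro L.ip_sym T_X assms)
  also have "\<dots> = a (T g) (T f)" by (simp add: T_solves assms)
  also have "\<dots> = a (T f) (T g)" by (intro A.ip_sym T_solves assms)
  finally show ?thesis by (simp add: T_solves assms)
qed

lemma T_energy: assumes "f \<in> X" shows "ip (T f) f = a (T f) (T f)"
  using T_sym[OF assms assms] T_solves[OF assms] by simp

text \<open>The quadratic form of the inverse operator is itself a semi-inner product, so it has its own
  Cauchy-Schwarz inequality. Estimates for \<open>T\<close> in norm will come from this one.\<close>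

sublocale B: semi_inner X "\<lambda>f g. ip (T f) g"
proof
  show "subspace X" by (rule L.carrier_subspace)
  show "ip (T x) y = ip (T y) x" if "x \<in> X" "y \<in> X" for x y
    using that T_sym[of x y] L.ip_sym[of x "T y"] T_X by simp
  show "ip (T (x + y)) z = ip (T x) z + ip (T y) z" if "x \<in> X" "y \<in> X" "z \<in> X" for x y z
    using that by (simp add: T_sym L.mem L.bilin T_X)
  show "ip (T (c *\<^sub>R x)) z = c * ip (T x) z" if "x \<in> X" "z \<in> X" for x z c
    using that by (simp add: T_sym L.mem L.bilin T_X)
  show "0 \<le> ip (T x) x" if "x \<in> X" for x
    using T_energy[OF that] A.ip_nonneg[OF T_solves(1)[OF that]] by simp
qed

lemma B_bound: assumes f: "f \<in> X" shows "\<alpha> * ip (T f) f \<le> ip f f"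
proof (rule power2_le_imp_le)
  have "(\<alpha> * ip (T f) f)\<^sup>2 \<le> \<alpha>\<^sup>2 * (ip (T f) (T f) * ip f f)"
    using mult_left_mono[OF L.Cauchy_Schwarz[OF T_X[OF f] f], of "\<alpha>\<^sup>2"] by (simp add: power_mult_distrib)
  also have "\<dots> \<le> ip f f * ip f f"
    using mult_right_mono[OF T_bound[OF f] L.ip_nonneg[OF f]] by (simp add: mult.assoc)
  finally show "(\<alpha> * ip (T f) f)\<^sup>2 \<le> (ip f f)\<^sup>2" by (simp add: power2_eq_square)
qed (simp add: L.ip_nonneg f)

definition eigen :: "real \<Rightarrow> 'v \<Rightarrow> bool" where
  "eigen e u \<longleftrightarrow> u \<in> V \<and> 0 < ip u u \<and> (\<forall>v\<in>V. a u v = e * ip u v)"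

lemma eigen_pos: assumes "eigen e u" shows "0 < e"
proof -
  have u: "u \<in> V" "0 < ip u u" "a u u = e * ip u u" using assms by (auto simp: eigen_def)
  have "\<alpha> * ip u u \<le> \<alpha> * h u u" using ip_le[OF u(1)] \<alpha>_pos by simp
  also have "\<dots> \<le> e * ip u u" using coercive[OF u(1)] u(3) by simp
  finally show ?thesis using u(2) \<alpha>_pos by simp
qed

lemma eigen_T: assumes "eigen e u" and x: "x \<in> X" shows "ip (T u) x = ip u x / e"
proof -
  have u: "u \<in> V" using assms by (auto simp: eigen_def)
  have "e * ip u (T x) = a u (T x)" using assms T_solves by (auto simp: eigen_def)
  also have "\<dots> = ip x u" using A.ip_sym[OF u] T_solves[OF x] u by simp
  also have "\<dots> = ip u x" by (intro L.ip_sym x VX u)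
  finally show ?thesis using T_sym[of u x] x VX[OF u] eigen_pos[OF assms(1)] by (simp add: field_simps)
qed

lemma eigen_orthogonal: assumes "eigen e u" "eigen e' u'" "e \<noteq> e'" shows "ip u u' = 0"
proof -
  have u: "u \<in> V" "u' \<in> V" using assms by (auto simp: eigen_def)
  have "e * ip u u' = a u u'" "e' * ip u' u = a u' u" using assms u by (auto simp: eigen_def)
  moreover have "ip u' u = ip u u'" "a u' u = a u u'" using u by (auto intro: L.ip_sym A.ip_sym VX)
  ultimately have "(e - e') * ip u u' = 0" by (simp add: algebra_simps)
  then show ?thesis using assms(3) by simp
qed

text \<open>The analogue of a complete ordered list of eigenvalues with multiplicities. Independence and
  completeness are meant modulo vectors of length zero.\<close>

definition eigen_list :: "(nat \<Rightarrow> real) \<Rightarrow> (nat \<Rightarrow> 'v) \<Rightarrow> bool" where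
  "eigen_list l u \<longleftrightarrow> (\<forall>k\<ge>1. eigen (l k) (u k)) \<and> (\<forall>k\<ge>1. l k \<le> l (Suc k)) \<and>
    (\<forall>K c. finite K \<and> K \<subseteq> {1..} \<and> ip (\<Sum>k\<in>K. c k *\<^sub>R u k) (\<Sum>k\<in>K. c k *\<^sub>R u k) = 0 \<longrightarrow> (\<forall>k\<in>K. c k = 0)) \<and>
    (\<forall>e v. eigen e v \<longrightarrow> (\<exists>K c. finite K \<and> K \<subseteq> {k. 1 \<le> k \<and> l k = e} \<and> 
        ip (v - (\<Sum>k\<in>K. c k *\<^sub>R u k)) (v - (\<Sum>k\<in>K. c k *\<^sub>R u k)) = 0))"

context
  fixes l :: "nat \<Rightarrow> real" and u :: "nat \<Rightarrow> 'v"
  assumes list: "eigen_list l u"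
begin

lemma list_eigen: "k \<ge> 1 \<Longrightarrow> eigen (l k) (u k)" 
  using list by (auto simp: eigen_list_def)

lemma list_pos: "k \<ge> 1 \<Longrightarrow> 0 < l k" 
  using list_eigen eigen_pos by auto

lemma list_X: "k \<ge> 1 \<Longrightarrow> u k \<in> X"
  using list_eigen VX by (auto simp: eigen_def)

lemma list_mono: "1 \<le> i \<Longrightarrow> i \<le> j \<Longrightarrow> l i \<le> l j"
proof (induction j)
  case (Suc j)
  then show ?case using list by (cases "i = Suc j") (auto simp: eigen_list_def intro: order_trans)
qed simp

text \<open>Eigenvectors within one eigenspace are not orthogonal to each other, but all have the same eigenvalue.
  Scaling the \<open>i\<close>-th coefficient by the square root of \<open>1 / l i - 1 / l k\<close> therefore produces a vector
  whose square length is exactly the difference of the two sides.\<close>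

lemma inverse_form_on_span:
  assumes K: "K \<subseteq> {1..k}" and f: "f = (\<Sum>i\<in>K. c i *\<^sub>R u i)"
  shows "ip f f / l k \<le> ip (T f) f"
proof (cases "k \<ge> 1")
  case True
  define d where "d i = sqrt (1 / l i - 1 / l k)" for i
  have K1: "1 \<le> i" "i \<le> k" if "i \<in> K" for i using that K by auto
  have uX: "u i \<in> X" if "i \<in> K" for i using list_X K1 that by auto
  have fX: "f \<in> X" unfolding f by (intro L.mem uX)
  define g where "g = (\<Sum>i\<in>K. (c i * d i) *\<^sub>R u i)"
  have d2: "d i * d i = 1 / l i - 1 / l k" if "i \<in> K" for i
  proof -
    have "1 / l k \<le> 1 / l i" using list_mono[of i k] K1[OF that] list_pos[of i] by (simp add: frac_le)
    then show ?thesis by (simp add: d_def)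
  qed
  have dd: "d i * d j * ip (u i) (u j) = (1 / l i - 1 / l k) * ip (u i) (u j)" if "i \<in> K" "j \<in> K" for i j
  proof (cases "l i = l j")
    case True then have "d j = d i" by (simp add: d_def)
    then show ?thesis using d2[OF that(1)] by simp
  next
    case False
    then have "ip (u i) (u j) = 0" using eigen_orthogonal list_eigen K1 that by metis
    then show ?thesis by simp
  qed
  have "0 \<le> ip g g" unfolding g_def by (intro L.ip_nonneg L.mem uX)
  also have "ip g g = (\<Sum>i\<in>K. \<Sum>j\<in>K. c i * c j * (d i * d j * ip (u i) (u j)))"
    unfolding g_def using uX
    by (subst sum.swap) (simp add: L.sum_left L.sum_right L.mem L.bilin sum_distrib_left mult_ac)
  also have "\<dots> = (\<Sum>i\<in>K. \<Sum>j\<in>K. c i * c j * ((1 / l i - 1 / l k) * ip (u i) (u j)))"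
    using dd by (intro sum.cong) auto
  also have "\<dots> = (\<Sum>i\<in>K. (1 / l i - 1 / l k) * (c i * ip (u i) f))"
    unfolding f using uX by (simp add: L.sum_right L.mem L.bilin sum_distrib_left mult_ac)
  also have "\<dots> = (\<Sum>i\<in>K. c i * ip (T (u i)) f) - (\<Sum>i\<in>K. c i * ip (u i) f) / l k"
    unfolding sum_divide_distrib sum_subtractf[symmetric]
    using eigen_T[OF list_eigen fX] K1 by (intro sum.cong) (auto simp: field_simps)
  also have "(\<Sum>i\<in>K. c i * ip (u i) f) = ip f f"
    using arg_cong[OF f, of "\<lambda>z. ip z f"] uX fX by (simp add: L.sum_left L.mem L.bilin)
  also have "(\<Sum>i\<in>K. c i * ip (T (u i)) f) = ip (T f) f"
    using arg_cong[OF f, of "\<lambda>z. ip (T z) f"] uX fX by (simp add: B.sum_left B.mem B.bilin)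
  finally show ?thesis by simp
next
  case False
  then have "f = 0" using K f by auto
  then show ?thesis using B.zero_left[OF L.zero_mem] L.zero_left[OF L.zero_mem] by simp
qed

text \<open>The supremum \<open>m\<close> of the inverse form over the unit ball of the complement would exceed \<open>1 / l k\<close>.
  By compactness it would be attained, hence \<open>1 / m\<close> would be an eigenvalue below \<open>l k\<close>, with an eigenvector
  orthogonal to all eigenvectors of index below \<open>k\<close>. This contradicts the completeness of the list.\<close>

lemma inverse_form_on_complement:
  assumes k: "k \<ge> 1" and f: "f \<in> X" "\<And>i. 1 \<le> i \<Longrightarrow> i < k \<Longrightarrow> ip f (u i) = 0"
  shows "ip (T f) f \<le> ip f f / l k"
proof (rule ccontr)
  assume contra: "\<not> ?thesis"
  define Y where "Y = {f \<in> X. \<forall>i. 1 \<le> i \<and> i < k \<longrightarrow> ip f (u i) = 0}"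
  have YX: "f \<in> X" if "f \<in> Y" for f using that by (auto simp: Y_def)
  have Y_scale: "c *\<^sub>R f \<in> Y" if "f \<in> Y" for c f
    using that list_X by (auto simp: Y_def L.mem L.bilin)
  have Y_T: "T f \<in> Y" if "f \<in> Y" for f
  proof -
    have fX: "f \<in> X" by (rule YX[OF that])
    have "ip (T f) (u i) = 0" if i: "1 \<le> i" "i < k" for i
    proof -
      have "ip (T f) (u i) = ip (T (u i)) f" by (rule B.ip_sym[OF fX list_X[OF i(1)]])
      also have "\<dots> = ip (u i) f / l i" by (rule eigen_T[OF list_eigen[OF i(1)] fX])
      also have "ip (u i) f = ip f (u i)" by (rule L.ip_sym[OF list_X[OF i(1)] fX])
      also have "\<dots> = 0" using \<open>f \<in> Y\<close> i by (auto simp: Y_def)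
      finally show ?thesis by simp
    qed
    then show ?thesis using T_X[OF fX] by (simp add: Y_def)
  qed
  define S where "S = (\<lambda>f. ip (T f) f) ` {f \<in> Y. ip f f \<le> 1}"
  define m where "m = Sup S"
  have bdd: "bdd_above S"
    unfolding S_def
  proof (rule bdd_aboveI2)
    fix f assume "f \<in> {f \<in> Y. ip f f \<le> 1}"
    then have "\<alpha> * ip (T f) f \<le> 1" using B_bound[of f] YX[of f] by auto
    then show "ip (T f) f \<le> 1 / \<alpha>" using \<alpha>_pos by (simp add: field_simps)
  qed
  have m_bound: "ip (T g) g \<le> m * ip g g" if g: "g \<in> Y" for g
  proof (cases "ip g g = 0")
    case True
    then show ?thesis using B_bound[OF YX[OF g]] \<alpha>_pos by (simp add: mult_le_0_iff)
  next
    case False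
    then have p: "ip g g > 0" using L.ip_nonneg[OF YX[OF g]] by simp
    define g' where "g' = (1 / sqrt (ip g g)) *\<^sub>R g"
    have g': "g' \<in> Y" unfolding g'_def by (intro Y_scale g)
    have "ip g' g' = 1" "ip (T g') g' = ip (T g) g / ip g g"
      unfolding g'_def using YX[OF g] p by (auto simp: L.bilin L.mem B.bilin)
    then have "ip (T g) g / ip g g \<in> S" using g' unfolding S_def by force
    then have "ip (T g) g / ip g g \<le> m" unfolding m_def using bdd by (intro cSup_upper)
    then show ?thesis using p by (simp add: field_simps)
  qed
  have lk: "l k > 0" using list_pos[OF k] .
  have fY: "f \<in> Y" using f by (auto simp: Y_def)
  have "ip f f / l k < m * ip f f" using contra m_bound[OF fY] by simp
  then have lt: "(1 / l k) * ip f f < m * ip f f" by simp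
  then have "ip f f \<noteq> 0" by auto
  then have p: "ip f f > 0" using L.ip_nonneg[OF f(1)] by simp
  have ff: "ip f f > 0" "1 / l k < m" using p lt by (simp, simp only: mult_less_cancel_right_pos)
  have m: "m > 0" using ff(2) lk by (meson divide_pos_pos less_trans zero_less_one)
  \<comment> \<open>Cauchy-Schwarz for the inverse form improves the bound on the form to one on the operator.\<close>
  have T_le: "ip (T g) (T g) \<le> m\<^sup>2 * ip g g" if g: "g \<in> Y" for g
  proof (cases "ip (T g) (T g) = 0")
    case False
    have gX: "g \<in> X" using YX g by auto
    have p: "ip (T g) (T g) > 0" using False L.ip_nonneg[OF T_X[OF gX]] by simp
    have "(ip (T g) (T g))\<^sup>2 \<le> ip (T g) g * ip (T (T g)) (T g)"
      using B.Cauchy_Schwarz[OF gX T_X[OF gX]] .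
    also have "\<dots> \<le> (m * ip g g) * (m * ip (T g) (T g))"
      using m_bound[OF g] m_bound[OF Y_T[OF g]] B.ip_nonneg[OF gX] B.ip_nonneg[OF T_X[OF gX]]
      by (intro mult_mono) auto
    finally show ?thesis using p by (simp add: power2_eq_square mult_ac)
  qed (use L.ip_nonneg[OF YX[OF g]] in simp)
  have "S \<noteq> {}" using L.mem(1) L.zero_left[OF L.mem(1)] L.zero_left[OF list_X] by (auto simp: S_def Y_def)
  then have "\<exists>f\<in>Y. ip f f \<le> 1 \<and> m - 1 / real (Suc n) < ip (T f) f" for n
    using less_cSupD[of S "m - 1 / real (Suc n)"] by (auto simp: m_def S_def)
  then obtain F where F: "\<And>n. F n \<in> Y" "\<And>n. ip (F n) (F n) \<le> 1" "\<And>n. m - 1 / real (Suc n) < ip (T (F n)) (F n)"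
    by metis
  have FX: "F n \<in> X" for n using YX F by auto
  \<comment> \<open>A maximising sequence consists of approximate eigenvectors.\<close>
  define R where "R n = T (F n) - m *\<^sub>R F n" for n
  have RX: "R n \<in> X" for n unfolding R_def using FX T_X by (auto intro!: L.diff_mem L.scale_mem)
  have R_le: "ip (R n) (R n) \<le> 2 * m * (1 / real (Suc n))" for n
  proof -
    have "ip (R n) (R n) = ip (T (F n)) (T (F n)) - 2 * m * ip (T (F n)) (F n) + m\<^sup>2 * ip (F n) (F n)"
      unfolding R_def using FX[of n] T_X[of "F n"] L.ip_sym[of "F n" "T (F n)"]
      by (simp add: L.bilin L.mem power2_eq_square algebra_simps)
    also have "\<dots> \<le> 2 * (m\<^sup>2 * 1) - 2 * m * (m - 1 / real (Suc n))"
    proof -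
      have "m\<^sup>2 * ip (F n) (F n) \<le> m\<^sup>2 * 1" by (intro mult_left_mono F) simp
      moreover have "2 * m * (m - 1 / real (Suc n)) \<le> 2 * m * ip (T (F n)) (F n)"
        using m by (intro mult_left_mono less_imp_le[OF F(3)]) simp
      ultimately show ?thesis using T_le[OF F(1), of n] by linarith
    qed
    also have "\<dots> = 2 * m * (1 / real (Suc n))" by (simp add: algebra_simps power2_eq_square)
    finally show ?thesis .
  qed
  have inv_lim: "(\<lambda>n. 1 / real (Suc n)) \<longlonglongrightarrow> 0" by (rule LIMSEQ_Suc[OF lim_1_over_n])
  have R_lim: "(\<lambda>n. ip (R n) (R n)) \<longlonglongrightarrow> 0"
  proof (rule Lim_null_comparison)
    show "\<forall>\<^sub>F n in sequentially. norm (ip (R n) (R n)) \<le> 2 * m * (1 / real (Suc n))"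
      using R_le L.ip_nonneg[OF RX] by auto
    show "(\<lambda>n. 2 * m * (1 / real (Suc n))) \<longlonglongrightarrow> 0" using tendsto_mult_left[OF inv_lim, of "2 * m"] by simp
  qed
  \<comment> \<open>This value makes half of the left side absorb the term with the norm of \<open>V\<close> in \<open>key\<close>.\<close>
  define \<epsilon> where "\<epsilon> = \<alpha>\<^sup>2 * (m\<^sup>2 / 4)"
  have \<epsilon>: "\<epsilon> > 0" using \<alpha>_pos m by (simp add: \<epsilon>_def)
  obtain D where D: "finite D" "D \<subseteq> X" "\<And>v. v \<in> V \<Longrightarrow> ip v v \<le> \<epsilon> * h v v + (\<Sum>e\<in>D. (ip v e)\<^sup>2)"
    using rellich[OF \<epsilon>] by blast
  have "Bseq (\<lambda>n. ip (F n) (T e))" if "e \<in> D" for e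
  proof (rule BseqI')
    fix n
    have TeX: "T e \<in> X" using that D T_X by auto
    have "\<bar>ip (F n) (T e)\<bar> \<le> sqrt (ip (F n) (F n)) * sqrt (ip (T e) (T e))"
      by (rule L.Cauchy_Schwarz_sqrt[OF FX TeX])
    also have "\<dots> \<le> 1 * sqrt (ip (T e) (T e))" 
      using F(2)[of n] L.ip_nonneg[OF TeX] by (intro mult_right_mono) auto
    finally show "norm (ip (F n) (T e)) \<le> sqrt (ip (T e) (T e))" by simp
  qed
  then obtain r :: "nat \<Rightarrow> nat" where r: "strict_mono r" "\<forall>e\<in>D. convergent (\<lambda>n. ip (F (r n)) (T e))"
    using bounded_finite_family_subseq[OF D(1), of "\<lambda>e n. ip (F n) (T e)"] by auto
  define G where "G n = F (r n)" for n
  have GX: "G n \<in> X" for n by (simp add: G_def FX)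
  have key: "m\<^sup>2 / 2 * ip (G i - G j) (G i - G j) \<le> 2 * (\<Sum>e\<in>D. (ip (G i) (T e) - ip (G j) (T e))\<^sup>2) 
      + (4 * ip (R (r i)) (R (r i)) + 4 * ip (R (r j)) (R (r j)))" for i j
  proof -
    let ?d = "G i - G j" and ?D = "T (G i) - T (G j)" and ?r = "R (r i) - R (r j)"
    have X: "?d \<in> X" "?D \<in> V" "?D \<in> X" "?r \<in> X" 
      using GX T_solves(1) VX RX by (auto intro: L.mem E.mem)
    have "m *\<^sub>R ?d = ?D - ?r" by (simp add: R_def G_def algebra_simps)
    then have "ip (m *\<^sub>R ?d) (m *\<^sub>R ?d) \<le> 2 * ip ?D ?D + 2 * ip ?r ?r"
      using L.diff_square_le[OF X(3,4)] by simp
    moreover have "ip (m *\<^sub>R ?d) (m *\<^sub>R ?d) = m\<^sup>2 * ip ?d ?d" using X by (simp add: L.bilin L.mem power2_eq_square)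
    moreover have "ip ?r ?r \<le> 2 * ip (R (r i)) (R (r i)) + 2 * ip (R (r j)) (R (r j))"
      by (intro L.diff_square_le RX)
    moreover have "ip ?D ?D \<le> \<epsilon> * h ?D ?D + (\<Sum>e\<in>D. (ip ?D e)\<^sup>2)" by (intro D X)
    moreover have "\<epsilon> * h ?D ?D \<le> m\<^sup>2 / 4 * ip ?d ?d"
      using mult_left_mono[OF T_diff_h_bound[OF GX GX, of i j], of "m\<^sup>2 / 4"] m by (simp add: \<epsilon>_def mult_ac)
    moreover have "(\<Sum>e\<in>D. (ip ?D e)\<^sup>2) = (\<Sum>e\<in>D. (ip (G i) (T e) - ip (G j) (T e))\<^sup>2)"
      using D(2) GX T_X by (intro sum.cong refl arg_cong[where f = "\<lambda>x. x\<^sup>2"]) (auto simp: L.bilin T_sym subset_iff)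
    ultimately show ?thesis by linarith
  qed
  \<comment> \<open>Along the subsequence the finitely many functionals converge, so \<open>T (G n)\<close> is Cauchy in \<open>V\<close>.\<close>
  have h_cauchy: "\<exists>N. \<forall>i\<ge>N. \<forall>j\<ge>N. h (T (G i) - T (G j)) (T (G i) - T (G j)) < e" if e: "e > 0" for e
  proof -
    define \<delta> where "\<delta> = \<alpha>\<^sup>2 * e * (m\<^sup>2 / 2) / (2 * real (card D) + 8 + 1)"
    have \<delta>: "\<delta> > 0" using e \<alpha>_pos m by (auto simp: \<delta>_def)
    have "\<forall>e\<in>D. \<exists>N. \<forall>i\<ge>N. \<forall>j\<ge>N. \<bar>ip (G i) (T e) - ip (G j) (T e)\<bar> < sqrt \<delta>"
    proof
      fix e assume "e \<in> D"
      then have "Cauchy (\<lambda>n. ip (G n) (T e))" using r(2) by (auto simp: G_def intro: convergent_Cauchy)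
      then show "\<exists>N. \<forall>i\<ge>N. \<forall>j\<ge>N. \<bar>ip (G i) (T e) - ip (G j) (T e)\<bar> < sqrt \<delta>"
        using \<delta> by (auto simp: Cauchy_def dist_real_def)
    qed
    then obtain N where N: "\<And>e i j. e \<in> D \<Longrightarrow> i \<ge> N e \<Longrightarrow> j \<ge> N e \<Longrightarrow> \<bar>ip (G i) (T e) - ip (G j) (T e)\<bar> < sqrt \<delta>"
      by metis
    have "\<exists>N'. \<forall>n\<ge>N'. ip (R n) (R n) < \<delta>" using order_tendstoD(2)[OF R_lim \<delta>] by (simp add: eventually_sequentially)
    then obtain N' where N': "\<And>n. n \<ge> N' \<Longrightarrow> ip (R n) (R n) < \<delta>" by blast
    define M where "M = Max (insert N' (N ` D))"
    have "h (T (G i) - T (G j)) (T (G i) - T (G j)) < e" if ij: "i \<ge> M" "j \<ge> M" for i j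
    proof -
      have "i \<ge> N'" "j \<ge> N'" "\<And>e. e \<in> D \<Longrightarrow> i \<ge> N e" "\<And>e. e \<in> D \<Longrightarrow> j \<ge> N e"
        using ij D(1) by (auto simp: M_def)
      moreover have "r i \<ge> i" "r j \<ge> j" using r(1) seq_suble by auto
      ultimately have RR: "ip (R (r i)) (R (r i)) < \<delta>" "ip (R (r j)) (R (r j)) < \<delta>" 
        and dd: "\<And>e. e \<in> D \<Longrightarrow> \<bar>ip (G i) (T e) - ip (G j) (T e)\<bar> < sqrt \<delta>"
        using N N' by auto
      have "(ip (G i) (T e) - ip (G j) (T e))\<^sup>2 \<le> \<delta>" if "e \<in> D" for e
        using power_mono[OF less_imp_le[OF dd[OF that]], of 2] \<delta> by simp
      then have "(\<Sum>e\<in>D. (ip (G i) (T e) - ip (G j) (T e))\<^sup>2) \<le> real (card D) * \<delta>"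
        by (rule sum_bounded_above)
      then have "m\<^sup>2 / 2 * ip (G i - G j) (G i - G j) \<le> 2 * (real (card D) * \<delta>) + 8 * \<delta>"
        using key[of i j] RR by linarith
      also have "\<dots> < (2 * real (card D) + 8 + 1) * \<delta>" using \<delta> by (simp add: algebra_simps)
      also have "\<dots> = m\<^sup>2 / 2 * (\<alpha>\<^sup>2 * e)" by (simp add: \<delta>_def field_simps)
      finally have "ip (G i - G j) (G i - G j) < \<alpha>\<^sup>2 * e" using m by (subst (asm) mult_less_cancel_left_pos) simp_all
      then have "\<alpha>\<^sup>2 * h (T (G i) - T (G j)) (T (G i) - T (G j)) < \<alpha>\<^sup>2 * e"
        using T_diff_h_bound[OF GX GX, of i j] by linarith
      then show ?thesis using \<alpha>_pos by simp
    qed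
    then show ?thesis by blast
  qed
  then obtain g where g: "g \<in> V" and glim: "(\<lambda>n. h (T (G n) - g) (T (G n) - g)) \<longlonglongrightarrow> 0"
    using E.ip_completeD[OF complete, of "\<lambda>n. T (G n)"] T_solves(1)[OF GX] by blast
  have gX: "g \<in> X" by (rule VX[OF g])
  have TGX: "T (G n) \<in> X" "T (G n) \<in> V" for n using GX T_X T_solves by auto
  have ilim: "(\<lambda>n. ip (T (G n) - g) (T (G n) - g)) \<longlonglongrightarrow> 0"
    by (rule Lim_null_comparison[OF _ glim]) (use ip_le L.ip_nonneg TGX g gX in \<open>auto simp: L.mem E.mem\<close>)
  have lim_TG: "(\<lambda>n. ip (T (G n)) x) \<longlonglongrightarrow> ip g x" if "x \<in> X" for x
    by (rule L.tendsto_ip[OF TGX(1) gX that ilim])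
  have R_r_lim: "(\<lambda>n. ip (R (r n)) x) \<longlonglongrightarrow> 0" if x: "x \<in> X" for x
  proof (rule Lim_null_comparison)
    show "\<forall>\<^sub>F n in sequentially. norm (ip (R (r n)) x) \<le> sqrt (ip (R (r n)) (R (r n))) * sqrt (ip x x)"
      using L.Cauchy_Schwarz_sqrt[OF RX x] by auto
    have "(\<lambda>n. ip (R (r n)) (R (r n))) \<longlonglongrightarrow> 0" using LIMSEQ_subseq_LIMSEQ[OF R_lim r(1)] by (simp add: o_def)
    from tendsto_mult_right[OF tendsto_real_sqrt[OF this], of "sqrt (ip x x)"]
    show "(\<lambda>n. sqrt (ip (R (r n)) (R (r n))) * sqrt (ip x x)) \<longlonglongrightarrow> 0" by simp
  qed
  have lim_G: "(\<lambda>n. m * ip (G n) x) \<longlonglongrightarrow> ip g x" if x: "x \<in> X" for x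
  proof -
    have "m * ip (G n) x = ip (T (G n)) x - ip (R (r n)) x" for n
      using x GX TGX by (simp add: R_def G_def[symmetric] L.bilin L.mem)
    then show ?thesis using tendsto_diff[OF lim_TG[OF x] R_r_lim[OF x]] by simp
  qed
  have Tg: "ip (T g) x = m * ip g x" if x: "x \<in> X" for x
  proof -
    have "(\<lambda>n. m * ip (T (G n)) x) \<longlonglongrightarrow> ip (T g) x"
      using lim_G[OF T_X[OF x]] GX gX x by (simp add: T_sym)
    moreover have "(\<lambda>n. m * ip (T (G n)) x) \<longlonglongrightarrow> m * ip g x"
      by (intro tendsto_intros lim_TG x)
    ultimately show ?thesis by (rule LIMSEQ_unique)
  qed
  \<comment> \<open>The limit does not vanish, because the form has values close to \<open>m\<close> on the unit ball.\<close>
  have gg: "ip g g \<ge> m\<^sup>2"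
  proof -
    have "(\<lambda>n. ip (T (G n)) (T (G n))) \<longlonglongrightarrow> ip g g" by (rule L.tendsto_square[OF TGX(1) gX ilim])
    then have A: "(\<lambda>n. sqrt (ip (T (G n)) (T (G n)))) \<longlonglongrightarrow> sqrt (ip g g)" by (rule tendsto_real_sqrt)
    have B: "(\<lambda>n. m - 1 / real (Suc (r n))) \<longlonglongrightarrow> m"
      using tendsto_diff[OF tendsto_const[of m] LIMSEQ_subseq_LIMSEQ[OF inv_lim r(1)]] by (simp add: o_def)
    have C: "m - 1 / real (Suc (r n)) \<le> sqrt (ip (T (G n)) (T (G n)))" for n
    proof -
      have "m - 1 / real (Suc (r n)) \<le> ip (T (G n)) (G n)" using F(3)[of "r n"] by (simp add: G_def)
      also have "\<dots> \<le> sqrt (ip (T (G n)) (T (G n))) * sqrt (ip (G n) (G n))"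
        using L.Cauchy_Schwarz_sqrt[OF TGX(1) GX, of n n] by linarith
      also have "\<dots> \<le> sqrt (ip (T (G n)) (T (G n))) * 1"
        using F(2)[of "r n"] L.ip_nonneg[OF TGX(1)] by (intro mult_left_mono) (auto simp: G_def)
      finally show ?thesis by simp
    qed
    have "m \<le> sqrt (ip g g)" by (rule LIMSEQ_le[OF B A]) (use C in auto)
    then show ?thesis using m power_mono[of m "sqrt (ip g g)" 2] L.ip_nonneg[OF gX] by simp
  qed
  \<comment> \<open>The limit \<open>g\<close> satisfies the eigenvalue equation only against test vectors; one more application of \<open>T\<close> yields a weak solution.\<close>
  let ?v = "T g"
  have v: "?v \<in> V" "?v \<in> X" using gX T_solves VX by auto
  have vv: "ip ?v ?v > 0"
  proof -
    have "ip ?v ?v = m * ip g ?v" by (rule Tg[OF v(2)])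
    also have "ip g ?v = ip ?v g" by (intro L.ip_sym gX v)
    also have "ip ?v g = m * ip g g" by (rule Tg[OF gX])
    finally show ?thesis using m gg by (simp add: order_less_le_trans[of 0 "m\<^sup>2"])
  qed
  have eig: "eigen (1 / m) ?v"
    unfolding eigen_def
  proof (intro conjI ballI v(1) vv)
    fix x assume x: "x \<in> V"
    show "a (T g) x = 1 / m * ip (T g) x" using Tg[OF VX[OF x]] T_solves(2)[OF gX x] m by simp
  qed
  obtain K c where K: "finite K" "K \<subseteq> {i. 1 \<le> i \<and> l i = 1 / m}" and
    w: "ip (?v - (\<Sum>i\<in>K. c i *\<^sub>R u i)) (?v - (\<Sum>i\<in>K. c i *\<^sub>R u i)) = 0"
    using list[unfolded eigen_list_def, THEN conjunct2, THEN conjunct2, THEN conjunct2, rule_format, OF eig] by blast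
  have "ip ?v (u i) = 0" if "i \<in> K" for i
  proof -
    have i: "1 \<le> i" "l i = 1 / m" using that K by auto
    have "1 / m < l k" using ff(2) m lk by (simp add: field_simps)
    then have "i < k" by (rule contrapos_pp) (use i list_mono[OF k, of i] in \<open>simp add: not_less\<close>)
    then have "ip (T (G n)) (u i) = 0" for n using Y_T[OF F(1)] i by (auto simp: G_def Y_def)
    then have "ip g (u i) = 0" using lim_TG[OF list_X[OF i(1)]] by (simp add: LIMSEQ_const_iff)
    then show ?thesis using Tg[OF list_X[OF i(1)]] by simp
  qed
  moreover have KX: "u i \<in> X" if "i \<in> K" for i using that K list_X by auto
  ultimately have o: "ip (\<Sum>i\<in>K. c i *\<^sub>R u i) ?v = 0"
    by (intro L.lincomb_null) (use v L.ip_sym[OF v(2)] in auto)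
  have SX: "(\<Sum>i\<in>K. c i *\<^sub>R u i) \<in> X" by (intro L.sum_mem L.scale_mem KX)
  have "ip ?v (?v - (\<Sum>i\<in>K. c i *\<^sub>R u i)) = 0"
    by (rule L.null_right[OF v(2) L.diff_mem[OF v(2) SX] w])
  then have "ip ?v ?v = ip ?v (\<Sum>i\<in>K. c i *\<^sub>R u i)" using L.diff_right[OF v(2) SX v(2)] by simp
  also have "\<dots> = 0" using o L.ip_sym[OF v(2) SX] by simp
  finally show False using vv by simp
qed

end

end


section \<open>Convergence of the spectra of forms\<close>

lemma tendsto_zero_of_gap:
  fixes t y \<kappa> :: "nat \<Rightarrow> real"
  assumes "t \<longlonglongrightarrow> t0" "t0 > 0" "\<kappa> \<longlonglongrightarrow> 0" "\<And>j. 0 \<le> y j" "\<forall>\<^sub>F j in sequentially. t j * y j \<le> \<kappa> j"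
  shows "y \<longlonglongrightarrow> 0"
proof (rule Lim_null_comparison)
  have "\<forall>\<^sub>F j in sequentially. t j > t0 / 2" using assms(1,2) by (intro order_tendstoD) auto
  with assms(5) show "\<forall>\<^sub>F j in sequentially. norm (y j) \<le> 2 / t0 * \<kappa> j"
  proof eventually_elim
    case (elim j)
    have "t0 / 2 * y j \<le> t j * y j" using elim assms(4)[of j] by (intro mult_right_mono) auto
    then show ?case using elim assms(2) assms(4)[of j] by (simp add: field_simps)
  qed
  show "(\<lambda>j. 2 / t0 * \<kappa> j) \<longlonglongrightarrow> 0" using tendsto_mult_left[OF assms(3), of "2 / t0"] by simp
qed

text \<open>Half of the min-max principle: some combination of the first \<open>k\<close> eigenvectors of \<open>a\<close> is orthogonal to
  the first \<open>k - 1\<close> eigenvectors of \<open>a'\<close>, and on it the two inverse forms can be compared.\<close>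

lemma inverse_eigenvalue_le:
  assumes "energy_form X V ip h a \<alpha> \<beta>" and "energy_form X V ip h a' \<alpha>' \<beta>'"
    and "energy_form.eigen_list V ip a l u" and "energy_form.eigen_list V ip a' l' u'"
    and k: "k \<ge> 1"
    and le: "\<And>f. f \<in> X \<Longrightarrow> ip (energy_form.T V ip a f) f \<le> ip (energy_form.T V ip a' f) f + \<eta> * ip f f"
  shows "1 / l k \<le> 1 / l' k + \<eta>"
proof -
  interpret A: energy_form X V ip h a \<alpha> \<beta> by fact
  interpret A': energy_form X V ip h a' \<alpha>' \<beta>' by fact
  note u = assms(3) and u' = assms(4)
  obtain c where c: "\<exists>j\<in>{1..k}. c j \<noteq> 0" "\<forall>i\<in>{1..<k}. (\<Sum>j\<in>{1..k}. c j * ip (u j) (u' i)) = 0"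
    using homogeneous_system_solution[of "{1..<k}" "{1..k}" "\<lambda>i j. ip (u j) (u' i)"] k by auto
  define f where "f = (\<Sum>j\<in>{1..k}. c j *\<^sub>R u j)"
  have uX: "u j \<in> X" if "j \<in> {1..k}" for j using A.list_X[OF u] that by simp
  have fX: "f \<in> X" unfolding f_def by (intro A.L.sum_mem A.L.scale_mem uX)
  have "ip f f \<noteq> 0"
  proof
    assume "ip f f = 0"
    moreover have "finite {1..k}" "{1..k} \<subseteq> {1..}" by auto
    ultimately have "\<forall>j\<in>{1..k}. c j = 0" using u unfolding A.eigen_list_def f_def by blast
    then show False using c(1) by blast
  qed
  then have p: "ip f f > 0" using A.L.ip_nonneg[OF fX] by simp
  have "ip f (u' i) = 0" if "1 \<le> i" "i < k" for i
  proof -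
    have X: "u' i \<in> X" by (rule A'.list_X[OF u' that(1)])
    have "ip f (u' i) = (\<Sum>j\<in>{1..k}. ip (c j *\<^sub>R u j) (u' i))"
      unfolding f_def by (rule A.L.sum_left[OF A.L.scale_mem[OF uX] X])
    also have "\<dots> = (\<Sum>j\<in>{1..k}. c j * ip (u j) (u' i))"
      by (rule sum.cong[OF refl]) (rule A.L.scale_left[OF uX X])
    finally show ?thesis using c(2) that by simp
  qed
  then have "ip (A'.T f) f \<le> ip f f / l' k" by (intro A'.inverse_form_on_complement[OF u' k fX])
  moreover have "ip f f / l k \<le> ip (A.T f) f"
    by (rule A.inverse_form_on_span[OF u, of "{1..k}" k f c]) (auto simp: f_def)
  ultimately have "ip f f / l k \<le> ip f f / l' k + \<eta> * ip f f" using le[OF fX] by linarith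
  then have "ip f f * (1 / l k) \<le> ip f f * (1 / l' k + \<eta>)" by (simp add: algebra_simps)
  then show ?thesis using p by (simp only: mult_le_cancel_left_pos)
qed

text \<open>Uniformly coercive symmetric forms \<open>a j\<close> and a form \<open>a0\<close> such that solutions with the same right side
  converge weakly. The right sides and the functionals that test the convergence are restricted to
  pairings with \<open>X\<close> and to \<open>a0 w\<close>; the latter are what the symmetry of \<open>a0\<close> needs.\<close>

locale converging_forms = rellich_pair X V ip h
  for X V :: "'v::real_vector set" and ip h :: "'v \<Rightarrow> 'v \<Rightarrow> real" +
  fixes a :: "nat \<Rightarrow> 'v \<Rightarrow> 'v \<Rightarrow> real" and a0 :: "'v \<Rightarrow> 'v \<Rightarrow> real" and \<alpha> \<beta> :: real
  assumes forms: "\<And>j. energy_form X V ip h (a j) \<alpha> \<beta>"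
    and a0_add_left: "\<And>u v w. \<lbrakk>u \<in> V; v \<in> V; w \<in> V\<rbrakk> \<Longrightarrow> a0 (u + v) w = a0 u w + a0 v w"
    and a0_add_right: "\<And>u v w. \<lbrakk>u \<in> V; v \<in> V; w \<in> V\<rbrakk> \<Longrightarrow> a0 w (u + v) = a0 w u + a0 w v"
    and a0_scale_left: "\<And>u w c. \<lbrakk>u \<in> V; w \<in> V\<rbrakk> \<Longrightarrow> a0 (c *\<^sub>R u) w = c * a0 u w"
    and a0_scale_right: "\<And>u w c. \<lbrakk>u \<in> V; w \<in> V\<rbrakk> \<Longrightarrow> a0 w (c *\<^sub>R u) = c * a0 w u"
    and a0_coercive: "\<And>v. v \<in> V \<Longrightarrow> \<alpha> * h v v \<le> a0 v v"
    and a0_bounded: "\<And>v. v \<in> V \<Longrightarrow> a0 v v \<le> \<beta> * h v v"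
    and a0_bounded2: "\<And>w v. \<lbrakk>w \<in> V; v \<in> V\<rbrakk> \<Longrightarrow> (a0 w v)\<^sup>2 \<le> (\<beta>\<^sup>2 * h w w) * h v v"
    and solutions_converge: "\<And>F G s s0. 
      \<lbrakk>F \<in> {ip e |e. e \<in> X} \<union> {a0 w |w. w \<in> V}; G \<in> {ip e |e. e \<in> X} \<union> {a0 w |w. w \<in> V};
       \<And>j. s j \<in> V; \<And>j v. v \<in> V \<Longrightarrow> a j (s j) v = F v; s0 \<in> V; \<And>v. v \<in> V \<Longrightarrow> a0 s0 v = F v\<rbrakk>
      \<Longrightarrow> (\<lambda>j. G (s j)) \<longlonglongrightarrow> G s0"
begin

lemma \<alpha>_pos: "0 < \<alpha>" using forms[of 0] by (simp add: energy_form_def energy_form_axioms_def)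

text \<open>Solve with right sides \<open>a0 u\<close> and \<open>a0 v\<close>. The solutions for \<open>a0\<close> are \<open>u\<close> and \<open>v\<close>, those for \<open>a j\<close> are
  \<open>s j\<close> and \<open>t j\<close>, and \<open>a0 v (s j) = a j (t j) (s j) = a j (s j) (t j) = a0 u (t j)\<close> by the symmetry of
  \<open>a j\<close>. Both ends converge, to \<open>a0 v u\<close> and to \<open>a0 u v\<close>.\<close>

lemma limit_form_symmetric: assumes u: "u \<in> V" and v: "v \<in> V" shows "a0 u v = a0 v u"
proof -
  have ex: "\<exists>s. \<forall>j. s j \<in> V \<and> (\<forall>v\<in>V. a j (s j) v = a0 w v)" if w: "w \<in> V" for w
  proof (rule choice, rule allI)
    fix j
    interpret A: energy_form X V ip h "a j" \<alpha> \<beta> by (rule forms)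
    show "\<exists>y. y \<in> V \<and> (\<forall>v\<in>V. a j y v = a0 w v)"
      using A.solve[of "a0 w" "\<beta>\<^sup>2 * h w w"] a0_add_right a0_scale_right a0_bounded2 w by blast
  qed
  obtain s where s: "\<And>j. s j \<in> V" "\<And>j x. x \<in> V \<Longrightarrow> a j (s j) x = a0 u x" using ex[OF u] by blast
  obtain t where t: "\<And>j. t j \<in> V" "\<And>j x. x \<in> V \<Longrightarrow> a j (t j) x = a0 v x" using ex[OF v] by blast
  have "(\<lambda>j. a0 v (s j)) \<longlonglongrightarrow> a0 v u"
    by (rule solutions_converge[where F = "a0 u"]) (use u v s in auto)
  moreover have "(\<lambda>j. a0 u (t j)) \<longlonglongrightarrow> a0 u v"
    by (rule solutions_converge[where F = "a0 v"]) (use u v t in auto)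
  moreover have "a0 v (s j) = a0 u (t j)" for j
  proof -
    interpret A: energy_form X V ip h "a j" \<alpha> \<beta> by (rule forms)
    have "a0 v (s j) = a j (t j) (s j)" using t(2) s(1) by simp
    also have "\<dots> = a j (s j) (t j)" by (intro A.A.ip_sym s t)
    finally show ?thesis using s(2) t(1) by simp
  qed
  ultimately have "(\<lambda>j. a0 u (t j)) \<longlonglongrightarrow> a0 v u" "(\<lambda>j. a0 u (t j)) \<longlonglongrightarrow> a0 u v" by simp_all
  then show ?thesis by (rule LIMSEQ_unique[rotated])
qed

sublocale A0: energy_form X V ip h a0 \<alpha> \<beta>
proof unfold_locales
  show "0 \<le> a0 x x" if "x \<in> V" for x 
    using a0_coercive[OF that] \<alpha>_pos E.ip_nonneg[OF that] by (meson mult_nonneg_nonneg order_trans less_imp_le)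
qed (simp_all add: E.carrier_subspace limit_form_symmetric a0_add_left a0_scale_left \<alpha>_pos a0_coercive a0_bounded)

abbreviation T :: "nat \<Rightarrow> 'v \<Rightarrow> 'v" where "T j \<equiv> energy_form.T V ip (a j)"

abbreviation D :: "nat \<Rightarrow> 'v \<Rightarrow> 'v" where "D j f \<equiv> T j f - A0.T f"

lemma D_V: assumes "f \<in> X" shows "D j f \<in> V" "D j f \<in> X"
proof -
  interpret A: energy_form X V ip h "a j" \<alpha> \<beta> by (rule forms)
  show "D j f \<in> V" using assms A.T_solves A0.T_solves by (intro E.diff_mem) auto
  then show "D j f \<in> X" by (rule VX)
qed

lemma D_sym: assumes "f \<in> X" "g \<in> X" shows "ip (D j f) g = ip f (D j g)"
proof -
  interpret A: energy_form X V ip h "a j" \<alpha> \<beta> by (rule forms)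
  show ?thesis using assms A.T_X A0.T_X A.T_sym A0.T_sym by (simp add: L.bilin)
qed

lemma D_bound: assumes "f \<in> X" shows "\<alpha>\<^sup>2 * h (D j f) (D j f) \<le> 4 * ip f f"
proof -
  interpret A: energy_form X V ip h "a j" \<alpha> \<beta> by (rule forms)
  have "\<alpha>\<^sup>2 * h (D j f) (D j f) \<le> \<alpha>\<^sup>2 * (2 * h (T j f) (T j f) + 2 * h (A0.T f) (A0.T f))"
    using assms A.T_solves A0.T_solves by (intro mult_left_mono E.diff_square_le) auto
  also have "\<dots> \<le> 4 * ip f f" using A.T_h_bound[OF assms] A0.T_h_bound[OF assms] by (simp add: algebra_simps)
  finally show ?thesis .
qed

lemma D_weak: assumes f: "f \<in> X" and e: "e \<in> X" shows "(\<lambda>j. ip (D j f) e) \<longlonglongrightarrow> 0"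
proof -
  have T: "T j f \<in> V" "v \<in> V \<Longrightarrow> a j (T j f) v = ip f v" "T j f \<in> X" for j v
  proof -
    interpret A: energy_form X V ip h "a j" \<alpha> \<beta> by (rule forms)
    show "T j f \<in> V" "v \<in> V \<Longrightarrow> a j (T j f) v = ip f v" "T j f \<in> X" using A.T_solves[OF f] VX by auto
  qed
  have "(\<lambda>j. ip e (T j f)) \<longlonglongrightarrow> ip e (A0.T f)"
    by (rule solutions_converge[where F = "ip f"]) (use f e T A0.T_solves in auto)
  from tendsto_diff[OF this tendsto_const[of "ip e (A0.T f)"]]
  have "(\<lambda>j. ip e (T j f) - ip e (A0.T f)) \<longlonglongrightarrow> 0" by simp
  moreover have "ip (D j f) e = ip e (T j f) - ip e (A0.T f)" for j
    using e f T(3) A0.T_X[OF f] L.ip_sym[OF D_V(2)[OF f] e] by (simp add: L.bilin)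
  ultimately show ?thesis by simp
qed

text \<open>Compactness turns weak into strong convergence: the differences are bounded in \<open>V\<close>, and finitely many
  functionals control the rest.\<close>

lemma D_strong: assumes f: "f \<in> X" shows "(\<lambda>j. ip (D j f) (D j f)) \<longlonglongrightarrow> 0"
proof (rule LIMSEQ_I)
  fix \<epsilon> :: real assume \<epsilon>: "\<epsilon> > 0"
  define \<epsilon>' where "\<epsilon>' = \<epsilon> * \<alpha>\<^sup>2 / (8 * (ip f f + 1))"
  have ff: "ip f f + 1 > 0" using L.ip_nonneg[OF f] by simp
  have "\<epsilon>' > 0" using \<epsilon> \<alpha>_pos ff by (simp add: \<epsilon>'_def)
  from rellich[OF this] obtain K where K: "finite K" "K \<subseteq> X" "\<And>v. v \<in> V \<Longrightarrow> ip v v \<le> \<epsilon>' * h v v + (\<Sum>e\<in>K. (ip v e)\<^sup>2)"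
    by blast
  have hle: "\<epsilon>' * h (D j f) (D j f) \<le> \<epsilon> / 2" for j
  proof -
    have "\<epsilon>' * h (D j f) (D j f) = \<epsilon> / (8 * (ip f f + 1)) * (\<alpha>\<^sup>2 * h (D j f) (D j f))" by (simp add: \<epsilon>'_def)
    also have "\<dots> \<le> \<epsilon> / (8 * (ip f f + 1)) * (4 * (ip f f + 1))"
      using D_bound[OF f, of j] \<epsilon> ff by (intro mult_left_mono) auto
    also have "\<dots> = \<epsilon> / 2" using ff by (simp add: field_simps)
    finally show ?thesis .
  qed
  have le: "ip (D j f) (D j f) \<le> \<epsilon> / 2 + (\<Sum>e\<in>K. (ip (D j f) e)\<^sup>2)" for j
    using K(3)[OF D_V(1)[OF f, of j]] hle[of j] by linarith
  have "(\<lambda>j. \<Sum>e\<in>K. (ip (D j f) e)\<^sup>2) \<longlonglongrightarrow> (\<Sum>e\<in>K. 0\<^sup>2)"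
    using K(2) by (intro tendsto_sum tendsto_power D_weak f) auto
  then have "\<forall>\<^sub>F j in sequentially. (\<Sum>e\<in>K. (ip (D j f) e)\<^sup>2) < \<epsilon> / 2"
    using \<epsilon> by (intro order_tendstoD(2)[of _ "\<Sum>e\<in>K. 0\<^sup>2"]) auto
  then obtain N where N: "\<And>j. j \<ge> N \<Longrightarrow> (\<Sum>e\<in>K. (ip (D j f) e)\<^sup>2) < \<epsilon> / 2"
    by (auto simp: eventually_sequentially)
  have "norm (ip (D j f) (D j f) - 0) < \<epsilon>" if "j \<ge> N" for j
    using le[of j] N[OF that] L.ip_nonneg[OF D_V(2)[OF f, of j]] by simp
  then show "\<exists>N. \<forall>j\<ge>N. norm (ip (D j f) (D j f) - 0) < \<epsilon>" by blast
qed

text \<open>The passage to operator norm. By symmetry, the functionals \<open>ip (D j f) e\<close> are bounded by the length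
  of \<open>f\<close> times that of \<open>D j e\<close>, which tends to zero for each of the finitely many \<open>e\<close>.\<close>

lemma D_uniform: 
  assumes \<delta>: "\<delta> > 0"
  shows "\<forall>\<^sub>F j in sequentially. \<forall>f\<in>X. ip (D j f) (D j f) \<le> \<delta> * ip f f"
proof -
  have "\<delta> * \<alpha>\<^sup>2 / 8 > 0" using \<delta> \<alpha>_pos by simp
  from rellich[OF this] obtain K where K: "finite K" "K \<subseteq> X" "\<And>v. v \<in> V \<Longrightarrow> ip v v \<le> \<delta> * \<alpha>\<^sup>2 / 8 * h v v + (\<Sum>e\<in>K. (ip v e)\<^sup>2)"
    by blast
  have KX: "e \<in> X" if "e \<in> K" for e using K that by auto
  have "(\<lambda>j. \<Sum>e\<in>K. ip (D j e) (D j e)) \<longlonglongrightarrow> (\<Sum>e\<in>K. 0)"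
    by (intro tendsto_sum D_strong KX)
  then have "\<forall>\<^sub>F j in sequentially. (\<Sum>e\<in>K. ip (D j e) (D j e)) < \<delta> / 2"
    using \<delta> by (intro order_tendstoD(2)[of _ "\<Sum>e\<in>K. 0"]) auto
  then show ?thesis
  proof (rule eventually_mono, intro ballI)
    fix j f assume j: "(\<Sum>e\<in>K. ip (D j e) (D j e)) < \<delta> / 2" and f: "f \<in> X"
    have n: "0 \<le> ip f f" by (rule L.ip_nonneg[OF f])
    have "ip (D j f) (D j f) \<le> \<delta> * \<alpha>\<^sup>2 / 8 * h (D j f) (D j f) + (\<Sum>e\<in>K. (ip (D j f) e)\<^sup>2)"
      by (rule K(3)[OF D_V(1)[OF f]])
    also have "\<delta> * \<alpha>\<^sup>2 / 8 * h (D j f) (D j f) = \<delta> / 8 * (\<alpha>\<^sup>2 * h (D j f) (D j f))" by simp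
    also have "\<dots> \<le> \<delta> / 8 * (4 * ip f f)" using D_bound[OF f, of j] \<delta> by (intro mult_left_mono) auto
    also have "(\<Sum>e\<in>K. (ip (D j f) e)\<^sup>2) \<le> (\<Sum>e\<in>K. ip f f * ip (D j e) (D j e))"
    proof (rule sum_mono)
      fix e assume e: "e \<in> K"
      show "(ip (D j f) e)\<^sup>2 \<le> ip f f * ip (D j e) (D j e)"
        unfolding D_sym[OF f KX[OF e]] by (rule L.Cauchy_Schwarz[OF f D_V(2)[OF KX[OF e]]])
    qed
    also have "\<dots> = ip f f * (\<Sum>e\<in>K. ip (D j e) (D j e))" by (simp add: sum_distrib_left)
    also have "\<dots> \<le> ip f f * (\<delta> / 2)" using j n by (intro mult_left_mono) auto
    finally show "ip (D j f) (D j f) \<le> \<delta> * ip f f" by simp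
  qed
qed

lemma form_uniform: 
  assumes \<eta>: "\<eta> > 0"
  shows "\<forall>\<^sub>F j in sequentially. \<forall>f\<in>X. \<bar>ip (T j f) f - ip (A0.T f) f\<bar> \<le> \<eta> * ip f f"
proof -
  have "\<eta>\<^sup>2 > 0" using \<eta> by simp
  from D_uniform[OF this] show ?thesis
  proof (rule eventually_mono, intro ballI)
    fix j f assume d: "\<forall>f\<in>X. ip (D j f) (D j f) \<le> \<eta>\<^sup>2 * ip f f" and f: "f \<in> X"
    interpret A: energy_form X V ip h "a j" \<alpha> \<beta> by (rule forms)
    have "ip (T j f) f - ip (A0.T f) f = ip (D j f) f" using f A.T_X A0.T_X by (simp add: L.bilin)
    also have "\<bar>\<dots>\<bar> \<le> sqrt (ip (D j f) (D j f)) * sqrt (ip f f)" by (rule L.Cauchy_Schwarz_sqrt[OF D_V(2)[OF f] f])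
    also have "\<dots> \<le> sqrt (\<eta>\<^sup>2 * ip f f) * sqrt (ip f f)"
      using d f L.ip_nonneg[OF f] by (intro mult_right_mono) auto
    also have "\<dots> = \<eta> * ip f f" using \<eta> L.ip_nonneg[OF f] by (simp add: real_sqrt_mult)
    finally show "\<bar>ip (T j f) f - ip (A0.T f) f\<bar> \<le> \<eta> * ip f f" .
  qed
qed

context
  fixes l :: "nat \<Rightarrow> nat \<Rightarrow> real" and u :: "nat \<Rightarrow> nat \<Rightarrow> 'v" and l0 :: "nat \<Rightarrow> real" and u0 :: "nat \<Rightarrow> 'v"
  assumes lists: "\<And>j. energy_form.eigen_list V ip (a j) (l j) (u j)" and list0: "A0.eigen_list l0 u0"
begin

lemma eigenvalues_converge: assumes k: "k \<ge> 1" shows "(\<lambda>j. l j k) \<longlonglongrightarrow> l0 k"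
proof -
  have lp: "l j k > 0" for j
  proof -
    interpret A: energy_form X V ip h "a j" \<alpha> \<beta> by (rule forms)
    show ?thesis by (rule A.list_pos[OF lists k])
  qed
  have l0p: "l0 k > 0" by (rule A0.list_pos[OF list0 k])
  have "(\<lambda>j. 1 / l j k) \<longlonglongrightarrow> 1 / l0 k"
  proof (rule LIMSEQ_I)
    fix r :: real assume r: "r > 0"
    then have "r / 2 > 0" by simp
    from form_uniform[OF this] obtain N 
      where N: "\<And>j f. j \<ge> N \<Longrightarrow> f \<in> X \<Longrightarrow> \<bar>ip (T j f) f - ip (A0.T f) f\<bar> \<le> r / 2 * ip f f"
      unfolding eventually_sequentially by blast
    have "norm (1 / l j k - 1 / l0 k) < r" if "j \<ge> N" for j
    proof -
      have le: "ip (T j f) f \<le> ip (A0.T f) f + r / 2 * ip f f" "ip (A0.T f) f \<le> ip (T j f) f + r / 2 * ip f f" if "f \<in> X" for f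
        using abs_le_D1[OF N[OF \<open>j \<ge> N\<close> that]] abs_le_D2[OF N[OF \<open>j \<ge> N\<close> that]] by linarith+
      have "1 / l j k \<le> 1 / l0 k + r / 2"
        by (rule inverse_eigenvalue_le[OF forms A0.energy_form_axioms lists list0 k le(1)])
      moreover have "1 / l0 k \<le> 1 / l j k + r / 2"
        by (rule inverse_eigenvalue_le[OF A0.energy_form_axioms forms list0 lists k le(2)])
      ultimately show ?thesis using r by (simp add: abs_le_iff)
    qed
    then show "\<exists>N. \<forall>j\<ge>N. norm (1 / l j k - 1 / l0 k) < r" by blast
  qed
  from tendsto_divide[OF tendsto_const[of 1] this] l0p show ?thesis by simp
qed

text \<open>Decompose \<open>u0 k\<close> into \<open>p + q + r\<close>, the parts with index below \<open>k\<close>, from \<open>k\<close> to \<open>N\<close>, and the rest.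
  Since \<open>A0.T (u0 k) = u0 k / l0 k\<close>, the form \<open>ip (A.T (u0 k)) x - ip (u0 k) x / l0 k\<close> is bounded by \<open>D j (u0 k)\<close>.
  It is tested with \<open>x = r\<close>, where the inverse form is at most \<open>1 / l j (Suc N)\<close>, and with \<open>x = p\<close>, where it
  is at least \<open>1 / l j (k - 1)\<close>.\<close>

lemma eigenvector_remainders:
  assumes k: "k \<ge> 1" and N: "N \<ge> k"
    and gap: "k = 1 \<or> l j (k - 1) < l j k"
    and c: "\<forall>m\<in>{1..N}. ip (u0 k - (\<Sum>i\<in>{1..N}. c i *\<^sub>R u j i)) (u j m) = 0"
    and r_def: "r = u0 k - (\<Sum>i\<in>{1..N}. c i *\<^sub>R u j i)" and p_def: "p = (\<Sum>i\<in>{1..<k}. c i *\<^sub>R u j i)"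
  shows "(1 / l0 k - 1 / l j (Suc N)) * sqrt (ip r r) \<le> sqrt (ip (D j (u0 k)) (D j (u0 k)))"
    and "k > 1 \<Longrightarrow> (1 / l j (k - 1) - 1 / l0 k) * sqrt (ip p p) \<le> sqrt (ip (D j (u0 k)) (D j (u0 k)))"
    and "r \<in> X" and "p \<in> X"
proof -
  interpret A: energy_form X V ip h "a j" \<alpha> \<beta> by (rule forms)
  note lst = lists[of j]
  define q where "q = (\<Sum>i\<in>{k..N}. c i *\<^sub>R u j i)"
  let ?\<phi> = "u0 k" and ?\<kappa> = "sqrt (ip (D j (u0 k)) (D j (u0 k)))"
  have \<phi>: "?\<phi> \<in> X" by (rule A0.list_X[OF list0 k])
  have uX: "u j i \<in> X" if "1 \<le> i" for i by (rule A.list_X[OF lst that])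
  show pX: "p \<in> X" unfolding p_def by (intro L.sum_mem L.scale_mem uX) auto
  have qX: "q \<in> X" unfolding q_def using k by (intro L.sum_mem L.scale_mem uX) auto
  have SX: "(\<Sum>i\<in>{1..N}. c i *\<^sub>R u j i) \<in> X" by (intro L.sum_mem L.scale_mem uX) auto
  show rX: "r \<in> X" unfolding r_def by (intro L.diff_mem \<phi> SX)
  have "{1..N} = {1..<k} \<union> {k..N}" using k N by auto
  then have "(\<Sum>i\<in>{1..N}. c i *\<^sub>R u j i) = p + q" 
    unfolding p_def q_def by (simp only:) (rule sum.union_disjoint, auto)
  then have dec: "?\<phi> = p + q + r" by (simp add: r_def)
  have r_u: "ip r (u j m) = 0" if "1 \<le> m" "m \<le> N" for m using c that by (simp add: r_def)
  have u_r: "ip (u j m) r = 0" if "1 \<le> m" "m \<le> N" for m 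
    using r_u[OF that] L.ip_sym[OF rX uX[OF that(1)]] by simp
  have T_u_r: "ip (A.T (u j m)) r = 0" if "1 \<le> m" "m \<le> N" for m
    using A.eigen_T[OF A.list_eigen[OF lst that(1)] rX] u_r[OF that] by simp
  have pr: "ip p r = 0" "ip (A.T p) r = 0" and qr: "ip q r = 0" "ip (A.T q) r = 0"
    unfolding p_def q_def using k N
    by (auto intro!: L.lincomb_null A.B.lincomb_null uX rX u_r T_u_r)
  have uu: "ip (u j i) (u j m) = 0" if "1 \<le> i" "i < k" "k \<le> m" for i m
  proof -
    have "l j i \<le> l j (k - 1)" by (rule A.list_mono[OF lst]) (use that in auto)
    also have "\<dots> < l j k" using gap that by auto
    also have "\<dots> \<le> l j m" by (rule A.list_mono[OF lst k that(3)])
    finally have "l j i \<noteq> l j m" by simp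
    then show ?thesis using A.eigen_orthogonal A.list_eigen[OF lst] that k by (meson order_trans)
  qed
  have up: "ip (u j m) p = 0" if "k \<le> m" for m
  proof -
    have um: "u j m \<in> X" using uX that k by simp
    have "ip p (u j m) = 0" unfolding p_def by (rule L.lincomb_null) (auto intro: uX um uu that)
    then show ?thesis using L.ip_sym[OF um pX] by simp
  qed
  have qp: "ip q p = 0" "ip (A.T q) p = 0"
    unfolding q_def using k A.eigen_T[OF A.list_eigen[OF lst] pX]
    by (auto intro!: L.lincomb_null A.B.lincomb_null uX pX simp: up)
  have rp: "ip r p = 0" "ip (A.T r) p = 0"
    using pr L.ip_sym[OF rX pX] A.B.ip_sym[OF rX pX] by auto
  have dec_r: "ip ?\<phi> r = ip r r" "ip (A.T ?\<phi>) r = ip (A.T r) r"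
    unfolding dec using pX qX rX pr qr by (simp_all add: L.add_left L.mem A.B.add_left)
  have dec_p: "ip ?\<phi> p = ip p p" "ip (A.T ?\<phi>) p = ip (A.T p) p"
    unfolding dec using pX qX rX rp qp by (simp_all add: L.add_left L.mem A.B.add_left)
  have test: "\<bar>ip (A.T ?\<phi>) x - ip ?\<phi> x / l0 k\<bar> \<le> ?\<kappa> * sqrt (ip x x)" if x: "x \<in> X" for x
  proof -
    have "ip (D j ?\<phi>) x = ip (A.T ?\<phi>) x - ip (A0.T ?\<phi>) x"
      using x \<phi> A.T_X A0.T_X by (simp add: L.bilin)
    also have "ip (A0.T ?\<phi>) x = ip ?\<phi> x / l0 k" by (rule A0.eigen_T[OF A0.list_eigen[OF list0 k] x])
    finally show ?thesis using L.Cauchy_Schwarz_sqrt[OF D_V(2)[OF \<phi>] x, of j] by simp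
  qed
  have cancel: "t * sqrt y \<le> \<kappa>" if "t * y \<le> \<kappa> * sqrt y" "0 \<le> y" "0 \<le> \<kappa>" for t y \<kappa> :: real
  proof (cases "y = 0")
    case False
    then have "sqrt y > 0" using that by simp
    moreover have "(t * sqrt y) * sqrt y \<le> \<kappa> * sqrt y" using that by (simp add: mult.assoc)
    ultimately show ?thesis by (simp only: mult_le_cancel_right_pos)
  qed (use that in simp)
  have \<kappa>0: "0 \<le> ?\<kappa>" using L.ip_nonneg[OF D_V(2)[OF \<phi>]] by simp
  have "ip (A.T r) r \<le> ip r r / l j (Suc N)"
    using r_u by (intro A.inverse_form_on_complement[OF lst _ rX]) auto
  moreover have "ip r r / l0 k - ip (A.T r) r \<le> ?\<kappa> * sqrt (ip r r)"
    using test[OF rX] unfolding dec_r by linarith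
  ultimately have "(1 / l0 k - 1 / l j (Suc N)) * ip r r \<le> ?\<kappa> * sqrt (ip r r)"
    by (simp add: algebra_simps)
  then show "(1 / l0 k - 1 / l j (Suc N)) * sqrt (ip r r) \<le> ?\<kappa>"
    by (rule cancel[OF _ L.ip_nonneg[OF rX] \<kappa>0])
  assume "k > 1"
  have "ip p p / l j (k - 1) \<le> ip (A.T p) p"
    by (rule A.inverse_form_on_span[OF lst, of "{1..<k}" _ _ c]) (auto simp: p_def)
  moreover have "ip (A.T p) p - ip p p / l0 k \<le> ?\<kappa> * sqrt (ip p p)"
    using test[OF pX] unfolding dec_p by linarith
  ultimately have "(1 / l j (k - 1) - 1 / l0 k) * ip p p \<le> ?\<kappa> * sqrt (ip p p)"
    by (simp add: algebra_simps)
  then show "(1 / l j (k - 1) - 1 / l0 k) * sqrt (ip p p) \<le> ?\<kappa>"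
    by (rule cancel[OF _ L.ip_nonneg[OF pX] \<kappa>0])
qed

lemma eigenvectors_converge:
  assumes k: "k \<ge> 1" and N: "N \<ge> k" and gap1: "k = 1 \<or> l0 (k - 1) < l0 k" and gap2: "l0 k < l0 (Suc N)"
  shows "\<exists>c. (\<lambda>j. ip ((\<Sum>i\<in>{k..N}. c j i *\<^sub>R u j i) - u0 k) ((\<Sum>i\<in>{k..N}. c j i *\<^sub>R u j i) - u0 k)) \<longlonglongrightarrow> 0"
proof -
  have \<phi>: "u0 k \<in> X" by (rule A0.list_X[OF list0 k])
  have uX: "u j i \<in> X" if "1 \<le> i" for i j
  proof -
    interpret A: energy_form X V ip h "a j" \<alpha> \<beta> by (rule forms)
    show ?thesis by (rule A.list_X[OF lists that])
  qed
  have "\<exists>c. \<forall>m\<in>{1..N}. ip (u0 k - (\<Sum>i\<in>{1..N}. c i *\<^sub>R u j i)) (u j m) = 0" for j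
    by (rule L.finite_projection) (auto simp: uX \<phi>)
  then obtain c where c: "\<And>j. \<forall>m\<in>{1..N}. ip (u0 k - (\<Sum>i\<in>{1..N}. c j i *\<^sub>R u j i)) (u j m) = 0" by metis
  define r where "r j = u0 k - (\<Sum>i\<in>{1..N}. c j i *\<^sub>R u j i)" for j
  define p where "p j = (\<Sum>i\<in>{1..<k}. c j i *\<^sub>R u j i)" for j
  define \<kappa> where "\<kappa> j = sqrt (ip (D j (u0 k)) (D j (u0 k)))" for j
  have \<kappa>: "\<kappa> \<longlonglongrightarrow> 0" unfolding \<kappa>_def using tendsto_real_sqrt[OF D_strong[OF \<phi>]] by simp
  have rX: "r j \<in> X" for j unfolding r_def by (intro L.diff_mem L.sum_mem L.scale_mem uX \<phi>) auto
  have pX: "p j \<in> X" for j unfolding p_def by (intro L.diff_mem L.sum_mem L.scale_mem uX \<phi>) auto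
  have gap: "\<forall>\<^sub>F j in sequentially. k = 1 \<or> l j (k - 1) < l j k"
  proof (cases "k = 1")
    case False
    then have lt: "l0 (k - 1) < (l0 (k - 1) + l0 k) / 2" "(l0 (k - 1) + l0 k) / 2 < l0 k" using gap1 by auto
    have "\<forall>\<^sub>F j in sequentially. l j (k - 1) < (l0 (k - 1) + l0 k) / 2"
      by (rule order_tendstoD(2)[OF eigenvalues_converge lt(1)]) (use k False in auto)
    moreover have "\<forall>\<^sub>F j in sequentially. (l0 (k - 1) + l0 k) / 2 < l j k"
      by (rule order_tendstoD(1)[OF eigenvalues_converge lt(2)]) (use k in auto)
    ultimately show ?thesis by eventually_elim auto
  qed simp
  have l0p: "l0 m > 0" if "m \<ge> 1" for m by (rule A0.list_pos[OF list0 that])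
  have lim_inv: "(\<lambda>j. 1 / l j m) \<longlonglongrightarrow> 1 / l0 m" if "m \<ge> 1" for m
    using l0p[OF that] by (intro tendsto_intros eigenvalues_converge that) auto
  have rlim: "(\<lambda>j. sqrt (ip (r j) (r j))) \<longlonglongrightarrow> 0"
  proof (rule tendsto_zero_of_gap[OF _ _ \<kappa>])
    show "(\<lambda>j. 1 / l0 k - 1 / l j (Suc N)) \<longlonglongrightarrow> 1 / l0 k - 1 / l0 (Suc N)"
      by (intro tendsto_intros lim_inv) simp
    show "1 / l0 k - 1 / l0 (Suc N) > 0" using gap2 l0p[OF k] by (simp add: frac_less2)
    show "\<forall>\<^sub>F j in sequentially. (1 / l0 k - 1 / l j (Suc N)) * sqrt (ip (r j) (r j)) \<le> \<kappa> j"
      using gap by eventually_elim (use eigenvector_remainders(1)[OF k N _ c r_def p_def] in \<open>simp add: \<kappa>_def\<close>)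
  qed (use L.ip_nonneg[OF rX] in auto)
  have plim: "(\<lambda>j. sqrt (ip (p j) (p j))) \<longlonglongrightarrow> 0"
  proof (cases "k = 1")
    case True
    then show ?thesis using L.zero_left[OF L.zero_mem] by (simp add: p_def)
  next
    case False
    then have k1: "k > 1" "k - 1 \<ge> 1" using k by auto
    show ?thesis
    proof (rule tendsto_zero_of_gap[OF _ _ \<kappa>])
      show "(\<lambda>j. 1 / l j (k - 1) - 1 / l0 k) \<longlonglongrightarrow> 1 / l0 (k - 1) - 1 / l0 k"
        by (intro tendsto_intros lim_inv k1)
      show "1 / l0 (k - 1) - 1 / l0 k > 0" using gap1 False l0p[OF k1(2)] by (simp add: frac_less2)
      show "\<forall>\<^sub>F j in sequentially. (1 / l j (k - 1) - 1 / l0 k) * sqrt (ip (p j) (p j)) \<le> \<kappa> j"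
        using gap by eventually_elim (use eigenvector_remainders(2)[OF k N _ c r_def p_def k1(1)] in \<open>simp add: \<kappa>_def\<close>)
    qed (use L.ip_nonneg[OF pX] in auto)
  qed
  have eq: "(\<Sum>i\<in>{k..N}. c j i *\<^sub>R u j i) - u0 k = (-1) *\<^sub>R (p j + r j)" for j
  proof -
    have "{1..N} = {1..<k} \<union> {k..N}" using k N by auto
    then have "(\<Sum>i\<in>{1..N}. c j i *\<^sub>R u j i) = p j + (\<Sum>i\<in>{k..N}. c j i *\<^sub>R u j i)" 
      unfolding p_def by (simp only:) (rule sum.union_disjoint, auto)
    then show ?thesis by (simp add: r_def)
  qed
  have "(\<lambda>j. ip ((\<Sum>i\<in>{k..N}. c j i *\<^sub>R u j i) - u0 k) ((\<Sum>i\<in>{k..N}. c j i *\<^sub>R u j i) - u0 k)) \<longlonglongrightarrow> 0"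
  proof (rule Lim_null_comparison)
    have "norm (ip ((-1) *\<^sub>R (p j + r j)) ((-1) *\<^sub>R (p j + r j))) \<le> 2 * (sqrt (ip (p j) (p j)))\<^sup>2 + 2 * (sqrt (ip (r j) (r j)))\<^sup>2" for j
    proof -
      have pr: "p j + r j \<in> X" by (intro L.add_mem pX rX)
      have "ip ((-1) *\<^sub>R (p j + r j)) ((-1) *\<^sub>R (p j + r j)) = ip (p j + r j) (p j + r j)"
        using L.scale_left[OF pr L.scale_mem[OF pr], of "-1" "-1"] L.scale_right[OF pr pr, of "-1"] by simp
      then show ?thesis
        using L.add_square_le[OF pX rX, of j j] L.ip_nonneg[OF pr] L.ip_nonneg[OF pX] L.ip_nonneg[OF rX] by simp
    qed
    then show "\<forall>\<^sub>F j in sequentially. norm (ip ((\<Sum>i\<in>{k..N}. c j i *\<^sub>R u j i) - u0 k) ((\<Sum>i\<in>{k..N}. c j i *\<^sub>R u j i) - u0 k))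
        \<le> 2 * (sqrt (ip (p j) (p j)))\<^sup>2 + 2 * (sqrt (ip (r j) (r j)))\<^sup>2" unfolding eq by simp
    have "(\<lambda>j. 2 * (sqrt (ip (p j) (p j)))\<^sup>2 + 2 * (sqrt (ip (r j) (r j)))\<^sup>2) \<longlonglongrightarrow> 2 * 0\<^sup>2 + 2 * 0\<^sup>2"
      by (intro tendsto_intros plim rlim)
    then show "(\<lambda>j. 2 * (sqrt (ip (p j) (p j)))\<^sup>2 + 2 * (sqrt (ip (r j) (r j)))\<^sup>2) \<longlonglongrightarrow> 0" by simp
  qed
  then show ?thesis by (intro exI[of _ c])
qed

end

end

section \<open>Calculus of smooth functions\<close>

lemma Ck_on_cong:
  assumes "open S" "\<And>x. x \<in> S \<Longrightarrow> f x = g x" "Ck_on k S f"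
  shows "Ck_on k S g"
  using assms
proof (induction k arbitrary: f g)
  case 0
  then show ?case using continuous_on_cong by auto
next
  case (Suc k)
  have d: "f differentiable (at x)" if "x \<in> S" for x using Suc.prems that by simp
  have "g differentiable (at x)" if "x \<in> S" for x
    using d[OF that] Suc.prems(1,2) that unfolding differentiable_def
    by (metis has_derivative_transform_within_open)
  moreover have "Ck_on k S (\<lambda>x. frechet_derivative g (at x) v)" for v
  proof (rule Suc.IH[OF Suc.prems(1)])
    show "Ck_on k S (\<lambda>x. frechet_derivative f (at x) v)" using Suc.prems by simp
    show "frechet_derivative f (at x) v = frechet_derivative g (at x) v" if "x \<in> S" for x
      using frechet_derivative_transform_within_open[OF d[OF that] Suc.prems(1) that Suc.prems(2)] by simp
  qed
  ultimately show ?case by simp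
qed

lemma Ck_on_imp_continuous: "Ck_on k S f \<Longrightarrow> continuous_on S f"
  by (cases k) (auto intro!: continuous_at_imp_continuous_on differentiable_imp_continuous_within)

lemma Ck_on_SucD: "Ck_on (Suc k) S f \<Longrightarrow> Ck_on k S f"
proof (induction k arbitrary: f)
  case 0
  then show ?case using Ck_on_imp_continuous[of "Suc 0"] by simp
next
  case (Suc k)
  have 1: "\<forall>x\<in>S. f differentiable at x" and 2: "\<forall>v. Ck_on (Suc k) S (\<lambda>x. frechet_derivative f (at x) v)"
    using Suc.prems by (auto simp del: Ck_on.simps simp: Ck_on.simps(2)[of "Suc k"])
  then show ?case using Suc.IH by (simp del: Ck_on.simps add: Ck_on.simps(2)[of k])
qed

lemma Ck_on_Un: "Ck_on k S f \<Longrightarrow> Ck_on k T f \<Longrightarrow> open S \<Longrightarrow> open T \<Longrightarrow> Ck_on k (S \<union> T) f"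
  by (induction k arbitrary: f) (auto intro: continuous_on_open_Un)

lemma Ck_on_const: "Ck_on k S (\<lambda>x. c)"
  by (induction k arbitrary: c) auto

lemma Ck_on_bounded_linear:
  assumes L: "bounded_linear L" and S: "open S" and f: "Ck_on k S f"
  shows "Ck_on k S (\<lambda>x. L (f x))"
  using f
proof (induction k arbitrary: f)
  case 0
  then show ?case using bounded_linear.continuous_on[OF L] by simp
next
  case (Suc k)
  have der: "((\<lambda>x. L (f x)) has_derivative (\<lambda>v. L (frechet_derivative f (at x) v))) (at x)" if "x \<in> S" for x
    using Suc.prems that by (intro bounded_linear.has_derivative[OF L]) (simp add: frechet_derivative_works[symmetric])
  have "Ck_on k S (\<lambda>x. frechet_derivative (\<lambda>x. L (f x)) (at x) v)" for v
  proof (rule Ck_on_cong[OF S])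
    show "Ck_on k S (\<lambda>x. L (frechet_derivative f (at x) v))" using Suc by simp
    show "L (frechet_derivative f (at x) v) = frechet_derivative (\<lambda>x. L (f x)) (at x) v" if "x \<in> S" for x
      using frechet_derivative_at[OF der[OF that]] by (metis)
  qed
  then show ?case using der by (auto simp: differentiable_def)
qed

lemma Ck_on_add:
  assumes S: "open S" and f: "Ck_on k S f" and g: "Ck_on k S g"
  shows "Ck_on k S (\<lambda>x. f x + g x)"
  using f g
proof (induction k arbitrary: f g)
  case 0
  then show ?case by (auto intro: continuous_intros)
next
  case (Suc k)
  have der: "((\<lambda>x. f x + g x) has_derivative (\<lambda>v. frechet_derivative f (at x) v + frechet_derivative g (at x) v)) (at x)" if "x \<in> S" for x
    using Suc.prems that by (intro has_derivative_add) (simp_all add: frechet_derivative_works[symmetric])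
  have "Ck_on k S (\<lambda>x. frechet_derivative (\<lambda>x. f x + g x) (at x) v)" for v
  proof (rule Ck_on_cong[OF S])
    show "Ck_on k S (\<lambda>x. frechet_derivative f (at x) v + frechet_derivative g (at x) v)" using Suc by simp
    show "frechet_derivative f (at x) v + frechet_derivative g (at x) v = frechet_derivative (\<lambda>x. f x + g x) (at x) v" if "x \<in> S" for x
      using frechet_derivative_at[OF der[OF that]] by (metis)
  qed
  then show ?case using der by (auto simp: differentiable_def)
qed

lemma Ck_on_scaleR:
  fixes f :: "'a::real_normed_vector \<Rightarrow> real"
  assumes S: "open S" and f: "Ck_on k S f" and g: "Ck_on k S g"
  shows "Ck_on k S (\<lambda>x. f x *\<^sub>R g x)"
  using f g
proof (induction k arbitrary: f g)
  case 0
  then show ?case by (auto intro: continuous_intros)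
next
  case (Suc k)
  let ?D = "\<lambda>f x. frechet_derivative f (at x)"
  have der: "((\<lambda>x. f x *\<^sub>R g x) has_derivative (\<lambda>v. f x *\<^sub>R ?D g x v + ?D f x v *\<^sub>R g x)) (at x)" if "x \<in> S" for x
    using Suc.prems that by (intro has_derivative_scaleR) (simp_all add: frechet_derivative_works[symmetric])
  have "Ck_on k S (\<lambda>x. ?D (\<lambda>x. f x *\<^sub>R g x) x v)" for v
  proof (rule Ck_on_cong[OF S])
    have "Ck_on k S f" "Ck_on k S g" using Suc.prems Ck_on_SucD by blast+
    then show "Ck_on k S (\<lambda>x. f x *\<^sub>R ?D g x v + ?D f x v *\<^sub>R g x)" 
      using Suc.prems by (intro Ck_on_add S Suc.IH) simp_all
    show "f x *\<^sub>R ?D g x v + ?D f x v *\<^sub>R g x = ?D (\<lambda>x. f x *\<^sub>R g x) x v" if "x \<in> S" for x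
      using frechet_derivative_at[OF der[OF that]] by (metis)
  qed
  then show ?case using der by (auto simp: differentiable_def)
qed

lemma Ck_on_sum:
  assumes "open S" "\<And>i. i \<in> I \<Longrightarrow> Ck_on k S (f i)"
  shows "Ck_on k S (\<lambda>x. \<Sum>i\<in>I. f i x)"
  using assms(2)
  by (induction I rule: infinite_finite_induct) (auto intro: Ck_on_const Ck_on_add[OF assms(1)])

text \<open>The derivative of \<open>f\<close> at \<open>g x\<close> is applied to a direction that varies with \<open>x\<close>; expanding that direction
  in a basis brings it into the form of a sum of products, to which the induction hypothesis applies.\<close>

lemma Ck_on_compose:
  fixes g :: "'a::real_normed_vector \<Rightarrow> 'b::euclidean_space" and f :: "'b \<Rightarrow> 'c::real_normed_vector"
  assumes S: "open S" and T: "open T" and gS: "g ` S \<subseteq> T"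
    and g: "Ck_on k S g" and f: "Ck_on k T f"
  shows "Ck_on k S (\<lambda>x. f (g x))"
  using g f
proof (induction k arbitrary: f)
  case 0
  then show ?case using continuous_on_compose2[OF _ _ gS] by auto
next
  case (Suc k)
  let ?D = "\<lambda>f x. frechet_derivative f (at x)"
  have df: "(f has_derivative ?D f (g x)) (at (g x))" and dg: "(g has_derivative ?D g x) (at x)" if "x \<in> S" for x
    using Suc.prems that gS by (auto simp: frechet_derivative_works[symmetric])
  have der: "((\<lambda>x. f (g x)) has_derivative (\<lambda>v. ?D f (g x) (?D g x v))) (at x)" if "x \<in> S" for x
    using diff_chain_at[OF dg[OF that] df[OF that]] by (simp add: o_def)
  have "Ck_on k S (\<lambda>x. ?D (\<lambda>x. f (g x)) x v)" for v
  proof (rule Ck_on_cong[OF S])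
    have 1: "Ck_on k S (\<lambda>x. ?D g x v)" and 2: "Ck_on k T (\<lambda>y. ?D f y b)" for b using Suc.prems by simp_all
    have gk: "Ck_on k S g" by (rule Ck_on_SucD[OF Suc.prems(1)])
    show "Ck_on k S (\<lambda>x. \<Sum>b\<in>Basis. (?D g x v \<bullet> b) *\<^sub>R ?D f (g x) b)"
    proof (intro Ck_on_sum Ck_on_scaleR S)
      show "Ck_on k S (\<lambda>x. ?D g x v \<bullet> b)" for b
        by (rule Ck_on_bounded_linear[OF bounded_linear_inner_left S 1])
      show "Ck_on k S (\<lambda>x. ?D f (g x) b)" for b by (rule Suc.IH[OF gk 2])
    qed
    show "(\<Sum>b\<in>Basis. (?D g x v \<bullet> b) *\<^sub>R ?D f (g x) b) = ?D (\<lambda>x. f (g x)) x v" if "x \<in> S" for x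
    proof -
      have lin: "linear (?D f (g x))" using df[OF that] has_derivative_linear by blast
      have "?D f (g x) (?D g x v) = ?D f (g x) (\<Sum>b\<in>Basis. (?D g x v \<bullet> b) *\<^sub>R b)" 
        by (simp only: euclidean_representation)
      also have "\<dots> = (\<Sum>b\<in>Basis. (?D g x v \<bullet> b) *\<^sub>R ?D f (g x) b)"
        by (simp add: linear_sum[OF lin] linear_cmul[OF lin])
      finally show ?thesis using frechet_derivative_at[OF der[OF that]] by metis
    qed
  qed
  then show ?case using der by (auto simp: differentiable_def)
qed

lemma smooth_on_continuous: "smooth_on S f \<Longrightarrow> continuous_on S f"
  unfolding smooth_on_def using Ck_on_imp_continuous by blast

lemma smooth_on_differentiable: "smooth_on S f \<Longrightarrow> x \<in> S \<Longrightarrow> f differentiable (at x)"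
  unfolding smooth_on_def using Ck_on.simps(2)[of 0 S f] by blast

lemma smooth_on_derivative: "smooth_on S f \<Longrightarrow> smooth_on S (\<lambda>x. frechet_derivative f (at x) v)"
  unfolding smooth_on_def using Ck_on.simps(2)[of _ S f] by blast

lemma smooth_on_cong: "open S \<Longrightarrow> (\<And>x. x \<in> S \<Longrightarrow> f x = g x) \<Longrightarrow> smooth_on S f \<Longrightarrow> smooth_on S g"
  unfolding smooth_on_def using Ck_on_cong[of S f g] by blast

lemma smooth_on_Un: "smooth_on S f \<Longrightarrow> smooth_on T f \<Longrightarrow> open S \<Longrightarrow> open T \<Longrightarrow> smooth_on (S \<union> T) f"
  unfolding smooth_on_def using Ck_on_Un by blast

lemma smooth_on_const: "smooth_on S (\<lambda>x. c)"
  unfolding smooth_on_def using Ck_on_const by blast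

lemma Ck_on_ident: "open S \<Longrightarrow> Ck_on k S (\<lambda>x. x)"
  by (cases k) (auto simp: Ck_on_const differentiable_ident)

lemma smooth_on_linear: "bounded_linear L \<Longrightarrow> open S \<Longrightarrow> smooth_on S L"
  unfolding smooth_on_def using Ck_on_bounded_linear[OF _ _ Ck_on_ident] by blast

lemma smooth_on_add: "open S \<Longrightarrow> smooth_on S f \<Longrightarrow> smooth_on S g \<Longrightarrow> smooth_on S (\<lambda>x. f x + g x)"
  unfolding smooth_on_def using Ck_on_add by blast

lemma smooth_on_mult: "open S \<Longrightarrow> smooth_on S f \<Longrightarrow> smooth_on S g \<Longrightarrow> smooth_on S (\<lambda>x. f x * g x :: real)"
  unfolding smooth_on_def using Ck_on_scaleR[of S _ f g] by simp

lemma smooth_on_compose: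
  fixes g :: "'a::real_normed_vector \<Rightarrow> 'b::euclidean_space"
  shows "open S \<Longrightarrow> open T \<Longrightarrow> g ` S \<subseteq> T \<Longrightarrow> smooth_on S g \<Longrightarrow> smooth_on T f \<Longrightarrow> smooth_on S (\<lambda>x. f (g x))"
  unfolding smooth_on_def using Ck_on_compose by blast

lemma smooth_on_prod:
  assumes "open S" "\<And>i. i \<in> I \<Longrightarrow> smooth_on S (f i)"
  shows "smooth_on S (\<lambda>x. \<Prod>i\<in>I. f i x :: real)"
  using assms(2)
  by (induction I rule: infinite_finite_induct) (auto intro: smooth_on_const smooth_on_mult[OF assms(1)])

subsection \<open>Bump functions\<close>

text \<open>The functions \<open>p(1/t) exp (-1/t)\<close>, extended by zero to the left: a class that contains
  \<open>exp (-1/t)\<close> and is closed under differentiation.\<close>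

definition flat_poly :: "real poly \<Rightarrow> real \<Rightarrow> real" where
  "flat_poly p t = (if t \<le> 0 then 0 else poly p (1 / t) * exp (- (1 / t)))"

lemma poly_exp_tendsto_0: "((\<lambda>s. poly p s * exp (- s)) \<longlongrightarrow> (0::real)) at_top"
proof -
  have "((\<lambda>s. \<Sum>i\<le>degree p. coeff p i * (s ^ i / exp s)) \<longlongrightarrow> (\<Sum>i\<le>degree p. coeff p i * 0)) at_top"
    by (intro tendsto_sum tendsto_mult tendsto_const tendsto_power_div_exp_0)
  then show ?thesis by (simp add: poly_altdef exp_minus sum_distrib_right divide_inverse mult.assoc)
qed

lemma flat_poly_derivative:
  "(flat_poly p has_real_derivative flat_poly ([:0, 0, 1:] * (p - pderiv p)) t) (at t)"
proof (cases t "0::real" rule: linorder_cases)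
  case less
  have "((\<lambda>_. 0) has_real_derivative 0) (at t)" by simp
  then have "(flat_poly p has_real_derivative 0) (at t)"
    by (rule has_field_derivative_transform_within_open[where S = "{..<0}"]) (use less in \<open>auto simp: flat_poly_def\<close>)
  then show ?thesis using less by (simp add: flat_poly_def)
next
  case greater
  have "((\<lambda>t. poly p (1 / t) * exp (- (1 / t))) has_real_derivative 
     poly ([:0, 0, 1:] * (p - pderiv p)) (1 / t) * exp (- (1 / t))) (at t)"
    using greater by (auto intro!: derivative_eq_intros simp: power2_eq_square field_simps)
  then have "(flat_poly p has_real_derivative poly ([:0, 0, 1:] * (p - pderiv p)) (1 / t) * exp (- (1 / t))) (at t)"
    by (rule has_field_derivative_transform_within_open[where S = "{0<..}"]) (use greater in \<open>auto simp: flat_poly_def\<close>)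
  then show ?thesis using greater by (simp add: flat_poly_def)
next
  case equal
  have "((\<lambda>h. (flat_poly p (0 + h) - flat_poly p 0) / h) \<longlongrightarrow> 0) (at 0)"
  proof (rule filterlim_split_at)
    show "((\<lambda>h. (flat_poly p (0 + h) - flat_poly p 0) / h) \<longlongrightarrow> 0) (at_left 0)"
      by (rule tendsto_eventually) (auto simp: flat_poly_def eventually_at_filter)
    have "((\<lambda>h. poly (pCons 0 p) (inverse h) * exp (- inverse h)) \<longlongrightarrow> 0) (at_right (0::real))"
      using filterlim_compose[OF poly_exp_tendsto_0 filterlim_inverse_at_top_right] .
    then show "((\<lambda>h. (flat_poly p (0 + h) - flat_poly p 0) / h) \<longlongrightarrow> 0) (at_right 0)"
      by (rule Lim_transform_eventually) (auto simp: flat_poly_def eventually_at_filter divide_inverse)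
  qed
  then show ?thesis using equal by (simp add: DERIV_def flat_poly_def)
qed

lemma smooth_flat_poly: "smooth_on UNIV (flat_poly p)"
  unfolding smooth_on_def
proof
  fix k show "Ck_on k UNIV (flat_poly p)"
  proof (induction k arbitrary: p)
    case 0
    then show ?case using DERIV_isCont[OF flat_poly_derivative] by (auto intro: continuous_at_imp_continuous_on)
  next
    case (Suc k)
    let ?q = "[:0, 0, 1:] * (p - pderiv p)"
    have der: "(flat_poly p has_derivative (\<lambda>v. flat_poly ?q x * v)) (at x)" for x
      using flat_poly_derivative[of p x] by (simp add: has_field_derivative_def)
    have "frechet_derivative (flat_poly p) (at x) v = v *\<^sub>R flat_poly ?q x" for x v
      using frechet_derivative_at[OF der[of x]] by (metis mult.commute real_scaleR_def)
    moreover have "Ck_on k UNIV (\<lambda>x. v *\<^sub>R flat_poly ?q x)" for v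
      by (rule Ck_on_bounded_linear[OF bounded_linear_scaleR_right open_UNIV Suc.IH])
    moreover have "flat_poly p differentiable (at x)" for x using der unfolding differentiable_def by blast
    ultimately show ?case by simp
  qed
qed

text \<open>For \<open>k \<ge> 1\<close> a smooth function that is positive exactly on the open box; it tends to the
  indicator function of the box as \<open>k\<close> grows.\<close>

definition box_bump :: "nat \<Rightarrow> 'a::euclidean_space \<Rightarrow> 'a \<Rightarrow> 'a \<Rightarrow> real" where
  "box_bump k a b x = (\<Prod>i\<in>Basis. flat_poly 1 (real k * (x \<bullet> i - a \<bullet> i)) * flat_poly 1 (real k * (b \<bullet> i - x \<bullet> i)))"

lemma smooth_box_bump: "smooth_on UNIV (box_bump k a b :: 'a::euclidean_space \<Rightarrow> real)"
  unfolding box_bump_def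
proof (rule smooth_on_prod[OF open_UNIV])
  fix i :: 'a
  have l: "smooth_on UNIV (\<lambda>x. x \<bullet> i)" by (rule smooth_on_linear[OF bounded_linear_inner_left open_UNIV])
  have aff: "smooth_on UNIV (\<lambda>x. flat_poly 1 (s * (x \<bullet> i) + t))" for s t
    by (rule smooth_on_compose[OF open_UNIV open_UNIV _ _ smooth_flat_poly[of 1]])
      (auto intro!: smooth_on_add smooth_on_mult smooth_on_const l)
  show "smooth_on UNIV (\<lambda>x. flat_poly 1 (real k * (x \<bullet> i - a \<bullet> i)) * flat_poly 1 (real k * (b \<bullet> i - x \<bullet> i)))"
    using smooth_on_mult[OF open_UNIV aff[of "real k" "- (real k * (a \<bullet> i))"] aff[of "- real k" "real k * (b \<bullet> i)"]]
    by (simp add: algebra_simps)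
qed

lemma flat_poly_1: "0 \<le> flat_poly 1 t" "flat_poly 1 t \<le> 1" "t \<le> 0 \<Longrightarrow> flat_poly 1 t = 0"
  by (auto simp: flat_poly_def)

lemma box_bump_bounds: "0 \<le> box_bump k a b x" "box_bump k a b x \<le> 1"
  unfolding box_bump_def by (auto intro!: prod_nonneg prod_le_1 flat_poly_1 mult_le_one mult_nonneg_nonneg)

lemma box_bump_outside: 
  assumes "x \<notin> box a b" shows "box_bump k a b (x::'a::euclidean_space) = 0"
proof -
  obtain i :: 'a where i: "i \<in> Basis" "x \<bullet> i \<le> a \<bullet> i \<or> b \<bullet> i \<le> x \<bullet> i" 
    using assms by (auto simp: mem_box not_less)
  then have "flat_poly 1 (real k * (x \<bullet> i - a \<bullet> i)) * flat_poly 1 (real k * (b \<bullet> i - x \<bullet> i)) = 0" 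
    by (auto simp: flat_poly_1 mult_nonneg_nonpos)
  then show ?thesis unfolding box_bump_def using i by (intro prod_zero) auto
qed

lemma box_bump_tendsto: 
  assumes x: "x \<in> box a b" shows "(\<lambda>k. box_bump k a b x) \<longlonglongrightarrow> 1"
proof -
  have one: "(\<lambda>k. flat_poly 1 (real k * s)) \<longlonglongrightarrow> 1" if s: "s > 0" for s
  proof -
    have "(\<lambda>k. exp (- (1 / real k * (1 / s)))) \<longlonglongrightarrow> exp (- (0 * (1 / s)))"
      by (intro tendsto_intros lim_1_over_n)
    then have "(\<lambda>k. exp (- (1 / real k * (1 / s)))) \<longlonglongrightarrow> 1" by simp
    then show ?thesis
      by (rule Lim_transform_eventually)
        (use s in \<open>auto simp: flat_poly_def mult_le_0_iff intro!: eventually_sequentiallyI[of 1]\<close>)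
  qed
  have "(\<lambda>k. box_bump k a b x) \<longlonglongrightarrow> (\<Prod>i\<in>(Basis::'a set). 1 * 1)" 
    unfolding box_bump_def
    by (intro tendsto_prod tendsto_mult one) (use x in \<open>auto simp: mem_box\<close>)
  then show ?thesis by simp
qed

section \<open>Integration in Euclidean space\<close>

text \<open>Difference quotients of an integrable function have integral zero by translation invariance. They
  converge to the derivative and, by the mean value theorem, are dominated on one compact set.\<close>

lemma integral_derivative_compact_support:
  fixes f :: "'a::euclidean_space \<Rightarrow> real"
  assumes diff: "\<And>x. f differentiable (at x)"
    and cont: "continuous_on UNIV (\<lambda>x. frechet_derivative f (at x) v)"
    and K: "compact K" and zero: "\<And>x. x \<notin> K \<Longrightarrow> f x = 0"
  shows "(LINT x|lborel. frechet_derivative f (at x) v) = 0"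
proof -
  define D where "D x = frechet_derivative f (at x) v" for x
  have fc: "continuous_on A f" for A
    using diff by (auto intro: continuous_at_imp_continuous_on differentiable_imp_continuous_within)
  have D0: "D x = 0" if "x \<notin> K" for x
  proof -
    have "frechet_derivative f (at x) = frechet_derivative (\<lambda>_. 0) (at x)"
      by (rule frechet_derivative_transform_within_open[OF diff, of "- K"]) 
        (use K zero that in \<open>auto simp: compact_imp_closed\<close>)
    then show ?thesis by (simp add: D_def)
  qed
  have "compact (D ` K)" by (rule compact_continuous_image[OF _ K]) (use cont in \<open>auto simp: D_def intro: continuous_on_subset\<close>)
  then obtain C0 where C0: "\<And>x. x \<in> K \<Longrightarrow> norm (D x) \<le> C0" using compact_imp_bounded bounded_iff by (metis imageI)
  define C where "C = max C0 0"
  have C: "\<bar>D x\<bar> \<le> C" for x using C0[of x] D0[of x] by (cases "x \<in> K") (auto simp: C_def)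
  define K' where "K' = (\<lambda>(x, t). x - t *\<^sub>R v) ` (K \<times> {0..1::real})"
  have K': "compact K'" unfolding K'_def
    by (intro compact_continuous_image compact_Times K compact_Icc) (auto simp: case_prod_unfold intro!: continuous_intros)
  define s where "s n x = real (Suc n) * (f (x + (1 / real (Suc n)) *\<^sub>R v) - f x)" for n x
  have mvt: "\<exists>z. 0 < z \<and> z < 1 / real (Suc n) \<and> s n x = D (x + z *\<^sub>R v)" for n x
  proof -
    have "((\<lambda>t. f (x + t *\<^sub>R v)) has_real_derivative D (x + t *\<^sub>R v)) (at t)" for t
    proof -
      have 1: "((\<lambda>t. x + t *\<^sub>R v) has_derivative (\<lambda>h. h *\<^sub>R v)) (at t)" by (auto intro!: derivative_eq_intros)
      have 2: "(f has_derivative frechet_derivative f (at (x + t *\<^sub>R v))) (at (x + t *\<^sub>R v))"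
        using diff frechet_derivative_works by blast
      have lin: "linear (frechet_derivative f (at (x + t *\<^sub>R v)))" by (rule linear_frechet_derivative[OF diff])
      have "((\<lambda>t. f (x + t *\<^sub>R v)) has_derivative (\<lambda>h. frechet_derivative f (at (x + t *\<^sub>R v)) (h *\<^sub>R v))) (at t)"
        using diff_chain_at[OF 1 2] by (simp add: o_def)
      then show ?thesis using linear_cmul[OF lin] by (simp add: has_field_derivative_def D_def mult_commute_abs)
    qed
    from MVT2[of 0 "1 / real (Suc n)", OF _ this] obtain z where
      "0 < z" "z < 1 / real (Suc n)" "f (x + (1 / real (Suc n)) *\<^sub>R v) - f x = 1 / real (Suc n) * D (x + z *\<^sub>R v)"
      by auto
    then show ?thesis by (intro exI[of _ z]) (simp add: s_def)
  qed
  then obtain z where z: "\<And>n x. 0 < z n x" "\<And>n x. z n x < 1 / real (Suc n)" "\<And>n x. s n x = D (x + z n x *\<^sub>R v)" by metis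
  have bound: "norm (s n x) \<le> C * indicator K' x" for n x
  proof (cases "x \<in> K'")
    case False
    have "1 / real (Suc n) \<le> 1" by simp
    then have "z n x \<in> {0..1}" using z(1)[of n x] z(2)[of n x] by (simp only: atLeastAtMost_iff) linarith
    moreover have "x = (x + z n x *\<^sub>R v) - z n x *\<^sub>R v" by simp
    ultimately have "x + z n x *\<^sub>R v \<notin> K" using False unfolding K'_def by force
    then show ?thesis using D0 z(3) C[of x] by simp
  qed (use C z(3) in simp)
  have f_int: "integrable lborel f"
  proof -
    have "integrable lborel (\<lambda>x. indicator K x *\<^sub>R f x)" by (rule borel_integrable_compact[OF K fc])
    moreover have "(\<lambda>x. indicator K x *\<^sub>R f x) = f" using zero by (auto simp: indicator_def fun_eq_iff)
    ultimately show ?thesis by simp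
  qed
  have shift: "integrable lborel (\<lambda>x. f (c + x)) \<and> (LINT x|lborel. f (c + x)) = (LINT x|lborel. f x)" for c
  proof -
    have m: "(+) c \<in> lborel \<rightarrow>\<^sub>M borel" by simp
    have fm: "f \<in> borel_measurable borel" by (intro borel_measurable_continuous_onI fc)
    show ?thesis using integrable_distr[OF m, of f] integral_distr[OF m fm] f_int by (simp add: lborel_distr_plus)
  qed
  have s_int: "(LINT x|lborel. s n x) = 0" for n
    using shift[of "(1 / real (Suc n)) *\<^sub>R v"] f_int 
    by (simp add: s_def add.commute)
  have "(\<lambda>n. LINT x|lborel. s n x) \<longlonglongrightarrow> (LINT x|lborel. D x)"
  proof (rule integral_dominated_convergence[where w = "\<lambda>x. C * indicator K' x"])
    show "D \<in> borel_measurable lborel" using cont by (auto simp: D_def[abs_def] intro: borel_measurable_continuous_onI)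
    show "s n \<in> borel_measurable lborel" for n
      unfolding s_def by (auto intro!: borel_measurable_continuous_onI continuous_intros continuous_on_compose2[OF fc[of UNIV]])
    show "integrable lborel (\<lambda>x. C * indicator K' x :: real)"
      using borel_integrable_compact[OF K' continuous_on_const[of K' C]] by (simp add: mult.commute)
    show "AE x in lborel. norm (s n x) \<le> C * indicator K' x" for n using bound by simp
    have "(\<lambda>n. s n x) \<longlonglongrightarrow> D x" for x
    proof -
      have "(\<lambda>n. z n x) \<longlonglongrightarrow> 0"
      proof (rule tendsto_sandwich[OF _ _ tendsto_const])
        show "(\<lambda>n. 1 / real (Suc n)) \<longlonglongrightarrow> 0" by (rule LIMSEQ_Suc[OF lim_1_over_n])
      qed (use less_imp_le[OF z(1)] less_imp_le[OF z(2)] in auto)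
      then have "(\<lambda>n. x + z n x *\<^sub>R v) \<longlonglongrightarrow> x + 0 *\<^sub>R v" by (intro tendsto_intros)
      then have "(\<lambda>n. D (x + z n x *\<^sub>R v)) \<longlonglongrightarrow> D x"
        using cont by (intro continuous_on_tendsto_compose[of UNIV D]) (auto simp: D_def[abs_def])
      then show ?thesis by (simp add: z(3))
    qed
    then show "AE x in lborel. (\<lambda>n. s n x) \<longlonglongrightarrow> D x" by simp
  qed
  then show ?thesis unfolding s_int D_def by (simp add: LIMSEQ_const_iff)
qed

text \<open>Boxes form a generator of the Borel sets that is closed under intersection, so all integrals of \<open>g\<close>
  over Borel sets vanish.\<close>

lemma AE_zero_of_box_integrals_borel:
  fixes g :: "'a::euclidean_space \<Rightarrow> real"
  assumes g: "integrable lborel g" and tot: "(LINT x|lborel. g x) = 0"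
    and box0: "\<And>c d. (LINT x:box c d|lborel. g x) = 0"
  shows "AE x in lborel. g x = 0"
proof (rule sigma_finite_measure.density_zero[OF sigma_finite_lborel g])
  let ?G = "range (\<lambda>(a, b). box a b :: 'a set)"
  have si: "set_integrable lborel A g" if "A \<in> sets borel" for A
    using integrable_mult_indicator[of A lborel g] g that by (simp add: set_integrable_def)
  fix A :: "'a set" assume "A \<in> sets lborel"
  then have A: "A \<in> sigma_sets UNIV ?G" by (simp add: borel_eq_box)
  have stable: "Int_stable ?G"
    by (auto simp: Int_stable_def Int_interval box_Int_box split: prod.splits)
  have "?G \<subseteq> Pow UNIV" by simp
  from stable this A show "(LINT x:A|lborel. g x) = 0"
  proof (induction A rule: sigma_sets_induct_disjoint)
    case (basic A)
    then show ?case using box0 by auto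
  next
    case empty
    then show ?case by (simp add: set_lebesgue_integral_def)
  next
    case (compl A)
    then have A: "A \<in> sets borel" by (simp add: borel_eq_box)
    have "(LINT x:A \<union> (UNIV - A)|lborel. g x) = (LINT x:A|lborel. g x) + (LINT x:UNIV - A|lborel. g x)"
      using A by (intro set_integral_Un si) auto
    then show ?case using compl tot by (simp add: set_lebesgue_integral_def)
  next
    case (union A)
    then have A: "A i \<in> sets borel" for i by (auto simp: borel_eq_box)
    have "(LINT x:(\<Union>i. A i)|lborel. g x) = (\<Sum>i. (LINT x:A i|lborel. g x))"
      using A union(1) by (intro lebesgue_integral_countable_add si) (auto simp: disjoint_family_on_def)
    then show ?case using union by simp
  qed
qed

text \<open>The fundamental lemma of the calculus of variations, localised to the closed boxes in \<open>U\<close>. On each of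
  them \<open>h\<close> is cut off and replaced by a Borel function.\<close>

lemma AE_zero_of_box_integrals:
  fixes h :: "'a::euclidean_space \<Rightarrow> real"
  assumes U: "open U"
    and int: "\<And>a b. cbox a b \<subseteq> U \<Longrightarrow> set_integrable lebesgue (cbox a b) h"
    and zero: "\<And>a b. cbox a b \<subseteq> U \<Longrightarrow> (LINT x:box a b|lebesgue. h x) = 0"
  shows "AE x in lebesgue. x \<in> U \<longrightarrow> h x = 0"
proof -
  have one: "AE x in lebesgue. x \<in> cbox a b \<longrightarrow> h x = 0" if ab: "cbox a b \<subseteq> U" for a b
  proof -
    define g where "g x = indicator (box a b) x *\<^sub>R h x" for x
    have "set_integrable lebesgue (box a b) h" 
      by (rule set_integrable_subset[OF int[OF ab]]) (auto simp: box_subset_cbox)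
    then have g: "integrable lebesgue g" by (simp add: g_def[abs_def] set_integrable_def)
    obtain g' where g': "g' \<in> borel_measurable lborel" "AE x in lborel. g x = g' x"
      using completion_ex_borel_measurable_real[OF borel_measurable_integrable[OF g]] by auto
    have ae: "AE x in lebesgue. g x = g' x" by (rule AE_completion[OF g'(2)])
    have g'm: "g' \<in> borel_measurable lebesgue" using g'(1) by (rule measurable_completion)
    have "integrable lebesgue g'" using g integrable_cong_AE[OF borel_measurable_integrable[OF g] g'm ae] by simp
    then have g'i: "integrable lborel g'" using g'(1) by (simp add: integrable_completion)
    have eq: "(LINT x:A|lborel. g' x) = (LINT x:A|lebesgue. g x)" if A: "A \<in> sets borel" for A
    proof -
      have "(LINT x:A|lborel. g' x) = (LINT x:A|lebesgue. g' x)"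
        unfolding set_lebesgue_integral_def using A g' by (intro integral_completion[symmetric]) auto
      also have "\<dots> = (LINT x:A|lebesgue. g x)"
        unfolding set_lebesgue_integral_def 
        using ae A g'm borel_measurable_integrable[OF g]
        by (intro integral_cong_AE borel_measurable_scaleR borel_measurable_indicator) auto
      finally show ?thesis .
    qed
    have "(LINT x|lborel. g' x) = (LINT x:UNIV|lborel. g' x)" by (simp add: set_lebesgue_integral_def)
    also have "\<dots> = (LINT x:box a b|lebesgue. h x)" by (subst eq) (simp_all add: g_def set_lebesgue_integral_def)
    finally have tot: "(LINT x|lborel. g' x) = 0" using zero[OF ab] by simp
    have bx: "(LINT x:box c d|lborel. g' x) = 0" for c d
    proof -
      obtain p q where pq: "box c d \<inter> box a b = box p q" by (rule that) (rule box_Int_box)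
      show ?thesis
      proof (cases "box p q = {}")
        case True
        then have "indicator (box c d) x *\<^sub>R g x = 0" for x
          using pq by (cases "x \<in> box c d \<inter> box a b") (auto simp: g_def indicator_def)
        then have "(\<lambda>x. indicator (box c d) x *\<^sub>R g x) = (\<lambda>_. 0)" by (rule ext)
        then show ?thesis by (subst eq) (simp_all add: set_lebesgue_integral_def del: real_scaleR_def)
      next
        case False
        have "cbox p q = closure (box p q)" using False by simp
        also have "\<dots> \<subseteq> closure (box a b)" using pq by (intro closure_mono) auto
        also have "\<dots> \<subseteq> cbox a b" by (rule closure_minimal[OF box_subset_cbox closed_cbox])
        finally have "cbox p q \<subseteq> U" using ab by simp
        moreover have "indicator (box c d) x *\<^sub>R g x = indicator (box p q) x *\<^sub>R h x" for x
          unfolding pq[symmetric] by (auto simp: g_def indicator_def)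
        ultimately show ?thesis using zero[of p q] by (subst eq) (simp_all add: set_lebesgue_integral_def)
      qed
    qed
    have "AE x in lborel. g' x = 0" by (rule AE_zero_of_box_integrals_borel[OF g'i tot bx])
    then have "AE x in lebesgue. g' x = 0" by (rule AE_completion)
    moreover have "AE x in lebesgue. x \<notin> cbox a b - box a b"
      by (rule AE_not_in) (use negligible_frontier_interval[of a b] in \<open>simp add: negligible_iff_null_sets\<close>)
    ultimately show ?thesis using ae by eventually_elim (auto simp: g_def)
  qed
  obtain \<D> where D: "countable \<D>" "\<D> \<subseteq> Pow U" "\<And>X. X \<in> \<D> \<Longrightarrow> \<exists>a b. X = cbox a b" "\<Union>\<D> = U"
    using open_countable_Union_open_cbox[OF U] by metis
  have "AE x in lebesgue. \<forall>X\<in>\<D>. x \<in> X \<longrightarrow> h x = 0"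
  proof (rule AE_ball_countable'[OF _ D(1)])
    fix X assume "X \<in> \<D>"
    then obtain a b where "X = cbox a b" "cbox a b \<subseteq> U" using D by fastforce
    then show "AE x in lebesgue. x \<in> X \<longrightarrow> h x = 0" using one by simp
  qed
  then show ?thesis by eventually_elim (use D(4) in blast)
qed

lemma integral_le_nn_integral: "ennreal (LINT x|M. f x) \<le> (\<integral>\<^sup>+x. ennreal (f x) \<partial>M)" for f :: "'a \<Rightarrow> real"
proof (cases "integrable M f")
  case True
  have "(LINT x|M. f x) \<le> (LINT x|M. max (f x) 0)" using True by (intro integral_mono) auto
  then have "ennreal (LINT x|M. f x) \<le> ennreal (LINT x|M. max (f x) 0)" by (rule ennreal_leI)
  also have "\<dots> = (\<integral>\<^sup>+x. ennreal (max (f x) 0) \<partial>M)"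
    using True by (intro nn_integral_eq_integral[symmetric]) auto
  also have "\<dots> = (\<integral>\<^sup>+x. ennreal (f x) \<partial>M)" by (intro nn_integral_cong) (auto simp: max_def ennreal_neg)
  finally show ?thesis .
qed (simp add: not_integrable_integral_eq)

lemma nn_integral_affine:
  fixes f :: "'a::euclidean_space \<Rightarrow> ennreal"
  assumes [measurable]: "f \<in> borel_measurable borel" and c: "c \<noteq> 0"
  shows "(\<integral>\<^sup>+x. f x \<partial>lborel) = ennreal (\<bar>c\<bar> ^ DIM('a)) * (\<integral>\<^sup>+x. f (t + c *\<^sub>R x) \<partial>lborel)"
  by (subst lborel_affine[OF c, of t])
    (simp add: nn_integral_density nn_integral_distr nn_integral_cmult)

text \<open>The lower bound for the scaling factor makes the constant independent of it.\<close>

lemma nn_integral_affine_le: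
  fixes f :: "'a::euclidean_space \<Rightarrow> ennreal"
  assumes f: "f \<in> borel_measurable borel" and c: "c \<ge> 1 / 2"
  shows "(\<integral>\<^sup>+x. f (t + c *\<^sub>R x) \<partial>lborel) \<le> ennreal (2 ^ DIM('a)) * (\<integral>\<^sup>+x. f x \<partial>lborel)"
proof -
  have "1 \<le> (2 * \<bar>c\<bar>) ^ DIM('a)" using c by (intro one_le_power) simp
  then have "(1::ennreal) \<le> ennreal (2 ^ DIM('a)) * ennreal (\<bar>c\<bar> ^ DIM('a))"
    by (simp add: ennreal_mult[symmetric] power_mult_distrib del: ennreal_1 add: ennreal_1[symmetric])
  then have "1 * (\<integral>\<^sup>+x. f (t + c *\<^sub>R x) \<partial>lborel) \<le> ennreal (2 ^ DIM('a)) * ennreal (\<bar>c\<bar> ^ DIM('a)) * (\<integral>\<^sup>+x. f (t + c *\<^sub>R x) \<partial>lborel)"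
    by (rule mult_right_mono) simp
  also have "\<dots> = ennreal (2 ^ DIM('a)) * (\<integral>\<^sup>+x. f x \<partial>lborel)"
    using c by (subst nn_integral_affine[OF f, of c t]) (auto simp: mult.assoc)
  finally show ?thesis by simp
qed

text \<open>Averaging over segments: at each time \<open>t\<close> one of the two end points of a segment moves the point
  at time \<open>t\<close> with speed at least one half, and it is this end point that is integrated first.\<close>

lemma segment_average_le:
  fixes N :: "'a::euclidean_space \<Rightarrow> ennreal" and K :: "'a set"
  assumes N[measurable]: "N \<in> borel_measurable borel" and K[measurable]: "K \<in> sets borel"
  shows "(\<integral>\<^sup>+x. \<integral>\<^sup>+y. (\<integral>\<^sup>+t. indicator K x * indicator K y * indicator {0..1::real} t * N (y + t *\<^sub>R (x - y)) \<partial>lborel) \<partial>lborel \<partial>lborel)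
    \<le> ennreal (2 ^ DIM('a)) * emeasure lborel K * (\<integral>\<^sup>+z. N z \<partial>lborel)" (is "?L \<le> ?C")
proof -
  let ?f = "\<lambda>x y t. indicator K x * indicator K y * indicator {0..1::real} t * N (y + t *\<^sub>R (x - y))"
  have sw: "y + t *\<^sub>R (x - y) = t *\<^sub>R x + (1 - t) *\<^sub>R y" for x y :: 'a and t :: real by (simp add: algebra_simps)
  have yt: "(\<integral>\<^sup>+y. \<integral>\<^sup>+t. ?f x y t \<partial>lborel \<partial>lborel) = (\<integral>\<^sup>+t. \<integral>\<^sup>+y. ?f x y t \<partial>lborel \<partial>lborel)" for x
    by (rule lborel_pair.Fubini'[symmetric]) measurable
  have xt: "(\<integral>\<^sup>+x. \<integral>\<^sup>+t. \<integral>\<^sup>+y. ?f x y t \<partial>lborel \<partial>lborel \<partial>lborel) = (\<integral>\<^sup>+t. \<integral>\<^sup>+x. \<integral>\<^sup>+y. ?f x y t \<partial>lborel \<partial>lborel \<partial>lborel)"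
    by (rule lborel_pair.Fubini'[symmetric]) measurable
  have xy: "(\<integral>\<^sup>+x. \<integral>\<^sup>+y. ?f x y t \<partial>lborel \<partial>lborel) = (\<integral>\<^sup>+y. \<integral>\<^sup>+x. ?f x y t \<partial>lborel \<partial>lborel)" for t
    by (rule lborel_pair.Fubini'[symmetric]) measurable
  have outer: "(\<integral>\<^sup>+x. indicator K x * D \<partial>lborel) = emeasure lborel K * D" if "K \<in> sets borel" for D :: ennreal and K :: "'a set"
    using that by (simp add: nn_integral_multc)
  have t_bound: "(\<integral>\<^sup>+x. \<integral>\<^sup>+y. ?f x y t \<partial>lborel \<partial>lborel) \<le> ?C * indicator {0..1} t" for t
  proof (cases "t \<in> {0..1}")
    case True
    show ?thesis
    proof (cases "t \<le> 1 / 2")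
      case t: True
      have "(\<integral>\<^sup>+y. ?f x y t \<partial>lborel) \<le> indicator K x * (ennreal (2 ^ DIM('a)) * (\<integral>\<^sup>+z. N z \<partial>lborel))" for x
      proof -
        have "(\<integral>\<^sup>+y. ?f x y t \<partial>lborel) \<le> (\<integral>\<^sup>+y. indicator K x * N (t *\<^sub>R x + (1 - t) *\<^sub>R y) \<partial>lborel)"
          by (intro nn_integral_mono) (auto simp: indicator_def sw)
        also have "\<dots> = indicator K x * (\<integral>\<^sup>+y. N (t *\<^sub>R x + (1 - t) *\<^sub>R y) \<partial>lborel)"
          by (rule nn_integral_cmult) measurable
        also have "\<dots> \<le> indicator K x * (ennreal (2 ^ DIM('a)) * (\<integral>\<^sup>+z. N z \<partial>lborel))"
          using t by (intro mult_left_mono nn_integral_affine_le[OF N]) auto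
        finally show ?thesis .
      qed
      then have "(\<integral>\<^sup>+x. \<integral>\<^sup>+y. ?f x y t \<partial>lborel \<partial>lborel) \<le> (\<integral>\<^sup>+x. indicator K x * (ennreal (2 ^ DIM('a)) * (\<integral>\<^sup>+z. N z \<partial>lborel)) \<partial>lborel)"
        by (rule nn_integral_mono)
      also have "\<dots> = ?C" unfolding outer[OF K] by (simp add: mult_ac)
      finally show ?thesis using True by simp
    next
      case t: False
      have "(\<integral>\<^sup>+x. ?f x y t \<partial>lborel) \<le> indicator K y * (ennreal (2 ^ DIM('a)) * (\<integral>\<^sup>+z. N z \<partial>lborel))" for y
      proof -
        have "(\<integral>\<^sup>+x. ?f x y t \<partial>lborel) \<le> (\<integral>\<^sup>+x. indicator K y * N ((1 - t) *\<^sub>R y + t *\<^sub>R x) \<partial>lborel)"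
          by (intro nn_integral_mono) (auto simp: indicator_def sw add.commute)
        also have "\<dots> = indicator K y * (\<integral>\<^sup>+x. N ((1 - t) *\<^sub>R y + t *\<^sub>R x) \<partial>lborel)"
          by (rule nn_integral_cmult) measurable
        also have "\<dots> \<le> indicator K y * (ennreal (2 ^ DIM('a)) * (\<integral>\<^sup>+z. N z \<partial>lborel))"
          using t by (intro mult_left_mono nn_integral_affine_le[OF N]) auto
        finally show ?thesis .
      qed
      then have "(\<integral>\<^sup>+y. \<integral>\<^sup>+x. ?f x y t \<partial>lborel \<partial>lborel) \<le> (\<integral>\<^sup>+y. indicator K y * (ennreal (2 ^ DIM('a)) * (\<integral>\<^sup>+z. N z \<partial>lborel)) \<partial>lborel)"
        by (rule nn_integral_mono)
      also have "\<dots> = ?C" unfolding outer[OF K] by (simp add: mult_ac)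
      finally show ?thesis unfolding xy using True by simp
    qed
  qed simp
  have "?L = (\<integral>\<^sup>+t. \<integral>\<^sup>+x. \<integral>\<^sup>+y. ?f x y t \<partial>lborel \<partial>lborel \<partial>lborel)" unfolding yt xt ..
  also have "\<dots> \<le> (\<integral>\<^sup>+t. ?C * indicator {0..1::real} t \<partial>lborel)" by (intro nn_integral_mono t_bound)
  also have "\<dots> = ?C * emeasure lborel {0..1::real}" by (rule nn_integral_cmult_indicator) simp
  also have "\<dots> = ?C" by simp
  finally show ?thesis .
qed

text \<open>The difference is the mean of the derivative along the segment, and the square of a mean is at most
  the mean of the squares.\<close>

lemma difference_square_le:
  fixes w :: "'a::euclidean_space \<Rightarrow> real"
  assumes U: "open U" and K: "convex K" "K \<subseteq> U"
    and diff: "\<And>x. x \<in> U \<Longrightarrow> w differentiable (at x)"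
    and cont: "\<And>b. continuous_on U (\<lambda>x. frechet_derivative w (at x) b)"
    and xy: "x \<in> K" "y \<in> K" and \<delta>: "norm (x - y) \<le> \<delta>"
  shows "ennreal ((w x - w y)\<^sup>2) \<le> ennreal (\<delta>\<^sup>2) * (\<integral>\<^sup>+t. indicator {0..1::real} t * 
    ennreal (\<Sum>b\<in>Basis. (frechet_derivative w (at (y + t *\<^sub>R (x - y))) b)\<^sup>2) \<partial>lborel)"
proof -
  define \<gamma> where "\<gamma> t = y + t *\<^sub>R (x - y)" for t :: real
  define N where "N z = (\<Sum>b\<in>Basis. (frechet_derivative w (at z) b)\<^sup>2)" for z
  define d where "d t = frechet_derivative w (at (\<gamma> t)) (x - y)" for t
  have \<gamma>: "\<gamma> t \<in> U" if "t \<in> {0..1}" for t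
  proof -
    have "\<gamma> t = (1 - t) *\<^sub>R y + t *\<^sub>R x" by (simp add: \<gamma>_def algebra_simps)
    then show ?thesis using convexD[OF K(1) xy(2,1), of "1 - t" t] that K(2) by auto
  qed
  have \<gamma>c: "continuous_on {0..1} \<gamma>" unfolding \<gamma>_def by (intro continuous_intros)
  have dc: "continuous_on {0..1} d" unfolding d_def
    by (rule continuous_on_compose2[OF cont \<gamma>c]) (use \<gamma> in auto)
  have Nc: "continuous_on {0..1} (\<lambda>t. N (\<gamma> t))" unfolding N_def
    by (intro continuous_on_sum continuous_on_power continuous_on_compose2[OF cont \<gamma>c]) (use \<gamma> in auto)
  have der: "((\<lambda>t. w (\<gamma> t)) has_vector_derivative d t) (at t within {0..1})" if t: "t \<in> {0..1}" for t
  proof -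
    have 1: "(\<gamma> has_derivative (\<lambda>h. h *\<^sub>R (x - y))) (at t)" unfolding \<gamma>_def by (auto intro!: derivative_eq_intros)
    have 2: "(w has_derivative frechet_derivative w (at (\<gamma> t))) (at (\<gamma> t))"
      using diff[OF \<gamma>[OF t]] frechet_derivative_works by blast
    have lin: "linear (frechet_derivative w (at (\<gamma> t)))" by (rule linear_frechet_derivative[OF diff[OF \<gamma>[OF t]]])
    have "((\<lambda>t. w (\<gamma> t)) has_derivative (\<lambda>h. h *\<^sub>R d t)) (at t)"
      using diff_chain_at[OF 1 2] by (simp add: o_def linear_cmul[OF lin] d_def)
    then show ?thesis by (simp add: has_vector_derivative_def has_derivative_at_withinI)
  qed
  have ftc: "(d has_integral (w x - w y)) {0..1}"
    using fundamental_theorem_of_calculus[of 0 1 "\<lambda>t. w (\<gamma> t)" d] der by (simp add: \<gamma>_def)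
  define c where "c = w x - w y"
  have d2: "(\<lambda>t. (d t)\<^sup>2) integrable_on {0..1}" by (intro integrable_continuous_real continuous_intros dc)
  \<comment> \<open>The variance of \<open>d\<close> is nonnegative.\<close>
  have "((\<lambda>t. (d t)\<^sup>2 - 2 * c * d t + c\<^sup>2) has_integral (integral {0..1} (\<lambda>t. (d t)\<^sup>2) - 2 * c * c + c\<^sup>2)) {0..1}"
    using has_integral_add[OF has_integral_diff[OF integrable_integral[OF d2] has_integral_mult_right[OF ftc, of "2 * c"]] has_integral_const_real[of "c\<^sup>2" 0 1]]
    by (simp add: c_def)
  moreover have "0 \<le> (d t)\<^sup>2 - 2 * c * d t + c\<^sup>2" for t using zero_le_power2[of "d t - c"] by (simp add: power2_diff algebra_simps)
  ultimately have "0 \<le> integral {0..1} (\<lambda>t. (d t)\<^sup>2) - 2 * c * c + c\<^sup>2" by (rule has_integral_nonneg)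
  then have c2: "c\<^sup>2 \<le> integral {0..1} (\<lambda>t. (d t)\<^sup>2)" by (simp add: power2_eq_square)
  have Ni: "(\<lambda>t. N (\<gamma> t)) integrable_on {0..1}" by (intro integrable_continuous_real Nc)
  have d_le: "(d t)\<^sup>2 \<le> \<delta>\<^sup>2 * N (\<gamma> t)" if t: "t \<in> {0..1}" for t
  proof -
    let ?D = "frechet_derivative w (at (\<gamma> t))"
    have lin: "linear ?D" by (rule linear_frechet_derivative[OF diff[OF \<gamma>[OF t]]])
    have "d t = ?D (\<Sum>b\<in>Basis. ((x - y) \<bullet> b) *\<^sub>R b)" by (simp only: d_def euclidean_representation)
    also have "\<dots> = (\<Sum>b\<in>Basis. ((x - y) \<bullet> b) * ?D b)" by (simp add: linear_sum[OF lin] linear_cmul[OF lin])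
    finally have "(d t)\<^sup>2 = (\<Sum>b\<in>Basis. ((x - y) \<bullet> b) * ?D b)\<^sup>2" by simp
    also have "\<dots> \<le> (\<Sum>b\<in>Basis. ((x - y) \<bullet> b)\<^sup>2) * (\<Sum>b\<in>Basis. (?D b)\<^sup>2)" by (rule Cauchy_Schwarz_ineq_sum)
    also have "(\<Sum>b\<in>Basis. ((x - y) \<bullet> b)\<^sup>2) = (norm (x - y))\<^sup>2" 
      by (simp add: norm_eq_sqrt_inner euclidean_inner[of "x - y" "x - y"] power2_eq_square sum_nonneg)
    also have "\<dots> * (\<Sum>b\<in>Basis. (?D b)\<^sup>2) \<le> \<delta>\<^sup>2 * N (\<gamma> t)"
      unfolding N_def using \<delta> by (intro mult_right_mono power_mono sum_nonneg) auto
    finally show ?thesis .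
  qed
  have "c\<^sup>2 \<le> integral {0..1} (\<lambda>t. \<delta>\<^sup>2 * N (\<gamma> t))"
  proof -
    have "(\<lambda>t. \<delta>\<^sup>2 * N (\<gamma> t)) integrable_on {0..1}" by (intro integrable_continuous_real continuous_intros Nc)
    from integral_le[OF d2 this d_le] show ?thesis using c2 by linarith
  qed
  also have "\<dots> = \<delta>\<^sup>2 * integral {0..1} (\<lambda>t. N (\<gamma> t))" by simp
  finally have "ennreal (c\<^sup>2) \<le> ennreal (\<delta>\<^sup>2 * integral {0..1} (\<lambda>t. N (\<gamma> t)))" by (rule ennreal_leI)
  also have "\<dots> = ennreal (\<delta>\<^sup>2) * ennreal (integral {0..1} (\<lambda>t. N (\<gamma> t)))" by (simp add: ennreal_mult')
  also have "ennreal (integral {0..1} (\<lambda>t. N (\<gamma> t))) = (\<integral>\<^sup>+t. ennreal (N (\<gamma> t)) * indicator {0..1} t \<partial>lborel)"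
    by (rule nn_integral_has_integral_lebesgue'[symmetric, OF _ integrable_integral[OF Ni]]) (auto simp: N_def sum_nonneg)
  finally show ?thesis by (simp add: c_def \<gamma>_def N_def mult.commute)
qed

text \<open>The Poincare inequality on a convex set, with the mean value as a rank one correction: the double
  integral of \<open>(w x - w y)\<^sup>2\<close> over \<open>K\<close> is \<open>2 |K| \<integral> w\<^sup>2 - 2 (\<integral> w)\<^sup>2\<close>, and it is bounded by averaging the
  square of the gradient over all segments.\<close>

lemma poincare_convex:
  fixes w :: "'a::euclidean_space \<Rightarrow> real"
  assumes U: "open U" and K: "compact K" "convex K" "K \<subseteq> U"
    and diff: "\<And>x. x \<in> U \<Longrightarrow> w differentiable (at x)"
    and cont: "\<And>b. continuous_on U (\<lambda>x. frechet_derivative w (at x) b)"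
    and \<delta>: "\<And>x y. x \<in> K \<Longrightarrow> y \<in> K \<Longrightarrow> norm (x - y) \<le> \<delta>"
  shows "measure lborel K * (LINT x:K|lborel. (w x)\<^sup>2) \<le> 
    2 ^ DIM('a) * \<delta>\<^sup>2 * measure lborel K * (LINT x:K|lborel. (\<Sum>b\<in>Basis. (frechet_derivative w (at x) b)\<^sup>2))
    + (LINT x:K|lborel. w x)\<^sup>2"
proof -
  define N where "N z = (\<Sum>b\<in>Basis. (frechet_derivative w (at z) b)\<^sup>2)" for z
  define k where "k = measure lborel K"
  define I1 where "I1 = (LINT x:K|lborel. w x)"
  define I2 where "I2 = (LINT x:K|lborel. (w x)\<^sup>2)"
  define IN where "IN = (LINT x:K|lborel. N x)"
  have Kb: "K \<in> sets borel" using K(1) by (simp add: compact_imp_closed)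
  have kK: "emeasure lborel K = ennreal k" unfolding k_def
    using K(1) emeasure_compact_finite by (intro emeasure_eq_ennreal_measure) (auto simp: less_top)
  have wc: "continuous_on K w" using diff K(3) 
    by (intro continuous_at_imp_continuous_on ballI differentiable_imp_continuous_within) auto
  have Nc: "continuous_on K N" unfolding N_def using K(3)
    by (intro continuous_on_sum continuous_on_power continuous_on_subset[OF cont]) auto
  have i1: "integrable lborel (\<lambda>x. indicator K x * w x)" using borel_integrable_compact[OF K(1) wc] by simp
  have i2: "integrable lborel (\<lambda>x. indicator K x * (w x)\<^sup>2)" 
    using borel_integrable_compact[OF K(1), of "\<lambda>x. (w x)\<^sup>2"] wc by (simp add: continuous_intros)
  have iN: "integrable lborel (\<lambda>x. indicator K x * N x)" using borel_integrable_compact[OF K(1) Nc] by simp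
  have iK: "integrable lborel (\<lambda>x. indicator K x :: real)" using Kb kK by simp
  have L1: "(LINT x|lborel. indicator K x * w x) = I1" "(LINT x|lborel. indicator K x * (w x)\<^sup>2) = I2" "(LINT x|lborel. indicator K x * N x) = IN"
    "(LINT x|lborel. indicator K x) = k"
    unfolding I1_def I2_def IN_def k_def set_lebesgue_integral_def using Kb by simp_all
  have Nm: "(\<lambda>z. ennreal (indicator K z * N z)) \<in> borel_measurable borel" using iN by simp
  have inner_eq: "(\<integral>\<^sup>+y. ennreal (indicator K x * (indicator K y * (w x - w y)\<^sup>2)) \<partial>lborel) = ennreal (indicator K x * (k * (w x)\<^sup>2 - 2 * w x * I1 + I2))" for x
  proof -
    have e: "(\<lambda>y. indicator K x * (indicator K y * (w x - w y)\<^sup>2)) = 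
      (\<lambda>y. indicator K x * ((w x)\<^sup>2 * indicator K y - 2 * w x * (indicator K y * w y) + indicator K y * (w y)\<^sup>2))"
      by (auto simp: fun_eq_iff indicator_def power2_diff algebra_simps)
    have int: "integrable lborel (\<lambda>y. indicator K x * (indicator K y * (w x - w y)\<^sup>2))"
      unfolding e by (intro integrable_mult_right Bochner_Integration.integrable_add Bochner_Integration.integrable_diff i1 i2 iK)
    have "(LINT y|lborel. indicator K x * (indicator K y * (w x - w y)\<^sup>2)) = indicator K x * ((w x)\<^sup>2 * k - 2 * w x * I1 + I2)"
      unfolding e using i1 i2 iK by (simp add: L1 k_def)
    moreover have "AE y in lborel. 0 \<le> indicator K x * (indicator K y * (w x - w y)\<^sup>2)" by simp
    ultimately show ?thesis using nn_integral_eq_integral[OF int] by (simp only: mult.commute[of _ k])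
  qed
  have f2: "(\<lambda>x. indicator K x * (k * (w x)\<^sup>2 - 2 * w x * I1 + I2)) = 
      (\<lambda>x. k * (indicator K x * (w x)\<^sup>2) - 2 * I1 * (indicator K x * w x) + I2 * indicator K x)"
    by (auto simp: fun_eq_iff indicator_def algebra_simps)
  have int2: "integrable lborel (\<lambda>x. indicator K x * (k * (w x)\<^sup>2 - 2 * w x * I1 + I2))"
    unfolding f2 by (intro integrable_mult_right Bochner_Integration.integrable_add Bochner_Integration.integrable_diff i1 i2 iK)
  have int2_eq: "(LINT x|lborel. indicator K x * (k * (w x)\<^sup>2 - 2 * w x * I1 + I2)) = k * I2 - 2 * I1 * I1 + I2 * k"
    unfolding f2 using i1 i2 iK by (simp add: L1 k_def)
  have "ennreal (k * I2 - 2 * I1 * I1 + I2 * k) \<le> (\<integral>\<^sup>+x. ennreal (indicator K x * (k * (w x)\<^sup>2 - 2 * w x * I1 + I2)) \<partial>lborel)"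
    unfolding int2_eq[symmetric] by (rule integral_le_nn_integral)
  also have "\<dots> = (\<integral>\<^sup>+x. \<integral>\<^sup>+y. ennreal (indicator K x * (indicator K y * (w x - w y)\<^sup>2)) \<partial>lborel \<partial>lborel)"
    unfolding inner_eq ..
  also have "\<dots> \<le> (\<integral>\<^sup>+x. \<integral>\<^sup>+y. ennreal (\<delta>\<^sup>2) * (\<integral>\<^sup>+t. indicator K x * indicator K y * indicator {0..1::real} t * 
      ennreal (indicator K (y + t *\<^sub>R (x - y)) * N (y + t *\<^sub>R (x - y))) \<partial>lborel) \<partial>lborel \<partial>lborel)"
  proof (intro nn_integral_mono)
    fix x y :: 'a
    show "ennreal (indicator K x * (indicator K y * (w x - w y)\<^sup>2)) \<le> ennreal (\<delta>\<^sup>2) * (\<integral>\<^sup>+t. indicator K x * indicator K y * indicator {0..1::real} t * 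
      ennreal (indicator K (y + t *\<^sub>R (x - y)) * N (y + t *\<^sub>R (x - y))) \<partial>lborel)"
    proof (cases "x \<in> K \<and> y \<in> K")
      case True
      have "y + t *\<^sub>R (x - y) \<in> K" if "t \<in> {0..1}" for t
      proof -
        have "y + t *\<^sub>R (x - y) = (1 - t) *\<^sub>R y + t *\<^sub>R x" by (simp add: algebra_simps)
        then show ?thesis using convexD[OF K(2), of y x "1 - t" t] True that by auto
      qed
      then have "(\<integral>\<^sup>+t. indicator K x * indicator K y * indicator {0..1::real} t * ennreal (indicator K (y + t *\<^sub>R (x - y)) * N (y + t *\<^sub>R (x - y))) \<partial>lborel)
        = (\<integral>\<^sup>+t. indicator {0..1::real} t * ennreal (N (y + t *\<^sub>R (x - y))) \<partial>lborel)"
        using True by (intro nn_integral_cong) (auto simp: indicator_def)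
      then show ?thesis using True difference_square_le[OF U K(2,3) diff cont, of x y \<delta>] \<delta>[of x y] by (simp add: N_def)
    qed auto
  qed
  also have "\<dots> = ennreal (\<delta>\<^sup>2) * (\<integral>\<^sup>+x. \<integral>\<^sup>+y. (\<integral>\<^sup>+t. indicator K x * indicator K y * indicator {0..1::real} t * 
      ennreal (indicator K (y + t *\<^sub>R (x - y)) * N (y + t *\<^sub>R (x - y))) \<partial>lborel) \<partial>lborel \<partial>lborel)"
    using Kb Nm by (simp add: nn_integral_cmult)
  also have "\<dots> \<le> ennreal (\<delta>\<^sup>2) * (ennreal (2 ^ DIM('a)) * emeasure lborel K * (\<integral>\<^sup>+z. ennreal (indicator K z * N z) \<partial>lborel))"
    by (intro mult_left_mono segment_average_le[OF Nm Kb]) simp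
  also have "(\<integral>\<^sup>+z. ennreal (indicator K z * N z) \<partial>lborel) = ennreal IN"
    unfolding L1(3)[symmetric] by (rule nn_integral_eq_integral[OF iN]) (simp add: N_def sum_nonneg)
  also have "ennreal (\<delta>\<^sup>2) * (ennreal (2 ^ DIM('a)) * emeasure lborel K * ennreal IN) = ennreal (\<delta>\<^sup>2 * (2 ^ DIM('a) * k * IN))"
    unfolding kK by (simp add: ennreal_mult' k_def)
  finally have "k * I2 - 2 * I1 * I1 + I2 * k \<le> \<delta>\<^sup>2 * (2 ^ DIM('a) * k * IN)"
  proof (subst (asm) ennreal_le_iff)
    have "0 \<le> IN" unfolding L1(3)[symmetric] N_def by (intro Bochner_Integration.integral_nonneg mult_nonneg_nonneg sum_nonneg) auto
    then show "0 \<le> \<delta>\<^sup>2 * (2 ^ DIM('a) * k * IN)" by (simp add: k_def)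
  qed
  moreover have "0 \<le> \<delta>\<^sup>2 * (2 ^ DIM('a) * k * IN)"
  proof -
    have "0 \<le> IN" unfolding L1(3)[symmetric] N_def by (intro Bochner_Integration.integral_nonneg mult_nonneg_nonneg sum_nonneg) auto
    then show ?thesis by (simp add: k_def)
  qed
  ultimately have "k * I2 \<le> 2 ^ DIM('a) * \<delta>\<^sup>2 * k * IN + I1\<^sup>2" by (simp add: power2_eq_square algebra_simps)
  then show ?thesis by (simp add: k_def I1_def I2_def IN_def N_def)
qed

section \<open>Charts and the metric in coordinates\<close>

lemma det_continuous_on:
  fixes F :: "'a::topological_space \<Rightarrow> real ^ 'n ^ 'n"
  assumes "\<And>i j. continuous_on S (\<lambda>x. F x $ i $ j)"
  shows "continuous_on S (\<lambda>x. det (F x))"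
  unfolding det_def by (intro continuous_intros assms)

text \<open>The matrices on the segment from the identity to \<open>G\<close> are all invertible, so the determinant cannot
  change its sign.\<close>

lemma det_pos_of_positive_definite:
  fixes G :: "real ^ 'n ^ 'n"
  assumes pos: "\<And>x. x \<noteq> 0 \<Longrightarrow> 0 < x \<bullet> (G *v x)"
  shows "0 < det G"
proof (rule ccontr)
  assume neg: "\<not> 0 < det G"
  define P where "P t = (1 - t) *\<^sub>R mat 1 + t *\<^sub>R G" for t :: real
  have nz: "det (P t) \<noteq> 0" if t: "0 \<le> t" "t \<le> 1" for t
  proof
    assume "det (P t) = 0"
    then have "\<not> inj ((*v) (P t))" using invertible_det_nz[of "P t"] invertible_left_inverse matrix_left_invertible_injective by metis
    then obtain x y where xy: "x \<noteq> y" "P t *v x = P t *v y" by (auto simp: inj_def)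
    define v where "v = x - y"
    have v: "v \<noteq> 0" "P t *v v = 0" using xy by (auto simp: v_def matrix_vector_mult_diff_distrib)
    have "0 = v \<bullet> (P t *v v)" using v by simp
    also have "\<dots> = (1 - t) * (v \<bullet> v) + t * (v \<bullet> (G *v v))"
      by (simp add: P_def matrix_vector_mult_add_rdistrib scaleR_matrix_vector_assoc[symmetric] inner_add_right)
    finally have "(1 - t) * (v \<bullet> v) + t * (v \<bullet> (G *v v)) = 0" by simp
    moreover have "0 < v \<bullet> v" "0 < v \<bullet> (G *v v)" using v pos by auto
    ultimately show False using t 
      by (metis add_nonneg_eq_0_iff diff_ge_0_iff_ge less_eq_real_def mult_eq_0_iff mult_nonneg_nonneg diff_zero less_irrefl zero_neq_one)
  qed
  have "continuous_on {0..1} (\<lambda>t. det (P t))"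
    by (rule det_continuous_on) (simp add: P_def, intro continuous_intros)
  moreover have "det (P 1) \<le> 0" "0 \<le> det (P 0)" using neg by (auto simp: P_def)
  ultimately obtain t where "0 \<le> t" "t \<le> 1" "det (P t) = 0"
    using IVT2'[of "\<lambda>t. det (P t)" 1 0 0] by auto
  then show False using nz by blast
qed

locale weighted_mfd =
  fixes M :: "('m::{t2_space,second_countable_topology}, 'n::finite) weighted_manifold"
  assumes wrm: "weighted_riemannian_manifold M"
begin

abbreviation "Atl \<equiv> atlas M"
abbreviation "g \<equiv> metric M"
abbreviation "\<mu> \<equiv> meas M"
abbreviation cod :: "('m, 'n) chart \<Rightarrow> (real ^ 'n) set" where "cod c \<equiv> snd c ` fst c"

lemma atlas: "smooth_atlas Atl" and riem: "riemannian_metric Atl g"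
  using wrm by (auto simp: weighted_riemannian_manifold_def)

lemma chart_cover: "\<exists>c\<in>Atl. x \<in> fst c"
  using atlas by (auto simp: smooth_atlas_def)

lemma chart_open: "c \<in> Atl \<Longrightarrow> open (fst c)" and cod_open: "c \<in> Atl \<Longrightarrow> open (cod c)"
  and chart_homeo: "c \<in> Atl \<Longrightarrow> homeomorphism (fst c) (cod c) (snd c) (chart_inv c)"
  and transition_smooth: "c \<in> Atl \<Longrightarrow> d \<in> Atl \<Longrightarrow> smooth_on (snd c ` (fst c \<inter> fst d)) (snd d \<circ> chart_inv c)"
  using atlas by (auto simp: smooth_atlas_def)

lemma inv_chart: "c \<in> Atl \<Longrightarrow> x \<in> fst c \<Longrightarrow> chart_inv c (snd c x) = x"
  using homeomorphism_apply1[OF chart_homeo] by blast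

lemma chart_inv: "c \<in> Atl \<Longrightarrow> y \<in> cod c \<Longrightarrow> snd c (chart_inv c y) = y"
  using homeomorphism_apply2[OF chart_homeo] by blast

lemma chart_inv_mem: "c \<in> Atl \<Longrightarrow> y \<in> cod c \<Longrightarrow> chart_inv c y \<in> fst c"
  using homeomorphism_image2[OF chart_homeo] by blast

lemma mem_chart_image: "c \<in> Atl \<Longrightarrow> y \<in> cod c \<Longrightarrow> y \<in> snd c ` (W \<inter> fst c) \<longleftrightarrow> chart_inv c y \<in> W"
  using chart_inv[of c y] chart_inv_mem[of c y] inv_chart[of c] by (auto 4 3 intro!: image_eqI[of _ "snd c" "chart_inv c y"])

lemma chart_cont: "c \<in> Atl \<Longrightarrow> continuous_on (fst c) (snd c)"
  and chart_inv_cont: "c \<in> Atl \<Longrightarrow> continuous_on (cod c) (chart_inv c)"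
  using homeomorphism_cont1[OF chart_homeo] homeomorphism_cont2[OF chart_homeo] by blast+

lemma open_chart_image: assumes c: "c \<in> Atl" and W: "open W" shows "open (snd c ` (W \<inter> fst c))"
proof -
  have "openin (top_of_set (fst c)) (W \<inter> fst c)" using W by (metis openin_open_Int inf_commute)
  then have "openin (top_of_set (cod c)) (snd c ` (W \<inter> fst c))"
    by (rule homeomorphism_imp_open_map[OF chart_homeo[OF c]])
  then show ?thesis using cod_open[OF c] by (auto simp: openin_open_eq)
qed

lemma open_chart_vimage: assumes c: "c \<in> Atl" and V: "open V" shows "open {x \<in> fst c. snd c x \<in> V}"
  using continuous_on_open_vimage[OF chart_open[OF c], of "snd c"] chart_cont[OF c] V
  by (auto simp: vimage_def Int_def conj_commute)

lemma chart_at: "chart_at Atl x \<in> Atl" "x \<in> fst (chart_at Atl x)"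
proof -
  have "\<exists>c. c \<in> Atl \<and> x \<in> fst c" using chart_cover[of x] by blast
  from someI_ex[OF this] show "chart_at Atl x \<in> Atl" "x \<in> fst (chart_at Atl x)"
    unfolding chart_at_def by blast+
qed

subsection \<open>Change of components\<close>

lemma transition_derivative: 
  assumes "c \<in> Atl" "d \<in> Atl" "x \<in> fst c" "x \<in> fst d"
  shows "((snd d \<circ> chart_inv c) has_derivative change_components c d x) (at (snd c x))"
proof -
  have "(snd d \<circ> chart_inv c) differentiable (at (snd c x))"
    by (rule smooth_on_differentiable[OF transition_smooth[OF assms(1,2)]]) (use assms in auto)
  then show ?thesis unfolding change_components_def[abs_def] by (simp add: frechet_derivative_works)
qed

lemma change_linear: "c \<in> Atl \<Longrightarrow> d \<in> Atl \<Longrightarrow> x \<in> fst c \<Longrightarrow> x \<in> fst d \<Longrightarrow> linear (change_components c d x)"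
  using transition_derivative has_derivative_linear by blast

text \<open>The chain rule for transition maps. It makes tensor components independent of the preferred charts.\<close>

lemma change_chain:
  assumes c: "c \<in> Atl" "d \<in> Atl" "e \<in> Atl" and x: "x \<in> fst c" "x \<in> fst d" "x \<in> fst e"
  shows "change_components d e x (change_components c d x v) = change_components c e x v"
proof -
  let ?S = "snd c ` (fst d \<inter> fst c)"
  have 1: "((snd d \<circ> chart_inv c) has_derivative change_components c d x) (at (snd c x))"
    by (rule transition_derivative) (use assms in auto)
  have "(snd d \<circ> chart_inv c) (snd c x) = snd d x" using inv_chart c x by simp
  then have 2: "((snd e \<circ> chart_inv d) has_derivative change_components d e x) (at ((snd d \<circ> chart_inv c) (snd c x)))"
    using transition_derivative[of d e x] assms by simp
  have "(((snd e \<circ> chart_inv d) \<circ> (snd d \<circ> chart_inv c)) has_derivative (change_components d e x \<circ> change_components c d x)) (at (snd c x))"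
    by (rule diff_chain_at[OF 1 2])
  then have "((snd e \<circ> chart_inv c) has_derivative (change_components d e x \<circ> change_components c d x)) (at (snd c x))"
  proof (rule has_derivative_transform_within_open)
    show "open ?S" by (rule open_chart_image[OF c(1) chart_open[OF c(2)]])
    show "snd c x \<in> ?S" using x by auto
    show "((snd e \<circ> chart_inv d) \<circ> (snd d \<circ> chart_inv c)) y = (snd e \<circ> chart_inv c) y" if "y \<in> ?S" for y
      using that inv_chart[OF c(1)] inv_chart[OF c(2)] by auto
  qed
  moreover have "((snd e \<circ> chart_inv c) has_derivative change_components c e x) (at (snd c x))"
    by (rule transition_derivative) (use assms in auto)
  ultimately have "change_components d e x \<circ> change_components c d x = change_components c e x"
    by (rule has_derivative_unique)
  then show ?thesis by (metis comp_apply)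
qed

lemma change_self: assumes c: "c \<in> Atl" "x \<in> fst c" shows "change_components c c x v = v"
proof -
  have "((\<lambda>y. y) has_derivative (\<lambda>v. v)) (at (snd c x))" by simp
  then have "((snd c \<circ> chart_inv c) has_derivative (\<lambda>v. v)) (at (snd c x))"
    by (rule has_derivative_transform_within_open[OF _ cod_open[OF c(1)]]) (use c chart_inv[OF c(1)] in auto)
  then show ?thesis using transition_derivative[OF c(1) c(1) c(2) c(2)] has_derivative_unique by metis
qed

abbreviation "tc c x \<equiv> to_chart Atl c x"
abbreviation "fc c x \<equiv> from_chart Atl c x"

lemma to_from: "c \<in> Atl \<Longrightarrow> x \<in> fst c \<Longrightarrow> tc c x (fc c x v) = v"
  by (simp add: to_chart_def from_chart_def change_chain chart_at change_self)

lemma from_to: "c \<in> Atl \<Longrightarrow> x \<in> fst c \<Longrightarrow> fc c x (tc c x v) = v"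
  by (simp add: to_chart_def from_chart_def change_chain chart_at change_self)

lemma tc_linear: "c \<in> Atl \<Longrightarrow> x \<in> fst c \<Longrightarrow> linear (tc c x)"
  unfolding to_chart_def[abs_def] by (intro change_linear chart_at)

lemma fc_linear: "c \<in> Atl \<Longrightarrow> x \<in> fst c \<Longrightarrow> linear (fc c x)"
  unfolding from_chart_def[abs_def] by (intro change_linear chart_at)

lemma fc_change: "c \<in> Atl \<Longrightarrow> d \<in> Atl \<Longrightarrow> x \<in> fst c \<Longrightarrow> x \<in> fst d \<Longrightarrow> fc d x (change_components c d x v) = fc c x v"
  by (simp add: from_chart_def change_chain chart_at)

lemma tc_change: "c \<in> Atl \<Longrightarrow> d \<in> Atl \<Longrightarrow> x \<in> fst c \<Longrightarrow> x \<in> fst d \<Longrightarrow> change_components c d x (tc c x v) = tc d x v"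
  by (simp add: to_chart_def change_chain chart_at)

subsection \<open>The metric\<close>

lemma g_bilinear: "bilinear (g x)" and g_sym: "g x v w = g x w v" and g_pos: "v \<noteq> 0 \<Longrightarrow> 0 < g x v v"
  using riem by (auto simp: riemannian_metric_def)

lemma g_add_left: "g x (u + v) w = g x u w + g x v w" and g_add_right: "g x w (u + v) = g x w u + g x w v"
  and g_scale_left: "g x (a *\<^sub>R u) w = a * g x u w" and g_scale_right: "g x w (a *\<^sub>R u) = a * g x w u"
  and g_diff_left: "g x (u - v) w = g x u w - g x v w" and g_diff_right: "g x w (u - v) = g x w u - g x w v"
  and g_zero_left: "g x 0 w = 0" and g_zero_right: "g x w 0 = 0"
  using g_bilinear[of x] 
  by (auto simp: bilinear_ladd bilinear_radd bilinear_lmul bilinear_rmul bilinear_lsub bilinear_rsub bilinear_lzero bilinear_rzero)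

lemmas g_bilin = g_add_left g_add_right g_scale_left g_scale_right g_diff_left g_diff_right g_zero_left g_zero_right

lemma g_nonneg: "0 \<le> g x v v" using g_pos[of v x] by (cases "v = 0") (auto simp: g_bilin)

lemma g_Cauchy_Schwarz: "(g x v w)\<^sup>2 \<le> g x v v * g x w w"
proof (cases "w = 0")
  case False
  then have p: "g x w w > 0" by (rule g_pos)
  have "0 \<le> g x (v - (g x v w / g x w w) *\<^sub>R w) (v - (g x v w / g x w w) *\<^sub>R w)" by (rule g_nonneg)
  also have "\<dots> = g x v v - (g x v w)\<^sup>2 / g x w w"
    using p g_sym[of x w v] by (simp add: g_bilin power2_eq_square field_simps)
  finally show ?thesis using p by (simp add: field_simps)
qed (simp add: g_bilin)

lemma g_sum_left: "g x (\<Sum>i\<in>I. f i) w = (\<Sum>i\<in>I. g x (f i) w)"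
  by (induction I rule: infinite_finite_induct) (auto simp: g_bilin)

lemma g_sum_right: "g x w (\<Sum>i\<in>I. f i) = (\<Sum>i\<in>I. g x w (f i))"
  by (induction I rule: infinite_finite_induct) (auto simp: g_bilin)

text \<open>The coefficients of the metric in a chart, as functions of the coordinates.\<close>

definition G :: "('m, 'n) chart \<Rightarrow> real ^ 'n \<Rightarrow> real ^ 'n \<Rightarrow> real ^ 'n \<Rightarrow> real" where
  "G c y v w = g (chart_inv c y) (fc c (chart_inv c y) v) (fc c (chart_inv c y) w)"

lemma G_smooth: "c \<in> Atl \<Longrightarrow> smooth_on (cod c) (\<lambda>y. G c y v w)"
  using riem by (auto simp: riemannian_metric_def G_def)

lemma G_cont: "c \<in> Atl \<Longrightarrow> continuous_on (cod c) (\<lambda>y. G c y v w)"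
  using G_smooth smooth_on_continuous by blast

lemma g_eq_G: "c \<in> Atl \<Longrightarrow> x \<in> fst c \<Longrightarrow> g x \<xi> \<eta> = G c (snd c x) (tc c x \<xi>) (tc c x \<eta>)"
  by (simp add: G_def inv_chart from_to)

lemma vec_basis_expansion: "v = (\<Sum>i\<in>UNIV. (v $ i) *\<^sub>R axis i 1)" for v :: "real ^ 'n"
  using basis_expansion[of v] by (simp add: scalar_mult_eq_scaleR)

lemma G_expand: 
  assumes "c \<in> Atl" "y \<in> cod c"
  shows "G c y v w = (\<Sum>i\<in>UNIV. \<Sum>j\<in>UNIV. v $ i * w $ j * G c y (axis i 1) (axis j 1))"
proof -
  let ?F = "fc c (chart_inv c y)"
  have lin: "linear ?F" by (rule fc_linear[OF assms(1) chart_inv_mem[OF assms]])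
  have e: "?F v = (\<Sum>i\<in>UNIV. (v $ i) *\<^sub>R ?F (axis i 1))" for v
    by (subst vec_basis_expansion[of v]) (simp add: linear_sum[OF lin] linear_cmul[OF lin])
  show ?thesis unfolding G_def e[of v] e[of w] 
    by (subst sum.swap) (simp add: g_sum_left g_sum_right g_bilin sum_distrib_left mult_ac)
qed

lemma gram_matrix_eq: "gram_matrix Atl g c (chart_inv c y) = (\<chi> i j. G c y (axis i 1) (axis j 1))"
  by (simp add: gram_matrix_def G_def)

lemma gram_det_pos: assumes c: "c \<in> Atl" and y: "y \<in> cod c" shows "0 < det (gram_matrix Atl g c (chart_inv c y))"
proof (rule det_pos_of_positive_definite)
  fix v :: "real ^ 'n" assume v: "v \<noteq> 0"
  have x: "chart_inv c y \<in> fst c" by (rule chart_inv_mem[OF c y])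
  have "fc c (chart_inv c y) v \<noteq> 0"
  proof
    assume "fc c (chart_inv c y) v = 0"
    then have "v = tc c (chart_inv c y) 0" using to_from[OF c x, of v] by simp
    then show False using v linear_0[OF tc_linear[OF c x]] by simp
  qed
  then have "0 < G c y v v" unfolding G_def by (rule g_pos)
  also have "G c y v v = v \<bullet> (gram_matrix Atl g c (chart_inv c y) *v v)"
    unfolding gram_matrix_eq G_expand[OF c y, of v v]
    by (simp add: inner_vec_def matrix_vector_mult_def sum_distrib_left mult_ac)
  finally show "0 < v \<bullet> (gram_matrix Atl g c (chart_inv c y) *v v)" .
qed

lemma gram_det_cont: "c \<in> Atl \<Longrightarrow> continuous_on (cod c) (\<lambda>y. det (gram_matrix Atl g c (chart_inv c y)))"
  unfolding gram_matrix_eq by (rule det_continuous_on) (simp add: G_cont)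

lemma countable_chart_cover: "\<exists>C. C \<subseteq> Atl \<and> countable C \<and> (\<Union>c\<in>C. fst c) = UNIV"
proof -
  obtain F' where F': "F' \<subseteq> fst ` Atl" "countable F'" "\<Union>F' = \<Union>(fst ` Atl)"
    using Lindelof[of "fst ` Atl"] chart_open by (metis imageE)
  have "\<forall>U\<in>F'. \<exists>c\<in>Atl. fst c = U" using F'(1) by auto
  then obtain h where h: "\<And>U. U \<in> F' \<Longrightarrow> h U \<in> Atl" "\<And>U. U \<in> F' \<Longrightarrow> fst (h U) = U" by metis
  have "(\<Union>c\<in>h ` F'. fst c) = \<Union>F'" using h by auto
  also have "\<dots> = UNIV" unfolding F'(3) using chart_cover by auto
  finally show ?thesis using h F'(2) by (intro exI[of _ "h ` F'"]) auto
qed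

end

section \<open>The measure in coordinates\<close>

context weighted_mfd
begin

text \<open>A choice of the Riemannian volume and of the density, whose existence is part of the definition of a
  weighted manifold.\<close>

definition vol_dens :: "'m measure \<times> ('m \<Rightarrow> real)" where
  "vol_dens = (SOME p. riemannian_volume Atl g (fst p) \<and> smooth_fun Atl (snd p) \<and> (\<forall>x. 0 < snd p x) \<and>
        \<mu> = completion (density (fst p) (\<lambda>x. ennreal (snd p x))))"

definition "vol = fst vol_dens"
definition "\<rho> = snd vol_dens"
definition "\<mu>0 = density vol (\<lambda>x. ennreal (\<rho> x))"

lemma vol: "riemannian_volume Atl g vol" and \<rho>_smooth: "smooth_fun Atl \<rho>" and \<rho>_pos: "0 < \<rho> x"
  and \<mu>_eq: "\<mu> = completion \<mu>0"
proof -
  let ?P = "\<lambda>p. riemannian_volume Atl g (fst p) \<and> smooth_fun Atl (snd p) \<and> (\<forall>x. 0 < snd p x) \<and>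
        \<mu> = completion (density (fst p) (\<lambda>x. ennreal (snd p x)))"
  obtain v r where "?P (v, r)" using wrm unfolding weighted_riemannian_manifold_def by auto
  then have "?P vol_dens" unfolding vol_dens_def by (rule someI)
  then show "riemannian_volume Atl g vol" "smooth_fun Atl \<rho>" "0 < \<rho> x" "\<mu> = completion \<mu>0"
    by (auto simp: vol_def \<rho>_def \<mu>0_def)
qed

lemma sets_vol[measurable_cong]: "sets vol = sets borel" using vol by (simp add: riemannian_volume_def)
lemma sets_\<mu>0[measurable_cong]: "sets \<mu>0 = sets borel" by (simp add: \<mu>0_def sets_vol)
lemma space_vol[simp]: "space vol = UNIV" using sets_eq_imp_space_eq[OF sets_vol] by simp
lemma space_\<mu>0[simp]: "space \<mu>0 = UNIV" by (simp add: \<mu>0_def)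
lemma space_\<mu>[simp]: "space \<mu> = UNIV" by (simp add: \<mu>_eq)
lemma borel_sets_\<mu>: "B \<in> sets borel \<Longrightarrow> B \<in> sets \<mu>" 
  unfolding \<mu>_eq by (rule sets_completionI_sets) (simp add: sets_\<mu>0)
lemma open_sets_\<mu>[intro]: "open W \<Longrightarrow> W \<in> sets \<mu>" by (rule borel_sets_\<mu>) simp

lemma smooth_fun_chart_cont: "smooth_fun Atl f \<Longrightarrow> c \<in> Atl \<Longrightarrow> continuous_on (cod c) (\<lambda>y. f (chart_inv c y))"
  using smooth_on_continuous[of "cod c" "f \<circ> chart_inv c"] by (simp add: smooth_fun_def o_def)

lemma continuous_of_charts:
  assumes "\<And>c. c \<in> Atl \<Longrightarrow> continuous_on (cod c) (\<lambda>y. f (chart_inv c y))"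
  shows "continuous_on UNIV f"
proof -
  have "continuous_on (fst c) f" if c: "c \<in> Atl" for c
  proof -
    have "continuous_on (fst c) (\<lambda>x. f (chart_inv c (snd c x)))"
      by (rule continuous_on_compose2[OF assms[OF c] chart_cont[OF c]]) auto
    then show ?thesis by (rule continuous_on_eq) (simp add: inv_chart[OF c])
  qed
  moreover have "(\<Union>c\<in>Atl. fst c) = UNIV" using chart_cover by blast
  ultimately show ?thesis using continuous_on_open_UN[of Atl fst f] chart_open by auto
qed

lemma smooth_fun_cont: "smooth_fun Atl f \<Longrightarrow> continuous_on UNIV f"
  by (rule continuous_of_charts) (rule smooth_fun_chart_cont)

lemma smooth_fun_borel: "smooth_fun Atl f \<Longrightarrow> f \<in> borel_measurable borel"
  by (rule borel_measurable_continuous_onI) (rule smooth_fun_cont)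

text \<open>The density of the measure in a chart with respect to Lebesgue measure.\<close>

definition w :: "('m, 'n) chart \<Rightarrow> real ^ 'n \<Rightarrow> real" where
  "w c y = \<rho> (chart_inv c y) * sqrt (det (gram_matrix Atl g c (chart_inv c y)))"

lemma w_pos: "c \<in> Atl \<Longrightarrow> y \<in> cod c \<Longrightarrow> 0 < w c y"
  unfolding w_def using gram_det_pos \<rho>_pos by simp

lemma w_cont: "c \<in> Atl \<Longrightarrow> continuous_on (cod c) (w c)"
  unfolding w_def using smooth_fun_chart_cont[OF \<rho>_smooth] gram_det_cont
  by (intro continuous_on_mult continuous_on_real_sqrt) auto

text \<open>The two sides of a chart: Lebesgue measure on its codomain and the given measure on its domain, both
  complete.\<close>

definition Lc :: "('m, 'n) chart \<Rightarrow> (real ^ 'n) measure" where "Lc c = lebesgue_on (cod c)"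
definition Mc :: "('m, 'n) chart \<Rightarrow> 'm measure" where "Mc c = restrict_space \<mu> (fst c)"

lemma cod_lborel: "c \<in> Atl \<Longrightarrow> cod c \<in> sets borel" using cod_open by simp
lemma cod_lebesgue: "c \<in> Atl \<Longrightarrow> cod c \<in> sets lebesgue" using cod_lborel sets_completionI_sets[of "cod c" lborel] by simp

lemma space_Lc: "space (Lc c) = cod c" by (simp add: Lc_def)
lemma space_Mc: "space (Mc c) = fst c" by (simp add: Mc_def space_restrict_space)

lemma AE_Lc: "c \<in> Atl \<Longrightarrow> (AE y in Lc c. P y) \<longleftrightarrow> (AE y in lebesgue. y \<in> cod c \<longrightarrow> P y)"
  unfolding Lc_def by (rule AE_restrict_space_iff) (simp add: cod_lebesgue)

lemma AE_Mc: "c \<in> Atl \<Longrightarrow> (AE x in Mc c. P x) \<longleftrightarrow> (AE x in \<mu>. x \<in> fst c \<longrightarrow> P x)"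
  unfolding Mc_def by (rule AE_restrict_space_iff) (simp add: open_sets_\<mu> chart_open)

lemma borel_on_Lc: assumes "c \<in> Atl" "f \<in> borel_measurable (restrict_space borel (cod c))" 
  shows "f \<in> borel_measurable (Lc c)"
proof -
  have "restrict_space borel (cod c) \<rightarrow>\<^sub>M N \<subseteq> restrict_space lebesgue (cod c) \<rightarrow>\<^sub>M N" for N :: "'z measure"
  proof
    fix f assume f: "f \<in> restrict_space borel (cod c) \<rightarrow>\<^sub>M N"
    have "id \<in> restrict_space lebesgue (cod c) \<rightarrow>\<^sub>M restrict_space borel (cod c)"
      by (rule measurable_restrict_space3) auto
    from measurable_compose[OF this f] show "f \<in> restrict_space lebesgue (cod c) \<rightarrow>\<^sub>M N" by simp
  qed
  then show ?thesis using assms by (auto simp: Lc_def)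
qed

lemma cont_Lc: "c \<in> Atl \<Longrightarrow> continuous_on (cod c) f \<Longrightarrow> f \<in> borel_measurable (Lc c)"
  by (intro borel_on_Lc borel_measurable_continuous_on_restrict)

lemma w_meas: "c \<in> Atl \<Longrightarrow> w c \<in> borel_measurable (Lc c)" by (intro cont_Lc w_cont)

text \<open>On Borel sets, the change of variables is the definition of the Riemannian volume.\<close>

lemma borel_change_of_variables:
  assumes c: "c \<in> Atl" and B: "B \<in> sets borel" "B \<subseteq> fst c"
  shows "emeasure \<mu>0 B = (\<integral>\<^sup>+y. ennreal (w c y) * indicator B (chart_inv c y) \<partial>restrict_space lborel (cod c))"
proof -
  let ?q = "\<lambda>y. sqrt (det (gram_matrix Atl g c (chart_inv c y)))"
  let ?R = "restrict_space lborel (cod c)" and ?V = "restrict_space vol (fst c)"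
  have dom: "fst c \<in> sets borel" using chart_open[OF c] by simp
  have sR: "sets ?R = sets (restrict_space borel (cod c))" by (simp add: sets_restrict_space)
  have ci: "chart_inv c \<in> borel_measurable ?R"
    using borel_measurable_continuous_on_restrict[OF chart_inv_cont[OF c]] 
    by (simp add: measurable_cong_sets[OF sR refl])
  have sV: "sets ?V = sets (restrict_space borel (fst c))" by (simp add: sets_restrict_space sets_vol)
  have ciV: "chart_inv c \<in> ?R \<rightarrow>\<^sub>M ?V"
    unfolding measurable_cong_sets[OF refl sV]
    by (rule measurable_restrict_space2) (use chart_inv_mem[OF c] ci in \<open>auto simp: space_restrict_space\<close>)
  have q: "?q \<in> borel_measurable ?R"
    unfolding measurable_cong_sets[OF sR refl]
    by (intro borel_measurable_continuous_on_restrict continuous_on_real_sqrt gram_det_cont c)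
  have eq: "distr (density ?R (\<lambda>y. ennreal (?q y))) ?V (chart_inv c) = ?V"
  proof (rule measure_eqI)
    fix A assume "A \<in> sets (distr (density ?R (\<lambda>y. ennreal (?q y))) ?V (chart_inv c))"
    then have AV: "A \<in> sets ?V" by simp
    then have A: "A \<in> sets borel" "A \<subseteq> fst c" using dom by (auto simp: sV sets_restrict_space_iff)
    have pre: "chart_inv c -` A \<inter> cod c = snd c ` A"
      using A(2) chart_inv[OF c] inv_chart[OF c] by (auto 4 4 intro: image_eqI[of _ "snd c" "chart_inv c _"])
    have preR: "chart_inv c -` A \<inter> space ?R \<in> sets ?R" using measurable_sets[OF ciV AV] .
    have "emeasure (distr (density ?R (\<lambda>y. ennreal (?q y))) ?V (chart_inv c)) A
       = (\<integral>\<^sup>+y. ennreal (?q y) * indicator (chart_inv c -` A \<inter> space ?R) y \<partial>?R)"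
      using ciV AV preR q by (simp add: emeasure_distr emeasure_density)
    also have "\<dots> = (\<integral>\<^sup>+y. ennreal (?q y) * indicator (chart_inv c -` A \<inter> space ?R) y * indicator (cod c) y \<partial>lborel)"
      using cod_lborel[OF c] by (simp add: nn_integral_restrict_space)
    also have "\<dots> = (\<integral>\<^sup>+y. ennreal (?q y) * indicator (snd c ` A) y \<partial>lborel)"
      using pre A(2) by (intro nn_integral_cong) (auto simp: space_restrict_space indicator_def)
    also have "\<dots> = emeasure vol A"
      using vol c A by (simp add: riemannian_volume_def)
    also have "\<dots> = emeasure ?V A" using dom A by (simp add: emeasure_restrict_space sets_vol)
    finally show "emeasure (distr (density ?R (\<lambda>y. ennreal (?q y))) ?V (chart_inv c)) A = emeasure ?V A" .
  qed simp
  have \<rho>m: "\<rho> \<in> borel_measurable borel" by (rule smooth_fun_borel[OF \<rho>_smooth])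
  have BV: "B \<in> sets ?V" using B dom by (simp add: sV sets_restrict_space_iff)
  have fV: "(\<lambda>x. ennreal (\<rho> x) * indicator B x) \<in> borel_measurable ?V"
    unfolding measurable_cong_sets[OF sV refl]
    by (rule measurable_restrict_space1) (use B \<rho>m in auto)
  have "emeasure \<mu>0 B = (\<integral>\<^sup>+x. ennreal (\<rho> x) * indicator B x \<partial>vol)"
    unfolding \<mu>0_def using B \<rho>m by (subst emeasure_density) (auto simp: sets_vol measurable_cong_sets[OF sets_vol refl])
  also have "\<dots> = (\<integral>\<^sup>+x. ennreal (\<rho> x) * indicator B x * indicator (fst c) x \<partial>vol)"
    using B(2) by (intro nn_integral_cong) (auto simp: indicator_def)
  also have "\<dots> = (\<integral>\<^sup>+x. ennreal (\<rho> x) * indicator B x \<partial>?V)"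
    using dom by (simp add: nn_integral_restrict_space sets_vol)
  also have "\<dots> = (\<integral>\<^sup>+x. ennreal (\<rho> x) * indicator B x \<partial>distr (density ?R (\<lambda>y. ennreal (?q y))) ?V (chart_inv c))"
    by (simp only: eq)
  also have "\<dots> = (\<integral>\<^sup>+y. ennreal (?q y) * (ennreal (\<rho> (chart_inv c y)) * indicator B (chart_inv c y)) \<partial>?R)"
    using ciV fV q by (simp add: nn_integral_distr nn_integral_density measurable_compose[OF ciV fV])
  also have "\<dots> = (\<integral>\<^sup>+y. ennreal (w c y) * indicator B (chart_inv c y) \<partial>?R)"
  proof (rule nn_integral_cong)
    fix y assume "y \<in> space ?R"
    then have "y \<in> cod c" by (simp add: space_restrict_space)
    then have "0 < det (gram_matrix Atl g c (chart_inv c y))" by (rule gram_det_pos[OF c])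
    then show "ennreal (?q y) * (ennreal (\<rho> (chart_inv c y)) * indicator B (chart_inv c y)) = ennreal (w c y) * indicator B (chart_inv c y)"
      using \<rho>_pos[of "chart_inv c y"] unfolding w_def by (subst ennreal_mult) (auto simp: mult_ac less_imp_le)
  qed
  finally show ?thesis .
qed

text \<open>Null sets of the manifold are null sets in the chart, because the density is positive. This is what
  extends the change of variables from Borel sets to the completed measures.\<close>

lemma null_chart_preimage:
  assumes c: "c \<in> Atl" and N: "N \<in> null_sets \<mu>0"
  shows "\<exists>Z\<in>null_sets lborel. chart_inv c -` N \<inter> cod c \<subseteq> Z"
proof -
  let ?R = "restrict_space lborel (cod c)"
  have dom: "fst c \<in> sets borel" using chart_open[OF c] by simp
  have NB: "N \<in> sets borel" using N by (auto simp: null_sets_def sets_\<mu>0)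
  define B where "B = N \<inter> fst c"
  have B: "B \<in> sets borel" "B \<subseteq> fst c" using NB dom by (auto simp: B_def)
  have "emeasure \<mu>0 B \<le> emeasure \<mu>0 N" using NB by (intro emeasure_mono) (auto simp: B_def sets_\<mu>0)
  then have "emeasure \<mu>0 B = 0" using N by auto
  then have 0: "(\<integral>\<^sup>+y. ennreal (w c y) * indicator B (chart_inv c y) \<partial>?R) = 0" using borel_change_of_variables[OF c B] by simp
  have sR: "sets ?R = sets (restrict_space borel (cod c))" by (simp add: sets_restrict_space)
  have ci: "chart_inv c \<in> borel_measurable ?R" "w c \<in> borel_measurable ?R"
    using borel_measurable_continuous_on_restrict[OF chart_inv_cont[OF c]] borel_measurable_continuous_on_restrict[OF w_cont[OF c]]
    by (simp_all add: measurable_cong_sets[OF sR refl])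
  have indB: "(indicator B :: 'm \<Rightarrow> ennreal) \<in> borel_measurable borel" using B by simp
  have m: "(\<lambda>y. ennreal (w c y) * indicator B (chart_inv c y)) \<in> borel_measurable ?R"
    using ci measurable_compose[OF ci(1) indB] by simp
  have "AE y in ?R. ennreal (w c y) * indicator B (chart_inv c y) = 0"
    using 0 nn_integral_0_iff_AE[OF m] by simp
  then have "AE y in lborel. y \<in> cod c \<longrightarrow> ennreal (w c y) * indicator B (chart_inv c y) = 0"
    using cod_lborel[OF c] by (simp add: AE_restrict_space_iff)
  then have "AE y in lborel. \<not> (y \<in> cod c \<and> chart_inv c y \<in> N)"
  proof eventually_elim
    case (elim y)
    show ?case
    proof
      assume y: "y \<in> cod c \<and> chart_inv c y \<in> N"
      then have "chart_inv c y \<in> B" using chart_inv_mem[OF c, of y] by (simp add: B_def)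
      then show False using elim y w_pos[OF c, of y] by simp
    qed
  qed
  then obtain Z where "{y \<in> space lborel. \<not> \<not> (y \<in> cod c \<and> chart_inv c y \<in> N)} \<subseteq> Z" "Z \<in> null_sets lborel"
    by (auto elim!: AE_E simp: null_sets_def)
  then show ?thesis by (intro bexI[of _ Z]) auto
qed

lemma chart_inv_measurable: assumes c: "c \<in> Atl" shows "chart_inv c \<in> Lc c \<rightarrow>\<^sub>M Mc c"
proof (rule measurableI)
  show "chart_inv c y \<in> space (Mc c)" if "y \<in> space (Lc c)" for y using that chart_inv_mem[OF c] by (simp add: space_Lc space_Mc)
  fix A assume "A \<in> sets (Mc c)"
  then obtain A' where A': "A' \<in> sets \<mu>" "A = A' \<inter> fst c" by (auto simp: Mc_def sets_restrict_space)
  obtain S N N' where S: "A' = S \<union> N" "N \<subseteq> N'" "N' \<in> null_sets \<mu>0" "S \<in> sets \<mu>0"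
    using A'(1) unfolding \<mu>_eq by (rule sets_completionE)
  obtain Z where Z: "Z \<in> null_sets lborel" "chart_inv c -` N' \<inter> cod c \<subseteq> Z" using null_chart_preimage[OF c S(3)] by blast
  have "chart_inv c \<in> borel_measurable (Lc c)" by (rule cont_Lc[OF c chart_inv_cont[OF c]])
  then have 1: "chart_inv c -` S \<inter> cod c \<in> sets (Lc c)" using S(4) measurable_sets[of "chart_inv c" "Lc c" borel S] by (simp add: sets_\<mu>0 space_Lc)
  have "chart_inv c -` N \<inter> cod c \<in> sets lebesgue"
    by (rule null_sets_completion[OF Z(1)]) (use Z(2) S(2) in auto)
  then have 2: "chart_inv c -` N \<inter> cod c \<in> sets (Lc c)" using cod_lebesgue[OF c] by (simp add: Lc_def sets_restrict_space_iff)
  have "chart_inv c -` A \<inter> space (Lc c) = (chart_inv c -` S \<inter> cod c) \<union> (chart_inv c -` N \<inter> cod c)"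
    using chart_inv_mem[OF c] by (auto simp: space_Lc A'(2) S(1))
  then show "chart_inv c -` A \<inter> space (Lc c) \<in> sets (Lc c)" using 1 2 by simp
qed

lemma nn_integral_Lc: "c \<in> Atl \<Longrightarrow> f \<in> borel_measurable (restrict_space lborel (cod c)) \<Longrightarrow> nn_integral (Lc c) f = nn_integral (restrict_space lborel (cod c)) f"
  unfolding Lc_def using cod_lborel cod_lebesgue by (simp add: nn_integral_restrict_space nn_integral_completion)

lemma chart_measure: assumes c: "c \<in> Atl" shows "Mc c = distr (density (Lc c) (\<lambda>y. ennreal (w c y))) (Mc c) (chart_inv c)"
proof (rule measure_eqI)
  fix A assume AM: "A \<in> sets (Mc c)"
  then obtain A' where A': "A' \<in> sets \<mu>" "A = A' \<inter> fst c" by (auto simp: Mc_def sets_restrict_space)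
  obtain S N N' where S: "A' = S \<union> N" "N \<subseteq> N'" "N' \<in> null_sets \<mu>0" "S \<in> sets \<mu>0"
    using A'(1) unfolding \<mu>_eq by (rule sets_completionE)
  obtain Z where Z: "Z \<in> null_sets lborel" "chart_inv c -` N' \<inter> cod c \<subseteq> Z" using null_chart_preimage[OF c S(3)] by blast
  have dom: "fst c \<in> sets borel" using chart_open[OF c] by simp
  define B where "B = S \<inter> fst c"
  have B: "B \<in> sets borel" "B \<subseteq> fst c" using S(4) dom by (auto simp: B_def sets_\<mu>0)
  have "emeasure (Mc c) A = emeasure \<mu> A" 
    unfolding Mc_def using A' dom borel_sets_\<mu>[OF dom] by (subst emeasure_restrict_space) auto
  also have "emeasure \<mu> A = emeasure \<mu> B"
  proof (rule emeasure_eq_AE)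
    have "AE x in \<mu>. x \<notin> N'" unfolding \<mu>_eq by (rule AE_not_in[OF null_sets_completionI[OF S(3)]])
    then show "AE x in \<mu>. x \<in> A \<longleftrightarrow> x \<in> B" by eventually_elim (use S(1,2) A'(2) in \<open>auto simp: B_def\<close>)
    show "A \<in> sets \<mu>" using A' borel_sets_\<mu>[OF dom] by auto
    show "B \<in> sets \<mu>" by (rule borel_sets_\<mu>[OF B(1)])
  qed
  also have "\<dots> = emeasure \<mu>0 B" unfolding \<mu>_eq using B by (simp add: sets_\<mu>0)
  also have "\<dots> = (\<integral>\<^sup>+y. ennreal (w c y) * indicator B (chart_inv c y) \<partial>restrict_space lborel (cod c))" 
    by (rule borel_change_of_variables[OF c B])
  also have "\<dots> = (\<integral>\<^sup>+y. ennreal (w c y) * indicator B (chart_inv c y) \<partial>Lc c)"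
  proof (rule nn_integral_Lc[OF c, symmetric])
    have sR: "sets (restrict_space lborel (cod c)) = sets (restrict_space borel (cod c))" by (simp add: sets_restrict_space)
    have ci: "chart_inv c \<in> borel_measurable (restrict_space lborel (cod c))" "w c \<in> borel_measurable (restrict_space lborel (cod c))"
      using borel_measurable_continuous_on_restrict[OF chart_inv_cont[OF c]] borel_measurable_continuous_on_restrict[OF w_cont[OF c]]
      by (simp_all add: measurable_cong_sets[OF sR refl])
    have indB: "(indicator B :: 'm \<Rightarrow> ennreal) \<in> borel_measurable borel" using B by simp
    show "(\<lambda>y. ennreal (w c y) * indicator B (chart_inv c y)) \<in> borel_measurable (restrict_space lborel (cod c))"
      using ci measurable_compose[OF ci(1) indB] by simp
  qed
  also have "\<dots> = (\<integral>\<^sup>+y. ennreal (w c y) * indicator (chart_inv c -` A \<inter> space (Lc c)) y \<partial>Lc c)"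
  proof (rule nn_integral_cong_AE)
    have "AE y in lebesgue. y \<notin> Z" by (rule AE_not_in[OF null_sets_completionI[OF Z(1)]])
    then have "AE y in lebesgue. y \<in> cod c \<longrightarrow> y \<notin> Z" by eventually_elim simp
    then have "AE y in Lc c. y \<notin> Z" using AE_Lc[OF c] by simp
    moreover have "AE y in Lc c. y \<in> cod c" using AE_space[of "Lc c"] by (simp add: space_Lc)
    ultimately show "AE y in Lc c. ennreal (w c y) * indicator B (chart_inv c y) = ennreal (w c y) * indicator (chart_inv c -` A \<inter> space (Lc c)) y"
      by eventually_elim (use Z(2) S(1,2) A'(2) chart_inv_mem[OF c] in \<open>auto simp: space_Lc B_def indicator_def\<close>)
  qed
  also have "\<dots> = emeasure (distr (density (Lc c) (\<lambda>y. ennreal (w c y))) (Mc c) (chart_inv c)) A"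
    using AM chart_inv_measurable[OF c] w_meas[OF c] measurable_sets[OF chart_inv_measurable[OF c] AM]
    by (simp add: emeasure_distr emeasure_density)
  finally show "emeasure (Mc c) A = emeasure (distr (density (Lc c) (\<lambda>y. ennreal (w c y))) (Mc c) (chart_inv c)) A" .
qed simp

lemma chart_integral:
  fixes f :: "'m \<Rightarrow> real"
  assumes c: "c \<in> Atl" and f: "f \<in> borel_measurable (Mc c)"
  shows "(LINT x|Mc c. f x) = (LINT y|Lc c. w c y * f (chart_inv c y))"
    and "integrable (Mc c) f \<longleftrightarrow> integrable (Lc c) (\<lambda>y. w c y * f (chart_inv c y))"
proof -
  have d: "chart_inv c \<in> density (Lc c) (\<lambda>y. ennreal (w c y)) \<rightarrow>\<^sub>M Mc c" using chart_inv_measurable[OF c] by simp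
  have pos: "AE y in Lc c. 0 \<le> w c y" using AE_space[of "Lc c"] by eventually_elim (use w_pos[OF c] in \<open>auto simp: space_Lc less_imp_le\<close>)
  have m: "(\<lambda>y. f (chart_inv c y)) \<in> borel_measurable (Lc c)" by (rule measurable_compose[OF chart_inv_measurable[OF c] f])
  have "(LINT x|Mc c. f x) = (LINT x|distr (density (Lc c) (\<lambda>y. ennreal (w c y))) (Mc c) (chart_inv c). f x)"
    using chart_measure[OF c] by simp
  also have "\<dots> = (LINT y|density (Lc c) (\<lambda>y. ennreal (w c y)). f (chart_inv c y))" by (rule integral_distr[OF d f])
  also have "\<dots> = (LINT y|Lc c. w c y * f (chart_inv c y))" using integral_density[OF m w_meas[OF c] pos] by simp
  finally show "(LINT x|Mc c. f x) = (LINT y|Lc c. w c y * f (chart_inv c y))" .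
  have "integrable (Mc c) f \<longleftrightarrow> integrable (distr (density (Lc c) (\<lambda>y. ennreal (w c y))) (Mc c) (chart_inv c)) f"
    using chart_measure[OF c] by simp
  also have "\<dots> \<longleftrightarrow> integrable (density (Lc c) (\<lambda>y. ennreal (w c y))) (\<lambda>y. f (chart_inv c y))" by (rule integrable_distr_eq[OF d f])
  also have "\<dots> \<longleftrightarrow> integrable (Lc c) (\<lambda>y. w c y * f (chart_inv c y))" using integrable_density[OF m w_meas[OF c] pos] by simp
  finally show "integrable (Mc c) f \<longleftrightarrow> integrable (Lc c) (\<lambda>y. w c y * f (chart_inv c y))" .
qed

lemma chart_AE:
  assumes c: "c \<in> Atl" and P: "AE y in Lc c. P (chart_inv c y)"
  shows "AE x in Mc c. P x"
proof -
  have "AE y in lebesgue. y \<in> cod c \<longrightarrow> P (chart_inv c y)"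
    using P AE_Lc[OF c] by simp
  then have "AE y in lborel. y \<in> cod c \<longrightarrow> P (chart_inv c y)" by (simp add: AE_completion_iff)
  then obtain Z where Z: "{y. \<not> (y \<in> cod c \<longrightarrow> P (chart_inv c y))} \<subseteq> Z" "Z \<in> null_sets lborel"
    by (auto elim!: AE_E simp: null_sets_def)
  define B where "B = snd c -` Z \<inter> fst c"
  have dom: "fst c \<in> sets borel" using chart_open[OF c] by simp
  have sm: "snd c \<in> borel_measurable (restrict_space borel (fst c))"
    by (rule borel_measurable_continuous_on_restrict[OF chart_cont[OF c]])
  have "Z \<in> sets borel" using Z by auto
  from measurable_sets[OF sm this] have "B \<in> sets (restrict_space borel (fst c))"
    unfolding B_def by (simp add: space_restrict_space)
  then have B: "B \<in> sets borel" "B \<subseteq> fst c" using dom by (auto simp: sets_restrict_space_iff)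
  have Zr: "AE y in restrict_space lborel (cod c). y \<notin> Z"
  proof -
    have "AE y in lborel. y \<in> cod c \<longrightarrow> y \<notin> Z" using AE_not_in[OF Z(2)] by eventually_elim simp
    then show ?thesis using cod_lborel[OF c] by (simp add: AE_restrict_space_iff)
  qed
  have "emeasure \<mu>0 B = (\<integral>\<^sup>+y. ennreal (w c y) * indicator B (chart_inv c y) \<partial>restrict_space lborel (cod c))"
    by (rule borel_change_of_variables[OF c B])
  also have "\<dots> = (\<integral>\<^sup>+y. 0 \<partial>restrict_space lborel (cod c))"
  proof (rule nn_integral_cong_AE)
    show "AE y in restrict_space lborel (cod c). ennreal (w c y) * indicator B (chart_inv c y) = 0"
      using Zr AE_space by eventually_elim (use chart_inv[OF c] in \<open>auto simp: B_def indicator_def space_restrict_space\<close>)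
  qed
  finally have "emeasure \<mu>0 B = 0" by simp
  then have "B \<in> null_sets \<mu>0" using B by (auto simp: null_sets_def sets_\<mu>0)
  then have "AE x in \<mu>. x \<notin> B" unfolding \<mu>_eq by (intro AE_not_in null_sets_completionI)
  then have "AE x in \<mu>. x \<in> fst c \<longrightarrow> P x"
  proof eventually_elim
    case (elim x)
    show ?case
    proof
      assume x: "x \<in> fst c"
      then have "snd c x \<notin> Z" using elim by (auto simp: B_def)
      then show "P x" using Z(1) x inv_chart[OF c x] by auto
    qed
  qed
  then show ?thesis using AE_Mc[OF c] by simp
qed

lemma AE_of_charts:
  assumes "\<And>c. c \<in> Atl \<Longrightarrow> AE x in Mc c. P x"
  shows "AE x in \<mu>. P x"
proof -
  obtain C where C: "C \<subseteq> Atl" "countable C" "(\<Union>c\<in>C. fst c) = UNIV" using countable_chart_cover by blast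
  have "AE x in \<mu>. \<forall>c\<in>C. x \<in> fst c \<longrightarrow> P x"
  proof (rule AE_ball_countable'[OF _ C(2)])
    fix c assume "c \<in> C"
    then have c: "c \<in> Atl" using C by auto
    show "AE x in \<mu>. x \<in> fst c \<longrightarrow> P x"
      using assms[OF c] AE_Mc[OF c] by simp
  qed
  then show ?thesis by eventually_elim (use C(3) in blast)
qed

lemma measurable_of_charts:
  assumes \<Omega>: "open \<Omega>" and f: "\<And>c. c \<in> Atl \<Longrightarrow> f \<in> borel_measurable (restrict_space \<mu> (\<Omega> \<inter> fst c))"
  shows "f \<in> borel_measurable (restrict_space \<mu> \<Omega>)"
proof -
  obtain C where C: "C \<subseteq> Atl" "countable C" "(\<Union>c\<in>C. fst c) = UNIV" using countable_chart_cover by blast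
  have s\<Omega>: "\<Omega> \<in> sets \<mu>" by (rule open_sets_\<mu>[OF \<Omega>])
  show ?thesis
  proof (rule measurable_piecewise_restrict[of "fst ` C"])
    show "countable (fst ` C)" using C by simp
    show "U \<inter> space (restrict_space \<mu> \<Omega>) \<in> sets (restrict_space \<mu> \<Omega>)" if U: "U \<in> fst ` C" for U
    proof -
      obtain c where "c \<in> C" "U = fst c" using U by blast
      then have "U \<in> sets \<mu>" using C(1) chart_open[of c] by auto
      then show ?thesis using s\<Omega> by (auto simp: space_restrict_space sets_restrict_space_iff)
    qed
    show "space (restrict_space \<mu> \<Omega>) \<subseteq> \<Union>(fst ` C)" using C(3) by auto
    fix U assume "U \<in> fst ` C"
    then obtain c where c: "c \<in> Atl" "U = fst c" using C by auto
    show "f \<in> borel_measurable (restrict_space (restrict_space \<mu> \<Omega>) U)"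
      using f[OF c(1)] c(2) by (simp add: restrict_restrict_space s\<Omega> open_sets_\<mu>[OF chart_open[OF c(1)]])
  qed
qed

text \<open>Every point has a neighbourhood that is the preimage of a ball on which the density is bounded.\<close>

lemma compact_finite_measure:
  assumes K: "compact K" shows "emeasure \<mu> K < \<infinity>"
proof -
  have nb: "\<exists>V. open V \<and> x \<in> V \<and> emeasure \<mu> V < \<infinity>" for x
  proof -
    obtain c where c: "c \<in> Atl" "x \<in> fst c" using chart_cover by blast
    have "snd c x \<in> cod c" using c by simp
    then obtain e where e: "e > 0" "cball (snd c x) e \<subseteq> cod c" using cod_open[OF c(1)] open_contains_cball by blast
    have "compact (w c ` cball (snd c x) e)" by (intro compact_continuous_image continuous_on_subset[OF w_cont[OF c(1)] e(2)]) simp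
    then obtain C where C: "\<And>y. y \<in> cball (snd c x) e \<Longrightarrow> norm (w c y) \<le> C" using compact_imp_bounded bounded_iff by (metis imageI)
    define V where "V = {z \<in> fst c. snd c z \<in> ball (snd c x) e}"
    have V: "open V" "x \<in> V" "V \<subseteq> fst c" unfolding V_def using open_chart_vimage[OF c(1) open_ball] c e by auto
    have "emeasure \<mu> V = emeasure \<mu>0 V" unfolding \<mu>_eq using V by (simp add: sets_\<mu>0)
    also have "\<dots> = (\<integral>\<^sup>+y. ennreal (w c y) * indicator V (chart_inv c y) \<partial>restrict_space lborel (cod c))"
      by (rule borel_change_of_variables[OF c(1)]) (use V in auto)
    also have "\<dots> = (\<integral>\<^sup>+y. ennreal (w c y) * indicator V (chart_inv c y) * indicator (cod c) y \<partial>lborel)"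
      using cod_lborel[OF c(1)] by (simp add: nn_integral_restrict_space)
    also have "\<dots> \<le> (\<integral>\<^sup>+y. ennreal C * indicator (cball (snd c x) e) y \<partial>lborel)"
    proof (rule nn_integral_mono)
      fix y
      show "ennreal (w c y) * indicator V (chart_inv c y) * indicator (cod c) y \<le> ennreal C * indicator (cball (snd c x) e) y"
      proof (cases "y \<in> cod c \<and> chart_inv c y \<in> V")
        case True
        then have "y \<in> ball (snd c x) e" using chart_inv[OF c(1)] by (auto simp: V_def)
        then have "y \<in> cball (snd c x) e" by auto
        then show ?thesis using True C[of y] by (auto intro!: ennreal_leI)
      qed (auto simp: indicator_def)
    qed
    also have "\<dots> = ennreal C * emeasure lborel (cball (snd c x) e)" by (simp add: nn_integral_cmult_indicator)
    also have "\<dots> < \<infinity>"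
      using emeasure_compact_finite[OF compact_cball, of "snd c x" e] by (simp add: ennreal_mult_less_top less_top)
    finally show ?thesis using V by blast
  qed
  then obtain V where V: "\<And>x. open (V x)" "\<And>x. x \<in> V x" "\<And>x. emeasure \<mu> (V x) < \<infinity>" by metis
  obtain F where F: "F \<subseteq> K" "finite F" "K \<subseteq> (\<Union>x\<in>F. V x)"
    using compactE_image[OF K, of K V] V by (metis UN_I subsetI)
  have "emeasure \<mu> K \<le> emeasure \<mu> (\<Union>x\<in>F. V x)" using F V by (intro emeasure_mono open_sets_\<mu>) auto
  also have "\<dots> \<le> (\<Sum>x\<in>F. emeasure \<mu> (V x))" using F V by (intro emeasure_subadditive_finite) auto
  also have "\<dots> < \<infinity>" using F V by (simp add: ennreal_sum_less_top)
  finally show ?thesis .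
qed

end

section \<open>Function spaces\<close>

text \<open>Functions form a real vector space pointwise, so that the theory of semi-inner products applies to
  spaces of functions and of vector fields.\<close>

instantiation "fun" :: (type, real_vector) real_vector
begin
definition scaleR_fun :: "real \<Rightarrow> ('a \<Rightarrow> 'b) \<Rightarrow> 'a \<Rightarrow> 'b" where
  "scaleR_fun c f = (\<lambda>x. c *\<^sub>R f x)"
instance by standard (auto simp: scaleR_fun_def fun_eq_iff algebra_simps)
end

lemma scaleR_fun_apply [simp]: "(c *\<^sub>R f) x = c *\<^sub>R f x"
  by (simp add: scaleR_fun_def)

lemma sum_fun_apply [simp]: "(\<Sum>i\<in>I. f i) x = (\<Sum>i\<in>I. f i x)"
  by (induction I rule: infinite_finite_induct) auto

lemma compact_continuous_bound:
  fixes F :: "'a::topological_space \<Rightarrow> 'b::real_normed_vector"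
  assumes "compact K" "continuous_on K F"
  shows "\<exists>B. \<forall>y\<in>K. norm (F y) \<le> B"
proof -
  have "bounded (F ` K)" by (rule compact_imp_bounded[OF compact_continuous_image[OF assms(2,1)]])
  then show ?thesis by (simp add: bounded_iff)
qed

lemma (in complete_measure) measurable_AE_cong:
  assumes f: "f \<in> M \<rightarrow>\<^sub>M N" and ae: "AE x in M. f x = h x" and h: "\<And>x. x \<in> space M \<Longrightarrow> h x \<in> space N"
  shows "h \<in> M \<rightarrow>\<^sub>M N"
proof (rule measurableI[OF h])
  fix A assume "A \<in> sets N"
  then have "f -` A \<inter> space M \<in> sets M" by (rule measurable_sets[OF f])
  moreover have "AE x in M. x \<in> f -` A \<inter> space M \<longleftrightarrow> x \<in> h -` A \<inter> space M"
    using ae by eventually_elim auto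
  ultimately show "h -` A \<inter> space M \<in> sets M"
    using in_sets_AE[of "f -` A \<inter> space M" "h -` A \<inter> space M"] by blast
qed

text \<open>A relatively compact open subset of the manifold. Its closure has finite measure and is covered by
  finitely many charts.\<close>

locale mfd_domain = weighted_mfd M
  for M :: "('m::{t2_space,second_countable_topology}, 'n::finite) weighted_manifold" +
  fixes \<Omega> :: "'m set"
  assumes open_\<Omega>: "open \<Omega>" and compact_\<Omega>: "compact (closure \<Omega>)"
begin

abbreviation "N \<equiv> restrict_space \<mu> \<Omega>"

lemma sets_\<Omega>[simp]: "\<Omega> \<in> sets \<mu>" by (rule open_sets_\<mu>[OF open_\<Omega>])

lemma space_N[simp]: "space N = \<Omega>" by (simp add: space_restrict_space)

lemma set_bm_iff: "set_borel_measurable \<mu> W f \<longleftrightarrow> f \<in> borel_measurable (restrict_space \<mu> W)" if "open W"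
  for f :: "'m \<Rightarrow> 'z::real_normed_vector"
  unfolding set_borel_measurable_def using that by (subst borel_measurable_restrict_space_iff) auto

lemma set_int_iff: "set_integrable \<mu> \<Omega> f \<longleftrightarrow> integrable N f" for f :: "'m \<Rightarrow> 'z::{banach, second_countable_topology}"
  unfolding set_integrable_def by (subst integrable_restrict_space) auto

lemma set_LINT: "(LINT x:\<Omega>|\<mu>. f x) = (LINT x|N. f x)" for f :: "'m \<Rightarrow> 'z::{banach, second_countable_topology}"
  unfolding set_lebesgue_integral_def by (subst integral_restrict_space) auto

lemma AE_N: "(AE x in N. P x) \<longleftrightarrow> (AE x in \<mu>. x \<in> \<Omega> \<longrightarrow> P x)"
  by (rule AE_restrict_space_iff) simp

lemma N_finite: "emeasure N \<Omega> < \<infinity>"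
proof -
  have "emeasure N \<Omega> = emeasure \<mu> \<Omega>" by (subst emeasure_restrict_space) auto
  also have "\<dots> \<le> emeasure \<mu> (closure \<Omega>)" by (rule emeasure_mono[OF closure_subset]) (simp add: borel_sets_\<mu>)
  also have "\<dots> < \<infinity>" by (rule compact_finite_measure[OF compact_\<Omega>])
  finally show ?thesis .
qed

lemma const_integrable: "integrable N (\<lambda>x. c :: real)"
proof -
  interpret finite_measure N by (rule finite_measureI) (use N_finite in simp)
  show ?thesis by simp
qed

lemma complete_\<mu>: "complete_measure \<mu>"
  unfolding \<mu>_eq by (rule completion.complete_measure_axioms)

lemma complete_restrict: "open W \<Longrightarrow> complete_measure (restrict_space \<mu> W)"
proof
  fix A B assume W: "open W" and BA: "B \<subseteq> A" and A: "A \<in> null_sets (restrict_space \<mu> W)"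
  interpret complete_measure \<mu> by (rule complete_\<mu>)
  have "A \<in> null_sets \<mu>" "A \<subseteq> W" using A null_sets_restrict_space[of W \<mu> A] open_sets_\<mu>[OF W] by auto
  then show "B \<in> sets (restrict_space \<mu> W)" using complete[OF BA] BA sets_restrict_space_iff[of W \<mu> B] open_sets_\<mu>[OF W] by auto
qed

lemma bm_sub: "f \<in> borel_measurable (restrict_space \<mu> V) \<Longrightarrow> W \<subseteq> V \<Longrightarrow> open W \<Longrightarrow> open V \<Longrightarrow> f \<in> borel_measurable (restrict_space \<mu> W)"
proof -
  assume f: "f \<in> borel_measurable (restrict_space \<mu> V)" and WV: "W \<subseteq> V" "open W" "open V"
  have "restrict_space (restrict_space \<mu> V) W = restrict_space \<mu> W"
    using WV by (subst restrict_restrict_space) (auto intro!: arg_cong[where f = "restrict_space \<mu>"])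
  then show ?thesis using measurable_restrict_space1[OF f, of W] by simp
qed

lemma borel_bm: "f \<in> borel_measurable (restrict_space borel W) \<Longrightarrow> f \<in> borel_measurable (restrict_space \<mu> W)"
proof -
  assume f: "f \<in> borel_measurable (restrict_space borel W)"
  have "id \<in> restrict_space \<mu> W \<rightarrow>\<^sub>M restrict_space borel W"
    by (rule measurable_restrict_space3) (auto simp: measurable_def borel_sets_\<mu>)
  from measurable_compose[OF this f] show ?thesis by simp
qed

lemma cont_bm: "continuous_on W f \<Longrightarrow> f \<in> borel_measurable (restrict_space \<mu> W)"
  by (intro borel_bm borel_measurable_continuous_on_restrict)

lemma bm_cong: "(\<And>x. x \<in> W \<Longrightarrow> f x = h x) \<Longrightarrow> f \<in> borel_measurable (restrict_space \<mu> W) \<Longrightarrow> h \<in> borel_measurable (restrict_space \<mu> W)"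
  by (subst measurable_cong[of _ _ f]) (auto simp: space_restrict_space)

lemma section_iff: "measurable_section M \<Omega> \<xi> \<longleftrightarrow> (\<forall>c\<in>Atl. (\<lambda>x. tc c x (\<xi> x)) \<in> borel_measurable (restrict_space \<mu> (\<Omega> \<inter> fst c)))"
  unfolding measurable_section_def by (intro ball_cong refl set_bm_iff open_Int open_\<Omega> chart_open)

lemma sectionD: "measurable_section M \<Omega> \<xi> \<Longrightarrow> c \<in> Atl \<Longrightarrow> (\<lambda>x. tc c x (\<xi> x)) \<in> borel_measurable (restrict_space \<mu> (\<Omega> \<inter> fst c))"
  using section_iff by blast

lemma vec_nth_bm: "f \<in> borel_measurable K \<Longrightarrow> (\<lambda>x. f x $ i) \<in> borel_measurable K" for f :: "'z \<Rightarrow> real ^ 'k::finite"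
  by (rule measurable_compose[where f = f and g = "\<lambda>v. v $ i"]) (auto intro!: borel_measurable_continuous_onI continuous_intros)

lemma vec_bm: "(\<And>i. (\<lambda>x. f x $ i) \<in> borel_measurable K) \<Longrightarrow> f \<in> borel_measurable K" for f :: "'z \<Rightarrow> real ^ 'n"
proof -
  assume a: "\<And>i. (\<lambda>x. f x $ i) \<in> borel_measurable K"
  have "(\<lambda>x. \<Sum>i\<in>UNIV. (f x $ i) *\<^sub>R axis i (1::real)) \<in> borel_measurable K"
    by (intro borel_measurable_sum borel_measurable_scaleR a) auto
  moreover have "(\<lambda>x. \<Sum>i\<in>UNIV. (f x $ i) *\<^sub>R axis i (1::real)) = f"
    by (rule ext) (rule vec_basis_expansion[symmetric])
  ultimately show ?thesis by simp
qed

lemma G_chart_bm: "c \<in> Atl \<Longrightarrow> W \<subseteq> fst c \<Longrightarrow> (\<lambda>x. G c (snd c x) v z) \<in> borel_measurable (restrict_space \<mu> W)"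
  by (intro cont_bm continuous_on_compose2[OF G_cont[of c v z] continuous_on_subset[OF chart_cont]]) auto

lemma g_bm:
  assumes "measurable_section M \<Omega> \<xi>" "measurable_section M \<Omega> \<eta>"
  shows "(\<lambda>x. g x (\<xi> x) (\<eta> x)) \<in> borel_measurable N"
proof (rule measurable_of_charts[OF open_\<Omega>])
  fix c assume c: "c \<in> Atl"
  have "(\<lambda>x. \<Sum>i\<in>UNIV. \<Sum>j\<in>UNIV. tc c x (\<xi> x) $ i * tc c x (\<eta> x) $ j * G c (snd c x) (axis i 1) (axis j 1))
    \<in> borel_measurable (restrict_space \<mu> (\<Omega> \<inter> fst c))"
    by (intro borel_measurable_sum borel_measurable_times vec_nth_bm sectionD[OF _ c] assms G_chart_bm[OF c]) auto
  then show "(\<lambda>x. g x (\<xi> x) (\<eta> x)) \<in> borel_measurable (restrict_space \<mu> (\<Omega> \<inter> fst c))"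
    by (rule bm_cong[rotated]) (use c in \<open>simp add: g_eq_G[OF c] G_expand[OF c, symmetric]\<close>)
qed

lemma section_add: "measurable_section M \<Omega> \<xi> \<Longrightarrow> measurable_section M \<Omega> \<eta> \<Longrightarrow> measurable_section M \<Omega> (\<xi> + \<eta>)"
  unfolding section_iff
proof (intro ballI)
  fix c assume a: "\<forall>c\<in>Atl. (\<lambda>x. tc c x (\<xi> x)) \<in> borel_measurable (restrict_space \<mu> (\<Omega> \<inter> fst c))"
    "\<forall>c\<in>Atl. (\<lambda>x. tc c x (\<eta> x)) \<in> borel_measurable (restrict_space \<mu> (\<Omega> \<inter> fst c))" and c: "c \<in> Atl"
  have "(\<lambda>x. tc c x (\<xi> x) + tc c x (\<eta> x)) \<in> borel_measurable (restrict_space \<mu> (\<Omega> \<inter> fst c))"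
    using a c by (intro borel_measurable_add) auto
  then show "(\<lambda>x. tc c x ((\<xi> + \<eta>) x)) \<in> borel_measurable (restrict_space \<mu> (\<Omega> \<inter> fst c))"
    by (rule bm_cong[rotated]) (use linear_add[OF tc_linear[OF c]] in simp)
qed

lemma section_mult: 
  assumes k: "k \<in> borel_measurable N" and \<xi>: "measurable_section M \<Omega> \<xi>" 
  shows "measurable_section M \<Omega> (\<lambda>x. k x *\<^sub>R \<xi> x)"
  unfolding section_iff
proof (intro ballI)
  fix c assume c: "c \<in> Atl"
  have "(\<lambda>x. k x *\<^sub>R tc c x (\<xi> x)) \<in> borel_measurable (restrict_space \<mu> (\<Omega> \<inter> fst c))"
    by (intro borel_measurable_scaleR sectionD[OF \<xi> c] bm_sub[OF k]) (use chart_open[OF c] open_\<Omega> in auto)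
  then show "(\<lambda>x. tc c x (k x *\<^sub>R \<xi> x)) \<in> borel_measurable (restrict_space \<mu> (\<Omega> \<inter> fst c))"
    by (rule bm_cong[rotated]) (use linear_cmul[OF tc_linear[OF c]] in simp)
qed

lemma section_scale: "measurable_section M \<Omega> \<xi> \<Longrightarrow> measurable_section M \<Omega> (a *\<^sub>R \<xi>)"
  using section_mult[of "\<lambda>_. a" \<xi>] by (simp add: scaleR_fun_def)

subsection \<open>Square integrable functions and vector fields\<close>

abbreviation "X2 \<equiv> L2 M \<Omega>"
abbreviation "XT \<equiv> L2T M \<Omega>"

definition ip :: "('m \<Rightarrow> real) \<Rightarrow> ('m \<Rightarrow> real) \<Rightarrow> real" where "ip u v = (LINT x|N. u x * v x)"
definition ipT :: "('m \<Rightarrow> real ^ 'n) \<Rightarrow> ('m \<Rightarrow> real ^ 'n) \<Rightarrow> real" where "ipT \<xi> \<eta> = (LINT x|N. g x (\<xi> x) (\<eta> x))"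

lemma X2_iff: "u \<in> X2 \<longleftrightarrow> u \<in> borel_measurable N \<and> integrable N (\<lambda>x. (u x)\<^sup>2)"
  by (auto simp: L2_def set_bm_iff[OF open_\<Omega>] set_int_iff)

lemma XT_iff: "\<xi> \<in> XT \<longleftrightarrow> measurable_section M \<Omega> \<xi> \<and> integrable N (\<lambda>x. g x (\<xi> x) (\<xi> x))"
  by (auto simp: L2T_def set_int_iff)

lemma ip_integrable: assumes "u \<in> X2" "v \<in> X2" shows "integrable N (\<lambda>x. u x * v x)"
proof (rule Bochner_Integration.integrable_bound)
  show "integrable N (\<lambda>x. (u x)\<^sup>2 + (v x)\<^sup>2)" using assms by (auto simp: X2_iff)
  show "(\<lambda>x. u x * v x) \<in> borel_measurable N" using assms by (auto simp: X2_iff)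
  have "\<bar>a * b\<bar> \<le> a\<^sup>2 + b\<^sup>2" for a b :: real
    using sum_squares_bound[of "\<bar>a\<bar>" "\<bar>b\<bar>"] mult_nonneg_nonneg[of "\<bar>a\<bar>" "\<bar>b\<bar>"] unfolding abs_mult power2_abs by linarith
  then show "AE x in N. norm (u x * v x) \<le> norm ((u x)\<^sup>2 + (v x)\<^sup>2)" by auto
qed

lemma g_abs_le: "\<bar>g x v z\<bar> \<le> g x v v + g x z z"
proof -
  have "\<bar>g x v z\<bar>\<^sup>2 \<le> (g x v v + g x z z)\<^sup>2"
    unfolding power2_sum power2_abs
    using g_Cauchy_Schwarz[of x v z] mult_nonneg_nonneg[OF g_nonneg[of x v] g_nonneg[of x z]] zero_le_power2[of "g x v v"] zero_le_power2[of "g x z z"]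
    by linarith
  then show ?thesis using g_nonneg[of x v] g_nonneg[of x z] power2_le_imp_le[of "\<bar>g x v z\<bar>"] by simp
qed

lemma ipT_integrable: assumes "\<xi> \<in> XT" "\<eta> \<in> XT" shows "integrable N (\<lambda>x. g x (\<xi> x) (\<eta> x))"
proof (rule Bochner_Integration.integrable_bound)
  show "integrable N (\<lambda>x. g x (\<xi> x) (\<xi> x) + g x (\<eta> x) (\<eta> x))" using assms by (auto simp: XT_iff)
  show "(\<lambda>x. g x (\<xi> x) (\<eta> x)) \<in> borel_measurable N" using assms by (auto simp: XT_iff intro: g_bm)
  show "AE x in N. norm (g x (\<xi> x) (\<eta> x)) \<le> norm (g x (\<xi> x) (\<xi> x) + g x (\<eta> x) (\<eta> x))" 
    using g_abs_le g_nonneg by (simp add: abs_of_nonneg)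
qed

sublocale X2: semi_inner X2 ip
proof
  have add: "u + v \<in> X2" if "u \<in> X2" "v \<in> X2" for u v
  proof -
    have "integrable N (\<lambda>x. (u x)\<^sup>2 + (v x)\<^sup>2 + 2 * (u x * v x))" 
      using that ip_integrable[OF that] by (auto simp: X2_iff)
    then show ?thesis using that by (auto simp: X2_iff power2_sum mult.assoc plus_fun_def)
  qed
  have scale: "c *\<^sub>R u \<in> X2" if "u \<in> X2" for u c
    using that by (auto simp: X2_iff power_mult_distrib scaleR_fun_def)
  have "0 \<in> X2" by (auto simp: X2_iff zero_fun_def)
  then show "subspace X2" using add scale by (auto simp: subspace_def)
  show "ip x y = ip y x" for x y by (simp add: ip_def mult.commute)
  show "ip (x + y) z = ip x z + ip y z" if "x \<in> X2" "y \<in> X2" "z \<in> X2" for x y z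
    using ip_integrable[OF that(1,3)] ip_integrable[OF that(2,3)] by (simp add: ip_def distrib_right)
  show "ip (c *\<^sub>R x) z = c * ip x z" if "x \<in> X2" "z \<in> X2" for x z c by (simp add: ip_def mult.assoc)
  show "0 \<le> ip x x" for x by (simp add: ip_def)
qed

sublocale XT: semi_inner XT ipT
proof
  have add: "\<xi> + \<eta> \<in> XT" if "\<xi> \<in> XT" "\<eta> \<in> XT" for \<xi> \<eta>
  proof -
    have "integrable N (\<lambda>x. g x (\<xi> x) (\<xi> x) + g x (\<eta> x) (\<eta> x) + 2 * g x (\<xi> x) (\<eta> x))" 
      using that ipT_integrable[OF that] by (auto simp: XT_iff)
    moreover have "g x (\<xi> x) (\<xi> x) + g x (\<eta> x) (\<eta> x) + 2 * g x (\<xi> x) (\<eta> x) = g x ((\<xi> + \<eta>) x) ((\<xi> + \<eta>) x)" for x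
      using g_sym[of x "\<xi> x" "\<eta> x"] by (simp add: g_bilin)
    ultimately show ?thesis using that section_add by (auto simp: XT_iff)
  qed
  have scale: "c *\<^sub>R \<xi> \<in> XT" if "\<xi> \<in> XT" for \<xi> c
    using that section_scale by (auto simp: XT_iff g_bilin)
  have z: "0 \<in> XT"
  proof -
    have "(\<lambda>x. tc c x 0) \<in> borel_measurable (restrict_space \<mu> (\<Omega> \<inter> fst c))" if c: "c \<in> Atl" for c
      by (rule bm_cong[of _ "\<lambda>_. 0"]) (use linear_0[OF tc_linear[OF c]] in auto)
    then show ?thesis by (auto simp: XT_iff zero_fun_def g_bilin section_iff)
  qed
  then show "subspace XT" using add scale by (auto simp: subspace_def)
  show "ipT x y = ipT y x" for x y unfolding ipT_def by (rule Bochner_Integration.integral_cong) (auto intro: g_sym)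
  show "ipT (x + y) z = ipT x z + ipT y z" if "x \<in> XT" "y \<in> XT" "z \<in> XT" for x y z
    using ipT_integrable[OF that(1,3)] ipT_integrable[OF that(2,3)] by (simp add: ipT_def g_bilin)
  show "ipT (c *\<^sub>R x) z = c * ipT x z" if "x \<in> XT" "z \<in> XT" for x z c by (simp add: ipT_def g_bilin)
  show "0 \<le> ipT x x" for x by (simp add: ipT_def g_nonneg)
qed

lemma bounded_X2: assumes m: "u \<in> borel_measurable N" and b: "\<And>x. x \<in> \<Omega> \<Longrightarrow> \<bar>u x\<bar> \<le> C" shows "u \<in> X2"
proof -
  have "integrable N (\<lambda>x. (u x)\<^sup>2)"
  proof (rule Bochner_Integration.integrable_bound[OF const_integrable[of "C\<^sup>2"]])
    have "(u x)\<^sup>2 \<le> C\<^sup>2" if "x \<in> \<Omega>" for x using b[OF that] by (simp add: abs_le_square_iff[symmetric])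
    then show "AE x in N. norm ((u x)\<^sup>2) \<le> norm (C\<^sup>2)" by (intro AE_I2) simp
  qed (use m in auto)
  then show ?thesis using m by (simp add: X2_iff)
qed

lemma bounded_XT: assumes m: "measurable_section M \<Omega> \<xi>" and b: "\<And>x. x \<in> \<Omega> \<Longrightarrow> g x (\<xi> x) (\<xi> x) \<le> C" shows "\<xi> \<in> XT"
proof -
  have "integrable N (\<lambda>x. g x (\<xi> x) (\<xi> x))"
  proof (rule Bochner_Integration.integrable_bound[OF const_integrable[of C]])
    show "AE x in N. norm (g x (\<xi> x) (\<xi> x)) \<le> norm C" using order_trans[OF b abs_ge_self] g_nonneg by (intro AE_I2) (simp add: abs_of_nonneg)
  qed (use g_bm[OF m m] in auto)
  then show ?thesis using m by (simp add: XT_iff)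
qed

subsection \<open>Pairings in a chart\<close>

abbreviation "U c \<equiv> snd c ` (\<Omega> \<inter> fst c)"

lemma U_open: "c \<in> Atl \<Longrightarrow> open (U c)" using open_chart_image[OF _ open_\<Omega>] .

text \<open>The integral over \<open>\<Omega>\<close> of a function supported in one chart. It is written with the quotient \<open>h / w\<close>
  because the weak gradient is defined by integrals with respect to Lebesgue measure: the density of the
  measure has to cancel.\<close>

lemma chart_pairing:
  fixes H :: "'m \<Rightarrow> real" and h :: "real ^ 'n \<Rightarrow> real"
  assumes c: "c \<in> Atl" and H: "H \<in> borel_measurable N" and H0: "\<And>x. x \<notin> fst c \<Longrightarrow> H x = 0"
    and Hh: "\<And>y. y \<in> U c \<Longrightarrow> H (chart_inv c y) = h y / w c y"
  shows "(LINT x|N. H x) = (LINT y:U c|lebesgue. h y)"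
    and "integrable N H \<Longrightarrow> set_integrable lebesgue (U c) h"
proof -
  have f: "(\<lambda>x. indicator \<Omega> x * H x) \<in> borel_measurable \<mu>"
    using H by (subst (asm) borel_measurable_restrict_space_iff) auto
  then have fc: "(\<lambda>x. indicator \<Omega> x * H x) \<in> borel_measurable (Mc c)" unfolding Mc_def by (rule measurable_restrict_space1)
  have dom: "fst c \<in> sets \<mu>" by (rule open_sets_\<mu>[OF chart_open[OF c]])
  have e1: "indicator (fst c) x *\<^sub>R (indicator \<Omega> x * H x) = indicator \<Omega> x *\<^sub>R H x" for x
    using H0[of x] by (auto simp: indicator_def)
  have e2: "indicator (cod c) y *\<^sub>R (w c y * (indicator \<Omega> (chart_inv c y) * H (chart_inv c y))) = indicator (U c) y *\<^sub>R h y" for y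
  proof (cases "y \<in> cod c")
    case True
    show ?thesis
    proof (cases "y \<in> U c")
      case yU: True
      then have "chart_inv c y \<in> \<Omega>" using mem_chart_image[OF c True, of \<Omega>] by simp
      then show ?thesis using yU True Hh[OF yU] w_pos[OF c True] by simp
    next
      case False
      then have "chart_inv c y \<notin> \<Omega>" using mem_chart_image[OF c True, of \<Omega>] by simp
      then show ?thesis using False by simp
    qed
  qed (auto simp: indicator_def)
  have cl: "cod c \<inter> space lebesgue \<in> sets lebesgue" using cod_lebesgue[OF c] by simp
  have "(LINT x|N. H x) = (LINT x|\<mu>. indicator \<Omega> x *\<^sub>R H x)" by (rule integral_restrict_space) simp
  also have "\<dots> = (LINT x|Mc c. indicator \<Omega> x * H x)"
    unfolding Mc_def using dom by (subst integral_restrict_space) (simp_all add: e1 del: real_scaleR_def)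
  also have "\<dots> = (LINT y|Lc c. w c y * (indicator \<Omega> (chart_inv c y) * H (chart_inv c y)))" by (rule chart_integral(1)[OF c fc])
  also have "\<dots> = (LINT y|lebesgue. indicator (cod c) y *\<^sub>R (w c y * (indicator \<Omega> (chart_inv c y) * H (chart_inv c y))))"
    unfolding Lc_def by (rule integral_restrict_space[OF cl])
  finally show "(LINT x|N. H x) = (LINT y:U c|lebesgue. h y)" unfolding e2 set_lebesgue_integral_def .
  assume "integrable N H"
  then have "integrable \<mu> (\<lambda>x. indicator \<Omega> x *\<^sub>R H x)" by (subst (asm) integrable_restrict_space) auto
  then have "integrable (Mc c) (\<lambda>x. indicator \<Omega> x * H x)"
    unfolding Mc_def using dom by (subst integrable_restrict_space) (simp_all add: e1 del: real_scaleR_def)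
  then have "integrable (Lc c) (\<lambda>y. w c y * (indicator \<Omega> (chart_inv c y) * H (chart_inv c y)))" using chart_integral(2)[OF c fc] by simp
  then have "integrable lebesgue (\<lambda>y. indicator (cod c) y *\<^sub>R (w c y * (indicator \<Omega> (chart_inv c y) * H (chart_inv c y))))"
    unfolding Lc_def by (subst (asm) integrable_restrict_space[OF cl])
  then show "set_integrable lebesgue (U c) h" unfolding e2 set_integrable_def .
qed

text \<open>Compactly supported coordinate functions, divided by the density, as elements of the two \<open>L\<^sup>2\<close>
  spaces: pairing with them is integration in the chart.\<close>

definition chart_fun :: "('m, 'n) chart \<Rightarrow> (real ^ 'n \<Rightarrow> real) \<Rightarrow> 'm \<Rightarrow> real" where
  "chart_fun c k x = (if x \<in> fst c then k (snd c x) / w c (snd c x) else 0)"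

definition chart_field :: "('m, 'n) chart \<Rightarrow> real ^ 'n \<Rightarrow> (real ^ 'n \<Rightarrow> real) \<Rightarrow> 'm \<Rightarrow> real ^ 'n" where
  "chart_field c v k x = chart_fun c k x *\<^sub>R (if x \<in> fst c then fc c x v else 0)"

text \<open>Bounded measurable functions with compact support in the codomain of a chart. Besides smooth test
  functions they include the indicator functions of boxes.\<close>

definition coord_test :: "('m, 'n) chart \<Rightarrow> (real ^ 'n \<Rightarrow> real) \<Rightarrow> bool" where
  "coord_test c k \<longleftrightarrow> k \<in> borel_measurable (restrict_space borel (cod c)) \<and> 
     (\<exists>C. \<forall>y\<in>cod c. \<bar>k y\<bar> \<le> C) \<and> (\<exists>K. compact K \<and> K \<subseteq> cod c \<and> (\<forall>y\<in>cod c. y \<notin> K \<longrightarrow> k y = 0))"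

lemma chart_fun_bm: assumes c: "c \<in> Atl" and k: "k \<in> borel_measurable (restrict_space borel (cod c))"
  shows "chart_fun c k \<in> borel_measurable N"
proof -
  have sm: "snd c \<in> restrict_space borel (fst c) \<rightarrow>\<^sub>M restrict_space borel (cod c)"
    by (rule measurable_restrict_space2) (auto simp: space_restrict_space intro: borel_measurable_continuous_on_restrict[OF chart_cont[OF c]])
  have "w c \<in> borel_measurable (restrict_space borel (cod c))" by (rule borel_measurable_continuous_on_restrict[OF w_cont[OF c]])
  then have "(\<lambda>y. k y / w c y) \<in> borel_measurable (restrict_space borel (cod c))" using k by simp
  from measurable_compose[OF sm this] have "(\<lambda>x. k (snd c x) / w c (snd c x)) \<in> borel_measurable (restrict_space borel (fst c))" .
  then have "(\<lambda>x. k (snd c x) / w c (snd c x)) \<in> borel_measurable (restrict_space \<mu> (fst c))" by (rule borel_bm)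
  then have "(\<lambda>x. indicator (fst c) x *\<^sub>R (k (snd c x) / w c (snd c x))) \<in> borel_measurable \<mu>"
    by (subst (asm) borel_measurable_restrict_space_iff) (use open_sets_\<mu>[OF chart_open[OF c]] in auto)
  moreover have "(\<lambda>x. indicator (fst c) x *\<^sub>R (k (snd c x) / w c (snd c x))) = chart_fun c k" by (auto simp: chart_fun_def indicator_def fun_eq_iff)
  ultimately show ?thesis by (simp add: measurable_restrict_space1)
qed

lemma continuous_over_w_bounded:
  assumes c: "c \<in> Atl" and k: "coord_test c k" and F: "continuous_on (cod c) F"
  shows "\<exists>C. \<forall>y\<in>cod c. \<bar>k y / w c y\<bar> * \<bar>F y\<bar> \<le> C"
proof -
  obtain C where C': "\<forall>y\<in>cod c. \<bar>k y\<bar> \<le> C"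
    by (rule exE[OF k[unfolded coord_test_def, THEN conjunct2, THEN conjunct1]])
  obtain K where K': "compact K \<and> K \<subseteq> cod c \<and> (\<forall>y\<in>cod c. y \<notin> K \<longrightarrow> k y = 0)"
    by (rule exE[OF k[unfolded coord_test_def, THEN conjunct2, THEN conjunct2]])
  have C: "\<bar>k y\<bar> \<le> C" if "y \<in> cod c" for y using bspec[OF C' that] .
  have K: "compact K" "K \<subseteq> cod c" using K' by simp_all
  have K0: "k y = 0" if "y \<in> cod c" "y \<notin> K" for y
    using bspec[OF K'[THEN conjunct2, THEN conjunct2] that(1)] that(2) by simp
  have nz: "\<forall>y\<in>K. w c y \<noteq> 0"
  proof
    fix y assume "y \<in> K"
    then have "y \<in> cod c" by (rule subsetD[OF K(2)])
    then show "w c y \<noteq> 0" using w_pos[OF c, of y] by simp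
  qed
  have "continuous_on K (\<lambda>y. F y / w c y)"
    by (rule continuous_on_divide[OF continuous_on_subset[OF F K(2)] continuous_on_subset[OF w_cont[OF c] K(2)] nz])
  from compact_continuous_bound[OF K(1) this] obtain B where B': "\<forall>y\<in>K. norm (F y / w c y) \<le> B" by (rule exE)
  have B: "norm (F y / w c y) \<le> B" if "y \<in> K" for y using bspec[OF B' that] .
  have "\<bar>k y / w c y\<bar> * \<bar>F y\<bar> \<le> max 0 C * max 0 B" if y: "y \<in> cod c" for y
  proof (cases "y \<in> K")
    case True
    have "\<bar>k y / w c y\<bar> * \<bar>F y\<bar> = \<bar>k y\<bar> * norm (F y / w c y)" by (simp add: abs_mult)
    also have "\<dots> \<le> max 0 C * max 0 B" using C[OF y] B[OF True] by (intro mult_mono) auto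
    finally show ?thesis .
  next
    case False
    then show ?thesis using K0[OF y] by simp
  qed
  then show ?thesis by blast
qed

lemma chart_fun_X2: assumes c: "c \<in> Atl" and k: "coord_test c k" shows "chart_fun c k \<in> X2"
proof -
  obtain C where C: "\<And>y. y \<in> cod c \<Longrightarrow> \<bar>k y / w c y\<bar> * \<bar>1\<bar> \<le> C" using continuous_over_w_bounded[OF c k continuous_on_const[of _ 1]] by blast
  show ?thesis
  proof (rule bounded_X2[OF chart_fun_bm[OF c], of _ "max 0 C"])
    show "\<bar>chart_fun c k x\<bar> \<le> max 0 C" for x using C[of "snd c x"] by (auto simp: chart_fun_def)
  qed (use k in \<open>simp add: coord_test_def\<close>)
qed

lemma coordinate_section: assumes c: "c \<in> Atl" shows "measurable_section M \<Omega> (\<lambda>x. if x \<in> fst c then fc c x v else 0)"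
  unfolding section_iff
proof
  fix d assume d: "d \<in> Atl"
  have od: "open (fst c)" "open (fst d)" using chart_open c d by auto
  have "smooth_on (snd c ` (fst c \<inter> fst d)) (\<lambda>y. frechet_derivative (snd d \<circ> chart_inv c) (at y) v)"
    by (rule smooth_on_derivative[OF transition_smooth[OF c d]])
  then have "continuous_on (fst c \<inter> fst d) (\<lambda>x. frechet_derivative (snd d \<circ> chart_inv c) (at (snd c x)) v)"
    using continuous_on_compose2[OF smooth_on_continuous continuous_on_subset[OF chart_cont[OF c]], of "snd c ` (fst c \<inter> fst d)" _ "fst c \<inter> fst d"] by auto
  then have "(\<lambda>x. change_components c d x v) \<in> borel_measurable (restrict_space \<mu> (fst c \<inter> fst d))"
    unfolding change_components_def by (rule cont_bm)
  then have "(\<lambda>x. indicator (fst c \<inter> fst d) x *\<^sub>R change_components c d x v) \<in> borel_measurable \<mu>"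
    by (subst (asm) borel_measurable_restrict_space_iff) (use od in \<open>auto intro: open_sets_\<mu>\<close>)
  then have "(\<lambda>x. indicator (fst c \<inter> fst d) x *\<^sub>R change_components c d x v) \<in> borel_measurable (restrict_space \<mu> (\<Omega> \<inter> fst d))"
    by (rule measurable_restrict_space1)
  then show "(\<lambda>x. tc d x (if x \<in> fst c then fc c x v else 0)) \<in> borel_measurable (restrict_space \<mu> (\<Omega> \<inter> fst d))"
  proof (rule bm_cong[rotated])
    fix x assume x: "x \<in> \<Omega> \<inter> fst d"
    show "indicator (fst c \<inter> fst d) x *\<^sub>R change_components c d x v = tc d x (if x \<in> fst c then fc c x v else 0)"
    proof (cases "x \<in> fst c")
      case True
      have "tc d x (fc c x v) = change_components c d x (tc c x (fc c x v))" using tc_change[OF c d True] x by simp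
      then show ?thesis using True x to_from[OF c True] by simp
    next
      case False
      then show ?thesis using x linear_0[OF tc_linear[OF d, of x]] by simp
    qed
  qed
qed

lemma chart_field_XT: assumes c: "c \<in> Atl" and k: "coord_test c k" shows "chart_field c v k \<in> XT"
proof -
  have "continuous_on (cod c) (\<lambda>y. sqrt (G c y v v))" by (intro continuous_on_real_sqrt G_cont c)
  then obtain C where C: "\<And>y. y \<in> cod c \<Longrightarrow> \<bar>k y / w c y\<bar> * \<bar>sqrt (G c y v v)\<bar> \<le> C" using continuous_over_w_bounded[OF c k] by blast
  show ?thesis
  proof (rule bounded_XT[of _ "C\<^sup>2"])
    show "measurable_section M \<Omega> (chart_field c v k)" unfolding chart_field_def[abs_def]
      by (rule section_mult[OF chart_fun_bm[OF c] coordinate_section[OF c]]) (use k in \<open>simp add: coord_test_def\<close>)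
    fix x
    show "g x (chart_field c v k x) (chart_field c v k x) \<le> C\<^sup>2"
    proof (cases "x \<in> fst c")
      case True
      have Gn: "0 \<le> G c (snd c x) v v" unfolding G_def by (rule g_nonneg)
      have "g x (chart_field c v k x) (chart_field c v k x) = (k (snd c x) / w c (snd c x))\<^sup>2 * G c (snd c x) v v"
        using True by (simp add: chart_field_def chart_fun_def g_bilin G_def inv_chart[OF c True] power2_eq_square)
      also have "\<dots> = (\<bar>k (snd c x) / w c (snd c x)\<bar> * \<bar>sqrt (G c (snd c x) v v)\<bar>)\<^sup>2"
        using Gn by (simp add: power_mult_distrib abs_mult abs_divide power_divide)
      also have "\<dots> \<le> C\<^sup>2" using C[of "snd c x"] True by (intro power_mono) auto
      finally show ?thesis .
    qed (simp add: chart_field_def g_bilin)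
  qed
qed

lemma ip_chart_fun: assumes c: "c \<in> Atl" and k: "coord_test c k" and u: "u \<in> X2"
  shows "ip u (chart_fun c k) = (LINT y:U c|lebesgue. u (chart_inv c y) * k y)"
  unfolding ip_def
proof (rule chart_pairing(1)[OF c])
  show "(\<lambda>x. u x * chart_fun c k x) \<in> borel_measurable N" using u chart_fun_X2[OF c k] by (auto simp: X2_iff)
  fix y assume "y \<in> U c"
  then have y: "y \<in> cod c" by auto
  show "u (chart_inv c y) * chart_fun c k (chart_inv c y) = u (chart_inv c y) * k y / w c y"
    using chart_inv_mem[OF c y] chart_inv[OF c y] by (simp add: chart_fun_def)
qed (simp add: chart_fun_def)

lemma ip_chart_fun_integrable: assumes c: "c \<in> Atl" and k: "coord_test c k" and u: "u \<in> X2"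
  shows "set_integrable lebesgue (U c) (\<lambda>y. u (chart_inv c y) * k y)"
proof (rule chart_pairing(2)[OF c])
  show i: "integrable N (\<lambda>x. u x * chart_fun c k x)" by (rule ip_integrable[OF u chart_fun_X2[OF c k]])
  show "(\<lambda>x. u x * chart_fun c k x) \<in> borel_measurable N" using i by simp
  fix y assume "y \<in> U c"
  then have y: "y \<in> cod c" by auto
  show "u (chart_inv c y) * chart_fun c k (chart_inv c y) = u (chart_inv c y) * k y / w c y"
    using chart_inv_mem[OF c y] chart_inv[OF c y] by (simp add: chart_fun_def)
qed (simp add: chart_fun_def)

lemma ipT_chart_field: assumes c: "c \<in> Atl" and k: "coord_test c k" and \<xi>: "\<xi> \<in> XT"
  shows "ipT \<xi> (chart_field c v k) = (LINT y:U c|lebesgue. g (chart_inv c y) (\<xi> (chart_inv c y)) (fc c (chart_inv c y) v) * k y)"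
    and "set_integrable lebesgue (U c) (\<lambda>y. g (chart_inv c y) (\<xi> (chart_inv c y)) (fc c (chart_inv c y) v) * k y)"
proof -
  have i: "integrable N (\<lambda>x. g x (\<xi> x) (chart_field c v k x))" by (rule ipT_integrable[OF \<xi> chart_field_XT[OF c k]])
  have 0: "g x (\<xi> x) (chart_field c v k x) = 0" if "x \<notin> fst c" for x using that by (simp add: chart_field_def g_bilin)
  have 1: "g (chart_inv c y) (\<xi> (chart_inv c y)) (chart_field c v k (chart_inv c y)) = g (chart_inv c y) (\<xi> (chart_inv c y)) (fc c (chart_inv c y) v) * k y / w c y" if "y \<in> U c" for y
  proof -
    have y: "y \<in> cod c" using that by auto
    show ?thesis using chart_inv_mem[OF c y] chart_inv[OF c y] by (simp add: chart_field_def chart_fun_def g_bilin)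
  qed
  show "ipT \<xi> (chart_field c v k) = (LINT y:U c|lebesgue. g (chart_inv c y) (\<xi> (chart_inv c y)) (fc c (chart_inv c y) v) * k y)"
    unfolding ipT_def by (rule chart_pairing(1)[OF c borel_measurable_integrable[OF i] 0 1])
  show "set_integrable lebesgue (U c) (\<lambda>y. g (chart_inv c y) (\<xi> (chart_inv c y)) (fc c (chart_inv c y) v) * k y)"
    by (rule chart_pairing(2)[OF c borel_measurable_integrable[OF i] 0 1 i])
qed

end

section \<open>Weak gradients\<close>

context mfd_domain
begin

lemma coord_test_cont:
  assumes cont: "continuous_on (cod c) k" and K: "compact K" "K \<subseteq> cod c" and zero: "\<And>y. y \<in> cod c \<Longrightarrow> y \<notin> K \<Longrightarrow> k y = 0"
  shows "coord_test c k"
proof -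
  obtain C where C: "\<forall>y\<in>K. norm (k y) \<le> C"
    by (rule exE[OF compact_continuous_bound[OF K(1) continuous_on_subset[OF cont K(2)]]])
  have "\<bar>k y\<bar> \<le> max 0 C" if "y \<in> cod c" for y using bspec[OF C, of y] zero[OF that] by (cases "y \<in> K") auto
  then have "\<exists>C. \<forall>y\<in>cod c. \<bar>k y\<bar> \<le> C" by blast
  moreover have "\<exists>K. compact K \<and> K \<subseteq> cod c \<and> (\<forall>y\<in>cod c. y \<notin> K \<longrightarrow> k y = 0)" using K zero by blast
  ultimately show ?thesis unfolding coord_test_def using borel_measurable_continuous_on_restrict[OF cont] by blast
qed

lemma test_support:
  assumes c: "c \<in> Atl" and \<psi>: "\<psi> \<in> test_functions Atl W" and W: "W \<subseteq> fst c"
  obtains K where "compact K" "K \<subseteq> snd c ` W" "\<And>y. y \<in> cod c \<Longrightarrow> y \<notin> K \<Longrightarrow> (\<psi> \<circ> chart_inv c) y = 0"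
    "\<And>y v. y \<in> cod c \<Longrightarrow> y \<notin> K \<Longrightarrow> frechet_derivative (\<psi> \<circ> chart_inv c) (at y) v = 0"
proof
  let ?S = "closure {x. \<psi> x \<noteq> 0}"
  let ?K = "snd c ` ?S"
  have S: "compact ?S" "?S \<subseteq> W" using \<psi> by (auto simp: test_functions_def)
  show K: "compact ?K" using S W by (intro compact_continuous_image continuous_on_subset[OF chart_cont[OF c]]) auto
  show "?K \<subseteq> snd c ` W" using S by auto
  show z: "(\<psi> \<circ> chart_inv c) y = 0" if "y \<in> cod c" "y \<notin> ?K" for y
  proof (rule ccontr)
    assume "(\<psi> \<circ> chart_inv c) y \<noteq> 0"
    then have "chart_inv c y \<in> ?S" using closure_subset by fastforce
    then have "snd c (chart_inv c y) \<in> ?K" by blast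
    then show False using that chart_inv[OF c that(1)] by simp
  qed
  show "frechet_derivative (\<psi> \<circ> chart_inv c) (at y) v = 0" if y: "y \<in> cod c" "y \<notin> ?K" for y v
  proof -
    have "frechet_derivative (\<lambda>_. 0) (at y) = frechet_derivative (\<psi> \<circ> chart_inv c) (at y)"
    proof (rule frechet_derivative_transform_within_open)
      show "open (cod c - ?K)" using cod_open[OF c] K by (auto intro!: open_Diff compact_imp_closed)
      show "0 = (\<psi> \<circ> chart_inv c) y" if "y \<in> cod c - ?K" for y using z[of y] that by simp
    qed (use y in auto)
    then show ?thesis by (metis frechet_derivative_const)
  qed
qed

lemma test_smooth: "\<psi> \<in> test_functions Atl W \<Longrightarrow> c \<in> Atl \<Longrightarrow> smooth_on (cod c) (\<psi> \<circ> chart_inv c)"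
  by (auto simp: test_functions_def smooth_fun_def)

lemma test_coord: 
  assumes c: "c \<in> Atl" and \<psi>: "\<psi> \<in> test_functions Atl (\<Omega> \<inter> fst c)"
  shows "coord_test c (\<psi> \<circ> chart_inv c)" and "coord_test c (\<lambda>y. frechet_derivative (\<psi> \<circ> chart_inv c) (at y) v)"
proof -
  obtain K where K: "compact K" "K \<subseteq> U c" "\<And>y. y \<in> cod c \<Longrightarrow> y \<notin> K \<Longrightarrow> (\<psi> \<circ> chart_inv c) y = 0"
    "\<And>y v. y \<in> cod c \<Longrightarrow> y \<notin> K \<Longrightarrow> frechet_derivative (\<psi> \<circ> chart_inv c) (at y) v = 0"
    using test_support[OF c \<psi> Int_lower2] by metis
  have Kc: "K \<subseteq> cod c" using K(2) by auto
  note s = test_smooth[OF \<psi> c]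
  show "coord_test c (\<psi> \<circ> chart_inv c)" 
    by (rule coord_test_cont[OF smooth_on_continuous[OF s] K(1) Kc K(3)])
  show "coord_test c (\<lambda>y. frechet_derivative (\<psi> \<circ> chart_inv c) (at y) v)"
    by (rule coord_test_cont[OF smooth_on_continuous[OF smooth_on_derivative[OF s]] K(1) Kc K(4)])
qed

text \<open>Whether \<open>u\<close> is in \<open>H\<^sup>1\<close> with gradient \<open>\<xi>\<close>, as one relation between \<open>u\<close> and \<open>\<xi>\<close>.\<close>

definition weak_grad :: "('m \<Rightarrow> real) \<Rightarrow> ('m \<Rightarrow> real ^ 'n) \<Rightarrow> bool" where
  "weak_grad u \<xi> \<longleftrightarrow> u \<in> X2 \<and> \<xi> \<in> XT \<and> is_weak_gradient M \<Omega> u \<xi>"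

abbreviation "dcoord c \<psi> v \<equiv> (\<lambda>y. frechet_derivative (\<psi> \<circ> chart_inv c) (at y) v)"

text \<open>The defining equation in a chart becomes the vanishing of a continuous linear functional on the
  product of the two spaces. Linearity and closedness of the gradient are immediate from this form.\<close>

lemma weak_grad_iff: "weak_grad u \<xi> \<longleftrightarrow> u \<in> X2 \<and> \<xi> \<in> XT \<and> (\<forall>c\<in>Atl. \<forall>v. \<forall>\<psi>\<in>test_functions Atl (\<Omega> \<inter> fst c). 
    ip u (chart_fun c (dcoord c \<psi> v)) + ipT \<xi> (chart_field c v (\<psi> \<circ> chart_inv c)) = 0)"
proof -
  have "(LINT y:U c|lebesgue. u (chart_inv c y) * frechet_derivative (\<psi> \<circ> chart_inv c) (at y) v) =
        - (LINT y:U c|lebesgue. g (chart_inv c y) (\<xi> (chart_inv c y)) (fc c (chart_inv c y) v) * \<psi> (chart_inv c y))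
    \<longleftrightarrow> ip u (chart_fun c (dcoord c \<psi> v)) + ipT \<xi> (chart_field c v (\<psi> \<circ> chart_inv c)) = 0"
    if "u \<in> X2" "\<xi> \<in> XT" "c \<in> Atl" "\<psi> \<in> test_functions Atl (\<Omega> \<inter> fst c)" for c v \<psi>
    using ip_chart_fun[OF that(3) test_coord(2)[OF that(3,4), of v] that(1)] ipT_chart_field(1)[OF that(3) test_coord(1)[OF that(3,4)] that(2), of v]
    by auto
  then show ?thesis unfolding weak_grad_def is_weak_gradient_def by blast
qed

lemma weak_grad_D: "weak_grad u \<xi> \<Longrightarrow> u \<in> X2" "weak_grad u \<xi> \<Longrightarrow> \<xi> \<in> XT"
  "weak_grad u \<xi> \<Longrightarrow> c \<in> Atl \<Longrightarrow> \<psi> \<in> test_functions Atl (\<Omega> \<inter> fst c) \<Longrightarrow> ip u (chart_fun c (dcoord c \<psi> v)) + ipT \<xi> (chart_field c v (\<psi> \<circ> chart_inv c)) = 0"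
  using weak_grad_iff by blast+

lemma weak_grad_I: "u \<in> X2 \<Longrightarrow> \<xi> \<in> XT \<Longrightarrow> (\<And>c v \<psi>. c \<in> Atl \<Longrightarrow> \<psi> \<in> test_functions Atl (\<Omega> \<inter> fst c) \<Longrightarrow> 
    ip u (chart_fun c (dcoord c \<psi> v)) + ipT \<xi> (chart_field c v (\<psi> \<circ> chart_inv c)) = 0) \<Longrightarrow> weak_grad u \<xi>"
  using weak_grad_iff by blast

lemma weak_grad_add: assumes "weak_grad u \<xi>" "weak_grad v \<eta>" shows "weak_grad (u + v) (\<xi> + \<eta>)"
proof (rule weak_grad_I)
  note D = weak_grad_D[OF assms(1)] weak_grad_D[OF assms(2)]
  show "u + v \<in> X2" "\<xi> + \<eta> \<in> XT" using D X2.add_mem XT.add_mem by auto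
  fix c z \<psi> assume c: "c \<in> Atl" and \<psi>: "\<psi> \<in> test_functions Atl (\<Omega> \<inter> fst c)"
  show "ip (u + v) (chart_fun c (dcoord c \<psi> z)) + ipT (\<xi> + \<eta>) (chart_field c z (\<psi> \<circ> chart_inv c)) = 0"
    using X2.add_left[OF D(1) D(4) chart_fun_X2[OF c test_coord(2)[OF c \<psi>, of z]]] XT.add_left[OF D(2) D(5) chart_field_XT[OF c test_coord(1)[OF c \<psi>], of z]]
      D(3)[OF c \<psi>, of z] D(6)[OF c \<psi>, of z] by linarith
qed

lemma weak_grad_scale: assumes "weak_grad u \<xi>" shows "weak_grad (a *\<^sub>R u) (a *\<^sub>R \<xi>)"
proof (rule weak_grad_I)
  note D = weak_grad_D[OF assms(1)]
  show "a *\<^sub>R u \<in> X2" "a *\<^sub>R \<xi> \<in> XT" using D X2.scale_mem XT.scale_mem by auto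
  fix c z \<psi> assume c: "c \<in> Atl" and \<psi>: "\<psi> \<in> test_functions Atl (\<Omega> \<inter> fst c)"
  show "ip (a *\<^sub>R u) (chart_fun c (dcoord c \<psi> z)) + ipT (a *\<^sub>R \<xi>) (chart_field c z (\<psi> \<circ> chart_inv c)) = 0"
    unfolding X2.scale_left[OF D(1) chart_fun_X2[OF c test_coord(2)[OF c \<psi>, of z]]] XT.scale_left[OF D(2) chart_field_XT[OF c test_coord(1)[OF c \<psi>], of z]]
    using D(3)[OF c \<psi>, of z] by (simp add: distrib_left[symmetric])
qed

lemma weak_grad_diff: "weak_grad u \<xi> \<Longrightarrow> weak_grad v \<eta> \<Longrightarrow> weak_grad (u - v) (\<xi> - \<eta>)"
  using weak_grad_add[of u \<xi> "(-1) *\<^sub>R v" "(-1) *\<^sub>R \<eta>"] weak_grad_scale[of v \<eta> "-1"] by simp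

text \<open>The weak gradient is a closed operator.\<close>

lemma weak_grad_lim:
  assumes "\<And>n. weak_grad (u n) (\<xi> n)" and v: "v \<in> X2" and \<eta>: "\<eta> \<in> XT"
    and "(\<lambda>n. ip (u n - v) (u n - v)) \<longlonglongrightarrow> 0" "(\<lambda>n. ipT (\<xi> n - \<eta>) (\<xi> n - \<eta>)) \<longlonglongrightarrow> 0"
  shows "weak_grad v \<eta>"
proof (rule weak_grad_I[OF v \<eta>])
  note D = weak_grad_D[OF assms(1)]
  fix c z \<psi> assume c: "c \<in> Atl" and \<psi>: "\<psi> \<in> test_functions Atl (\<Omega> \<inter> fst c)"
  have "(\<lambda>n. ip (u n) (chart_fun c (dcoord c \<psi> z)) + ipT (\<xi> n) (chart_field c z (\<psi> \<circ> chart_inv c))) \<longlonglongrightarrow> ip v (chart_fun c (dcoord c \<psi> z)) + ipT \<eta> (chart_field c z (\<psi> \<circ> chart_inv c))"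
    by (intro tendsto_add X2.tendsto_ip XT.tendsto_ip D v \<eta> assms chart_fun_X2 chart_field_XT c test_coord \<psi>)
  then show "ip v (chart_fun c (dcoord c \<psi> z)) + ipT \<eta> (chart_field c z (\<psi> \<circ> chart_inv c)) = 0"
    using D(3)[OF c \<psi>] by (simp add: LIMSEQ_const_iff)
qed

text \<open>The bump function of a box in a chart, extended by zero. It is smooth in every other chart because it
  is a composition with a transition map near its support and zero elsewhere.\<close>

lemma box_bump_test:
  fixes k :: nat and a b :: "real ^ 'n"
  assumes c: "c \<in> Atl" and ab: "cbox a b \<subseteq> U c"
  defines "\<psi> \<equiv> \<lambda>x. if x \<in> fst c then box_bump k a b (snd c x) else 0"
  shows "\<psi> \<in> test_functions Atl (\<Omega> \<inter> fst c)" and "y \<in> cod c \<Longrightarrow> (\<psi> \<circ> chart_inv c) y = box_bump k a b y"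
proof -
  have abc: "cbox a b \<subseteq> cod c" using ab by auto
  show "(\<psi> \<circ> chart_inv c) y = box_bump k a b y" if "y \<in> cod c" for y
    using chart_inv_mem[OF c that] chart_inv[OF c that] by (simp add: \<psi>_def)
  define K where "K = chart_inv c ` cbox a b"
  have K: "compact K" unfolding K_def by (intro compact_continuous_image continuous_on_subset[OF chart_inv_cont[OF c] abc] compact_cbox)
  then have Kc: "closed K" by (rule compact_imp_closed)
  have KU: "K \<subseteq> \<Omega> \<inter> fst c"
  proof
    fix x assume "x \<in> K"
    then obtain y where y: "y \<in> cbox a b" "x = chart_inv c y" by (auto simp: K_def)
    then have "y \<in> U c" "y \<in> cod c" using ab by auto
    then show "x \<in> \<Omega> \<inter> fst c" using y mem_chart_image[OF c, of y \<Omega>] chart_inv_mem[OF c] by auto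
  qed
  have z: "\<psi> x = 0" if "x \<notin> K" for x
  proof (cases "x \<in> fst c")
    case True
    have "snd c x \<notin> box a b"
    proof
      assume "snd c x \<in> box a b"
      then have "snd c x \<in> cbox a b" using box_subset_cbox by auto
      then have "chart_inv c (snd c x) \<in> K" by (auto simp: K_def)
      then show False using that inv_chart[OF c True] by simp
    qed
    then show ?thesis by (simp add: \<psi>_def box_bump_outside)
  qed (simp add: \<psi>_def)
  have cl: "closure {x. \<psi> x \<noteq> 0} \<subseteq> K" by (rule closure_minimal[OF _ Kc]) (use z in auto)
  have "smooth_fun Atl \<psi>"
    unfolding smooth_fun_def
  proof
    fix d assume d: "d \<in> Atl"
    let ?S = "snd d ` (fst c \<inter> fst d)" and ?T = "snd d ` ((- K) \<inter> fst d)"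
    have oS: "open ?S" by (rule open_chart_image[OF d chart_open[OF c]])
    have oT: "open ?T" by (rule open_chart_image[OF d]) (use Kc in auto)
    have s1: "smooth_on ?S (\<psi> \<circ> chart_inv d)"
    proof (rule smooth_on_cong[OF oS])
      have tr: "smooth_on ?S (snd c \<circ> chart_inv d)" using transition_smooth[OF d c] by (simp add: inf_commute)
      show "smooth_on ?S (\<lambda>y. box_bump k a b ((snd c \<circ> chart_inv d) y))"
        by (rule smooth_on_compose[OF oS open_UNIV _ tr smooth_box_bump]) simp
      show "box_bump k a b ((snd c \<circ> chart_inv d) y) = (\<psi> \<circ> chart_inv d) y" if "y \<in> ?S" for y
        using that inv_chart[OF d] by (auto simp: \<psi>_def)
    qed
    have s2: "smooth_on ?T (\<psi> \<circ> chart_inv d)"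
    proof (rule smooth_on_cong[OF oT _ smooth_on_const])
      show "0 = (\<psi> \<circ> chart_inv d) y" if "y \<in> ?T" for y
        using that inv_chart[OF d] z by auto
    qed
    have "?S \<union> ?T = cod d" using KU by auto
    then show "smooth_on (cod d) (\<psi> \<circ> chart_inv d)" using smooth_on_Un[OF s1 s2 oS oT] by simp
  qed
  moreover have "compact (closure {x. \<psi> x \<noteq> 0})" using compact_Int_closed[OF K closed_closure, of "{x. \<psi> x \<noteq> 0}"] cl by (simp add: Int_absorb1)
  ultimately show "\<psi> \<in> test_functions Atl (\<Omega> \<inter> fst c)" using cl KU by (auto simp: test_functions_def)
qed

lemma indicator_coord_test:
  assumes c: "c \<in> Atl" and ab: "cbox a b \<subseteq> cod c" and B: "B \<in> sets borel" "B \<subseteq> cbox a b" 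
  shows "coord_test c (indicator B)"
  unfolding coord_test_def
proof (intro conjI)
  show "(indicator B :: _ \<Rightarrow> real) \<in> borel_measurable (restrict_space borel (cod c))"
    by (rule measurable_restrict_space1) (use B in simp)
  show "\<exists>C. \<forall>y\<in>cod c. \<bar>indicator B y :: real\<bar> \<le> C" by (rule exI[of _ 1]) (auto simp: indicator_def)
  show "\<exists>K. compact K \<and> K \<subseteq> cod c \<and> (\<forall>y\<in>cod c. y \<notin> K \<longrightarrow> indicator B y = (0::real))"
    by (rule exI[of _ "cbox a b"]) (use ab B in \<open>auto simp: indicator_def\<close>)
qed

text \<open>In a chart the components \<open>g(\<zeta>, v)\<close> have vanishing integral against the bump functions of all boxes,
  hence in the limit over all boxes.\<close>

lemma weak_grad_zero_unique: 
  assumes "weak_grad 0 \<zeta>" shows "AE x in N. \<zeta> x = 0"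
proof -
  note D = weak_grad_D[OF assms]
  have "AE x in Mc c. x \<in> \<Omega> \<longrightarrow> \<zeta> x = 0" if c: "c \<in> Atl" for c
  proof (rule chart_AE[OF c])
    have comp: "AE y in lebesgue. y \<in> U c \<longrightarrow> g (chart_inv c y) (\<zeta> (chart_inv c y)) (fc c (chart_inv c y) v) = 0" for v
    proof (rule AE_zero_of_box_integrals[OF U_open[OF c]])
      let ?h = "\<lambda>y. g (chart_inv c y) (\<zeta> (chart_inv c y)) (fc c (chart_inv c y) v)"
      fix a b assume ab: "cbox a b \<subseteq> U c"
      have abc: "cbox a b \<subseteq> cod c" using ab by auto
      have "set_integrable lebesgue (U c) (\<lambda>y. ?h y * indicator (cbox a b) y)"
        by (rule ipT_chart_field(2)[OF c indicator_coord_test[OF c abc] D(2)]) auto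
      moreover have "indicator (U c) y *\<^sub>R (?h y * indicator (cbox a b) y) = indicator (cbox a b) y *\<^sub>R ?h y" for y
        using ab by (auto simp: indicator_def)
      ultimately show int: "set_integrable lebesgue (cbox a b) ?h" unfolding set_integrable_def by (simp only:)
      define \<psi> where "\<psi> k x = (if x \<in> fst c then box_bump k a b (snd c x) else 0)" for k x
      have \<psi>: "\<psi> k \<in> test_functions Atl (\<Omega> \<inter> fst c)" for k
        using box_bump_test(1)[OF c ab, of k] by (simp add: \<psi>_def[abs_def])
      have \<psi>e: "(\<psi> k \<circ> chart_inv c) y = box_bump k a b y" if "y \<in> cod c" for k y
        using box_bump_test(2)[OF c ab that, of k] by (simp add: \<psi>_def[abs_def])
      have zero: "(LINT y|lebesgue. indicator (cbox a b) y * ?h y * box_bump k a b y) = 0" for k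
      proof -
        have "ip 0 (chart_fun c (dcoord c (\<psi> k) v)) = 0" by (rule X2.zero_left[OF chart_fun_X2[OF c test_coord(2)[OF c \<psi>]]])
        then have "ipT \<zeta> (chart_field c v (\<psi> k \<circ> chart_inv c)) = 0" using D(3)[OF c \<psi>[of k], of v] by simp
        then have "(LINT y:U c|lebesgue. ?h y * (\<psi> k \<circ> chart_inv c) y) = 0"
          using ipT_chart_field(1)[OF c test_coord(1)[OF c \<psi>] D(2), of v k] by simp
        moreover have "indicator (U c) y *\<^sub>R (?h y * (\<psi> k \<circ> chart_inv c) y) = indicator (cbox a b) y * ?h y * box_bump k a b y" for y
        proof (cases "y \<in> U c")
          case True
          then have "y \<in> cod c" by auto
          then show ?thesis using True \<psi>e[of y k] box_bump_outside[of y a b k] box_subset_cbox[of a b] by (auto simp: indicator_def)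
        next
          case False
          then show ?thesis using ab by (auto simp: indicator_def)
        qed
        ultimately show ?thesis unfolding set_lebesgue_integral_def by (simp only:)
      qed
      have "(\<lambda>k. LINT y|lebesgue. indicator (cbox a b) y * ?h y * box_bump k a b y) \<longlonglongrightarrow> (LINT y|lebesgue. indicator (box a b) y * ?h y)"
      proof (rule integral_dominated_convergence[where w = "\<lambda>y. \<bar>indicator (cbox a b) y * ?h y\<bar>"])
        have int': "integrable lebesgue (\<lambda>y. indicator (cbox a b) y * ?h y)" using int by (simp add: set_integrable_def)
        then show "integrable lebesgue (\<lambda>y. \<bar>indicator (cbox a b) y * ?h y\<bar>)" by (rule integrable_abs)
        have "box_bump k a b \<in> borel_measurable borel" for k
          by (rule borel_measurable_continuous_onI) (rule smooth_on_continuous[OF smooth_box_bump])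
        then have "box_bump k a b \<in> borel_measurable lebesgue" for k using measurable_completion[of "box_bump k a b" lborel borel] by simp
        then show "(\<lambda>y. indicator (cbox a b) y * ?h y * box_bump k a b y) \<in> borel_measurable lebesgue" for k
          by (rule borel_measurable_times[OF borel_measurable_integrable[OF int']])
        have "set_integrable lebesgue (box a b) ?h" by (rule set_integrable_subset[OF int]) (auto simp: box_subset_cbox)
        then show "(\<lambda>y. indicator (box a b) y * ?h y) \<in> borel_measurable lebesgue" by (auto simp: set_integrable_def)
        show "AE y in lebesgue. norm (indicator (cbox a b) y * ?h y * box_bump k a b y) \<le> \<bar>indicator (cbox a b) y * ?h y\<bar>" for k
          using box_bump_bounds[of k a b] by (intro AE_I2) (simp add: abs_mult mult_left_le)
        have "(\<lambda>k. indicator (cbox a b) y * ?h y * box_bump k a b y) \<longlonglongrightarrow> indicator (box a b) y * ?h y" for y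
        proof (cases "y \<in> box a b")
          case True
          then have "y \<in> cbox a b" using box_subset_cbox by auto
          then show ?thesis using True tendsto_mult_left[OF box_bump_tendsto[OF True], of "?h y"] by simp
        next
          case False
          then show ?thesis by (simp add: box_bump_outside)
        qed
        then show "AE y in lebesgue. (\<lambda>k. indicator (cbox a b) y * ?h y * box_bump k a b y) \<longlonglongrightarrow> indicator (box a b) y * ?h y" by simp
      qed
      then show "(LINT y:box a b|lebesgue. ?h y) = 0" unfolding zero set_lebesgue_integral_def by (simp add: LIMSEQ_const_iff)
    qed
    have "AE y in lebesgue. \<forall>i\<in>(UNIV :: 'n set). y \<in> U c \<longrightarrow> g (chart_inv c y) (\<zeta> (chart_inv c y)) (fc c (chart_inv c y) (axis i 1)) = 0"
      by (rule AE_ball_countable') (use comp in auto)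
    then have "AE y in lebesgue. y \<in> cod c \<longrightarrow> chart_inv c y \<in> \<Omega> \<longrightarrow> \<zeta> (chart_inv c y) = 0"
    proof eventually_elim
      case (elim y)
      show ?case
      proof (intro impI)
        assume y: "y \<in> cod c" and "chart_inv c y \<in> \<Omega>"
        then have yU: "y \<in> U c" using mem_chart_image[OF c y, of \<Omega>] by simp
        let ?x = "chart_inv c y"
        have x: "?x \<in> fst c" by (rule chart_inv_mem[OF c y])
        have lin: "linear (fc c ?x)" by (rule fc_linear[OF c x])
        have "\<zeta> ?x = fc c ?x (tc c ?x (\<zeta> ?x))" using from_to[OF c x] by simp
        also have "\<dots> = (\<Sum>i\<in>UNIV. (tc c ?x (\<zeta> ?x) $ i) *\<^sub>R fc c ?x (axis i 1))"
          by (subst vec_basis_expansion[of "tc c ?x (\<zeta> ?x)"]) (simp add: linear_sum[OF lin] linear_cmul[OF lin])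
        finally have e: "\<zeta> ?x = (\<Sum>i\<in>UNIV. (tc c ?x (\<zeta> ?x) $ i) *\<^sub>R fc c ?x (axis i 1))" .
        have "g ?x (\<zeta> ?x) (\<zeta> ?x) = g ?x (\<zeta> ?x) (\<Sum>i\<in>UNIV. (tc c ?x (\<zeta> ?x) $ i) *\<^sub>R fc c ?x (axis i 1))"
          by (rule arg_cong[OF e])
        also have "\<dots> = 0" using elim yU by (simp add: g_sum_right g_bilin)
        finally show "\<zeta> ?x = 0" using g_pos[of "\<zeta> ?x" ?x] by force
      qed
    qed
    then show "AE y in Lc c. chart_inv c y \<in> \<Omega> \<longrightarrow> \<zeta> (chart_inv c y) = 0" using AE_Lc[OF c] by simp
  qed
  then have "AE x in \<mu>. x \<in> \<Omega> \<longrightarrow> \<zeta> x = 0" by (rule AE_of_charts)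
  then show ?thesis by (simp add: AE_N)
qed

lemma weak_grad_unique: assumes "weak_grad u \<xi>" "weak_grad u \<eta>" shows "AE x in N. \<xi> x = \<eta> x"
proof -
  have "weak_grad 0 (\<xi> - \<eta>)" using weak_grad_diff[OF assms] by simp
  from weak_grad_zero_unique[OF this] show ?thesis by eventually_elim simp
qed

subsection \<open>Test functions are Sobolev functions\<close>

definition gram :: "('m, 'n) chart \<Rightarrow> real ^ 'n \<Rightarrow> real ^ 'n ^ 'n" where
  "gram c y = gram_matrix Atl g c (chart_inv c y)"

text \<open>Cramer's rule for the equations \<open>g(\<eta>, e\<^sub>i) = \<partial>\<^sub>i \<psi>\<close>. The explicit formula shows that the solution is
  continuous in the point.\<close>

definition grad_coord :: "('m \<Rightarrow> real) \<Rightarrow> ('m, 'n) chart \<Rightarrow> real ^ 'n \<Rightarrow> real ^ 'n" where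
  "grad_coord \<psi> c y = (\<chi> k. det (\<chi> i j. if j = k then dcoord c \<psi> (axis i 1) y else gram c y $ i $ j) / det (gram c y))"

text \<open>The components of the gradient in the preferred chart at \<open>x\<close>.\<close>

definition classical_grad :: "('m \<Rightarrow> real) \<Rightarrow> 'm \<Rightarrow> real ^ 'n" where
  "classical_grad \<psi> x = fc (chart_at Atl x) x (grad_coord \<psi> (chart_at Atl x) (snd (chart_at Atl x) x))"

lemma grad_coord_iff:
  assumes c: "c \<in> Atl" and y: "y \<in> cod c"
  shows "(\<forall>i. G c y \<eta> (axis i 1) = dcoord c \<psi> (axis i 1) y) \<longleftrightarrow> \<eta> = grad_coord \<psi> c y"
proof -
  have "det (gram c y) \<noteq> 0" using gram_det_pos[OF c y] by (simp add: gram_def)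
  from cramer[OF this, of \<eta> "\<chi> i. dcoord c \<psi> (axis i 1) y"]
  have "gram c y *v \<eta> = (\<chi> i. dcoord c \<psi> (axis i 1) y) \<longleftrightarrow> \<eta> = grad_coord \<psi> c y"
    by (simp add: grad_coord_def cong: if_cong)
  moreover have "(gram c y *v \<eta>) $ i = G c y \<eta> (axis i 1)" for i
  proof -
    have "G c y \<eta> (axis i 1) = (\<Sum>k\<in>UNIV. \<Sum>j\<in>UNIV. \<eta> $ k * (axis i 1 :: real ^ 'n) $ j * G c y (axis k 1) (axis j 1))" by (rule G_expand[OF c y])
    also have "\<dots> = (\<Sum>k\<in>UNIV. \<eta> $ k * G c y (axis k 1) (axis i 1))"
      by (intro sum.cong refl) (simp add: axis_def if_distrib if_distribR cong: if_cong)
    also have "\<dots> = (gram c y *v \<eta>) $ i"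
      using g_sym by (simp add: matrix_vector_mult_def gram_def gram_matrix_eq G_def mult.commute)
    finally show ?thesis by simp
  qed
  ultimately show ?thesis by (simp add: vec_eq_iff)
qed

lemma chart_deriv: assumes "smooth_on (cod c) (\<psi> \<circ> chart_inv c)" "y \<in> cod c"
  shows "((\<psi> \<circ> chart_inv c) has_derivative (\<lambda>v. dcoord c \<psi> v y)) (at y)"
  using smooth_on_differentiable[OF assms] by (simp add: frechet_derivative_works)

text \<open>The gradient defined by the preferred chart represents the differential in every chart, by the chain
  rule.\<close>

lemma classical_grad:
  assumes \<psi>: "smooth_fun Atl \<psi>" and c: "c \<in> Atl" and x: "x \<in> fst c"
  shows "g x (classical_grad \<psi> x) (fc c x v) = dcoord c \<psi> v (snd c x)"
    and "tc c x (classical_grad \<psi> x) = grad_coord \<psi> c (snd c x)"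
proof -
  have s: "smooth_on (cod c) (\<psi> \<circ> chart_inv c)" if "c \<in> Atl" for c using \<psi> that by (auto simp: smooth_fun_def)
  have expand: "dcoord c \<psi> v y = (\<Sum>i\<in>UNIV. v $ i * dcoord c \<psi> (axis i 1) y)" if c: "c \<in> Atl" and y: "y \<in> cod c" for c y v
  proof -
    have lin: "linear (\<lambda>v. dcoord c \<psi> v y)" using chart_deriv[OF s[OF c] y] has_derivative_linear by blast
    show ?thesis by (subst vec_basis_expansion[of v]) (simp add: linear_sum[OF lin] linear_cmul[OF lin])
  qed
  let ?d = "chart_at Atl x"
  have d: "?d \<in> Atl" "x \<in> fst ?d" by (rule chart_at)+
  have yd: "snd ?d x \<in> cod ?d" using d by simp
  have yc: "snd c x \<in> cod c" using x by simp
  have Gd: "g x (classical_grad \<psi> x) (fc ?d x v) = dcoord ?d \<psi> v (snd ?d x)" for v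
  proof -
    have "g x (classical_grad \<psi> x) (fc ?d x v) = G ?d (snd ?d x) (grad_coord \<psi> ?d (snd ?d x)) v"
      by (simp add: classical_grad_def G_def inv_chart[OF d])
    also have "\<dots> = (\<Sum>i\<in>UNIV. v $ i * G ?d (snd ?d x) (grad_coord \<psi> ?d (snd ?d x)) (axis i 1))"
      unfolding G_def
      by (subst vec_basis_expansion[of v]) (simp add: linear_sum[OF fc_linear[OF d(1) chart_inv_mem[OF d(1) yd]]] linear_cmul[OF fc_linear[OF d(1) chart_inv_mem[OF d(1) yd]]] g_sum_right g_bilin)
    also have "\<dots> = (\<Sum>i\<in>UNIV. v $ i * dcoord ?d \<psi> (axis i 1) (snd ?d x))"
      using grad_coord_iff[OF d(1) yd, of "grad_coord \<psi> ?d (snd ?d x)" \<psi>] by simp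
    also have "\<dots> = dcoord ?d \<psi> v (snd ?d x)" by (rule expand[OF d(1) yd, symmetric])
    finally show ?thesis .
  qed
  show 1: "g x (classical_grad \<psi> x) (fc c x v) = dcoord c \<psi> v (snd c x)" for v
  proof -
    have tr: "((snd ?d \<circ> chart_inv c) has_derivative change_components c ?d x) (at (snd c x))" by (rule transition_derivative[OF c d(1) x d(2)])
    have tx: "(snd ?d \<circ> chart_inv c) (snd c x) = snd ?d x" using inv_chart[OF c x] by simp
    have "((\<psi> \<circ> chart_inv ?d) has_derivative (\<lambda>v. dcoord ?d \<psi> v (snd ?d x))) (at ((snd ?d \<circ> chart_inv c) (snd c x)))"
      unfolding tx by (rule chart_deriv[OF s[OF d(1)] yd])
    from diff_chain_at[OF tr this]
    have "(((\<psi> \<circ> chart_inv ?d) \<circ> (snd ?d \<circ> chart_inv c)) has_derivative ((\<lambda>v. dcoord ?d \<psi> v (snd ?d x)) \<circ> change_components c ?d x)) (at (snd c x))" .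
    then have "((\<psi> \<circ> chart_inv c) has_derivative ((\<lambda>v. dcoord ?d \<psi> v (snd ?d x)) \<circ> change_components c ?d x)) (at (snd c x))"
    proof (rule has_derivative_transform_within_open)
      show "open (snd c ` (fst ?d \<inter> fst c))" by (rule open_chart_image[OF c chart_open[OF d(1)]])
      show "snd c x \<in> snd c ` (fst ?d \<inter> fst c)" using x d by auto
      show "((\<psi> \<circ> chart_inv ?d) \<circ> (snd ?d \<circ> chart_inv c)) y = (\<psi> \<circ> chart_inv c) y" if "y \<in> snd c ` (fst ?d \<inter> fst c)" for y
        using that inv_chart[OF c] inv_chart[OF d(1)] by auto
    qed
    then have "(\<lambda>v. dcoord ?d \<psi> v (snd ?d x)) \<circ> change_components c ?d x = (\<lambda>v. dcoord c \<psi> v (snd c x))"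
      using chart_deriv[OF s[OF c] yc] has_derivative_unique by blast
    then have "dcoord c \<psi> v (snd c x) = dcoord ?d \<psi> (change_components c ?d x v) (snd ?d x)" by (metis comp_apply)
    also have "\<dots> = g x (classical_grad \<psi> x) (fc ?d x (change_components c ?d x v))" by (rule Gd[symmetric])
    also have "fc ?d x (change_components c ?d x v) = fc c x v" by (rule fc_change[OF c d(1) x d(2)])
    finally show ?thesis by (rule sym)
  qed
  have "G c (snd c x) (tc c x (classical_grad \<psi> x)) (axis i 1) = dcoord c \<psi> (axis i 1) (snd c x)" for i
    using 1[of "axis i 1"] by (simp add: G_def inv_chart[OF c x] from_to[OF c x])
  then show "tc c x (classical_grad \<psi> x) = grad_coord \<psi> c (snd c x)"
    using grad_coord_iff[OF c yc] by blast
qed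

lemma grad_coord_cont:
  assumes \<psi>: "smooth_fun Atl \<psi>" and c: "c \<in> Atl"
  shows "continuous_on (cod c) (\<lambda>y. grad_coord \<psi> c y $ k)"
proof -
  have s: "smooth_on (cod c) (\<psi> \<circ> chart_inv c)" using \<psi> c by (auto simp: smooth_fun_def)
  have "continuous_on (cod c) (\<lambda>y. det (\<chi> i j. if j = k then dcoord c \<psi> (axis i 1) y else gram c y $ i $ j) / det (gram c y))"
  proof (rule continuous_on_divide)
    show "continuous_on (cod c) (\<lambda>y. det (\<chi> i j. if j = k then dcoord c \<psi> (axis i 1) y else gram c y $ i $ j))"
    proof (rule det_continuous_on)
      fix i j
      show "continuous_on (cod c) (\<lambda>y. (\<chi> i j. if j = k then dcoord c \<psi> (axis i 1) y else gram c y $ i $ j) $ i $ j)"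
        using smooth_on_continuous[OF smooth_on_derivative[OF s, of "axis i 1"]] G_cont[OF c, of "axis i 1" "axis j 1"]
        by (cases "j = k") (simp_all add: gram_def gram_matrix_eq)
    qed
    show "continuous_on (cod c) (\<lambda>y. det (gram c y))" unfolding gram_def by (rule gram_det_cont[OF c])
    show "\<forall>y\<in>cod c. det (gram c y) \<noteq> 0" unfolding gram_def using gram_det_pos[OF c] by (metis less_irrefl)
  qed
  then show ?thesis by (simp add: grad_coord_def)
qed

text \<open>Integration by parts in a chart: the product of \<open>\<psi>\<close> with the test function has compact support, so
  the integral of its derivative vanishes.\<close>

lemma test_weak_grad:
  assumes \<psi>: "\<psi> \<in> test_functions Atl \<Omega>"
  shows "weak_grad \<psi> (classical_grad \<psi>)"
proof (rule weak_grad_I)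
  have sf: "smooth_fun Atl \<psi>" and Sc: "compact (closure {x. \<psi> x \<noteq> 0})" and S\<Omega>: "closure {x. \<psi> x \<noteq> 0} \<subseteq> \<Omega>" 
    using \<psi> by (auto simp: test_functions_def)
  let ?S = "closure {x. \<psi> x \<noteq> 0}"
  have sm: "smooth_on (cod c) (\<psi> \<circ> chart_inv c)" if "c \<in> Atl" for c using sf that by (auto simp: smooth_fun_def)
  have \<psi>0: "\<psi> x = 0" if "x \<notin> ?S" for x
    by (rule ccontr) (use that subsetD[OF closure_subset, of x "{x. \<psi> x \<noteq> 0}"] in simp)
  have d0: "dcoord c \<psi> v (snd c x) = 0" if "x \<notin> ?S" "c \<in> Atl" "x \<in> fst c" for c x v
  proof -
    have "frechet_derivative (\<lambda>_. 0) (at (snd c x)) = frechet_derivative (\<psi> \<circ> chart_inv c) (at (snd c x))"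
    proof (rule frechet_derivative_transform_within_open)
      show "open (snd c ` ((- ?S) \<inter> fst c))" by (rule open_chart_image[OF that(2)]) auto
      show "snd c x \<in> snd c ` ((- ?S) \<inter> fst c)" using that by auto
      show "0 = (\<psi> \<circ> chart_inv c) y" if y: "y \<in> snd c ` ((- ?S) \<inter> fst c)" for y
      proof -
        obtain x' where x': "x' \<notin> ?S" "x' \<in> fst c" "y = snd c x'" using y by blast
        show ?thesis using \<psi>0[OF x'(1)] inv_chart[OF \<open>c \<in> Atl\<close> x'(2)] x'(3) by simp
      qed
    qed auto
    then show ?thesis by (metis frechet_derivative_const)
  qed
  have cg0: "classical_grad \<psi> x = 0" if "x \<notin> ?S" for x
  proof -
    obtain c where c: "c \<in> Atl" "x \<in> fst c" using chart_cover by blast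
    have "g x (classical_grad \<psi> x) (fc c x (tc c x (classical_grad \<psi> x))) = 0"
      using classical_grad(1)[OF sf c] d0[OF that c] by simp
    then have "g x (classical_grad \<psi> x) (classical_grad \<psi> x) = 0" using from_to[OF c] by simp
    then show ?thesis using g_pos[of "classical_grad \<psi> x" x] by force
  qed
  show \<psi>X: "\<psi> \<in> X2"
  proof -
    obtain C where C: "\<forall>x\<in>?S. norm (\<psi> x) \<le> C"
      by (rule exE[OF compact_continuous_bound[OF Sc continuous_on_subset[OF smooth_fun_cont[OF sf] subset_UNIV]]])
    have "\<bar>\<psi> x\<bar> \<le> max 0 C" for x using bspec[OF C, of x] \<psi>0[of x] by (cases "x \<in> ?S") auto
    moreover have "\<psi> \<in> borel_measurable N" by (rule cont_bm[OF continuous_on_subset[OF smooth_fun_cont[OF sf]]]) simp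
    ultimately show ?thesis by (intro bounded_X2) auto
  qed
  show cX: "classical_grad \<psi> \<in> XT"
  proof -
    have ms: "measurable_section M \<Omega> (classical_grad \<psi>)"
      unfolding section_iff
    proof
      fix c assume c: "c \<in> Atl"
      have "(\<lambda>x. grad_coord \<psi> c (snd c x)) \<in> borel_measurable (restrict_space \<mu> (\<Omega> \<inter> fst c))"
      proof (rule vec_bm)
        show "(\<lambda>x. grad_coord \<psi> c (snd c x) $ i) \<in> borel_measurable (restrict_space \<mu> (\<Omega> \<inter> fst c))" for i
          by (intro cont_bm continuous_on_compose2[OF grad_coord_cont[OF sf c, of i] continuous_on_subset[OF chart_cont[OF c]]]) auto
      qed
      then show "(\<lambda>x. tc c x (classical_grad \<psi> x)) \<in> borel_measurable (restrict_space \<mu> (\<Omega> \<inter> fst c))"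
        by (rule bm_cong[rotated]) (use classical_grad(2)[OF sf c] in auto)
    qed
    let ?q = "\<lambda>x. g x (classical_grad \<psi> x) (classical_grad \<psi> x)"
    have "continuous_on UNIV ?q"
    proof (rule continuous_of_charts)
      fix c assume c: "c \<in> Atl"
      have "continuous_on (cod c) (\<lambda>y. \<Sum>i\<in>UNIV. \<Sum>j\<in>UNIV. grad_coord \<psi> c y $ i * grad_coord \<psi> c y $ j * G c y (axis i 1) (axis j 1))"
        by (intro continuous_on_sum continuous_on_mult grad_coord_cont[OF sf c] G_cont[OF c])
      then show "continuous_on (cod c) (\<lambda>y. ?q (chart_inv c y))"
      proof (rule continuous_on_eq)
        fix y assume y: "y \<in> cod c"
        have x: "chart_inv c y \<in> fst c" by (rule chart_inv_mem[OF c y])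
        show "(\<Sum>i\<in>UNIV. \<Sum>j\<in>UNIV. grad_coord \<psi> c y $ i * grad_coord \<psi> c y $ j * G c y (axis i 1) (axis j 1)) = ?q (chart_inv c y)"
          unfolding G_expand[OF c y, symmetric] g_eq_G[OF c x] classical_grad(2)[OF sf c x] chart_inv[OF c y] ..
      qed
    qed
    from compact_continuous_bound[OF Sc continuous_on_subset[OF this subset_UNIV]]
    obtain C where C: "\<forall>x\<in>?S. norm (?q x) \<le> C" by (rule exE)
    have "?q x \<le> max 0 C" for x using bspec[OF C, of x] cg0[of x] by (cases "x \<in> ?S") (auto simp: g_bilin)
    then show ?thesis by (intro bounded_XT[OF ms]) auto
  qed
  fix c v \<phi> assume c: "c \<in> Atl" and \<phi>: "\<phi> \<in> test_functions Atl (\<Omega> \<inter> fst c)"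
  let ?\<psi> = "\<psi> \<circ> chart_inv c" and ?\<phi> = "\<phi> \<circ> chart_inv c"
  obtain K where K: "compact K" "K \<subseteq> U c" "\<And>y. y \<in> cod c \<Longrightarrow> y \<notin> K \<Longrightarrow> ?\<phi> y = 0"
    "\<And>y v. y \<in> cod c \<Longrightarrow> y \<notin> K \<Longrightarrow> dcoord c \<phi> v y = 0"
    using test_support[OF c \<phi> Int_lower2] by metis
  define F where "F y = (if y \<in> cod c then ?\<psi> y * ?\<phi> y else 0)" for y
  define D where "D y = (if y \<in> cod c then ?\<psi> y * dcoord c \<phi> v y + dcoord c \<psi> v y * ?\<phi> y else 0)" for y
  have Kc: "K \<subseteq> cod c" using K(2) by auto
  have oK: "open (- K)" using K(1) by (simp add: compact_imp_closed open_Compl)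
  have F0: "F y = 0" if "y \<notin> K" for y using K(3)[OF _ that] by (auto simp: F_def)
  have D0: "D y = 0" if "y \<notin> K" for y using K(3)[OF _ that] K(4)[OF _ that] by (auto simp: D_def)
  have derK: "(F has_derivative (\<lambda>h. ?\<psi> y * dcoord c \<phi> h y + dcoord c \<psi> h y * ?\<phi> y)) (at y)" if y: "y \<in> cod c" for y
  proof -
    have "((\<lambda>y. ?\<psi> y * ?\<phi> y) has_derivative (\<lambda>h. ?\<psi> y * dcoord c \<phi> h y + dcoord c \<psi> h y * ?\<phi> y)) (at y)"
      by (rule has_derivative_mult[OF chart_deriv[OF sm[OF c] y] chart_deriv[OF test_smooth[OF \<phi> c] y]])
    then show ?thesis by (rule has_derivative_transform_within_open[OF _ cod_open[OF c] y]) (simp add: F_def)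
  qed
  have derO: "(F has_derivative (\<lambda>h. 0)) (at y)" if "y \<notin> K" for y
    by (rule has_derivative_transform_within_open[of "\<lambda>_. 0" _ _ _ "- K"]) (use oK that F0 in auto)
  have FD: "frechet_derivative F (at y) v = D y" for y
  proof (cases "y \<in> cod c")
    case True
    then show ?thesis using fun_cong[OF frechet_derivative_at[OF derK[OF True]], of v] by (simp add: D_def)
  next
    case False
    then have "y \<notin> K" using Kc by auto
    then show ?thesis using fun_cong[OF frechet_derivative_at[OF derO], of y v] D0 by simp
  qed
  have Dcont: "continuous_on UNIV D"
  proof -
    have "continuous_on (cod c) (\<lambda>y. ?\<psi> y * dcoord c \<phi> v y + dcoord c \<psi> v y * ?\<phi> y)"
      by (intro continuous_on_add continuous_on_mult smooth_on_continuous smooth_on_derivative sm c test_smooth[OF \<phi>])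
    then have "continuous_on (cod c) D" by (rule continuous_on_eq) (simp add: D_def)
    moreover have "continuous_on (- K) D" by (rule continuous_on_eq[OF continuous_on_const[of _ 0]]) (use D0 in auto)
    ultimately have "continuous_on (cod c \<union> - K) D" by (intro continuous_on_open_Un cod_open[OF c] oK)
    moreover have "cod c \<union> - K = UNIV" using Kc by auto
    ultimately show ?thesis by simp
  qed
  have "(LINT y|lborel. frechet_derivative F (at y) v) = 0"
  proof (rule integral_derivative_compact_support[OF _ _ K(1) F0])
    show "F differentiable (at y)" for y using derK[of y] derO[of y] Kc by (cases "y \<in> cod c") (auto simp: differentiable_def)
    show "continuous_on UNIV (\<lambda>y. frechet_derivative F (at y) v)" using Dcont by (simp add: FD)
  qed
  then have "(LINT y|lborel. D y) = 0" by (simp add: FD)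
  then have D_int: "(LINT y|lebesgue. D y) = 0" 
    using integral_completion[of D lborel] borel_measurable_continuous_onI[OF Dcont] by simp
  have e: "ipT (classical_grad \<psi>) (chart_field c v ?\<phi>) = (LINT y:U c|lebesgue. dcoord c \<psi> v y * ?\<phi> y)"
    and i: "set_integrable lebesgue (U c) (\<lambda>y. dcoord c \<psi> v y * ?\<phi> y)"
  proof -
    have eq: "g (chart_inv c y) (classical_grad \<psi> (chart_inv c y)) (fc c (chart_inv c y) v) = dcoord c \<psi> v y" if "y \<in> U c" for y
    proof -
      have y: "y \<in> cod c" using that by auto
      show ?thesis using classical_grad(1)[OF sf c chart_inv_mem[OF c y], of v] chart_inv[OF c y] by simp
    qed
    have ind: "indicator (U c) y *\<^sub>R (g (chart_inv c y) (classical_grad \<psi> (chart_inv c y)) (fc c (chart_inv c y) v) * ?\<phi> y) = indicator (U c) y *\<^sub>R (dcoord c \<psi> v y * ?\<phi> y)" for y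
      using eq[of y] by (cases "y \<in> U c") simp_all
    show "ipT (classical_grad \<psi>) (chart_field c v ?\<phi>) = (LINT y:U c|lebesgue. dcoord c \<psi> v y * ?\<phi> y)"
      using ipT_chart_field(1)[OF c test_coord(1)[OF c \<phi>] cX, of v] unfolding set_lebesgue_integral_def ind by simp
    show "set_integrable lebesgue (U c) (\<lambda>y. dcoord c \<psi> v y * ?\<phi> y)"
      using ipT_chart_field(2)[OF c test_coord(1)[OF c \<phi>] cX, of v] unfolding set_integrable_def ind by simp
  qed
  have "ip \<psi> (chart_fun c (dcoord c \<phi> v)) + ipT (classical_grad \<psi>) (chart_field c v ?\<phi>) 
    = (LINT y:U c|lebesgue. \<psi> (chart_inv c y) * dcoord c \<phi> v y + dcoord c \<psi> v y * ?\<phi> y)"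
    unfolding ip_chart_fun[OF c test_coord(2)[OF c \<phi>] \<psi>X] e
    by (rule set_integral_add(2)[symmetric]) (rule ip_chart_fun_integrable[OF c test_coord(2)[OF c \<phi>] \<psi>X], rule i)
  also have "\<dots> = (LINT y|lebesgue. D y)"
    unfolding set_lebesgue_integral_def
  proof (rule Bochner_Integration.integral_cong[OF refl])
    fix y
    show "indicator (U c) y *\<^sub>R (\<psi> (chart_inv c y) * dcoord c \<phi> v y + dcoord c \<psi> v y * ?\<phi> y) = D y"
    proof (cases "y \<in> U c")
      case True
      then have "y \<in> cod c" by auto
      then show ?thesis using True by (simp add: D_def)
    next
      case False
      then have "y \<notin> K" using K(2) by auto
      then show ?thesis using D0 False by simp
    qed
  qed
  finally show "ip \<psi> (chart_fun c (dcoord c \<phi> v)) + ipT (classical_grad \<psi>) (chart_field c v ?\<phi>) = 0" using D_int by simp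
qed

end

section \<open>Sobolev spaces\<close>

text \<open>The Riesz-Fischer theorem for fibrewise norms. The square norm \<open>Q x\<close> depends on the point and is only
  comparable to the Euclidean one at each single point, so completeness does not reduce to that of a
  space of vector valued functions. A subsequence with summable differences converges almost everywhere,
  and Fatou's lemma identifies the limit.\<close>

lemma pointwise_limit_of_Cauchy:
  fixes F :: "nat \<Rightarrow> 'x \<Rightarrow> 'e::euclidean_space" and Q :: "'x \<Rightarrow> 'e \<Rightarrow> real"
  assumes meas: "\<And>m n. (\<lambda>x. Q x (F m x - F n x)) \<in> borel_measurable M"
    and cont: "\<And>x. continuous_on UNIV (Q x)"
    and lower: "\<And>x. \<exists>c>0. \<forall>v. c * (norm v)\<^sup>2 \<le> Q x v"
    and Cauchy: "\<And>e. e > 0 \<Longrightarrow> \<exists>N. \<forall>m\<ge>N. \<forall>n\<ge>N. (\<integral>\<^sup>+x. ennreal (Q x (F m x - F n x)) \<partial>M) \<le> ennreal e"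
  shows "\<exists>r::nat\<Rightarrow>nat. (AE x in M. convergent (\<lambda>k. F (r k) x)) \<and>
    (\<forall>e>0. \<exists>N. \<forall>n\<ge>N. (\<integral>\<^sup>+x. ennreal (Q x (F n x - lim (\<lambda>k. F (r k) x))) \<partial>M) \<le> ennreal e)"
proof -
  have "\<exists>N. \<forall>m\<ge>N. \<forall>n\<ge>N. (\<integral>\<^sup>+x. ennreal (Q x (F m x - F n x)) \<partial>M) \<le> ennreal ((1/4) ^ k)" for k :: nat
    by (rule Cauchy) simp
  then obtain N where N: "\<And>k m n. m \<ge> N k \<Longrightarrow> n \<ge> N k \<Longrightarrow> (\<integral>\<^sup>+x. ennreal (Q x (F m x - F n x)) \<partial>M) \<le> ennreal ((1/4) ^ k)" by metis
  \<comment> \<open>A monotone sequence that stays above every \<open>N k\<close> and above \<open>k\<close>.\<close>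
  define r where "r k = k + (\<Sum>i\<le>k. N i)" for k
  have rN: "r k \<ge> N k" for k unfolding r_def using member_le_sum[of k "{..k}" N] by simp
  have r_ge: "r k \<ge> k" for k by (simp add: r_def)
  have rS: "r (Suc k) \<ge> r k" for k by (simp add: r_def)
  have Q0: "0 \<le> Q x v" for x v
  proof -
    obtain c where c: "c > 0" "\<forall>v. c * (norm v)\<^sup>2 \<le> Q x v" using lower[of x] by blast
    have "0 \<le> c * (norm v)\<^sup>2" using c(1) by simp
    also have "\<dots> \<le> Q x v" using c(2) by blast
    finally show ?thesis .
  qed
  let ?q = "\<lambda>k x. Q x (F (r (Suc k)) x - F (r k) x)"
  have qm: "?q k \<in> borel_measurable M" for k by (rule meas)
  have "(\<integral>\<^sup>+x. (\<Sum>k. ennreal (2 ^ k * ?q k x)) \<partial>M) = (\<Sum>k. \<integral>\<^sup>+x. ennreal (2 ^ k * ?q k x) \<partial>M)"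
    by (rule nn_integral_suminf) (use qm in simp)
  also have "\<dots> \<le> (\<Sum>k. ennreal ((1/2) ^ k))"
  proof (rule suminf_le)
    fix k
    have "(\<integral>\<^sup>+x. ennreal (2 ^ k * ?q k x) \<partial>M) = ennreal (2 ^ k) * (\<integral>\<^sup>+x. ennreal (?q k x) \<partial>M)"
      using qm Q0 by (subst nn_integral_cmult[symmetric]) (auto simp: ennreal_mult')
    also have "\<dots> \<le> ennreal (2 ^ k) * ennreal ((1/4) ^ k)"
      using order_trans[OF rN rS] rN by (intro mult_left_mono N) auto
    also have "\<dots> = ennreal ((1/2) ^ k)" by (simp add: ennreal_mult[symmetric] power_mult_distrib[symmetric])
    finally show "(\<integral>\<^sup>+x. ennreal (2 ^ k * ?q k x) \<partial>M) \<le> ennreal ((1/2) ^ k)" .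
  qed auto
  also have "\<dots> < \<infinity>"
    unfolding infinity_ennreal_def less_top[symmetric]
    by (rule ennreal_suminf_neq_top) (auto intro!: summable_geometric)
  finally have fin: "(\<integral>\<^sup>+x. (\<Sum>k. ennreal (2 ^ k * ?q k x)) \<partial>M) \<noteq> \<infinity>" by simp
  have "AE x in M. (\<Sum>k. ennreal (2 ^ k * ?q k x)) \<noteq> \<infinity>"
    by (rule nn_integral_PInf_AE[OF _ fin]) (use qm in simp)
  then have conv: "AE x in M. convergent (\<lambda>k. F (r k) x)"
  proof eventually_elim
    case (elim x)
    define T where "T = enn2real (\<Sum>k. ennreal (2 ^ k * ?q k x))"
    have T: "ennreal T = (\<Sum>k. ennreal (2 ^ k * ?q k x))" using elim by (simp add: T_def less_top)
    have T0: "T \<ge> 0" by (simp add: T_def)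
    have qT: "2 ^ k * ?q k x \<le> T" for k
    proof -
      have "ennreal (2 ^ k * ?q k x) \<le> (\<Sum>k. ennreal (2 ^ k * ?q k x))"
        using sum_le_suminf[of "\<lambda>k. ennreal (2 ^ k * ?q k x)" "{k}"] by simp
      then show ?thesis unfolding T[symmetric] using T0 by simp
    qed
    obtain c where c: "c > 0" "\<And>v. c * (norm v)\<^sup>2 \<le> Q x v" using lower by blast
    have bound: "norm (F (r (Suc k)) x - F (r k) x) \<le> sqrt (T / c) * (sqrt (1/2)) ^ k" for k
    proof (rule power2_le_imp_le)
      have "2 ^ k * (c * (norm (F (r (Suc k)) x - F (r k) x))\<^sup>2) \<le> T"
        by (rule order_trans[OF mult_left_mono[OF c(2)] qT]) simp
      then have "(norm (F (r (Suc k)) x - F (r k) x))\<^sup>2 \<le> T / c * (1/2) ^ k"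
        using c(1) by (simp add: field_simps power_divide)
      also have "\<dots> = (sqrt (T / c) * (sqrt (1/2)) ^ k)\<^sup>2"
        using T0 c(1) by (simp add: power_mult_distrib power_mult[symmetric] mult.commute[of _ 2]) (simp add: power_mult)
      finally show "(norm (F (r (Suc k)) x - F (r k) x))\<^sup>2 \<le> (sqrt (T / c) * (sqrt (1/2)) ^ k)\<^sup>2" .
    qed (use T0 c(1) in simp)
    have "summable (\<lambda>k. sqrt (T / c) * (sqrt (1/2)) ^ k)"
      by (intro summable_mult summable_geometric) (simp add: real_sqrt_lt_1_iff)
    then have "summable (\<lambda>k. F (r (Suc k)) x - F (r k) x)"
      by (rule summable_comparison_test'[where N = 0]) (use bound in auto)
    then have "convergent (\<lambda>n. \<Sum>k<n. F (r (Suc k)) x - F (r k) x)" by (simp add: summable_iff_convergent)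
    then have "convergent (\<lambda>n. F (r n) x - F (r 0) x)" by (simp only: sum_lessThan_telescope[of "\<lambda>k. F (r k) x"])
    then have "convergent (\<lambda>n. (F (r n) x - F (r 0) x) + F (r 0) x)" by (intro convergent_add convergent_const)
    then show ?case by simp
  qed
  have "\<exists>N. \<forall>n\<ge>N. (\<integral>\<^sup>+x. ennreal (Q x (F n x - lim (\<lambda>k. F (r k) x))) \<partial>M) \<le> ennreal e" if e: "e > 0" for e
  proof -
    obtain N1 where N1: "\<And>m n. m \<ge> N1 \<Longrightarrow> n \<ge> N1 \<Longrightarrow> (\<integral>\<^sup>+x. ennreal (Q x (F m x - F n x)) \<partial>M) \<le> ennreal e"
      using Cauchy[OF e] by blast
    have "(\<integral>\<^sup>+x. ennreal (Q x (F n x - lim (\<lambda>k. F (r k) x))) \<partial>M) \<le> ennreal e" if n: "n \<ge> N1" for n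
    proof -
      have "AE x in M. ennreal (Q x (F n x - lim (\<lambda>k. F (r k) x))) = liminf (\<lambda>k. ennreal (Q x (F n x - F (r k) x)))"
        using conv
      proof eventually_elim
        case (elim x)
        then have "(\<lambda>k. F (r k) x) \<longlonglongrightarrow> lim (\<lambda>k. F (r k) x)" by (simp add: convergent_LIMSEQ_iff)
        then have "(\<lambda>k. F n x - F (r k) x) \<longlonglongrightarrow> F n x - lim (\<lambda>k. F (r k) x)" by (intro tendsto_intros)
        then have "(\<lambda>k. Q x (F n x - F (r k) x)) \<longlonglongrightarrow> Q x (F n x - lim (\<lambda>k. F (r k) x))"
          by (intro continuous_on_tendsto_compose[OF cont[of x]]) auto
        then have "(\<lambda>k. ennreal (Q x (F n x - F (r k) x))) \<longlonglongrightarrow> ennreal (Q x (F n x - lim (\<lambda>k. F (r k) x)))"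
          by (rule tendsto_ennrealI)
        from lim_imp_Liminf[OF _ this] show ?case by simp
      qed
      then have "(\<integral>\<^sup>+x. ennreal (Q x (F n x - lim (\<lambda>k. F (r k) x))) \<partial>M) = (\<integral>\<^sup>+x. liminf (\<lambda>k. ennreal (Q x (F n x - F (r k) x))) \<partial>M)"
        by (rule nn_integral_cong_AE)
      also have "\<dots> \<le> liminf (\<lambda>k. \<integral>\<^sup>+x. ennreal (Q x (F n x - F (r k) x)) \<partial>M)"
        by (rule nn_integral_liminf) (use meas in simp)
      also have "\<dots> \<le> ennreal e"
      proof (rule Liminf_le)
        have "\<And>k. k \<ge> N1 \<Longrightarrow> (\<integral>\<^sup>+x. ennreal (Q x (F n x - F (r k) x)) \<partial>M) \<le> ennreal e"
          using N1[OF n] r_ge order_trans by blast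
        then show "\<forall>\<^sub>F k in sequentially. (\<integral>\<^sup>+x. ennreal (Q x (F n x - F (r k) x)) \<partial>M) \<le> ennreal e"
          by (rule eventually_sequentiallyI)
      qed simp
      finally show ?thesis .
    qed
    then show ?thesis by blast
  qed
  then show ?thesis using conv by blast
qed

context mfd_domain
begin

lemma g_continuous: "continuous_on UNIV (\<lambda>v. g x v v)"
proof -
  have "bounded_bilinear (g x)" using g_bilinear by (simp add: bilinear_conv_bounded_bilinear)
  then show ?thesis by (rule bounded_bilinear.continuous_on) (intro continuous_on_id)+
qed

lemma g_lower: "\<exists>c>0. \<forall>v. c * (norm v)\<^sup>2 \<le> g x v v"
proof -
  let ?S = "sphere (0 :: real ^ 'n) 1"
  have ne: "?S \<noteq> {}" by simp
  obtain v0 where v0: "v0 \<in> ?S" "\<And>v. v \<in> ?S \<Longrightarrow> g x v0 v0 \<le> g x v v"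
    using continuous_attains_inf[OF compact_sphere ne continuous_on_subset[OF g_continuous[of x] subset_UNIV]] by blast
  have "v0 \<noteq> 0" using v0(1) by auto
  then have p: "g x v0 v0 > 0" by (rule g_pos)
  have "g x v0 v0 * (norm v)\<^sup>2 \<le> g x v v" for v
  proof (cases "v = 0")
    case False
    define u where "u = (1 / norm v) *\<^sub>R v"
    have "u \<in> ?S" using False by (simp add: u_def)
    then have "g x v0 v0 \<le> g x u u" by (rule v0(2))
    also have "\<dots> = g x v v / (norm v)\<^sup>2" by (simp add: u_def g_bilin power2_eq_square)
    finally show ?thesis using False by (simp add: field_simps)
  qed (simp add: g_bilin)
  then show ?thesis using p by blast
qed

text \<open>Functions and vector fields are completed together: this is the square norm on pairs that belongs to
  the \<open>H\<^sup>1\<close> norm.\<close>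

definition pair_square :: "'m \<Rightarrow> real \<times> (real ^ 'n) \<Rightarrow> real" where "pair_square x p = (fst p)\<^sup>2 + g x (snd p) (snd p)"

lemma pair_square_continuous: "continuous_on UNIV (pair_square x)"
  unfolding pair_square_def
  by (intro continuous_intros continuous_on_compose2[OF g_continuous[of x]]) auto

lemma pair_square_lower: "\<exists>c>0. \<forall>p. c * (norm p)\<^sup>2 \<le> pair_square x p"
proof -
  obtain c where c: "c > 0" "\<And>v. c * (norm v)\<^sup>2 \<le> g x v v" using g_lower by blast
  have "min c 1 * (norm p)\<^sup>2 \<le> pair_square x p" for p
  proof -
    have "(norm p)\<^sup>2 = (fst p)\<^sup>2 + (norm (snd p))\<^sup>2" by (cases p) (simp add: norm_Pair)
    then have "min c 1 * (norm p)\<^sup>2 = min c 1 * (fst p)\<^sup>2 + min c 1 * (norm (snd p))\<^sup>2" by (simp add: algebra_simps)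
    also have "\<dots> \<le> 1 * (fst p)\<^sup>2 + c * (norm (snd p))\<^sup>2" by (intro add_mono mult_right_mono) auto
    finally show ?thesis using c(2)[of "snd p"] by (simp add: pair_square_def)
  qed
  then show ?thesis using c(1) by (intro exI[of _ "min c 1"]) auto
qed

lemma fields_complete:
  assumes u: "\<And>n::nat. u n \<in> X2" and \<xi>: "\<And>n. \<xi> n \<in> XT"
    and Cauchy: "\<And>e. e > 0 \<Longrightarrow> \<exists>N. \<forall>m\<ge>N. \<forall>n\<ge>N. ip (u m - u n) (u m - u n) + ipT (\<xi> m - \<xi> n) (\<xi> m - \<xi> n) < e"
  shows "\<exists>v\<in>X2. \<exists>\<eta>\<in>XT. (\<lambda>n. ip (u n - v) (u n - v)) \<longlonglongrightarrow> 0 \<and> (\<lambda>n. ipT (\<xi> n - \<eta>) (\<xi> n - \<eta>)) \<longlonglongrightarrow> 0"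
proof -
  define F where "F n x = (u n x, \<xi> n x)" for n x
  have QF: "pair_square x (F m x - F n x) = ((u m - u n) x)\<^sup>2 + g x ((\<xi> m - \<xi> n) x) ((\<xi> m - \<xi> n) x)" for m n x
    by (simp add: pair_square_def F_def)
  have dX: "u m - u n \<in> X2" "\<xi> m - \<xi> n \<in> XT" for m n using u \<xi> X2.diff_mem XT.diff_mem by auto
  have int: "integrable N (\<lambda>x. pair_square x (F m x - F n x))" for m n
    unfolding QF using dX[of m n] by (auto simp: X2_iff XT_iff)
  have Q0: "0 \<le> pair_square x p" for x p by (simp add: pair_square_def g_nonneg)
  have intval: "(\<integral>\<^sup>+x. ennreal (pair_square x (F m x - F n x)) \<partial>N) = ennreal (ip (u m - u n) (u m - u n) + ipT (\<xi> m - \<xi> n) (\<xi> m - \<xi> n))" for m n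
  proof -
    have "(\<integral>\<^sup>+x. ennreal (pair_square x (F m x - F n x)) \<partial>N) = ennreal (LINT x|N. pair_square x (F m x - F n x))"
      by (rule nn_integral_eq_integral[OF int]) (simp add: Q0)
    also have "(LINT x|N. pair_square x (F m x - F n x)) = ip (u m - u n) (u m - u n) + ipT (\<xi> m - \<xi> n) (\<xi> m - \<xi> n)"
      unfolding QF ip_def ipT_def using dX[of m n] by (subst Bochner_Integration.integral_add) (auto simp: X2_iff XT_iff power2_eq_square)
    finally show ?thesis .
  qed
  have "\<exists>r::nat\<Rightarrow>nat. (AE x in N. convergent (\<lambda>k. F (r k) x)) \<and>
    (\<forall>e>0. \<exists>N'. \<forall>n\<ge>N'. (\<integral>\<^sup>+x. ennreal (pair_square x (F n x - lim (\<lambda>k. F (r k) x))) \<partial>N) \<le> ennreal e)"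
  proof (rule pointwise_limit_of_Cauchy[OF _ pair_square_continuous pair_square_lower])
    show "(\<lambda>x. pair_square x (F m x - F n x)) \<in> borel_measurable N" for m n using int by simp
    show "\<exists>N'. \<forall>m\<ge>N'. \<forall>n\<ge>N'. (\<integral>\<^sup>+x. ennreal (pair_square x (F m x - F n x)) \<partial>N) \<le> ennreal e" if e: "e > 0" for e
    proof -
      obtain N' where N': "\<forall>m\<ge>N'. \<forall>n\<ge>N'. ip (u m - u n) (u m - u n) + ipT (\<xi> m - \<xi> n) (\<xi> m - \<xi> n) < e" using Cauchy[OF e] by (rule exE)
      then show ?thesis unfolding intval by (intro exI[of _ N'] allI impI ennreal_leI less_imp_le) blast
    qed
  qed
  then obtain r :: "nat \<Rightarrow> nat" where conv: "AE x in N. convergent (\<lambda>k. F (r k) x)"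
    and lim: "\<And>e. e > 0 \<Longrightarrow> \<exists>N'. \<forall>n\<ge>N'. (\<integral>\<^sup>+x. ennreal (pair_square x (F n x - lim (\<lambda>k. F (r k) x))) \<partial>N) \<le> ennreal e" by blast
  define v where "v x = fst (lim (\<lambda>k. F (r k) x))" for x
  define \<eta> where "\<eta> x = snd (lim (\<lambda>k. F (r k) x))" for x
  have tends: "AE x in N. (\<lambda>k. u (r k) x) \<longlonglongrightarrow> v x \<and> (\<lambda>k. \<xi> (r k) x) \<longlonglongrightarrow> \<eta> x"
    using conv
  proof eventually_elim
    case (elim x)
    then have "(\<lambda>k. F (r k) x) \<longlonglongrightarrow> lim (\<lambda>k. F (r k) x)" by (simp add: convergent_LIMSEQ_iff)
    from tendsto_fst[OF this] tendsto_snd[OF this] show ?case by (simp add: F_def v_def \<eta>_def)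
  qed
  have vm: "v \<in> borel_measurable N"
  proof -
    interpret complete_measure N by (rule complete_restrict[OF open_\<Omega>])
    show ?thesis
    proof (rule measurable_AE_cong)
      show "(\<lambda>x. lim (\<lambda>k. u (r k) x)) \<in> borel_measurable N"
        by (rule borel_measurable_lim_metric) (use u in \<open>simp add: X2_iff\<close>)
      show "AE x in N. lim (\<lambda>k. u (r k) x) = v x" using tends by eventually_elim (simp add: limI)
    qed simp
  qed
  have \<eta>m: "measurable_section M \<Omega> \<eta>"
    unfolding section_iff
  proof
    fix c assume c: "c \<in> Atl"
    have o: "open (\<Omega> \<inter> fst c)" using chart_open[OF c] open_\<Omega> by auto
    interpret complete_measure "restrict_space \<mu> (\<Omega> \<inter> fst c)" by (rule complete_restrict[OF o])
    show "(\<lambda>x. tc c x (\<eta> x)) \<in> borel_measurable (restrict_space \<mu> (\<Omega> \<inter> fst c))"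
    proof (rule measurable_AE_cong)
      show "(\<lambda>x. lim (\<lambda>k. tc c x (\<xi> (r k) x))) \<in> borel_measurable (restrict_space \<mu> (\<Omega> \<inter> fst c))"
        by (rule borel_measurable_lim_metric) (use \<xi> in \<open>simp add: XT_iff sectionD[OF _ c]\<close>)
      have "AE x in \<mu>. x \<in> \<Omega> \<inter> fst c \<longrightarrow> lim (\<lambda>k. tc c x (\<xi> (r k) x)) = tc c x (\<eta> x)"
        using tends unfolding AE_N
      proof eventually_elim
        case (elim x)
        show ?case
        proof
          assume x: "x \<in> \<Omega> \<inter> fst c"
          have "bounded_linear (tc c x)" using tc_linear[OF c, of x] x by (simp add: linear_conv_bounded_linear)
          from bounded_linear.tendsto[OF this] have "(\<lambda>k. tc c x (\<xi> (r k) x)) \<longlonglongrightarrow> tc c x (\<eta> x)" using elim x by blast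
          then show "lim (\<lambda>k. tc c x (\<xi> (r k) x)) = tc c x (\<eta> x)" by (rule limI)
        qed
      qed
      then show "AE x in restrict_space \<mu> (\<Omega> \<inter> fst c). lim (\<lambda>k. tc c x (\<xi> (r k) x)) = tc c x (\<eta> x)"
        using o by (subst AE_restrict_space_iff) auto
    qed simp
  qed
  have Qv: "pair_square x (F n x - lim (\<lambda>k. F (r k) x)) = ((u n - v) x)\<^sup>2 + g x ((\<xi> n - \<eta>) x) ((\<xi> n - \<eta>) x)" for n x
    by (simp add: pair_square_def F_def v_def \<eta>_def)
  have diffs: "u n - v \<in> X2 \<and> \<xi> n - \<eta> \<in> XT \<and> ip (u n - v) (u n - v) \<le> e \<and> ipT (\<xi> n - \<eta>) (\<xi> n - \<eta>) \<le> e"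
    if le: "(\<integral>\<^sup>+x. ennreal (pair_square x (F n x - lim (\<lambda>k. F (r k) x))) \<partial>N) \<le> ennreal e" and e: "e > 0" for n e
  proof -
    have um: "(u n - v) \<in> borel_measurable N" using u[of n] vm by (auto simp: X2_iff fun_diff_def intro: borel_measurable_diff)
    have sm: "measurable_section M \<Omega> (\<xi> n - \<eta>)"
    proof -
      have "measurable_section M \<Omega> (\<xi> n + (-1) *\<^sub>R \<eta>)" using \<xi>[of n] \<eta>m by (intro section_add section_scale) (simp add: XT_iff)
      then show ?thesis by simp
    qed
    have 1: "(\<integral>\<^sup>+x. ennreal (((u n - v) x)\<^sup>2) \<partial>N) \<le> ennreal e"
      by (rule order_trans[OF nn_integral_mono le]) (auto simp: Qv g_nonneg intro!: ennreal_leI)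
    have 2: "(\<integral>\<^sup>+x. ennreal (g x ((\<xi> n - \<eta>) x) ((\<xi> n - \<eta>) x)) \<partial>N) \<le> ennreal e"
      by (rule order_trans[OF nn_integral_mono le]) (auto simp: Qv intro!: ennreal_leI)
    have i1: "integrable N (\<lambda>x. ((u n - v) x)\<^sup>2)"
    proof (rule integrableI_bounded)
      show "(\<lambda>x. ((u n - v) x)\<^sup>2) \<in> borel_measurable N" by (rule borel_measurable_power[OF um])
      have "(\<integral>\<^sup>+x. ennreal (norm (((u n - v) x)\<^sup>2)) \<partial>N) \<le> ennreal e"
        using 1 by (simp only: real_norm_def abs_power2)
      then show "(\<integral>\<^sup>+x. ennreal (norm (((u n - v) x)\<^sup>2)) \<partial>N) < \<infinity>" by (rule le_less_trans) simp
    qed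
    have i2: "integrable N (\<lambda>x. g x ((\<xi> n - \<eta>) x) ((\<xi> n - \<eta>) x))"
    proof (rule integrableI_bounded)
      show "(\<lambda>x. g x ((\<xi> n - \<eta>) x) ((\<xi> n - \<eta>) x)) \<in> borel_measurable N" by (rule g_bm[OF sm sm])
      have "(\<integral>\<^sup>+x. ennreal (norm (g x ((\<xi> n - \<eta>) x) ((\<xi> n - \<eta>) x))) \<partial>N) \<le> ennreal e"
        using 2 by (simp only: real_norm_def abs_of_nonneg[OF g_nonneg])
      then show "(\<integral>\<^sup>+x. ennreal (norm (g x ((\<xi> n - \<eta>) x) ((\<xi> n - \<eta>) x))) \<partial>N) < \<infinity>" by (rule le_less_trans) simp
    qed
    have "ennreal (ip (u n - v) (u n - v)) \<le> ennreal e"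
      using 1 nn_integral_eq_integral[OF i1] by (simp add: ip_def power2_eq_square)
    moreover have "ennreal (ipT (\<xi> n - \<eta>) (\<xi> n - \<eta>)) \<le> ennreal e"
      using 2 nn_integral_eq_integral[OF i2] g_nonneg by (simp add: ipT_def)
    ultimately show ?thesis using um sm i1 i2 e by (simp add: X2_iff XT_iff)
  qed
  obtain n1 where "(\<integral>\<^sup>+x. ennreal (pair_square x (F n1 x - lim (\<lambda>k. F (r k) x))) \<partial>N) \<le> ennreal 1" using lim[of 1] by auto
  from diffs[OF this] have d1: "u n1 - v \<in> X2" "\<xi> n1 - \<eta> \<in> XT" by auto
  have "v = u n1 - (u n1 - v)" "\<eta> = \<xi> n1 - (\<xi> n1 - \<eta>)" by simp_all
  then have v: "v \<in> X2" and \<eta>: "\<eta> \<in> XT" using X2.diff_mem[OF u d1(1)] XT.diff_mem[OF \<xi> d1(2)] by metis+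
  have small: "\<exists>N'. \<forall>n\<ge>N'. ip (u n - v) (u n - v) \<le> e \<and> ipT (\<xi> n - \<eta>) (\<xi> n - \<eta>) \<le> e" if "e > 0" for e
    using lim[OF that] diffs[OF _ that] by (elim exE) (intro exI allI impI, blast)
  have "(\<lambda>n. ip (u n - v) (u n - v)) \<longlonglongrightarrow> 0"
  proof (rule LIMSEQ_I)
    fix e :: real assume "e > 0"
    then have "e / 2 > 0" by simp
    from small[OF this] obtain N' where N': "\<And>n. n \<ge> N' \<Longrightarrow> ip (u n - v) (u n - v) \<le> e / 2" by blast
    have "norm (ip (u n - v) (u n - v) - 0) < e" if "n \<ge> N'" for n
      using N'[OF that] X2.ip_nonneg[OF X2.diff_mem[OF u v], of n] \<open>e > 0\<close> by simp
    then show "\<exists>N'. \<forall>n\<ge>N'. norm (ip (u n - v) (u n - v) - 0) < e" by blast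
  qed
  moreover have "(\<lambda>n. ipT (\<xi> n - \<eta>) (\<xi> n - \<eta>)) \<longlonglongrightarrow> 0"
  proof (rule LIMSEQ_I)
    fix e :: real assume "e > 0"
    then have "e / 2 > 0" by simp
    from small[OF this] obtain N' where N': "\<And>n. n \<ge> N' \<Longrightarrow> ipT (\<xi> n - \<eta>) (\<xi> n - \<eta>) \<le> e / 2" by blast
    have "norm (ipT (\<xi> n - \<eta>) (\<xi> n - \<eta>) - 0) < e" if "n \<ge> N'" for n
      using N'[OF that] XT.ip_nonneg[OF XT.diff_mem[OF \<xi> \<eta>], of n] \<open>e > 0\<close> by simp
    then show "\<exists>N'. \<forall>n\<ge>N'. norm (ipT (\<xi> n - \<eta>) (\<xi> n - \<eta>) - 0) < e" by blast
  qed
  ultimately show ?thesis using v \<eta> by blast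
qed

abbreviation "S1 \<equiv> H1 M \<Omega>"
abbreviation "S10 \<equiv> H10 M \<Omega>"
abbreviation "gr u \<equiv> grad M \<Omega> u"
abbreviation "test \<equiv> test_functions Atl \<Omega>"

lemma S1_iff: "u \<in> S1 \<longleftrightarrow> (\<exists>\<xi>. weak_grad u \<xi>)" by (auto simp: H1_def weak_grad_def)

lemma gr_weak_grad: assumes "u \<in> S1" shows "weak_grad u (gr u)"
proof -
  have "\<exists>\<xi>. \<xi> \<in> XT \<and> is_weak_gradient M \<Omega> u \<xi>" and uX: "u \<in> X2" using assms by (auto simp: H1_def)
  from someI_ex[OF this(1)] show ?thesis using uX by (simp add: grad_def weak_grad_def)
qed

lemma gr_XT: "u \<in> S1 \<Longrightarrow> gr u \<in> XT" and S1_X2: "u \<in> S1 \<Longrightarrow> u \<in> X2"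
  using gr_weak_grad weak_grad_D by blast+

lemma gr_eq: "weak_grad u \<xi> \<Longrightarrow> AE x in N. gr u x = \<xi> x"
  using gr_weak_grad[of u] S1_iff weak_grad_unique by blast

lemma ipT_cong:
  assumes "AE x in N. \<xi> x = \<xi>' x" "\<xi> \<in> XT" "\<xi>' \<in> XT" "\<eta> \<in> XT"
  shows "ipT \<xi> \<eta> = ipT \<xi>' \<eta>"
  unfolding ipT_def
proof (rule integral_cong_AE)
  show "(\<lambda>x. g x (\<xi> x) (\<eta> x)) \<in> borel_measurable N" "(\<lambda>x. g x (\<xi>' x) (\<eta> x)) \<in> borel_measurable N"
    using assms by (auto simp: XT_iff intro: g_bm)
  show "AE x in N. g x (\<xi> x) (\<eta> x) = g x (\<xi>' x) (\<eta> x)" using assms(1) by eventually_elim simp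
qed

lemma S1_subspace: "subspace S1"
proof -
  have "weak_grad 0 0"
  proof (rule weak_grad_I[OF X2.zero_mem XT.zero_mem])
    fix c v \<psi> assume c: "c \<in> Atl" and \<psi>: "\<psi> \<in> test_functions Atl (\<Omega> \<inter> fst c)"
    show "ip 0 (chart_fun c (dcoord c \<psi> v)) + ipT 0 (chart_field c v (\<psi> \<circ> chart_inv c)) = 0"
      using X2.zero_left[OF chart_fun_X2[OF c test_coord(2)[OF c \<psi>, of v]]] XT.zero_left[OF chart_field_XT[OF c test_coord(1)[OF c \<psi>], of v]]
      by linarith
  qed
  then have 0: "0 \<in> S1" unfolding S1_iff by (rule exI[of "weak_grad 0"])
  have "x + y \<in> S1" if x: "x \<in> S1" and y: "y \<in> S1" for x y
    unfolding S1_iff by (rule exI[of "weak_grad (x + y)", OF weak_grad_add[OF gr_weak_grad[OF x] gr_weak_grad[OF y]]])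
  moreover have "c *\<^sub>R x \<in> S1" if x: "x \<in> S1" for x c
    unfolding S1_iff by (rule exI[of "weak_grad (c *\<^sub>R x)", OF weak_grad_scale[OF gr_weak_grad[OF x]]])
  ultimately show ?thesis using 0 by (simp add: subspace_def)
qed

lemma gr_add: assumes "u \<in> S1" "v \<in> S1" shows "AE x in N. gr (u + v) x = gr u x + gr v x"
  using gr_eq[OF weak_grad_add[OF gr_weak_grad[OF assms(1)] gr_weak_grad[OF assms(2)]]] by simp

lemma gr_scale: assumes "u \<in> S1" shows "AE x in N. gr (a *\<^sub>R u) x = a *\<^sub>R gr u x"
  using gr_eq[OF weak_grad_scale[OF gr_weak_grad[OF assms]]] by simp

lemma gr_diff: assumes "u \<in> S1" "v \<in> S1" shows "AE x in N. gr (u - v) x = gr u x - gr v x"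
  using gr_eq[OF weak_grad_diff[OF gr_weak_grad[OF assms(1)] gr_weak_grad[OF assms(2)]]] by simp

text \<open>The inner product of \<open>H\<^sup>1\<close>.\<close>

definition hip :: "('m \<Rightarrow> real) \<Rightarrow> ('m \<Rightarrow> real) \<Rightarrow> real" where "hip u v = ip u v + ipT (gr u) (gr v)"

sublocale S1: semi_inner S1 hip
proof
  show "subspace S1" by (rule S1_subspace)
  note D = S1_X2 gr_XT
  have add: "u + v \<in> S1" if "u \<in> S1" "v \<in> S1" for u v using S1_subspace that by (rule subspace_add)
  have scale: "c *\<^sub>R u \<in> S1" if "u \<in> S1" for u c using S1_subspace that by (rule subspace_scale)
  show "hip x y = hip y x" if "x \<in> S1" "y \<in> S1" for x y
    unfolding hip_def using X2.ip_sym[OF D(1)[OF that(1)] D(1)[OF that(2)]] XT.ip_sym[OF D(2)[OF that(1)] D(2)[OF that(2)]] by simp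
  show "hip (x + y) z = hip x z + hip y z" if that: "x \<in> S1" "y \<in> S1" "z \<in> S1" for x y z
  proof -
    have "ipT (gr (x + y)) (gr z) = ipT (gr x + gr y) (gr z)"
      by (rule ipT_cong) (use gr_add[OF that(1,2)] D add that XT.add_mem in auto)
    then show ?thesis using D that by (simp add: hip_def X2.add_left XT.add_left)
  qed
  show "hip (c *\<^sub>R x) z = c * hip x z" if that: "x \<in> S1" "z \<in> S1" for x z c
  proof -
    have "ipT (gr (c *\<^sub>R x)) (gr z) = ipT (c *\<^sub>R gr x) (gr z)"
      by (rule ipT_cong) (use gr_scale[OF that(1)] D scale that XT.scale_mem in auto)
    then show ?thesis using D that by (simp add: hip_def X2.scale_left XT.scale_left algebra_simps)
  qed
  show "0 \<le> hip x x" if "x \<in> S1" for x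
    using X2.ip_nonneg[OF D(1)[OF that]] XT.ip_nonneg[OF D(2)[OF that]] by (simp add: hip_def)
qed

lemma H1_norm_eq: assumes "u \<in> S1" shows "H1_norm M \<Omega> u = sqrt (hip u u)"
proof -
  have "integrable N (\<lambda>x. (u x)\<^sup>2)" "integrable N (\<lambda>x. g x (gr u x) (gr u x))"
    using S1_X2[OF assms] gr_XT[OF assms] by (auto simp: X2_iff XT_iff)
  then show ?thesis unfolding H1_norm_def set_LINT hip_def ip_def ipT_def 
    by (simp add: power2_eq_square)
qed

lemma hip_diff: assumes "u \<in> S1" "v \<in> S1" 
  shows "hip (u - v) (u - v) = ip (u - v) (u - v) + ipT (gr u - gr v) (gr u - gr v)"
proof -
  note D = gr_XT[OF assms(1)] gr_XT[OF assms(2)] gr_XT[OF S1.diff_mem[OF assms]]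
  have ae: "AE x in N. gr (u - v) x = (gr u - gr v) x" using gr_diff[OF assms] by simp
  have "ipT (gr (u - v)) (gr (u - v)) = ipT (gr u - gr v) (gr (u - v))"
    by (rule ipT_cong[OF ae D(3) XT.diff_mem[OF D(1,2)] D(3)])
  also have "\<dots> = ipT (gr (u - v)) (gr u - gr v)" by (rule XT.ip_sym[OF XT.diff_mem[OF D(1,2)] D(3)])
  also have "\<dots> = ipT (gr u - gr v) (gr u - gr v)"
    by (rule ipT_cong[OF ae D(3) XT.diff_mem[OF D(1,2)] XT.diff_mem[OF D(1,2)]])
  finally show ?thesis by (simp add: hip_def)
qed

text \<open>The limits of the functions and of their gradients exist since the spaces of square integrable
  functions and fields are complete, and they belong together since the gradient is closed.\<close>

lemma S1_complete: "S1.ip_complete"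
  unfolding S1.ip_complete_def
proof (intro allI impI)
  fix s :: "nat \<Rightarrow> 'm \<Rightarrow> real"
  assume a: "(\<forall>n. s n \<in> S1) \<and> (\<forall>e>0. \<exists>N. \<forall>m\<ge>N. \<forall>n\<ge>N. hip (s m - s n) (s m - s n) < e)"
  have s: "s n \<in> S1" for n using a by simp
  have C: "\<exists>N. \<forall>m\<ge>N. \<forall>n\<ge>N. ip (s m - s n) (s m - s n) + ipT (gr (s m) - gr (s n)) (gr (s m) - gr (s n)) < e" if "e > 0" for e
    using conjunct2[OF a, rule_format, OF that] unfolding hip_diff[OF s s] .
  obtain v \<eta> where v: "v \<in> X2" "\<eta> \<in> XT" "(\<lambda>n. ip (s n - v) (s n - v)) \<longlonglongrightarrow> 0" "(\<lambda>n. ipT (gr (s n) - \<eta>) (gr (s n) - \<eta>)) \<longlonglongrightarrow> 0"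
    using fields_complete[OF S1_X2[OF s] gr_XT[OF s] C] by auto
  have W: "weak_grad v \<eta>" by (rule weak_grad_lim[OF gr_weak_grad[OF s] v])
  then have vS: "v \<in> S1" using S1_iff by blast
  have eq: "ipT (gr (s n) - gr v) (gr (s n) - gr v) = ipT (gr (s n) - \<eta>) (gr (s n) - \<eta>)" for n
  proof -
    have ae: "AE x in N. (gr (s n) - gr v) x = (gr (s n) - \<eta>) x" using gr_eq[OF W] by eventually_elim simp
    have X: "gr (s n) - gr v \<in> XT" "gr (s n) - \<eta> \<in> XT" by (intro XT.diff_mem gr_XT s vS v)+
    have "ipT (gr (s n) - gr v) (gr (s n) - gr v) = ipT (gr (s n) - \<eta>) (gr (s n) - gr v)" by (rule ipT_cong[OF ae X X(1)])
    also have "\<dots> = ipT (gr (s n) - gr v) (gr (s n) - \<eta>)" by (rule XT.ip_sym[OF X(2,1)])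
    also have "\<dots> = ipT (gr (s n) - \<eta>) (gr (s n) - \<eta>)" by (rule ipT_cong[OF ae X X(2)])
    finally show ?thesis .
  qed
  have "(\<lambda>n. hip (s n - v) (s n - v)) \<longlonglongrightarrow> 0 + 0"
    unfolding hip_diff[OF s vS] eq by (rule tendsto_add[OF v(3,4)])
  then show "\<exists>x\<in>S1. (\<lambda>n. hip (s n - x) (s n - x)) \<longlonglongrightarrow> 0" using vS by auto
qed

lemma test_S1: "\<psi> \<in> test \<Longrightarrow> \<psi> \<in> S1" using test_weak_grad S1_iff by blast

lemma test_add: assumes "\<phi> \<in> test" "\<psi> \<in> test" shows "\<phi> + \<psi> \<in> test"
proof -
  have s: "smooth_fun Atl (\<phi> + \<psi>)" unfolding smooth_fun_def
  proof
    fix c assume c: "c \<in> Atl"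
    have "smooth_on (cod c) (\<lambda>y. (\<phi> \<circ> chart_inv c) y + (\<psi> \<circ> chart_inv c) y)"
      by (rule smooth_on_add[OF cod_open[OF c] test_smooth[OF assms(1) c] test_smooth[OF assms(2) c]])
    then show "smooth_on (cod c) ((\<phi> + \<psi>) \<circ> chart_inv c)" by (simp add: o_def)
  qed
  let ?A = "closure {x. \<phi> x \<noteq> 0}" and ?B = "closure {x. \<psi> x \<noteq> 0}" and ?C = "closure {x. (\<phi> + \<psi>) x \<noteq> 0}"
  have sub: "?C \<subseteq> ?A \<union> ?B" unfolding closure_Un[symmetric] by (rule closure_mono) auto
  have AB: "compact ?A" "compact ?B" "?A \<subseteq> \<Omega>" "?B \<subseteq> \<Omega>" using assms by (auto simp: test_functions_def)
  have "compact ?C" using compact_Int_closed[OF compact_Un[OF AB(1,2)] closed_closure, of "{x. (\<phi> + \<psi>) x \<noteq> 0}"] sub by (simp add: Int_absorb1)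
  then show ?thesis using s sub AB by (auto simp: test_functions_def)
qed

lemma test_scale: assumes "\<phi> \<in> test" shows "a *\<^sub>R \<phi> \<in> test"
proof -
  have s: "smooth_fun Atl (a *\<^sub>R \<phi>)" unfolding smooth_fun_def
  proof
    fix c assume c: "c \<in> Atl"
    have "smooth_on (cod c) (\<lambda>y. a * (\<phi> \<circ> chart_inv c) y)"
      by (rule smooth_on_mult[OF cod_open[OF c] smooth_on_const test_smooth[OF assms c]])
    then show "smooth_on (cod c) ((a *\<^sub>R \<phi>) \<circ> chart_inv c)" by (simp add: o_def)
  qed
  let ?A = "closure {x. \<phi> x \<noteq> 0}" and ?C = "closure {x. (a *\<^sub>R \<phi>) x \<noteq> 0}"
  have sub: "?C \<subseteq> ?A" by (rule closure_mono) auto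
  have A: "compact ?A" "?A \<subseteq> \<Omega>" using assms by (auto simp: test_functions_def)
  have "compact ?C" using compact_Int_closed[OF A(1) closed_closure, of "{x. (a *\<^sub>R \<phi>) x \<noteq> 0}"] sub by (simp add: Int_absorb1)
  then show ?thesis using s sub A by (auto simp: test_functions_def)
qed

lemma test_zero: "0 \<in> test"
  using smooth_on_const[of _ 0] by (auto simp: test_functions_def smooth_fun_def o_def zero_fun_def)

lemma S10_iff: "u \<in> S10 \<longleftrightarrow> u \<in> S1 \<and> (\<forall>e>0. \<exists>\<psi>\<in>test. sqrt (hip (u - \<psi>) (u - \<psi>)) < e)"
proof -
  have "H1_norm M \<Omega> (\<lambda>x. u x - \<psi> x) = sqrt (hip (u - \<psi>) (u - \<psi>))" if "u \<in> S1" "\<psi> \<in> test" for \<psi>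
    using H1_norm_eq[OF S1.diff_mem[OF that(1) test_S1[OF that(2)]]] by (simp add: fun_diff_def)
  then show ?thesis unfolding H10_def by auto
qed

lemma S10_S1: "u \<in> S10 \<Longrightarrow> u \<in> S1" using S10_iff by blast

lemma S10_approx: assumes "u \<in> S10" "e > 0" shows "\<exists>\<psi>\<in>test. sqrt (hip (u - \<psi>) (u - \<psi>)) < e"
  using assms S10_iff by blast

lemma test_S10: assumes "\<psi> \<in> test" shows "\<psi> \<in> S10"
proof -
  have "sqrt (hip (\<psi> - \<psi>) (\<psi> - \<psi>)) = 0" using S1.zero_left[OF S1.zero_mem] by simp
  then show ?thesis using assms test_S1 unfolding S10_iff by (metis)
qed

lemma S10_closed: 
  assumes v: "v \<in> S1" and ap: "\<And>e. e > 0 \<Longrightarrow> \<exists>u\<in>S10. sqrt (hip (v - u) (v - u)) < e"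
  shows "v \<in> S10"
  unfolding S10_iff
proof (intro conjI v allI impI)
  fix e :: real assume "e > 0"
  then have e2: "e / 2 > 0" by simp
  obtain u where u: "u \<in> S10" "sqrt (hip (v - u) (v - u)) < e / 2" using ap[OF e2] by blast
  obtain \<psi> where \<psi>: "\<psi> \<in> test" "sqrt (hip (u - \<psi>) (u - \<psi>)) < e / 2" using S10_approx[OF u(1) e2] by blast
  have "(v - u) + (u - \<psi>) = v - \<psi>" by simp
  then have "sqrt (hip (v - \<psi>) (v - \<psi>)) \<le> sqrt (hip (v - u) (v - u)) + sqrt (hip (u - \<psi>) (u - \<psi>))"
    using S1.triangle[OF S1.diff_mem[OF v S10_S1[OF u(1)]] S1.diff_mem[OF S10_S1[OF u(1)] test_S1[OF \<psi>(1)]]] by simp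
  then show "\<exists>\<psi>\<in>test. sqrt (hip (v - \<psi>) (v - \<psi>)) < e" using u \<psi> by (intro bexI[of _ \<psi>]) auto
qed

lemma S10_subspace: "subspace S10"
  unfolding subspace_def
proof (intro conjI ballI allI)
  show "0 \<in> S10" by (rule test_S10[OF test_zero])
  fix x assume x: "x \<in> S10"
  note xS = S10_S1[OF x]
  show "x + y \<in> S10" if y: "y \<in> S10" for y
    unfolding S10_iff
  proof (intro conjI allI impI)
    note yS = S10_S1[OF y]
    show "x + y \<in> S1" by (intro S1.add_mem xS yS)
    fix e :: real assume "e > 0"
    then have e2: "e / 2 > 0" by simp
    obtain \<phi> where \<phi>: "\<phi> \<in> test" "sqrt (hip (x - \<phi>) (x - \<phi>)) < e / 2" using S10_approx[OF x e2] by blast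
    obtain \<psi> where \<psi>: "\<psi> \<in> test" "sqrt (hip (y - \<psi>) (y - \<psi>)) < e / 2" using S10_approx[OF y e2] by blast
    have eq: "(x - \<phi>) + (y - \<psi>) = (x + y) - (\<phi> + \<psi>)" by simp
    have "sqrt (hip ((x + y) - (\<phi> + \<psi>)) ((x + y) - (\<phi> + \<psi>))) \<le> sqrt (hip (x - \<phi>) (x - \<phi>)) + sqrt (hip (y - \<psi>) (y - \<psi>))"
      using S1.triangle[OF S1.diff_mem[OF xS test_S1[OF \<phi>(1)]] S1.diff_mem[OF yS test_S1[OF \<psi>(1)]]] by (simp only: eq)
    then show "\<exists>\<psi>\<in>test. sqrt (hip (x + y - \<psi>) (x + y - \<psi>)) < e" using \<phi> \<psi> test_add by (intro bexI[of _ "\<phi> + \<psi>"]) auto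
  qed
  show "c *\<^sub>R x \<in> S10" for c
    unfolding S10_iff
  proof (intro conjI allI impI)
    show "c *\<^sub>R x \<in> S1" by (intro S1.scale_mem xS)
    fix e :: real assume "e > 0"
    then have e2: "e / (\<bar>c\<bar> + 1) > 0" by simp
    obtain \<phi> where \<phi>: "\<phi> \<in> test" "sqrt (hip (x - \<phi>) (x - \<phi>)) < e / (\<bar>c\<bar> + 1)" using S10_approx[OF x e2] by blast
    have d: "x - \<phi> \<in> S1" by (intro S1.diff_mem xS test_S1 \<phi>)
    have "c *\<^sub>R x - c *\<^sub>R \<phi> = c *\<^sub>R (x - \<phi>)" by (simp add: scaleR_diff_right)
    then have "sqrt (hip (c *\<^sub>R x - c *\<^sub>R \<phi>) (c *\<^sub>R x - c *\<^sub>R \<phi>)) = \<bar>c\<bar> * sqrt (hip (x - \<phi>) (x - \<phi>))"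
      using S1.scale_left[OF d S1.scale_mem[OF d]] S1.scale_right[OF d d] by (simp add: real_sqrt_mult mult.assoc[symmetric])
    also have "\<dots> \<le> (\<bar>c\<bar> + 1) * sqrt (hip (x - \<phi>) (x - \<phi>))" using S1.ip_nonneg[OF d] by (intro mult_right_mono) auto
    also have "\<dots> < e" using \<phi>(2) by (simp add: field_simps)
    finally show "\<exists>\<psi>\<in>test. sqrt (hip (c *\<^sub>R x - \<psi>) (c *\<^sub>R x - \<psi>)) < e" using \<phi> test_scale by (intro bexI[of _ "c *\<^sub>R \<phi>"]) auto
  qed
qed

sublocale S10: semi_inner S10 hip
  by unfold_locales (auto simp: S10_subspace S1.bilin S10_S1 S1.ip_nonneg intro: S1.ip_sym)

lemma S10_complete: "S10.ip_complete"
  unfolding S10.ip_complete_def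
proof (intro allI impI)
  fix s :: "nat \<Rightarrow> 'm \<Rightarrow> real"
  assume a: "(\<forall>n. s n \<in> S10) \<and> (\<forall>e>0. \<exists>N. \<forall>m\<ge>N. \<forall>n\<ge>N. hip (s m - s n) (s m - s n) < e)"
  have s: "s n \<in> S10" "s n \<in> S1" for n using conjunct1[OF a] S10_S1 by auto
  obtain v where v: "v \<in> S1" "(\<lambda>n. hip (s n - v) (s n - v)) \<longlonglongrightarrow> 0"
    using S1.ip_completeD[OF S1_complete s(2) conjunct2[OF a, rule_format]] by blast
  have "v \<in> S10"
  proof (rule S10_closed[OF v(1)])
    fix e :: real assume "e > 0"
    then have "e\<^sup>2 > 0" by simp
    then have "\<forall>\<^sub>F n in sequentially. hip (s n - v) (s n - v) < e\<^sup>2" by (rule order_tendstoD(2)[OF v(2)])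
    then obtain n where n: "hip (s n - v) (s n - v) < e\<^sup>2" by (meson eventually_sequentially order_refl)
    have d: "s n - v \<in> S1" by (intro S1.diff_mem s v)
    have "v - s n = (-1) *\<^sub>R (s n - v)" by simp
    then have "hip (v - s n) (v - s n) = hip (s n - v) (s n - v)"
      using S1.scale_left[OF d S1.scale_mem[OF d], of "-1" "-1"] S1.scale_right[OF d d, of "-1"] by simp
    then have "sqrt (hip (v - s n) (v - s n)) < sqrt (e\<^sup>2)" using n by (intro real_sqrt_less_mono) simp
    then have "sqrt (hip (v - s n) (v - s n)) < e" using \<open>e > 0\<close> by simp
    then show "\<exists>u\<in>S10. sqrt (hip (v - u) (v - u)) < e" using s(1) by blast
  qed
  then show "\<exists>x\<in>S10. (\<lambda>n. hip (s n - x) (s n - x)) \<longlonglongrightarrow> 0" using v(2) by blast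
qed

end

section \<open>The compactness estimate\<close>

text \<open>A family may repeat a vector, and a set may not. Multiplying the members by the square root of the
  length of the family makes up for the repetitions.\<close>

lemma (in semi_inner) finite_family_to_set:
  assumes I: "finite I" and e: "\<And>i. i \<in> I \<Longrightarrow> e i \<in> X"
  shows "\<exists>D. finite D \<and> D \<subseteq> X \<and> (\<forall>u\<in>X. (\<Sum>i\<in>I. (ip u (e i))\<^sup>2) \<le> (\<Sum>d\<in>D. (ip u d)\<^sup>2))"
proof (cases "I = {}")
  case False
  define s where "s = sqrt (real (card I))"
  have s: "s > 0" using I False by (simp add: s_def card_gt_0_iff)
  define D where "D = (\<lambda>x. s *\<^sub>R x) ` (e ` I)"
  have inj: "inj_on (\<lambda>x. s *\<^sub>R x) (e ` I)" using s by (auto simp: inj_on_def)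
  have "(\<Sum>i\<in>I. (ip u (e i))\<^sup>2) \<le> (\<Sum>d\<in>D. (ip u d)\<^sup>2)" if u: "u \<in> X" for u
  proof -
    have "(\<Sum>i\<in>I. (ip u (e i))\<^sup>2) \<le> (\<Sum>i\<in>I. \<Sum>x\<in>e ` I. (ip u x)\<^sup>2)"
      using I by (intro sum_mono member_le_sum) auto
    also have "\<dots> = (\<Sum>x\<in>e ` I. real (card I) * (ip u x)\<^sup>2)" by (simp add: sum_distrib_left)
    also have "\<dots> = (\<Sum>x\<in>e ` I. (ip u (s *\<^sub>R x))\<^sup>2)"
    proof (rule sum.cong[OF refl])
      fix x assume "x \<in> e ` I"
      then have "x \<in> X" using e by auto
      then show "real (card I) * (ip u x)\<^sup>2 = (ip u (s *\<^sub>R x))\<^sup>2"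
        using u by (simp add: scale_right power_mult_distrib s_def)
    qed
    also have "\<dots> = (\<Sum>d\<in>D. (ip u d)\<^sup>2)" unfolding D_def by (subst sum.reindex[OF inj]) simp
    finally show ?thesis .
  qed
  moreover have "finite D" "D \<subseteq> X" unfolding D_def using I e scale_mem by auto
  ultimately show ?thesis by blast
next
  case True
  then show ?thesis by (intro exI[of _ "{}"]) simp
qed

text \<open>Summing the Poincare inequality over a division of a box into pieces of small diameter.\<close>

lemma poincare_box:
  fixes w :: "'a::euclidean_space \<Rightarrow> real" and a b :: 'a
  assumes U: "open U" and Q: "cbox a b \<subseteq> U"
    and diff: "\<And>x. x \<in> U \<Longrightarrow> w differentiable (at x)"
    and cont: "\<And>v. continuous_on U (\<lambda>x. frechet_derivative w (at x) v)"
    and d: "d division_of cbox a b" and \<delta>: "\<And>K x y. K \<in> d \<Longrightarrow> x \<in> K \<Longrightarrow> y \<in> K \<Longrightarrow> norm (x - y) \<le> \<delta>"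
  shows "(LINT x:cbox a b|lborel. (w x)\<^sup>2) \<le> 
    2 ^ DIM('a) * \<delta>\<^sup>2 * (LINT x:cbox a b|lborel. (\<Sum>v\<in>Basis. (frechet_derivative w (at x) v)\<^sup>2))
    + (\<Sum>K\<in>d. ((LINT x:K|lborel. w x) / sqrt (measure lborel K))\<^sup>2)"
proof -
  define Nf where "Nf z = (\<Sum>v\<in>Basis. (frechet_derivative w (at z) v)\<^sup>2)" for z
  have wc: "continuous_on U w" using diff by (intro continuous_at_imp_continuous_on ballI differentiable_imp_continuous_within) auto
  have w2c: "continuous_on U (\<lambda>x. (w x)\<^sup>2)" by (intro continuous_intros wc)
  have Nc: "continuous_on U Nf" unfolding Nf_def by (intro continuous_on_sum continuous_on_power cont)
  have leb: "(LINT x:K|lborel. f x) = integral K f \<and> set_integrable lborel K f" if "compact K" "K \<subseteq> U" "continuous_on U f" for K and f :: "'a \<Rightarrow> real"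
  proof -
    have "set_integrable lborel K f" unfolding set_integrable_def
      by (rule borel_integrable_compact[OF that(1) continuous_on_subset[OF that(3,2)]])
    then show ?thesis using set_borel_integral_eq_integral(2) by blast
  qed
  have Kd: "compact K \<and> convex K \<and> K \<subseteq> U \<and> K \<subseteq> cbox a b" if K: "K \<in> d" for K
  proof -
    obtain p q where "K = cbox p q" using division_ofD(4)[OF d K] by blast
    moreover have "K \<subseteq> cbox a b" by (rule division_ofD(2)[OF d K])
    ultimately show ?thesis using Q by auto
  qed
  have sum_d: "(LINT x:cbox a b|lborel. f x) = (\<Sum>K\<in>d. LINT x:K|lborel. f x)" if f: "continuous_on U f" for f :: "'a \<Rightarrow> real"
  proof -
    have "(LINT x:cbox a b|lborel. f x) = integral (cbox a b) f" using leb[OF compact_cbox Q f] by simp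
    also have "\<dots> = (\<Sum>K\<in>d. integral K f)"
      by (rule integral_combine_division_topdown[OF integrable_continuous[OF continuous_on_subset[OF f Q]] d])
    also have "\<dots> = (\<Sum>K\<in>d. LINT x:K|lborel. f x)"
      using leb[OF _ _ f] Kd by (intro sum.cong) auto
    finally show ?thesis .
  qed
  have piece: "(LINT x:K|lborel. (w x)\<^sup>2) \<le> 2 ^ DIM('a) * \<delta>\<^sup>2 * (LINT x:K|lborel. Nf x) + ((LINT x:K|lborel. w x) / sqrt (measure lborel K))\<^sup>2"
    if K: "K \<in> d" for K
  proof -
    have Kp: "compact K" "convex K" "K \<subseteq> U" using Kd[OF K] by auto
    have P: "measure lborel K * (LINT x:K|lborel. (w x)\<^sup>2) \<le> 2 ^ DIM('a) * \<delta>\<^sup>2 * measure lborel K * (LINT x:K|lborel. Nf x) + (LINT x:K|lborel. w x)\<^sup>2"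
      unfolding Nf_def by (rule poincare_convex[OF U Kp diff cont \<delta>[OF K]])
    show ?thesis
    proof (cases "measure lborel K = 0")
      case True
      have Kb: "K \<in> sets lborel" using Kp(1) by (simp add: compact_imp_closed)
      have "emeasure lborel K = ennreal (measure lborel K)"
        using emeasure_compact_finite[OF Kp(1)] by (intro emeasure_eq_ennreal_measure) (auto simp: less_top)
      then have "K \<in> null_sets lborel" using True Kb by (auto simp: null_sets_def)
      then have ae: "AE x in lborel. x \<notin> K" by (rule AE_not_in)
      have "(LINT x:K|lborel. (w x)\<^sup>2) = (LINT x|(lborel :: 'a measure). 0)"
        unfolding set_lebesgue_integral_def
      proof (rule integral_cong_AE)
        show "AE x in lborel. indicator K x *\<^sub>R (w x)\<^sup>2 = (0::real)" using ae by eventually_elim simp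
        show "(\<lambda>x. indicator K x *\<^sub>R (w x)\<^sup>2) \<in> borel_measurable lborel" 
          using leb[OF Kp(1,3) w2c] unfolding set_integrable_def by (intro borel_measurable_integrable) blast
      qed simp
      moreover have "0 \<le> (LINT x:K|lborel. Nf x)" unfolding set_lebesgue_integral_def Nf_def
        by (intro Bochner_Integration.integral_nonneg) (simp add: sum_nonneg)
      ultimately show ?thesis by (simp del: real_scaleR_def)
    next
      case False
      then have m: "measure lborel K > 0" by (simp add: zero_less_measure_iff)
      have "measure lborel K * (LINT x:K|lborel. (w x)\<^sup>2) \<le> measure lborel K * (2 ^ DIM('a) * \<delta>\<^sup>2 * (LINT x:K|lborel. Nf x) + (LINT x:K|lborel. w x)\<^sup>2 / measure lborel K)"
        using P m by (simp add: algebra_simps)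
      then have "(LINT x:K|lborel. (w x)\<^sup>2) \<le> 2 ^ DIM('a) * \<delta>\<^sup>2 * (LINT x:K|lborel. Nf x) + (LINT x:K|lborel. w x)\<^sup>2 / measure lborel K"
        using m by (simp only: mult_le_cancel_left_pos)
      then show ?thesis using m by (simp add: power_divide)
    qed
  qed
  have "(LINT x:cbox a b|lborel. (w x)\<^sup>2) = (\<Sum>K\<in>d. LINT x:K|lborel. (w x)\<^sup>2)" by (rule sum_d[OF w2c])
  also have "\<dots> \<le> (\<Sum>K\<in>d. 2 ^ DIM('a) * \<delta>\<^sup>2 * (LINT x:K|lborel. Nf x) + ((LINT x:K|lborel. w x) / sqrt (measure lborel K))\<^sup>2)"
    by (rule sum_mono[OF piece])
  also have "\<dots> = 2 ^ DIM('a) * \<delta>\<^sup>2 * (LINT x:cbox a b|lborel. Nf x) + (\<Sum>K\<in>d. ((LINT x:K|lborel. w x) / sqrt (measure lborel K))\<^sup>2)"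
    unfolding sum_d[OF Nc] by (simp add: sum.distrib sum_distrib_left)
  finally show ?thesis unfolding Nf_def .
qed

context mfd_domain
begin

lemma lebesgue_lborel_box:
  fixes f :: "real ^ 'n \<Rightarrow> real"
  assumes c: "c \<in> Atl" and K: "compact K" "K \<subseteq> cod c" and f: "continuous_on (cod c) f" and f0: "\<And>y. y \<in> cod c \<Longrightarrow> y \<notin> U c \<Longrightarrow> f y = 0"
  shows "(LINT y:U c|lebesgue. f y * indicator K y) = (LINT y:K|lborel. f y)"
proof -
  have int: "integrable lborel (\<lambda>y. indicator K y *\<^sub>R f y)" by (rule borel_integrable_compact[OF K(1) continuous_on_subset[OF f K(2)]])
  have "(LINT y:U c|lebesgue. f y * indicator K y) = (LINT y|lebesgue. indicator K y *\<^sub>R f y)"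
    unfolding set_lebesgue_integral_def
  proof (rule Bochner_Integration.integral_cong[OF refl])
    fix y
    show "indicator (U c) y *\<^sub>R (f y * indicator K y) = indicator K y *\<^sub>R f y"
      using f0[of y] K(2) by (auto simp: indicator_def)
  qed
  also have "\<dots> = (LINT y|lborel. indicator K y *\<^sub>R f y)"
    by (rule integral_completion) (use int in \<open>simp only: borel_measurable_integrable\<close>)
  finally show ?thesis unfolding set_lebesgue_integral_def .
qed

text \<open>In a chart, divide a box into pieces so small that the gradient term in the Poincare inequality gets
  the factor \<open>\<epsilon>\<close>. The mean values over the pieces are pairings with finitely many functions.\<close>

lemma local_compactness_estimate:
  assumes c: "c \<in> Atl" and ab: "cbox a b \<subseteq> cod c" and \<epsilon>: "\<epsilon> > 0"
  shows "\<exists>D. finite D \<and> D \<subseteq> X2 \<and> (\<forall>\<psi>\<in>test. 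
    (LINT x|N. indicator {x \<in> fst c. snd c x \<in> cbox a b} x * (\<psi> x)\<^sup>2) \<le> \<epsilon> * ipT (gr \<psi>) (gr \<psi>) + (\<Sum>e\<in>D. (ip \<psi> e)\<^sup>2))"
proof -
  let ?Q = "cbox a b" and ?P = "{x \<in> fst c. snd c x \<in> cbox a b}"
  obtain W where W': "\<forall>y\<in>?Q. norm (w c y) \<le> W" by (rule exE[OF compact_continuous_bound[OF compact_cbox continuous_on_subset[OF w_cont[OF c] ab]]])
  define W1 where "W1 = max W 1"
  have W: "w c y \<le> W1" if "y \<in> ?Q" for y using bspec[OF W' that] by (simp add: W1_def)
  have W1: "W1 > 0" by (simp add: W1_def)
  have nz: "\<forall>y\<in>?Q. w c y \<noteq> 0" 
  proof
    fix y assume "y \<in> ?Q" 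
    then have "y \<in> cod c" by (rule subsetD[OF ab])
    then show "w c y \<noteq> 0" using w_pos[OF c, of y] by simp
  qed
  \<comment> \<open>\<open>\<Gamma>\<close> bounds the Euclidean square of the differential by the weighted square of the gradient: \<open>g(\<xi>, e\<^sub>i)\<^sup>2 \<le> g(\<xi>, \<xi>) g(e\<^sub>i, e\<^sub>i)\<close>.\<close>
  define \<Gamma> where "\<Gamma> y = (\<Sum>v\<in>Basis. G c y v v) / w c y" for y
  have "continuous_on ?Q \<Gamma>" unfolding \<Gamma>_def
    by (intro continuous_on_divide continuous_on_sum continuous_on_subset[OF G_cont[OF c] ab] continuous_on_subset[OF w_cont[OF c] ab] nz)
  then obtain B where B': "\<forall>y\<in>?Q. norm (\<Gamma> y) \<le> B" by (rule exE[OF compact_continuous_bound[OF compact_cbox]])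
  define B1 where "B1 = max B 1"
  have B: "\<Gamma> y \<le> B1" if "y \<in> ?Q" for y using bspec[OF B' that] by (simp add: B1_def)
  have B1: "B1 > 0" by (simp add: B1_def)
  define \<delta> where "\<delta> = sqrt (\<epsilon> / (W1 * 2 ^ DIM(real ^ 'n) * B1))"
  have \<delta>: "\<delta> > 0" using \<epsilon> W1 B1 by (simp add: \<delta>_def)
  have \<delta>2: "W1 * (2 ^ DIM(real ^ 'n) * \<delta>\<^sup>2 * B1) = \<epsilon>" 
  proof -
    have "\<delta>\<^sup>2 = \<epsilon> / (W1 * 2 ^ DIM(real ^ 'n) * B1)" using \<epsilon> W1 B1 by (simp add: \<delta>_def)
    then show ?thesis using W1 B1 by (simp add: field_simps)
  qed
  have gauge: "gauge (\<lambda>x. ball x (\<delta> / 2))" using \<delta> by (intro gauge_ball) simp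
  obtain p where p: "p tagged_division_of ?Q" "(\<lambda>x. ball x (\<delta> / 2)) fine p" by (rule fine_division_exists[OF gauge])
  define d where "d = snd ` p"
  have d: "d division_of ?Q" unfolding d_def by (rule division_of_tagged_division[OF p(1)])
  have diam: "norm (x - y) \<le> \<delta>" if K: "K \<in> d" and xy: "x \<in> K" "y \<in> K" for K x y
  proof -
    obtain z where "(z, K) \<in> p" using K by (auto simp: d_def)
    then have "K \<subseteq> ball z (\<delta> / 2)" by (rule fineD[OF p(2)])
    then have "dist z x < \<delta> / 2" "dist z y < \<delta> / 2" using xy by auto
    then have "dist x y < \<delta>" by (metis dist_commute dist_triangle_half_r)
    then show ?thesis by (simp add: dist_norm)
  qed
  have dK: "compact K \<and> K \<subseteq> ?Q \<and> K \<in> sets borel" if K: "K \<in> d" for K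
  proof -
    obtain r q where "K = cbox r q" using division_ofD(4)[OF d K] by blast
    then show ?thesis using division_ofD(2)[OF d K] by auto
  qed
  define e where "e K = sqrt (W1 / measure lborel K) *\<^sub>R chart_fun c (indicator K)" for K
  have ind: "coord_test c (indicator K)" if "K \<in> d" for K
    by (rule indicator_coord_test[OF c ab]) (use dK[OF that] in auto)
  have eX: "e K \<in> X2" if "K \<in> d" for K unfolding e_def by (intro X2.scale_mem chart_fun_X2[OF c ind[OF that]])
  have "\<exists>D. finite D \<and> D \<subseteq> X2 \<and> (\<forall>u\<in>X2. (\<Sum>K\<in>d. (ip u (e K))\<^sup>2) \<le> (\<Sum>d\<in>D. (ip u d)\<^sup>2))"
    by (rule X2.finite_family_to_set[OF division_ofD(1)[OF d] eX])
  then obtain D where D: "finite D" "D \<subseteq> X2" "\<And>u. u \<in> X2 \<Longrightarrow> (\<Sum>K\<in>d. (ip u (e K))\<^sup>2) \<le> (\<Sum>d\<in>D. (ip u d)\<^sup>2)" by blast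
  have main: "(LINT x|N. indicator ?P x * (\<psi> x)\<^sup>2) \<le> \<epsilon> * ipT (gr \<psi>) (gr \<psi>) + (\<Sum>e\<in>D. (ip \<psi> e)\<^sup>2)" if \<psi>: "\<psi> \<in> test" for \<psi>
  proof -
    have sf: "smooth_fun Atl \<psi>" and S\<Omega>: "closure {x. \<psi> x \<noteq> 0} \<subseteq> \<Omega>" using \<psi> by (auto simp: test_functions_def)
    let ?w = "\<psi> \<circ> chart_inv c"
    have sm: "smooth_on (cod c) ?w" using sf c by (auto simp: smooth_fun_def)
    have \<psi>X: "\<psi> \<in> X2" by (rule S1_X2[OF test_S1[OF \<psi>]])
    have \<psi>0: "\<psi> x = 0" if "x \<notin> \<Omega>" for x
    proof (rule ccontr)
      assume "\<psi> x \<noteq> 0"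
      then have "x \<in> closure {x. \<psi> x \<noteq> 0}" by (intro subsetD[OF closure_subset]) simp
      then show False using S\<Omega> that by auto
    qed
    have w0: "?w y = 0" if "y \<in> cod c" "y \<notin> U c" for y
      using \<psi>0[of "chart_inv c y"] mem_chart_image[OF c that(1), of \<Omega>] that(2) by auto
    have wcont: "continuous_on (cod c) ?w" by (rule smooth_on_continuous[OF sm])
    have Pm: "(indicator ?P :: 'm \<Rightarrow> real) \<in> borel_measurable \<mu>"
    proof -
      have "{x \<in> fst c. snd c x \<in> - ?Q} \<in> sets \<mu>" by (rule open_sets_\<mu>[OF open_chart_vimage[OF c]]) auto
      moreover have "?P = fst c - {x \<in> fst c. snd c x \<in> - ?Q}" by auto
      ultimately have "?P \<in> sets \<mu>" using open_sets_\<mu>[OF chart_open[OF c]] by auto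
      then show ?thesis by simp
    qed
    have PN: "(indicator ?P :: 'm \<Rightarrow> real) \<in> borel_measurable N" by (rule measurable_restrict_space1[OF Pm])
    have P_inv: "indicator ?P (chart_inv c y) = (indicator ?Q y :: real)" if "y \<in> cod c" for y
      using chart_inv_mem[OF c that] chart_inv[OF c that] by (simp add: indicator_def)
    have Uc: "y \<in> cod c" if "y \<in> U c" for y using that by auto
    have "(LINT x|N. indicator ?P x * (\<psi> x)\<^sup>2) = (LINT y:U c|lebesgue. w c y * (?w y)\<^sup>2 * indicator ?Q y)"
    proof (rule chart_pairing(1)[OF c])
      show "(\<lambda>x. indicator ?P x * (\<psi> x)\<^sup>2) \<in> borel_measurable N" using PN \<psi>X by (auto simp: X2_iff)
      show "indicator ?P x * (\<psi> x)\<^sup>2 = 0" if "x \<notin> fst c" for x using that by simp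
      show "indicator ?P (chart_inv c y) * (\<psi> (chart_inv c y))\<^sup>2 = w c y * (?w y)\<^sup>2 * indicator ?Q y / w c y" if "y \<in> U c" for y
        using P_inv[OF Uc[OF that]] w_pos[OF c Uc[OF that]] by simp
    qed
    also have "\<dots> = (LINT y:?Q|lborel. w c y * (?w y)\<^sup>2)"
    proof (rule lebesgue_lborel_box[OF c compact_cbox ab])
      show "continuous_on (cod c) (\<lambda>y. w c y * (?w y)\<^sup>2)"
        by (intro continuous_on_mult continuous_on_power w_cont[OF c] wcont)
      show "w c y * (?w y)\<^sup>2 = 0" if "y \<in> cod c" "y \<notin> U c" for y using w0[OF that] by simp
    qed
    also have "\<dots> \<le> (LINT y:?Q|lborel. W1 * (?w y)\<^sup>2)"
    proof (rule set_integral_mono)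
      show "set_integrable lborel ?Q (\<lambda>y. w c y * (?w y)\<^sup>2)" "set_integrable lborel ?Q (\<lambda>y. W1 * (?w y)\<^sup>2)"
        unfolding set_integrable_def
        by (intro borel_integrable_compact compact_cbox continuous_on_mult continuous_on_power continuous_on_const continuous_on_subset[OF w_cont[OF c] ab] continuous_on_subset[OF wcont ab])+
    qed (use W in \<open>auto intro: mult_right_mono\<close>)
    also have "\<dots> = W1 * (LINT y:?Q|lborel. (?w y)\<^sup>2)" by simp
    finally have 1: "(LINT x|N. indicator ?P x * (\<psi> x)\<^sup>2) \<le> W1 * (LINT y:?Q|lborel. (?w y)\<^sup>2)" .
    have 2: "(LINT y:?Q|lborel. (?w y)\<^sup>2) \<le> 2 ^ DIM(real ^ 'n) * \<delta>\<^sup>2 * (LINT y:?Q|lborel. (\<Sum>v\<in>Basis. (dcoord c \<psi> v y)\<^sup>2))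
      + (\<Sum>K\<in>d. ((LINT y:K|lborel. ?w y) / sqrt (measure lborel K))\<^sup>2)"
      by (rule poincare_box[OF cod_open[OF c] ab smooth_on_differentiable[OF sm] smooth_on_continuous[OF smooth_on_derivative[OF sm]] d diam])
    let ?q = "\<lambda>x. g x (classical_grad \<psi> x) (classical_grad \<psi> x)"
    have WGc: "weak_grad \<psi> (classical_grad \<psi>)" by (rule test_weak_grad[OF \<psi>])
    have cX: "classical_grad \<psi> \<in> XT" by (rule weak_grad_D(2)[OF WGc])
    have qi: "integrable N ?q" using cX by (simp add: XT_iff)
    have Pqi: "integrable N (\<lambda>x. indicator ?P x * ?q x)"
    proof (rule Bochner_Integration.integrable_bound[OF qi])
      show "(\<lambda>x. indicator ?P x * ?q x) \<in> borel_measurable N"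
        by (rule borel_measurable_times[OF PN borel_measurable_integrable[OF qi]])
      show "AE x in N. norm (indicator ?P x * ?q x) \<le> norm (?q x)" by (intro AE_I2) (simp add: indicator_def)
    qed
    have qh: "indicator ?P (chart_inv c y) * ?q (chart_inv c y) = w c y * ?q (chart_inv c y) * indicator ?Q y / w c y" if "y \<in> U c" for y
      using P_inv[OF Uc[OF that]] w_pos[OF c Uc[OF that]] by simp
    have qval: "(LINT x|N. indicator ?P x * ?q x) = (LINT y:U c|lebesgue. w c y * ?q (chart_inv c y) * indicator ?Q y)"
      and qint: "set_integrable lebesgue (U c) (\<lambda>y. w c y * ?q (chart_inv c y) * indicator ?Q y)"
      using chart_pairing[OF c borel_measurable_integrable[OF Pqi] _ qh] Pqi by auto
    have pt: "(\<Sum>v\<in>Basis. (dcoord c \<psi> v y)\<^sup>2) \<le> B1 * (w c y * ?q (chart_inv c y))" if "y \<in> ?Q" for y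
    proof -
      have y: "y \<in> cod c" by (rule subsetD[OF ab that])
      have x: "chart_inv c y \<in> fst c" by (rule chart_inv_mem[OF c y])
      have "(dcoord c \<psi> v y)\<^sup>2 \<le> ?q (chart_inv c y) * G c y v v" for v
        using g_Cauchy_Schwarz[of "chart_inv c y" "classical_grad \<psi> (chart_inv c y)" "fc c (chart_inv c y) v"]
          classical_grad(1)[OF sf c x, of v] chart_inv[OF c y] by (simp add: G_def)
      then have "(\<Sum>v\<in>Basis. (dcoord c \<psi> v y)\<^sup>2) \<le> (\<Sum>v\<in>Basis. ?q (chart_inv c y) * G c y v v)" by (rule sum_mono)
      also have "\<dots> = \<Gamma> y * (w c y * ?q (chart_inv c y))" 
      proof -
        have "(\<Sum>v\<in>Basis. ?q (chart_inv c y) * G c y v v) = ?q (chart_inv c y) * (\<Sum>v\<in>Basis. G c y v v)"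
          by (rule sum_distrib_left[symmetric])
        then show ?thesis using w_pos[OF c y] by (simp add: \<Gamma>_def)
      qed
      also have "\<dots> \<le> B1 * (w c y * ?q (chart_inv c y))"
        using B[OF that] w_pos[OF c y] g_nonneg by (intro mult_right_mono) auto
      finally show ?thesis .
    qed
    have dcont: "continuous_on (cod c) (\<lambda>y. \<Sum>v\<in>Basis. (dcoord c \<psi> v y)\<^sup>2)"
      by (intro continuous_on_sum continuous_on_power smooth_on_continuous smooth_on_derivative sm)
    have d0: "(\<Sum>v\<in>Basis. (dcoord c \<psi> v y)\<^sup>2) = 0" if y: "y \<in> cod c" and yU: "y \<notin> U c" for y
    proof -
      have x: "chart_inv c y \<in> fst c" by (rule chart_inv_mem[OF c y])
      have n: "chart_inv c y \<notin> \<Omega>" using mem_chart_image[OF c y, of \<Omega>] yU by auto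
      let ?C = "closure {x. \<psi> x \<noteq> 0}"
      have nC: "chart_inv c y \<notin> ?C" using n S\<Omega> by auto
      have "dcoord c \<psi> v y = 0" for v
      proof -
        have "frechet_derivative (\<lambda>_. 0) (at y) = frechet_derivative ?w (at y)"
        proof (rule frechet_derivative_transform_within_open)
          show "open (snd c ` ((- ?C) \<inter> fst c))" by (rule open_chart_image[OF c]) auto
          show "y \<in> snd c ` ((- ?C) \<inter> fst c)" using mem_chart_image[OF c y, of "- ?C"] nC by simp
          show "0 = ?w z" if z: "z \<in> snd c ` ((- ?C) \<inter> fst c)" for z
          proof -
            obtain x' where x': "x' \<notin> ?C" "x' \<in> fst c" "z = snd c x'" using z by blast
            have "\<psi> x' = 0" by (rule ccontr) (use x'(1) subsetD[OF closure_subset, of x' "{x. \<psi> x \<noteq> 0}"] in simp)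
            then show ?thesis using inv_chart[OF c x'(2)] x'(3) by simp
          qed
        qed auto
        then show ?thesis by (metis frechet_derivative_const)
      qed
      then show ?thesis by simp
    qed
    have "(LINT y:?Q|lborel. (\<Sum>v\<in>Basis. (dcoord c \<psi> v y)\<^sup>2)) = (LINT y:U c|lebesgue. (\<Sum>v\<in>Basis. (dcoord c \<psi> v y)\<^sup>2) * indicator ?Q y)"
      by (rule lebesgue_lborel_box[OF c compact_cbox ab dcont d0, symmetric])
    also have "\<dots> \<le> (LINT y:U c|lebesgue. B1 * (w c y * ?q (chart_inv c y) * indicator ?Q y))"
      unfolding set_lebesgue_integral_def
    proof (rule integral_mono')
      show "integrable lebesgue (\<lambda>y. indicator (U c) y *\<^sub>R (B1 * (w c y * ?q (chart_inv c y) * indicator ?Q y)))"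
        using integrable_mult_right[OF qint[unfolded set_integrable_def], of B1] by (simp add: mult.left_commute)
      fix y
      show "indicator (U c) y *\<^sub>R ((\<Sum>v\<in>Basis. (dcoord c \<psi> v y)\<^sup>2) * indicator ?Q y) \<le> indicator (U c) y *\<^sub>R (B1 * (w c y * ?q (chart_inv c y) * indicator ?Q y))"
        using pt[of y] by (auto simp: indicator_def)
      show "0 \<le> indicator (U c) y *\<^sub>R (B1 * (w c y * ?q (chart_inv c y) * indicator ?Q y))"
        using B1 w_pos[OF c Uc, of y] g_nonneg by (auto simp: indicator_def less_imp_le)
    qed
    also have "\<dots> = B1 * (LINT x|N. indicator ?P x * ?q x)" unfolding qval by simp
    also have "\<dots> \<le> B1 * ipT (classical_grad \<psi>) (classical_grad \<psi>)"
      unfolding ipT_def using B1 Pqi qi g_nonneg by (intro mult_left_mono integral_mono) (auto simp: indicator_def)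
    also have "ipT (classical_grad \<psi>) (classical_grad \<psi>) = ipT (gr \<psi>) (gr \<psi>)"
    proof -
      have gX: "gr \<psi> \<in> XT" by (rule gr_XT[OF test_S1[OF \<psi>]])
      have ae: "AE x in N. classical_grad \<psi> x = gr \<psi> x" using gr_eq[OF WGc] by eventually_elim simp
      have "ipT (classical_grad \<psi>) (classical_grad \<psi>) = ipT (gr \<psi>) (classical_grad \<psi>)" by (rule ipT_cong[OF ae cX gX cX])
      also have "\<dots> = ipT (classical_grad \<psi>) (gr \<psi>)" by (rule XT.ip_sym[OF gX cX])
      also have "\<dots> = ipT (gr \<psi>) (gr \<psi>)" by (rule ipT_cong[OF ae cX gX gX])
      finally show ?thesis .
    qed
    finally have 3: "(LINT y:?Q|lborel. (\<Sum>v\<in>Basis. (dcoord c \<psi> v y)\<^sup>2)) \<le> B1 * ipT (gr \<psi>) (gr \<psi>)" .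
    have 4: "W1 * ((LINT y:K|lborel. ?w y) / sqrt (measure lborel K))\<^sup>2 = (ip \<psi> (e K))\<^sup>2" if K: "K \<in> d" for K
    proof -
      have Kp: "compact K" "K \<subseteq> cod c" using dK[OF K] ab by auto
      have "ip \<psi> (chart_fun c (indicator K)) = (LINT y:U c|lebesgue. ?w y * indicator K y)" using ip_chart_fun[OF c ind[OF K] \<psi>X] by simp
      also have "\<dots> = (LINT y:K|lborel. ?w y)" by (rule lebesgue_lborel_box[OF c Kp wcont w0])
      finally have i: "ip \<psi> (chart_fun c (indicator K)) = (LINT y:K|lborel. ?w y)" .
      have "ip \<psi> (e K) = sqrt (W1 / measure lborel K) * (LINT y:K|lborel. ?w y)"
        unfolding e_def X2.scale_right[OF chart_fun_X2[OF c ind[OF K]] \<psi>X] i ..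
      then show ?thesis using W1 by (simp add: power_mult_distrib power_divide)
    qed
    have "(LINT x|N. indicator ?P x * (\<psi> x)\<^sup>2) \<le> W1 * (2 ^ DIM(real ^ 'n) * \<delta>\<^sup>2 * (B1 * ipT (gr \<psi>) (gr \<psi>))
      + (\<Sum>K\<in>d. ((LINT y:K|lborel. ?w y) / sqrt (measure lborel K))\<^sup>2))"
    proof -
      have "2 ^ DIM(real ^ 'n) * \<delta>\<^sup>2 * (LINT y:?Q|lborel. (\<Sum>v\<in>Basis. (dcoord c \<psi> v y)\<^sup>2)) \<le> 2 ^ DIM(real ^ 'n) * \<delta>\<^sup>2 * (B1 * ipT (gr \<psi>) (gr \<psi>))"
        by (intro mult_left_mono 3) simp
      then have "(LINT y:?Q|lborel. (?w y)\<^sup>2) \<le> 2 ^ DIM(real ^ 'n) * \<delta>\<^sup>2 * (B1 * ipT (gr \<psi>) (gr \<psi>)) + (\<Sum>K\<in>d. ((LINT y:K|lborel. ?w y) / sqrt (measure lborel K))\<^sup>2)"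
        using 2 by linarith
      from mult_left_mono[OF this less_imp_le[OF W1]] show ?thesis using 1 by linarith
    qed
    also have "\<dots> = (W1 * (2 ^ DIM(real ^ 'n) * \<delta>\<^sup>2 * B1)) * ipT (gr \<psi>) (gr \<psi>) + (\<Sum>K\<in>d. W1 * ((LINT y:K|lborel. ?w y) / sqrt (measure lborel K))\<^sup>2)"
      by (simp only: distrib_left sum_distrib_left mult.assoc)
    also have "\<dots> = \<epsilon> * ipT (gr \<psi>) (gr \<psi>) + (\<Sum>K\<in>d. (ip \<psi> (e K))\<^sup>2)"
      unfolding \<delta>2 using 4 by simp
    also have "\<dots> \<le> \<epsilon> * ipT (gr \<psi>) (gr \<psi>) + (\<Sum>e\<in>D. (ip \<psi> e)\<^sup>2)" using D(3)[OF \<psi>X] by simp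
    finally show ?thesis .
  qed
  then show ?thesis using D(1,2) by blast
qed

text \<open>Finitely many box neighbourhoods cover the compact closure of \<open>\<Omega>\<close>; the local estimates are added up
  with \<open>\<epsilon>\<close> divided by their number.\<close>

lemma compactness_estimate_test:
  assumes \<epsilon>: "\<epsilon> > 0"
  shows "\<exists>D. finite D \<and> D \<subseteq> X2 \<and> (\<forall>\<psi>\<in>test. ip \<psi> \<psi> \<le> \<epsilon> * ipT (gr \<psi>) (gr \<psi>) + (\<Sum>e\<in>D. (ip \<psi> e)\<^sup>2))"
proof -
  have "\<exists>c a b. c \<in> Atl \<and> x \<in> fst c \<and> cbox a b \<subseteq> cod c \<and> snd c x \<in> box a b" for x
  proof -
    obtain c where c: "c \<in> Atl" "x \<in> fst c" using chart_cover by blast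
    have "snd c x \<in> cod c" using c by simp
    then obtain a b where "cbox a b \<subseteq> cod c" "snd c x \<in> box a b" by (rule open_contains_cbox[OF cod_open[OF c(1)]])
    then show ?thesis using c by (intro exI[of _ c] exI[of _ a] exI[of _ b] conjI)
  qed
  then obtain ch lo hi where ch: "\<And>x. ch x \<in> Atl" "\<And>x. x \<in> fst (ch x)" "\<And>x. cbox (lo x) (hi x) \<subseteq> cod (ch x)" "\<And>x. snd (ch x) x \<in> box (lo x) (hi x)" by metis
  define V where "V x = {z \<in> fst (ch x). snd (ch x) z \<in> box (lo x) (hi x)}" for x
  define P where "P x = {z \<in> fst (ch x). snd (ch x) z \<in> cbox (lo x) (hi x)}" for x
  have Vo: "open (V x)" for x unfolding V_def by (rule open_chart_vimage[OF ch(1) open_box])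
  have xV: "x \<in> V x" for x unfolding V_def using ch(2,4) by simp
  have VP: "V x \<subseteq> P x" for x unfolding V_def P_def using box_subset_cbox by auto
  obtain F where F: "F \<subseteq> closure \<Omega>" "finite F" "closure \<Omega> \<subseteq> (\<Union>x\<in>F. V x)"
    by (rule compactE_image[OF compact_\<Omega>, of "closure \<Omega>" V]) (use Vo xV in auto)
  define \<epsilon>' where "\<epsilon>' = \<epsilon> / (real (card F) + 1)"
  have \<epsilon>': "\<epsilon>' > 0" using \<epsilon> by (simp add: \<epsilon>'_def)
  define good where "good x D \<longleftrightarrow> finite D \<and> D \<subseteq> X2 \<and> (\<forall>\<psi>\<in>test. (LINT z|N. indicator (P x) z * (\<psi> z)\<^sup>2) \<le> \<epsilon>' * ipT (gr \<psi>) (gr \<psi>) + (\<Sum>e\<in>D. (ip \<psi> e)\<^sup>2))" for x D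
  have "\<exists>D. good x D" for x
    unfolding good_def P_def by (rule local_compactness_estimate[OF ch(1) ch(3) \<epsilon>'])
  then have "\<exists>D. \<forall>x. good x (D x)" by (intro choice allI)
  then obtain D where good: "\<And>x. good x (D x)" by blast
  have D: "finite (D x)" "D x \<subseteq> X2" 
    "\<psi> \<in> test \<Longrightarrow> (LINT z|N. indicator (P x) z * (\<psi> z)\<^sup>2) \<le> \<epsilon>' * ipT (gr \<psi>) (gr \<psi>) + (\<Sum>e\<in>D x. (ip \<psi> e)\<^sup>2)" for x \<psi>
    using good[of x] unfolding good_def by blast+
  have "\<exists>E. finite E \<and> E \<subseteq> X2 \<and> (\<forall>u\<in>X2. (\<Sum>i\<in>Sigma F D. (ip u (snd i))\<^sup>2) \<le> (\<Sum>d\<in>E. (ip u d)\<^sup>2))"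
  proof (rule X2.finite_family_to_set)
    show "finite (Sigma F D)" using F(2) D(1) by auto
    show "snd i \<in> X2" if "i \<in> Sigma F D" for i using subsetD[OF D(2)[of "fst i"], of "snd i"] that by auto
  qed
  then obtain E where E: "finite E" "E \<subseteq> X2" "\<And>u. u \<in> X2 \<Longrightarrow> (\<Sum>i\<in>Sigma F D. (ip u (snd i))\<^sup>2) \<le> (\<Sum>d\<in>E. (ip u d)\<^sup>2)" by blast
  have "ip \<psi> \<psi> \<le> \<epsilon> * ipT (gr \<psi>) (gr \<psi>) + (\<Sum>e\<in>E. (ip \<psi> e)\<^sup>2)" if \<psi>: "\<psi> \<in> test" for \<psi>
  proof -
    have \<psi>X: "\<psi> \<in> X2" by (rule S1_X2[OF test_S1[OF \<psi>]])
    have Pm: "P x \<in> sets \<mu>" for x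
    proof -
      have "{z \<in> fst (ch x). snd (ch x) z \<in> - cbox (lo x) (hi x)} \<in> sets \<mu>" by (rule open_sets_\<mu>[OF open_chart_vimage[OF ch(1)]]) auto
      moreover have "P x = fst (ch x) - {z \<in> fst (ch x). snd (ch x) z \<in> - cbox (lo x) (hi x)}" by (auto simp: P_def)
      ultimately show ?thesis using open_sets_\<mu>[OF chart_open[OF ch(1)], of x] by auto
    qed
    have ind: "(indicator (P x) :: 'm \<Rightarrow> real) \<in> borel_measurable N" for x
      by (rule measurable_restrict_space1) (use Pm in simp)
    have i2: "integrable N (\<lambda>z. (\<psi> z)\<^sup>2)" using \<psi>X by (simp add: X2_iff)
    have ii: "integrable N (\<lambda>z. indicator (P x) z * (\<psi> z)\<^sup>2)" for x
    proof (rule Bochner_Integration.integrable_bound[OF i2])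
      show "(\<lambda>z. indicator (P x) z * (\<psi> z)\<^sup>2) \<in> borel_measurable N"
        by (rule borel_measurable_times[OF ind borel_measurable_integrable[OF i2]])
      show "AE z in N. norm (indicator (P x) z * (\<psi> z)\<^sup>2) \<le> norm ((\<psi> z)\<^sup>2)" by (intro AE_I2) (simp add: indicator_def)
    qed
    have "ip \<psi> \<psi> = (LINT z|N. (\<psi> z)\<^sup>2)" by (simp add: ip_def power2_eq_square)
    also have "\<dots> \<le> (LINT z|N. (\<Sum>x\<in>F. indicator (P x) z * (\<psi> z)\<^sup>2))"
    proof (rule integral_mono[OF i2])
      show "integrable N (\<lambda>z. \<Sum>x\<in>F. indicator (P x) z * (\<psi> z)\<^sup>2)" by (intro Bochner_Integration.integrable_sum ii)
      fix z assume "z \<in> space N"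
      then have "z \<in> closure \<Omega>" using closure_subset by auto
      then obtain x where x: "x \<in> F" "z \<in> V x" using F(3) by blast
      then have "indicator (P x) z * (\<psi> z)\<^sup>2 = (\<psi> z)\<^sup>2" using subsetD[OF VP x(2)] by simp
      moreover have "indicator (P x) z * (\<psi> z)\<^sup>2 \<le> (\<Sum>x\<in>F. indicator (P x) z * (\<psi> z)\<^sup>2)"
        by (rule member_le_sum[OF x(1) _ F(2)]) auto
      ultimately show "(\<psi> z)\<^sup>2 \<le> (\<Sum>x\<in>F. indicator (P x) z * (\<psi> z)\<^sup>2)" by linarith
    qed
    also have "\<dots> = (\<Sum>x\<in>F. (LINT z|N. indicator (P x) z * (\<psi> z)\<^sup>2))" by (rule Bochner_Integration.integral_sum[OF ii])
    also have "\<dots> \<le> (\<Sum>x\<in>F. \<epsilon>' * ipT (gr \<psi>) (gr \<psi>) + (\<Sum>e\<in>D x. (ip \<psi> e)\<^sup>2))" by (intro sum_mono D(3)[OF \<psi>])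
    also have "\<dots> = real (card F) * \<epsilon>' * ipT (gr \<psi>) (gr \<psi>) + (\<Sum>i\<in>Sigma F D. (ip \<psi> (snd i))\<^sup>2)"
      using F(2) D(1) by (simp add: sum.distrib sum.Sigma case_prod_unfold)
    also have "\<dots> \<le> \<epsilon> * ipT (gr \<psi>) (gr \<psi>) + (\<Sum>e\<in>E. (ip \<psi> e)\<^sup>2)"
    proof (rule add_mono[OF mult_right_mono E(3)[OF \<psi>X]])
      show "real (card F) * \<epsilon>' \<le> \<epsilon>" using \<epsilon> by (simp add: \<epsilon>'_def field_simps)
      show "0 \<le> ipT (gr \<psi>) (gr \<psi>)" by (rule XT.ip_nonneg[OF gr_XT[OF test_S1[OF \<psi>]]])
    qed
    finally show ?thesis .
  qed
  then show ?thesis using E(1,2) by blast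
qed

lemma ip_le_hip: "u \<in> S1 \<Longrightarrow> ip u u \<le> hip u u"
  using XT.ip_nonneg[OF gr_XT] by (simp add: hip_def)

lemma ipT_le_hip: "u \<in> S1 \<Longrightarrow> ipT (gr u) (gr u) \<le> hip u u"
  using X2.ip_nonneg[OF S1_X2] by (simp add: hip_def)

lemma compactness_estimate:
  assumes \<epsilon>: "\<epsilon> > 0"
  shows "\<exists>D. finite D \<and> D \<subseteq> X2 \<and> (\<forall>u\<in>S10. ip u u \<le> \<epsilon> * hip u u + (\<Sum>e\<in>D. (ip u e)\<^sup>2))"
proof -
  obtain D where D: "finite D" "D \<subseteq> X2" "\<And>\<psi>. \<psi> \<in> test \<Longrightarrow> ip \<psi> \<psi> \<le> \<epsilon> * ipT (gr \<psi>) (gr \<psi>) + (\<Sum>e\<in>D. (ip \<psi> e)\<^sup>2)"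
    using compactness_estimate_test[OF \<epsilon>] by blast
  have "ip u u \<le> \<epsilon> * hip u u + (\<Sum>e\<in>D. (ip u e)\<^sup>2)" if u: "u \<in> S10" for u
  proof -
    have uS: "u \<in> S1" by (rule S10_S1[OF u])
    have "\<exists>\<psi>\<in>test. sqrt (hip (u - \<psi>) (u - \<psi>)) < 1 / real (Suc n)" for n by (rule S10_approx[OF u]) simp
    then obtain \<psi> where \<psi>: "\<And>n. \<psi> n \<in> test" "\<And>n. sqrt (hip (u - \<psi> n) (u - \<psi> n)) < 1 / real (Suc n)" by metis
    have \<psi>S: "\<psi> n \<in> S1" for n by (rule test_S1[OF \<psi>(1)])
    have sw: "hip (\<psi> n - u) (\<psi> n - u) = hip (u - \<psi> n) (u - \<psi> n)" for n
    proof -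
      have d: "\<psi> n - u \<in> S1" by (intro S1.diff_mem \<psi>S uS)
      have "u - \<psi> n = (-1) *\<^sub>R (\<psi> n - u)" by simp
      then show ?thesis using S1.scale_left[OF d S1.scale_mem[OF d], of "-1" "-1"] S1.scale_right[OF d d, of "-1"] by simp
    qed
    have sq: "(\<lambda>n. sqrt (hip (\<psi> n - u) (\<psi> n - u))) \<longlonglongrightarrow> 0"
    proof (rule tendsto_sandwich[OF _ _ tendsto_const])
      show "(\<lambda>n. 1 / real (Suc n)) \<longlonglongrightarrow> 0" by (rule LIMSEQ_Suc[OF lim_1_over_n])
      show "\<forall>\<^sub>F n in sequentially. sqrt (hip (\<psi> n - u) (\<psi> n - u)) \<le> 1 / real (Suc n)"
        unfolding sw using less_imp_le[OF \<psi>(2)] by (intro always_eventually allI)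
      show "\<forall>\<^sub>F n in sequentially. 0 \<le> sqrt (hip (\<psi> n - u) (\<psi> n - u))"
        using S1.ip_nonneg[OF S1.diff_mem[OF \<psi>S uS]] by (intro always_eventually allI) simp
    qed
    have "(\<lambda>n. (sqrt (hip (\<psi> n - u) (\<psi> n - u)))\<^sup>2) \<longlonglongrightarrow> 0\<^sup>2" by (rule tendsto_power[OF sq])
    then have hl: "(\<lambda>n. hip (\<psi> n - u) (\<psi> n - u)) \<longlonglongrightarrow> 0"
      using S1.ip_nonneg[OF S1.diff_mem[OF \<psi>S uS]] by simp
    have il: "(\<lambda>n. ip (\<psi> n - u) (\<psi> n - u)) \<longlonglongrightarrow> 0"
    proof (rule Lim_null_comparison[OF _ hl], intro always_eventually allI)
      fix n
      have d: "\<psi> n - u \<in> S1" by (intro S1.diff_mem \<psi>S uS)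
      show "norm (ip (\<psi> n - u) (\<psi> n - u)) \<le> hip (\<psi> n - u) (\<psi> n - u)"
        using ip_le_hip[OF d] X2.ip_nonneg[OF S1_X2[OF d]] by simp
    qed
    have "ip (\<psi> n) (\<psi> n) \<le> \<epsilon> * hip (\<psi> n) (\<psi> n) + (\<Sum>e\<in>D. (ip (\<psi> n) e)\<^sup>2)" for n
      using D(3)[OF \<psi>(1)[of n]] mult_left_mono[OF ipT_le_hip[OF \<psi>S[of n]] less_imp_le[OF \<epsilon>]] by linarith
    moreover have "(\<lambda>n. ip (\<psi> n) (\<psi> n)) \<longlonglongrightarrow> ip u u" by (rule X2.tendsto_square[OF S1_X2[OF \<psi>S] S1_X2[OF uS] il])
    moreover have "(\<lambda>n. \<epsilon> * hip (\<psi> n) (\<psi> n) + (\<Sum>e\<in>D. (ip (\<psi> n) e)\<^sup>2)) \<longlonglongrightarrow> \<epsilon> * hip u u + (\<Sum>e\<in>D. (ip u e)\<^sup>2)"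
    proof (intro tendsto_add tendsto_mult tendsto_const tendsto_sum tendsto_power)
      show "(\<lambda>n. hip (\<psi> n) (\<psi> n)) \<longlonglongrightarrow> hip u u" by (rule S1.tendsto_square[OF \<psi>S uS hl])
      fix e assume "e \<in> D"
      then have e: "e \<in> X2" using D(2) by auto
      show "(\<lambda>n. ip (\<psi> n) e) \<longlonglongrightarrow> ip u e" by (rule X2.tendsto_ip[OF S1_X2[OF \<psi>S] S1_X2[OF uS] e il])
    qed
    ultimately show ?thesis by (intro LIMSEQ_le) auto
  qed
  then show ?thesis using D(1,2) by blast
qed

end

section \<open>Energy forms of elliptic fields\<close>

context mfd_domain
begin

lemma null_iff: assumes "v \<in> X2" shows "ip v v = 0 \<longleftrightarrow> (AE x in N. v x = 0)"
proof -
  have "ip v v = 0 \<longleftrightarrow> (AE x in N. v x * v x = 0)"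
    unfolding ip_def by (rule integral_nonneg_eq_0_iff_AE[OF ip_integrable[OF assms assms]]) simp
  then show ?thesis by simp
qed

lemma L2_norm_eq: "L2_norm M \<Omega> f = sqrt (ip f f)"
  by (simp add: L2_norm_def set_LINT ip_def power2_eq_square)

text \<open>Some negative \<open>m\<close> satisfies \<open>- m \<parallel>u\<parallel>\<^sup>2 \<le> \<parallel>\<nabla>u\<parallel>\<^sup>2\<close> for all \<open>u\<close> of unit norm in \<open>H\<^sup>1\<^sub>0\<close>. With
  \<open>\<parallel>u\<parallel>\<^sup>2 = 1 - \<parallel>\<nabla>u\<parallel>\<^sup>2\<close> this reads \<open>- m / (1 - m) \<le> \<parallel>\<nabla>u\<parallel>\<^sup>2\<close>.\<close>

lemma poincare_of_m0:
  assumes "m0 M \<Omega> < 0"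
  shows "\<exists>\<delta>>0. \<forall>u\<in>S10. \<delta> * hip u u \<le> ipT (gr u) (gr u)"
proof -
  obtain m where m: "m < 0" and pos: "(INF u\<in>{u \<in> S10. H1_norm M \<Omega> u = 1}.
        ereal (LINT x:\<Omega>|\<mu>. m * (u x)\<^sup>2 + g x (gr u x) (gr u x))) > 0"
    using assms unfolding m0_def Inf_less_iff by auto
  define \<delta> where "\<delta> = - m / (1 - m)"
  have \<delta>: "\<delta> > 0" using m by (simp add: \<delta>_def divide_neg_pos)
  have unit: "\<delta> \<le> ipT (gr u) (gr u)" if u: "u \<in> S10" and n: "hip u u = 1" for u
  proof -
    have uS: "u \<in> S1" by (rule S10_S1[OF u])
    have i: "integrable N (\<lambda>x. (u x)\<^sup>2)" "integrable N (\<lambda>x. g x (gr u x) (gr u x))"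
      using S1_X2[OF uS] gr_XT[OF uS] by (auto simp: X2_iff XT_iff)
    have "u \<in> {u \<in> S10. H1_norm M \<Omega> u = 1}" using u n H1_norm_eq[OF uS] by simp
    then have "0 < ereal (LINT x:\<Omega>|\<mu>. m * (u x)\<^sup>2 + g x (gr u x) (gr u x))"
      by (rule less_le_trans[OF pos INF_lower])
    also have "(LINT x:\<Omega>|\<mu>. m * (u x)\<^sup>2 + g x (gr u x) (gr u x)) = m * ip u u + ipT (gr u) (gr u)"
      unfolding set_LINT ip_def ipT_def using i by (simp add: power2_eq_square)
    finally have "0 < m * ip u u + ipT (gr u) (gr u)" by simp
    moreover have "ip u u = 1 - ipT (gr u) (gr u)" using n by (simp add: hip_def)
    ultimately have "- m \<le> (1 - m) * ipT (gr u) (gr u)" by (simp add: algebra_simps)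
    then show ?thesis using m unfolding \<delta>_def by (subst pos_divide_le_eq) (auto simp: mult.commute)
  qed
  have "\<delta> * hip u u \<le> ipT (gr u) (gr u)" if u: "u \<in> S10" for u
  proof (cases "hip u u = 0")
    case True
    then show ?thesis using XT.ip_nonneg[OF gr_XT[OF S10_S1[OF u]]] by simp
  next
    case False
    then have h: "hip u u > 0" using S10.ip_nonneg[OF u] by simp
    define c where "c = 1 / sqrt (hip u u)"
    have c2: "c * c = 1 / hip u u" using h by (simp add: c_def)
    have cu: "c *\<^sub>R u \<in> S10" by (rule S10.scale_mem[OF u])
    have uX: "u \<in> X2" by (rule S1_X2[OF S10_S1[OF u]])
    have hc: "hip (c *\<^sub>R u) (c *\<^sub>R u) = (c * c) * hip u u"
      using u cu by (simp add: S10.scale_left S10.scale_right)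
    have ic: "ip (c *\<^sub>R u) (c *\<^sub>R u) = (c * c) * ip u u"
      using uX X2.scale_mem[OF uX] by (simp add: X2.scale_left X2.scale_right)
    have "ipT (gr (c *\<^sub>R u)) (gr (c *\<^sub>R u)) = (c * c) * ipT (gr u) (gr u)"
      using hc ic unfolding hip_def by (simp add: algebra_simps)
    moreover have "\<delta> \<le> ipT (gr (c *\<^sub>R u)) (gr (c *\<^sub>R u))" by (rule unit[OF cu]) (use hc c2 h in simp)
    ultimately have "\<delta> \<le> ipT (gr u) (gr u) / hip u u" using c2 by simp
    then show ?thesis using h by (simp add: pos_le_divide_eq)
  qed
  then show ?thesis using \<delta> by blast
qed

definition energy :: "('m \<Rightarrow> real ^ 'n \<Rightarrow> real ^ 'n) \<Rightarrow> ('m \<Rightarrow> real) \<Rightarrow> ('m \<Rightarrow> real) \<Rightarrow> real" where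
  "energy L u v = ipT (\<lambda>x. L x (gr u x)) (gr v)"

lemma weak_solution_iff: "weak_solution M \<Omega> L f u \<longleftrightarrow> u \<in> S10 \<and> (\<forall>v\<in>S10. energy L u v = f v)"
  by (simp add: weak_solution_def divergence_def set_LINT energy_def ipT_def)

text \<open>With \<open>\<eta> = T \<xi>\<close>, the bound on the inverse reads \<open>g(\<eta>, \<eta>) \<le> b g(\<eta>, \<xi>)\<close>, and Cauchy-Schwarz does the
  rest. The lower bound makes \<open>T\<close> injective, so that \<open>inv T\<close> is an actual inverse on its range.\<close>

lemma inverse_ellipticity_bound:
  assumes T: "linear T" and a: "a > 0" and b: "b > 0"
    and lower: "\<And>\<xi>. a * g x \<xi> \<xi> \<le> g x \<xi> (T \<xi>)" and upper: "\<And>\<xi>. 1 / b * g x \<xi> \<xi> \<le> g x \<xi> (inv T \<xi>)"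
  shows "g x (T \<xi>) (T \<xi>) \<le> b\<^sup>2 * g x \<xi> \<xi>"
proof -
  have "inj T"
    unfolding linear_injective_0[OF T]
  proof (intro allI impI)
    fix v assume "T v = 0"
    then have "a * g x v v \<le> 0" using lower[of v] by (simp add: g_bilin)
    then have "\<not> 0 < g x v v" using a by (simp add: mult_le_0_iff)
    then show "v = 0" using g_pos[of v x] by blast
  qed
  then have "inv T (T \<xi>) = \<xi>" by (rule inv_f_f)
  then have 1: "g x (T \<xi>) (T \<xi>) \<le> b * g x (T \<xi>) \<xi>" using upper[of "T \<xi>"] b by (simp add: field_simps)
  define p where "p = g x (T \<xi>) (T \<xi>)"
  have p: "p \<ge> 0" by (simp add: p_def g_nonneg)
  have "p\<^sup>2 \<le> (b * g x (T \<xi>) \<xi>)\<^sup>2" using 1 p unfolding p_def by (rule power_mono)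
  also have "\<dots> \<le> b\<^sup>2 * (p * g x \<xi> \<xi>)"
    unfolding power_mult_distrib p_def by (intro mult_left_mono g_Cauchy_Schwarz) simp
  finally have "p * p \<le> p * (b\<^sup>2 * g x \<xi> \<xi>)" by (simp add: power2_eq_square algebra_simps)
  then show ?thesis using p g_nonneg[of x \<xi>] unfolding p_def[symmetric]
    by (cases "p = 0") (simp_all add: mult_le_cancel_left)
qed

text \<open>In a chart, expand \<open>\<xi>\<close> in the coordinate fields, on which \<open>L\<close> is measurable by definition.\<close>

lemma section_coefficient:
  assumes L: "coefficient_field M UNIV L" and \<xi>: "measurable_section M \<Omega> \<xi>"
  shows "measurable_section M \<Omega> (\<lambda>x. L x (\<xi> x))"
  unfolding section_iff
proof (intro ballI)
  fix c assume c: "c \<in> Atl"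
  have lin: "linear (L x)" for x using L by (simp add: coefficient_field_def)
  have "set_borel_measurable \<mu> (fst c) (\<lambda>x. tc c x (L x (fc c x v)))" for v
    using L c by (simp add: coefficient_field_def)
  then have Lv: "(\<lambda>x. tc c x (L x (fc c x v))) \<in> borel_measurable (restrict_space \<mu> (fst c))" for v
    using set_bm_iff[OF chart_open[OF c]] by blast
  have "(\<lambda>x. \<Sum>i\<in>UNIV. (tc c x (\<xi> x) $ i) *\<^sub>R tc c x (L x (fc c x (axis i 1)))) \<in> borel_measurable (restrict_space \<mu> (\<Omega> \<inter> fst c))"
    by (intro borel_measurable_sum borel_measurable_scaleR vec_nth_bm sectionD[OF \<xi> c] bm_sub[OF Lv])
      (use chart_open[OF c] open_\<Omega> in auto)
  then show "(\<lambda>x. tc c x (L x (\<xi> x))) \<in> borel_measurable (restrict_space \<mu> (\<Omega> \<inter> fst c))"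
  proof (rule bm_cong[rotated])
    fix x assume "x \<in> \<Omega> \<inter> fst c"
    then have x: "x \<in> fst c" by simp
    have l: "linear (\<lambda>v. tc c x (L x (fc c x v)))"
      using linear_compose[OF linear_compose[OF fc_linear[OF c x] lin] tc_linear[OF c x]] by (simp add: o_def)
    have "tc c x (L x (\<xi> x)) = tc c x (L x (fc c x (\<Sum>i\<in>UNIV. (tc c x (\<xi> x) $ i) *\<^sub>R axis i 1)))"
      by (simp only: vec_basis_expansion[symmetric] from_to[OF c x])
    also have "\<dots> = (\<Sum>i\<in>UNIV. (tc c x (\<xi> x) $ i) *\<^sub>R tc c x (L x (fc c x (axis i 1))))"
      by (simp only: linear_sum[OF l] linear_cmul[OF l])
    finally show "(\<Sum>i\<in>UNIV. (tc c x (\<xi> x) $ i) *\<^sub>R tc c x (L x (fc c x (axis i 1)))) = tc c x (L x (\<xi> x))" ..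
  qed
qed

lemma functional_ip: assumes e: "e \<in> X2" shows "ip e \<in> dual_space S1 (H1_norm M \<Omega>)"
  unfolding dual_space_def
proof (intro CollectI conjI ballI allI)
  fix u v :: "'m \<Rightarrow> real" and s t assume u: "u \<in> S1" and v: "v \<in> S1"
  have "(\<lambda>x. s *\<^sub>R u x + t *\<^sub>R v x) = s *\<^sub>R u + t *\<^sub>R v" by (rule ext) simp
  then show "ip e (\<lambda>x. s *\<^sub>R u x + t *\<^sub>R v x) = s * ip e u + t * ip e v"
    using e S1_X2[OF u] S1_X2[OF v] by (simp add: X2.bilin X2.mem)
next
  show "\<exists>C. \<forall>u\<in>S1. \<bar>ip e u\<bar> \<le> C * H1_norm M \<Omega> u"
  proof (rule exI, rule ballI)
    fix u assume u: "u \<in> S1"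
    have "\<bar>ip e u\<bar> \<le> sqrt (ip e e) * sqrt (ip u u)" by (rule X2.Cauchy_Schwarz_sqrt[OF e S1_X2[OF u]])
    also have "\<dots> \<le> sqrt (ip e e) * H1_norm M \<Omega> u"
      unfolding H1_norm_eq[OF u] by (intro mult_left_mono real_sqrt_le_mono ip_le_hip[OF u] real_sqrt_ge_zero X2.ip_nonneg[OF e])
    finally show "\<bar>ip e u\<bar> \<le> sqrt (ip e e) * H1_norm M \<Omega> u" .
  qed
qed

lemma functional_gradient: assumes \<eta>: "\<eta> \<in> XT" shows "(\<lambda>v. ipT \<eta> (gr v)) \<in> dual_space S1 (H1_norm M \<Omega>)"
  unfolding dual_space_def
proof (intro CollectI conjI ballI allI)
  fix u v :: "'m \<Rightarrow> real" and s t assume u: "u \<in> S1" and v: "v \<in> S1"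
  note S = S1.scale_mem[OF u, of s] S1.scale_mem[OF v, of t]
  have eq: "(\<lambda>x. s *\<^sub>R u x + t *\<^sub>R v x) = s *\<^sub>R u + t *\<^sub>R v" by (rule ext) simp
  have ae: "AE x in N. gr (s *\<^sub>R u + t *\<^sub>R v) x = (s *\<^sub>R gr u + t *\<^sub>R gr v) x"
    using gr_add[OF S] gr_scale[OF u, of s] gr_scale[OF v, of t] by eventually_elim simp
  have X: "gr (s *\<^sub>R u + t *\<^sub>R v) \<in> XT" "s *\<^sub>R gr u + t *\<^sub>R gr v \<in> XT"
    by (intro gr_XT S1.add_mem S XT.add_mem XT.scale_mem u v)+
  have "ipT \<eta> (gr (s *\<^sub>R u + t *\<^sub>R v)) = ipT (gr (s *\<^sub>R u + t *\<^sub>R v)) \<eta>" by (rule XT.ip_sym[OF \<eta> X(1)])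
  also have "\<dots> = ipT (s *\<^sub>R gr u + t *\<^sub>R gr v) \<eta>" by (rule ipT_cong[OF ae X \<eta>])
  also have "\<dots> = ipT \<eta> (s *\<^sub>R gr u + t *\<^sub>R gr v)" by (rule XT.ip_sym[OF X(2) \<eta>])
  also have "\<dots> = s * ipT \<eta> (gr u) + t * ipT \<eta> (gr v)"
    using \<eta> gr_XT[OF u] gr_XT[OF v] by (simp add: XT.bilin XT.mem)
  finally show "ipT \<eta> (gr (\<lambda>x. s *\<^sub>R u x + t *\<^sub>R v x)) = s * ipT \<eta> (gr u) + t * ipT \<eta> (gr v)" unfolding eq .
next
  show "\<exists>C. \<forall>u\<in>S1. \<bar>ipT \<eta> (gr u)\<bar> \<le> C * H1_norm M \<Omega> u"
  proof (rule exI, rule ballI)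
    fix u assume u: "u \<in> S1"
    have "\<bar>ipT \<eta> (gr u)\<bar> \<le> sqrt (ipT \<eta> \<eta>) * sqrt (ipT (gr u) (gr u))" by (rule XT.Cauchy_Schwarz_sqrt[OF \<eta> gr_XT[OF u]])
    also have "\<dots> \<le> sqrt (ipT \<eta> \<eta>) * H1_norm M \<Omega> u"
      unfolding H1_norm_eq[OF u] by (intro mult_left_mono real_sqrt_le_mono ipT_le_hip[OF u] real_sqrt_ge_zero XT.ip_nonneg[OF \<eta>])
    finally show "\<bar>ipT \<eta> (gr u)\<bar> \<le> sqrt (ipT \<eta> \<eta>) * H1_norm M \<Omega> u" .
  qed
qed

lemma dual_S1_Hm1: assumes "F \<in> dual_space S1 (H1_norm M \<Omega>)" shows "F \<in> Hm1 M \<Omega>"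
proof -
  have lin: "\<forall>u\<in>S1. \<forall>v\<in>S1. \<forall>a b. F (\<lambda>x. a *\<^sub>R u x + b *\<^sub>R v x) = a * F u + b * F v"
    and bd: "\<exists>C. \<forall>u\<in>S1. \<bar>F u\<bar> \<le> C * H1_norm M \<Omega> u"
    using assms unfolding dual_space_def by blast+
  obtain C where C: "\<forall>u\<in>S1. \<bar>F u\<bar> \<le> C * H1_norm M \<Omega> u" by (rule exE[OF bd])
  show ?thesis unfolding Hm1_def dual_space_def
  proof (intro CollectI conjI ballI allI)
    fix u v :: "'m \<Rightarrow> real" and s t assume u: "u \<in> S10" and v: "v \<in> S10"
    show "F (\<lambda>x. s *\<^sub>R u x + t *\<^sub>R v x) = s * F u + t * F v"
      by (rule lin[rule_format, OF S10_S1[OF u] S10_S1[OF v]])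
  next
    show "\<exists>C. \<forall>u\<in>S10. \<bar>F u\<bar> \<le> C * H1_norm M \<Omega> u"
      by (rule exI[of _ C], rule ballI, rule bspec[OF C], rule S10_S1)
  qed
qed

context
  fixes a b :: real and L :: "'m \<Rightarrow> real ^ 'n \<Rightarrow> real ^ 'n"
  assumes a: "0 < a" and ab: "a \<le> b" and L: "L \<in> elliptic_fields M UNIV a b"
begin

lemma linear_field: "linear (L x)"
  using L by (simp add: elliptic_fields_def coefficient_field_def)

lemma elliptic_AE: 
  "AE x in N. (\<forall>\<xi>. a * g x \<xi> \<xi> \<le> g x \<xi> (L x \<xi>)) \<and> (\<forall>\<xi>. g x (L x \<xi>) (L x \<xi>) \<le> b\<^sup>2 * g x \<xi> \<xi>)"
proof -
  have "AE x in \<mu>. x \<in> UNIV \<longrightarrow> (\<forall>\<xi>. g x \<xi> (L x \<xi>) \<ge> a * g x \<xi> \<xi> \<and> g x \<xi> (inv (L x) \<xi>) \<ge> 1 / b * g x \<xi> \<xi>)"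
    using L unfolding elliptic_fields_def by blast
  then have "AE x in \<mu>. x \<in> \<Omega> \<longrightarrow> (\<forall>\<xi>. g x \<xi> (L x \<xi>) \<ge> a * g x \<xi> \<xi> \<and> g x \<xi> (inv (L x) \<xi>) \<ge> 1 / b * g x \<xi> \<xi>)"
    by eventually_elim simp
  then have "AE x in N. \<forall>\<xi>. g x \<xi> (L x \<xi>) \<ge> a * g x \<xi> \<xi> \<and> g x \<xi> (inv (L x) \<xi>) \<ge> 1 / b * g x \<xi> \<xi>"
    unfolding AE_N .
  then show ?thesis
  proof eventually_elim
    case (elim x)
    have "g x (L x \<xi>) (L x \<xi>) \<le> b\<^sup>2 * g x \<xi> \<xi>" for \<xi>
      by (rule inverse_ellipticity_bound[OF linear_field a]) (use elim a ab in auto)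
    then show ?case using elim by blast
  qed
qed

lemma assumes \<xi>: "\<xi> \<in> XT" shows flux_XT: "(\<lambda>x. L x (\<xi> x)) \<in> XT"
  and flux_bound: "ipT (\<lambda>x. L x (\<xi> x)) (\<lambda>x. L x (\<xi> x)) \<le> b\<^sup>2 * ipT \<xi> \<xi>"
proof -
  have \<xi>m: "measurable_section M \<Omega> \<xi>" and i: "integrable N (\<lambda>x. g x (\<xi> x) (\<xi> x))" using \<xi> by (auto simp: XT_iff)
  have m: "measurable_section M \<Omega> (\<lambda>x. L x (\<xi> x))"
    by (rule section_coefficient[OF _ \<xi>m]) (use L in \<open>simp add: elliptic_fields_def\<close>)
  have ae: "AE x in N. g x (L x (\<xi> x)) (L x (\<xi> x)) \<le> b\<^sup>2 * g x (\<xi> x) (\<xi> x)"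
    using elliptic_AE by eventually_elim blast
  have i2: "integrable N (\<lambda>x. b\<^sup>2 * g x (\<xi> x) (\<xi> x))" using i by simp
  have iL: "integrable N (\<lambda>x. g x (L x (\<xi> x)) (L x (\<xi> x)))"
  proof (rule Bochner_Integration.integrable_bound[OF i2 g_bm[OF m m]])
    show "AE x in N. norm (g x (L x (\<xi> x)) (L x (\<xi> x))) \<le> norm (b\<^sup>2 * g x (\<xi> x) (\<xi> x))"
      using ae by eventually_elim (simp add: g_nonneg abs_of_nonneg)
  qed
  then show "(\<lambda>x. L x (\<xi> x)) \<in> XT" using m by (simp add: XT_iff)
  show "ipT (\<lambda>x. L x (\<xi> x)) (\<lambda>x. L x (\<xi> x)) \<le> b\<^sup>2 * ipT \<xi> \<xi>"
    using integral_mono_AE[OF iL i2 ae] by (simp add: ipT_def)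
qed

lemma energy_add_left: assumes u: "u \<in> S1" and v: "v \<in> S1" and z: "z \<in> S1"
  shows "energy L (u + v) z = energy L u z + energy L v z"
proof -
  note X = flux_XT[OF gr_XT]
  have "AE x in N. L x (gr (u + v) x) = ((\<lambda>x. L x (gr u x)) + (\<lambda>x. L x (gr v x))) x"
    using gr_add[OF u v] by eventually_elim (simp add: linear_add[OF linear_field])
  then have "energy L (u + v) z = ipT ((\<lambda>x. L x (gr u x)) + (\<lambda>x. L x (gr v x))) (gr z)"
    unfolding energy_def by (rule ipT_cong[OF _ X[OF S1.add_mem[OF u v]] XT.add_mem[OF X[OF u] X[OF v]] gr_XT[OF z]])
  then show ?thesis unfolding energy_def by (simp only: XT.add_left[OF X[OF u] X[OF v] gr_XT[OF z]])
qed

lemma energy_scale_left: assumes u: "u \<in> S1" and z: "z \<in> S1" shows "energy L (c *\<^sub>R u) z = c * energy L u z"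
proof -
  note X = flux_XT[OF gr_XT]
  have "AE x in N. L x (gr (c *\<^sub>R u) x) = (c *\<^sub>R (\<lambda>x. L x (gr u x))) x"
    using gr_scale[OF u, of c] by eventually_elim (simp add: linear_cmul[OF linear_field])
  then have "energy L (c *\<^sub>R u) z = ipT (c *\<^sub>R (\<lambda>x. L x (gr u x))) (gr z)"
    unfolding energy_def by (rule ipT_cong[OF _ X[OF S1.scale_mem[OF u]] XT.scale_mem[OF X[OF u]] gr_XT[OF z]])
  then show ?thesis unfolding energy_def by (simp only: XT.scale_left[OF X[OF u] gr_XT[OF z]])
qed

lemma functional_energy: "z \<in> S1 \<Longrightarrow> energy L z \<in> dual_space S1 (H1_norm M \<Omega>)"
  using functional_gradient[OF flux_XT[OF gr_XT]] by (simp add: energy_def[abs_def])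

lemma energy_right: assumes "z \<in> S1" "u \<in> S1" "v \<in> S1" 
  shows "energy L z (s *\<^sub>R u + t *\<^sub>R v) = s * energy L z u + t * energy L z v"
proof -
  have "(\<lambda>x. s *\<^sub>R u x + t *\<^sub>R v x) = s *\<^sub>R u + t *\<^sub>R v" by (rule ext) simp
  moreover have "\<forall>u\<in>S1. \<forall>v\<in>S1. \<forall>s t. energy L z (\<lambda>x. s *\<^sub>R u x + t *\<^sub>R v x) = s * energy L z u + t * energy L z v"
    by (rule conjunct1[OF CollectD[OF functional_energy[OF assms(1), unfolded dual_space_def]]])
  ultimately show ?thesis using assms(2,3) by metis
qed

lemma energy_coercive: assumes u: "u \<in> S1" shows "a * ipT (gr u) (gr u) \<le> energy L u u"
proof -
  have i: "integrable N (\<lambda>x. a * g x (gr u x) (gr u x))" using gr_XT[OF u] by (simp add: XT_iff)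
  have "AE x in N. a * g x (gr u x) (gr u x) \<le> g x (L x (gr u x)) (gr u x)"
    using elliptic_AE
  proof eventually_elim
    case (elim x)
    then show ?case unfolding g_sym[of x "L x (gr u x)"] by blast
  qed
  from integral_mono_AE[OF i ipT_integrable[OF flux_XT[OF gr_XT[OF u]] gr_XT[OF u]] this]
  show ?thesis by (simp add: energy_def ipT_def)
qed

lemma energy_bounded2: assumes z: "z \<in> S1" and v: "v \<in> S1" shows "(energy L z v)\<^sup>2 \<le> (b\<^sup>2 * hip z z) * hip v v"
proof -
  note X = gr_XT[OF z] gr_XT[OF v]
  have "(energy L z v)\<^sup>2 \<le> ipT (\<lambda>x. L x (gr z x)) (\<lambda>x. L x (gr z x)) * ipT (gr v) (gr v)"
    unfolding energy_def by (rule XT.Cauchy_Schwarz[OF flux_XT[OF X(1)] X(2)])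
  also have "\<dots> \<le> (b\<^sup>2 * ipT (gr z) (gr z)) * ipT (gr v) (gr v)"
    by (rule mult_right_mono[OF flux_bound[OF X(1)] XT.ip_nonneg[OF X(2)]])
  also have "\<dots> \<le> (b\<^sup>2 * hip z z) * hip v v"
    by (intro mult_mono mult_left_mono ipT_le_hip z v XT.ip_nonneg X mult_nonneg_nonneg S1.ip_nonneg) auto
  finally show ?thesis .
qed

lemma energy_bounded: assumes v: "v \<in> S1" shows "energy L v v \<le> b * hip v v"
proof (rule power2_le_imp_le)
  show "(energy L v v)\<^sup>2 \<le> (b * hip v v)\<^sup>2" using energy_bounded2[OF v v] by (simp add: power2_eq_square algebra_simps)
  show "0 \<le> b * hip v v" using a ab S1.ip_nonneg[OF v] by simp
qed

lemma energy_sym: assumes sym: "symmetric_field M UNIV L" and u: "u \<in> S1" and v: "v \<in> S1" shows "energy L u v = energy L v u"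
proof -
  note X = gr_XT[OF u] gr_XT[OF v] flux_XT[OF gr_XT[OF u]] flux_XT[OF gr_XT[OF v]]
  have "AE x in \<mu>. x \<in> UNIV \<longrightarrow> (\<forall>\<xi> \<eta>. g x (L x \<xi>) \<eta> = g x \<xi> (L x \<eta>))" using sym by (simp add: symmetric_field_def)
  then have "AE x in N. g x (L x (gr u x)) (gr v x) = g x (gr u x) (L x (gr v x))"
    unfolding AE_N by eventually_elim simp
  then have "energy L u v = ipT (gr u) (\<lambda>x. L x (gr v x))"
    unfolding energy_def ipT_def
    by (intro integral_cong_AE g_bm) (use X in \<open>simp_all add: XT_iff\<close>)
  also have "\<dots> = energy L v u" unfolding energy_def by (rule XT.ip_sym[OF X(1,4)])
  finally show ?thesis .
qed

end

lemma rellich: "rellich_pair X2 S10 ip hip"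
proof unfold_locales
  show "S10 \<subseteq> X2" using S1_X2[OF S10_S1] by blast
  show "ip v v \<le> hip v v" if "v \<in> S10" for v by (rule ip_le_hip[OF S10_S1[OF that]])
  show "S10.ip_complete" by (rule S10_complete)
  show "\<exists>D. finite D \<and> D \<subseteq> X2 \<and> (\<forall>v\<in>S10. ip v v \<le> \<epsilon> * hip v v + (\<Sum>e\<in>D. (ip v e)\<^sup>2))" if "\<epsilon> > 0" for \<epsilon>
    by (rule compactness_estimate[OF that])
qed

lemma elliptic_energy_form:
  assumes a: "0 < a" and ab: "a \<le> b" and L: "L \<in> elliptic_fields M UNIV a b" and sym: "symmetric_field M UNIV L"
    and \<delta>: "\<delta> > 0" "\<And>u. u \<in> S10 \<Longrightarrow> \<delta> * hip u u \<le> ipT (gr u) (gr u)"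
  shows "energy_form X2 S10 ip hip (energy L) (a * \<delta>) b"
proof (intro energy_form.intro rellich energy_form_axioms.intro)
  note E = a ab L
  have coer: "(a * \<delta>) * hip v v \<le> energy L v v" if "v \<in> S10" for v
    using order_trans[OF mult_left_mono[OF \<delta>(2)[OF that]] energy_coercive[OF E S10_S1[OF that]]] a by (simp add: mult.assoc)
  show "semi_inner S10 (energy L)"
  proof
    show "subspace S10" by (rule S10_subspace)
    show "energy L x y = energy L y x" if "x \<in> S10" "y \<in> S10" for x y
      by (rule energy_sym[OF E sym S10_S1[OF that(1)] S10_S1[OF that(2)]])
    show "energy L (x + y) z = energy L x z + energy L y z" if "x \<in> S10" "y \<in> S10" "z \<in> S10" for x y z
      by (rule energy_add_left[OF E S10_S1[OF that(1)] S10_S1[OF that(2)] S10_S1[OF that(3)]])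
    show "energy L (c *\<^sub>R x) z = c * energy L x z" if "x \<in> S10" "z \<in> S10" for x z c
      by (rule energy_scale_left[OF E S10_S1[OF that(1)] S10_S1[OF that(2)]])
    show "0 \<le> energy L x x" if "x \<in> S10" for x
      using coer[OF that] S10.ip_nonneg[OF that] a \<delta>(1) by (meson mult_nonneg_nonneg order_trans less_imp_le)
  qed
  show "0 < a * \<delta>" using a \<delta>(1) by simp
  show "(a * \<delta>) * hip v v \<le> energy L v v" if "v \<in> S10" for v by (rule coer[OF that])
  show "energy L v v \<le> b * hip v v" if "v \<in> S10" for v by (rule energy_bounded[OF E S10_S1[OF that]])
qed

end

section \<open>Convergence of the spectrum\<close>

context mfd_domain
begin

text \<open>H-convergence is used with the domain \<open>\<Omega>\<close> itself, and only through the weak convergence of the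
  solutions: all right sides and all test functionals extend from \<open>H\<^sup>1\<^sub>0\<close> to bounded functionals on
  \<open>H\<^sup>1\<close>, where weak convergence is formulated.\<close>

lemma H_limit_form:
  assumes a: "0 < a" and ab: "a \<le> b" and L: "\<And>j. L j \<in> elliptic_fields M UNIV a b"
    and sym: "\<And>j. symmetric_field M UNIV (L j)" and H: "H_converges M UNIV a b L L0" and m: "m0 M \<Omega> < 0"
    and \<delta>: "\<delta> > 0" "\<And>u. u \<in> S10 \<Longrightarrow> \<delta> * hip u u \<le> ipT (gr u) (gr u)"
  shows "converging_forms X2 S10 ip hip (\<lambda>j. energy (L j)) (energy L0) (a * \<delta>) b"
proof (intro converging_forms.intro rellich converging_forms_axioms.intro)
  have L0: "L0 \<in> elliptic_fields M UNIV a b" using H by (simp add: H_converges_def)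
  note E = a ab L0 and S = S10_S1
  show "energy_form X2 S10 ip hip (energy (L j)) (a * \<delta>) b" for j
    by (rule elliptic_energy_form[OF a ab L sym \<delta>])
  show "energy L0 (u + v) z = energy L0 u z + energy L0 v z" if "u \<in> S10" "v \<in> S10" "z \<in> S10" for u v z
    by (rule energy_add_left[OF E S[OF that(1)] S[OF that(2)] S[OF that(3)]])
  show "energy L0 z (u + v) = energy L0 z u + energy L0 z v" if "u \<in> S10" "v \<in> S10" "z \<in> S10" for u v z
    using energy_right[OF E S[OF that(3)] S[OF that(1)] S[OF that(2)], of 1 1] by simp
  show "energy L0 (c *\<^sub>R u) z = c * energy L0 u z" if "u \<in> S10" "z \<in> S10" for u z c
    by (rule energy_scale_left[OF E S[OF that(1)] S[OF that(2)]])
  show "energy L0 z (c *\<^sub>R u) = c * energy L0 z u" if "u \<in> S10" "z \<in> S10" for u z c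
    using energy_right[OF E S[OF that(2)] S[OF that(1)] S[OF that(1)], of c 0] by simp
  show "(a * \<delta>) * hip v v \<le> energy L0 v v" if "v \<in> S10" for v
    using order_trans[OF mult_left_mono[OF \<delta>(2)[OF that]] energy_coercive[OF E S[OF that]]] a by (simp add: mult.assoc)
  show "energy L0 v v \<le> b * hip v v" if "v \<in> S10" for v by (rule energy_bounded[OF E S[OF that]])
  show "(energy L0 z v)\<^sup>2 \<le> (b\<^sup>2 * hip z z) * hip v v" if "z \<in> S10" "v \<in> S10" for z v
    by (rule energy_bounded2[OF E S[OF that(1)] S[OF that(2)]])
  have dual: "F \<in> dual_space S1 (H1_norm M \<Omega>)" if F: "F \<in> {ip e |e. e \<in> X2} \<union> {energy L0 z |z. z \<in> S10}" for F
    using F functional_ip functional_energy[OF E S] by blast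
  show "(\<lambda>j. G (s j)) \<longlonglongrightarrow> G s0"
    if F: "F \<in> {ip e |e. e \<in> X2} \<union> {energy L0 z |z. z \<in> S10}" and G: "G \<in> {ip e |e. e \<in> X2} \<union> {energy L0 z |z. z \<in> S10}"
      and s: "\<And>j. s j \<in> S10" "\<And>j v. v \<in> S10 \<Longrightarrow> energy (L j) (s j) v = F v"
      and s0: "s0 \<in> S10" "\<And>v. v \<in> S10 \<Longrightarrow> energy L0 s0 v = F v" for F G s s0
  proof -
    have F': "F \<in> Hm1 M \<Omega>" by (rule dual_S1_Hm1[OF dual[OF F]])
    have sol: "(\<forall>j. weak_solution M \<Omega> (L j) F (s j)) \<and> weak_solution M \<Omega> L0 F s0"
      unfolding weak_solution_iff using s s0 by simp
    have "\<forall>\<omega>. open \<omega> \<and> compact (closure \<omega>) \<and> closure \<omega> \<subseteq> UNIV \<and> m0 M \<omega> < 0 \<longrightarrow>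
        (\<forall>f\<in>Hm1 M \<omega>. \<forall>u u0. (\<forall>j. weak_solution M \<omega> (L j) f (u j)) \<and> weak_solution M \<omega> L0 f u0 \<longrightarrow>
           weakly_converges (H1 M \<omega>) (H1_norm M \<omega>) u u0 \<and>
           weakly_converges (L2T M \<omega>) (L2T_norm M \<omega>)
             (\<lambda>j x. L j x (grad M \<omega> (u j) x)) (\<lambda>x. L0 x (grad M \<omega> u0 x)))"
      using H unfolding H_converges_def by (elim conjE)
    from this[rule_format, of \<Omega>, OF _ F' sol] have "weakly_converges S1 (H1_norm M \<Omega>) s s0"
      using open_\<Omega> compact_\<Omega> m by simp
    then show ?thesis using dual[OF G] unfolding weakly_converges_def by blast
  qed
qed

lemma eigenpair_iff: 
  "eigenpair M \<Omega> L e v \<longleftrightarrow> v \<in> S10 \<and> 0 < ip v v \<and> (\<forall>z\<in>S10. energy L v z = e * ip v z)"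
proof -
  have "(LINT x:\<Omega>|\<mu>. e * v x * z x) = e * ip v z" for z
    unfolding set_LINT ip_def by (simp add: mult.assoc)
  moreover have "\<not> (AE x in \<mu>. x \<in> \<Omega> \<longrightarrow> v x = 0) \<longleftrightarrow> 0 < ip v v" if v: "v \<in> S10"
    unfolding AE_N[symmetric] using null_iff[OF S1_X2[OF S10_S1[OF v]]] X2.ip_nonneg[OF S1_X2[OF S10_S1[OF v]]] by auto
  ultimately show ?thesis unfolding eigenpair_def weak_solution_iff by auto
qed

text \<open>Vanishing almost everywhere is the same as having length zero, so the two notions of a complete list
  of eigenvalues agree.\<close>

lemma eigen_list_of_eigenvalue_list:
  assumes E: "energy_form X2 S10 ip hip (energy L) \<alpha> \<beta>" and list: "eigenvalue_list M \<Omega> L l u"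
  shows "energy_form.eigen_list S10 ip (energy L) l u"
proof -
  interpret E: energy_form X2 S10 ip hip "energy L" \<alpha> \<beta> by (rule E)
  have ei: "E.eigen e v \<longleftrightarrow> eigenpair M \<Omega> L e v" for e v unfolding E.eigen_def eigenpair_iff ..
  have 1: "\<And>k. k \<ge> 1 \<Longrightarrow> eigenpair M \<Omega> L (l k) (u k)" and 2: "\<And>k. k \<ge> 1 \<Longrightarrow> l k \<le> l (Suc k)"
    and 3: "\<And>K c. finite K \<Longrightarrow> K \<subseteq> {1..} \<Longrightarrow> AE x in \<mu>. x \<in> \<Omega> \<longrightarrow> (\<Sum>k\<in>K. c k * u k x) = 0 \<Longrightarrow> \<forall>k\<in>K. c k = 0"
    and 4: "\<And>e v. eigenpair M \<Omega> L e v \<Longrightarrow> finite {k. 1 \<le> k \<and> l k = e} \<and>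
        (\<exists>c. AE x in \<mu>. x \<in> \<Omega> \<longrightarrow> v x = (\<Sum>k\<in>{k. 1 \<le> k \<and> l k = e}. c k * u k x))"
    using list unfolding eigenvalue_list_def by blast+
  have uX: "u k \<in> X2" if "k \<ge> 1" for k using 1[OF that] S1_X2[OF S10_S1] by (simp add: eigenpair_iff)
  have sX: "(\<Sum>k\<in>K. c k *\<^sub>R u k) \<in> X2" if "K \<subseteq> {1..}" for K c
    by (intro X2.sum_mem X2.scale_mem uX) (use that in auto)
  show ?thesis unfolding E.eigen_list_def ei
  proof (intro conjI allI impI)
    show "eigenpair M \<Omega> L (l k) (u k)" if "1 \<le> k" for k by (rule 1[OF that])
    show "l k \<le> l (Suc k)" if "1 \<le> k" for k by (rule 2[OF that])
  next
    fix K :: "nat set" and c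
    assume a: "finite K \<and> K \<subseteq> {1..} \<and> ip (\<Sum>k\<in>K. c k *\<^sub>R u k) (\<Sum>k\<in>K. c k *\<^sub>R u k) = 0"
    then have "AE x in N. (\<Sum>k\<in>K. c k *\<^sub>R u k) x = 0" using null_iff[OF sX] by blast
    then show "\<forall>k\<in>K. c k = 0" using 3[of K c] a unfolding AE_N by simp
  next
    fix e v assume ev: "eigenpair M \<Omega> L e v"
    define K where "K = {k. 1 \<le> k \<and> l k = e}"
    have K: "finite K" "K \<subseteq> {1..}" using 4[OF ev] by (auto simp: K_def)
    obtain c where c: "AE x in \<mu>. x \<in> \<Omega> \<longrightarrow> v x = (\<Sum>k\<in>K. c k * u k x)" using 4[OF ev] unfolding K_def by blast
    have vX: "v \<in> X2" using ev S1_X2[OF S10_S1] by (simp add: eigenpair_iff)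
    have "AE x in N. v x = (\<Sum>k\<in>K. c k * u k x)" using c unfolding AE_N .
    then have "AE x in N. (v - (\<Sum>k\<in>K. c k *\<^sub>R u k)) x = 0" by eventually_elim simp
    then have "ip (v - (\<Sum>k\<in>K. c k *\<^sub>R u k)) (v - (\<Sum>k\<in>K. c k *\<^sub>R u k)) = 0"
      using null_iff[OF X2.diff_mem[OF vX sX[OF K(2)]]] by blast
    then show "\<exists>K c. finite K \<and> K \<subseteq> {k. 1 \<le> k \<and> l k = e} \<and>
        ip (v - (\<Sum>k\<in>K. c k *\<^sub>R u k)) (v - (\<Sum>k\<in>K. c k *\<^sub>R u k)) = 0"
      using K(1) unfolding K_def by blast
  qed
qed

end

theorem lemma10:
  fixes M :: "('m::{t2_space,second_countable_topology}, 'n::finite) weighted_manifold"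
    and a b :: real
    and L :: "nat \<Rightarrow> 'm \<Rightarrow> real ^ 'n \<Rightarrow> real ^ 'n"
    and L0 :: "'m \<Rightarrow> real ^ 'n \<Rightarrow> real ^ 'n"
    and \<Omega> :: "'m set"
    and l :: "nat \<Rightarrow> nat \<Rightarrow> real" and u :: "nat \<Rightarrow> nat \<Rightarrow> 'm \<Rightarrow> real"
    and l0 :: "nat \<Rightarrow> real" and u0 :: "nat \<Rightarrow> 'm \<Rightarrow> real"
  assumes "weighted_riemannian_manifold M"
    and "0 < a" and "a \<le> b"
    and "\<And>j. L j \<in> elliptic_fields M UNIV a b"
    and "\<And>j. symmetric_field M UNIV (L j)"
    and "H_converges M UNIV a b L L0"
    and "open \<Omega>" and "compact (closure \<Omega>)" and "m0 M \<Omega> < 0"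
    and "\<And>j. eigenvalue_list M \<Omega> (L j) (l j) (u j)"
    and "eigenvalue_list M \<Omega> L0 l0 u0"
  shows "(\<forall>j. 0 < l j 1) \<and> 0 < l0 1 \<and>
    (\<forall>k\<ge>1. (\<lambda>j. l j k) \<longlonglongrightarrow> l0 k) \<and>
    (\<forall>k\<ge>1. \<forall>s\<ge>1.
       (if k = 1 then 0 else l0 (k - 1)) < l0 k \<and>
       (\<forall>i\<in>{k..k + s - 1}. l0 i = l0 k) \<and> l0 k < l0 (k + s) \<longrightarrow>
       (\<exists>c :: nat \<Rightarrow> nat \<Rightarrow> real.
          (\<lambda>j. L2_norm M \<Omega> (\<lambda>x. (\<Sum>i=k..k + s - 1. c j i * u j i x) - u0 k x)) \<longlonglongrightarrow> 0))"
proof -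
  interpret mfd_domain M \<Omega>
    by (intro mfd_domain.intro weighted_mfd.intro mfd_domain_axioms.intro assms)
  obtain \<delta> where \<delta>: "\<delta> > 0" "\<And>v. v \<in> S10 \<Longrightarrow> \<delta> * hip v v \<le> ipT (gr v) (gr v)"
    using poincare_of_m0[OF assms(9)] by blast
  interpret C: converging_forms X2 S10 ip hip "\<lambda>j. energy (L j)" "energy L0" "a * \<delta>" b
    by (rule H_limit_form[OF assms(2-6,9) \<delta>])
  have lists: "energy_form.eigen_list S10 ip (energy (L j)) (l j) (u j)" for j
    by (rule eigen_list_of_eigenvalue_list[OF C.forms assms(10)])
  have list0: "C.A0.eigen_list l0 u0"
    by (rule eigen_list_of_eigenvalue_list[OF C.A0.energy_form_axioms assms(11)])
  have "0 < l j 1" for j by (rule energy_form.list_pos[OF C.forms lists]) simp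
  moreover have "0 < l0 1" by (rule C.A0.list_pos[OF list0]) simp
  moreover have "(\<lambda>j. l j k) \<longlonglongrightarrow> l0 k" if "k \<ge> 1" for k by (rule C.eigenvalues_converge[OF lists list0 that])
  moreover have "\<exists>c :: nat \<Rightarrow> nat \<Rightarrow> real. 
      (\<lambda>j. L2_norm M \<Omega> (\<lambda>x. (\<Sum>i=k..k + s - 1. c j i * u j i x) - u0 k x)) \<longlonglongrightarrow> 0"
    if k: "k \<ge> 1" and s: "s \<ge> 1" and gap1: "(if k = 1 then 0 else l0 (k - 1)) < l0 k" and gap2: "l0 k < l0 (k + s)" for k s
  proof -
    have N: "k \<le> k + s - 1" and SN: "Suc (k + s - 1) = k + s" using s by simp_all
    have g1: "k = 1 \<or> l0 (k - 1) < l0 k" using gap1 by (auto split: if_splits)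
    have g2: "l0 k < l0 (Suc (k + s - 1))" using gap2 unfolding SN .
    obtain c :: "nat \<Rightarrow> nat \<Rightarrow> real" where c: "(\<lambda>j. ip ((\<Sum>i\<in>{k..k + s - 1}. c j i *\<^sub>R u j i) - u0 k) ((\<Sum>i\<in>{k..k + s - 1}. c j i *\<^sub>R u j i) - u0 k)) \<longlonglongrightarrow> 0"
      using C.eigenvectors_converge[OF lists list0 k N g1 g2] by blast
    have "(\<lambda>x. (\<Sum>i=k..k + s - 1. c j i * u j i x) - u0 k x) = (\<Sum>i\<in>{k..k + s - 1}. c j i *\<^sub>R u j i) - u0 k" for j
      by (rule ext) simp
    then show ?thesis using tendsto_real_sqrt[OF c] unfolding L2_norm_eq by (intro exI[of _ c]) simp
  qed
  ultimately show ?thesis by blast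
qed

end
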